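(* Let $(\rho_h,m_h)$, where $(m_h,\rho_h): I=(0,T)\to \mathcal M_h\times\mathcal R_h$, be a solution of the semidiscrete problem $$(m_h,z)+(K(|\nabla\rho_h|)\nabla\rho_h,z)=0\quad\forall z\in\mathcal M_h,$$ $$(\phi\rho_{h,t},r)-(m_h,\nabla r)=(f,r)-\langle\psi,r\rangle\quad\forall r\in\mathcal R_h,$$ with initial data $\rho_h(\cdot,0)=\pi\rho^0$. Then there exists a positive constant $C$ such that $$\|\rho_h\|_{L^\infty(I;L^2(\Omega))}^2+\|\nabla\rho_h\|_{L^\beta(I;L^\beta(\Omega))}^{\beta}\le C\left(\|\rho^0\|^2+\mathcal A\right)$$ and $$\|\rho_{h,t}\|_{L^2(I;L^2(\Omega))}^2+\|\nabla\rho_h\|_{L^\infty(I;L^\beta(\Omega))}^{\beta}+\|m_h\|_{L^\infty(I;L^2(\Omega))}\le C\mathcal B,$$ where $$\mathcal A=1+\|\psi\|_{L^\infty(I;L^\infty(\Gamma))}^{\lambda}+\|f\|_{L^2(I;L^2(\Omega))}^2,$$ $$\mathcal B=\|\rho^0\|^2+\|\nabla\rho^0\|_{0,\beta}^{\beta}+\|\psi(0)\|_{L^2(\Gamma)}\|\rho^0\|_{L^2(\Gamma)}+\|\psi_t\|_{L^\infty(I;L^\infty(\Gamma))}^{\lambda}+\mathcal A.$$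
   Context: Nonlinearity: $N\ge1$, real exponents $0=\alpha_0<\alpha_1<\dots<\alpha_N$, and coefficients $a_0,a_N>0$, $a_1,\dots,a_{N-1}\ge0$ are fixed; $g(s)=\sum_{i=0}^N a_is^{\alpha_i}$ for $s\ge0$; $K(\xi)=1/g(s(\xi))$ for $\xi\ge0$, where $s=s(\xi)$ is the unique non-negative solution of $sg(s)=\xi$. Exponents: $a=\frac{\alpha_N}{\alpha_N+1}\in(0,1)$, $\beta=2-a\in(1,2)$, $\lambda=\frac{\beta}{\beta-1}\in(2,\infty)$. Domain and data: $\Omega\subset\mathbb R^d$, $d\ge2$, is a bounded domain with boundary $\Gamma$; $0<T<\infty$, $I=(0,T)$; $\phi\in C^1(\Omega)$ with $0<\phi_*<\phi(x)<\phi^*$ for all $x\in\Omega$; $\rho^0(x)$ and $\psi(x,t)$ (the latter on $\Gamma\times(0,T)$) are smooth functions; $f$ is a given function on $\Omega\times(0,T)$. $(\cdot,\cdot)$ is the inner product of $L^2(\Omega)$ or $(L^2(\Omega))^d$, $\langle\cdot,\cdot\rangle$ that of $L^2(\Gamma)$; $\|\cdot\|$ is the $L^2(\Omega)$ norm (scalar or vector), $\|\cdot\|_{0,\beta}$ the $L^\beta(\Omega)$ norm; the subscript $t$ denotes the time derivative. Discretization: $\{\mathcal T_h\}_h$ is a family of quasiuniform triangulations of $\overline\Omega$, $h$ the maximum diameter of the mesh elements; $\mathcal M_h$ (vector-valued) and $\mathcal R_h$ (scalar) are the spaces of discontinuous piecewise polynomials of degree $k\ge0$ over $\mathcal T_h$,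 and $\mathcal M_h\times\mathcal R_h$ are the mixed element spaces approximating $H(\mathrm{div},\Omega)\times H^1(\Omega)$. $\pi: H^1(\Omega)\to\mathcal R_h$ is the $L^2$-projection: $(\pi\rho-\rho,r)=0$ for all $r\in\mathcal R_h$. It is taken to satisfy $\|\pi\rho\|_{s}\le C_0\|\rho\|_{s}$ for $\rho\in H^s(\Omega)$, $s\in\{0,1\}$, and $\|\pi\rho-\rho\|_{0,q}\le C_1h^s\|\rho\|_{s,q}$ for $\rho\in W^{s,q}(\Omega)$, $0\le s\le k+1$, $1\le q\le\infty$, where $\|\cdot\|_{s,q}$ is the $W^{s,q}(\Omega)$ norm and $\|\cdot\|_s=\|\cdot\|_{s,2}$. Convention on constants: $C$ is a positive generic constant whose value depends on the exponents and coefficients of $g$, the spatial dimension $d$ and the domain $\Omega$, and is independent of the initial data and boundary data and of the mesh size.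
   Formalization: R_h is taken as piecewise polynomials in H^1, continuous on the closed domain (fully discontinuous R_h contradicts H^1-stability of π); Ω is the interior of its closure; C may also depend on T, φ_*, φ^*, k, the quasiuniformity constant, C_0, C_1 (φ=f=1, ψ=ρ^0=0 forces dependence on T). *)

theory Defs
  imports "HOL-Analysis.Analysis" "HOL-Probability.Essential_Supremum"
begin

section \<open>The nonlinearity\<close>

text \<open>The term \<open>i = 0\<close> is split off because \<open>0 powr 0 = 0\<close> in HOL, whereas
  \<open>s\<close> to the power \<open>\<alpha>\<^sub>0 = 0\<close> means \<open>1\<close> for every \<open>s \<ge> 0\<close>.\<close>

definition forchheimer_g :: "nat \<Rightarrow> (nat \<Rightarrow> real) \<Rightarrow> (nat \<Rightarrow> real) \<Rightarrow> real \<Rightarrow> real" where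
  "forchheimer_g N a \<alpha> s = a 0 + (\<Sum>i=1..N. a i * s powr \<alpha> i)"

definition forchheimer_K :: "nat \<Rightarrow> (nat \<Rightarrow> real) \<Rightarrow> (nat \<Rightarrow> real) \<Rightarrow> real \<Rightarrow> real" where
  "forchheimer_K N a \<alpha> \<xi> =
     1 / forchheimer_g N a \<alpha> (THE s. 0 \<le> s \<and> s * forchheimer_g N a \<alpha> s = \<xi>)"

definition forchheimer_data :: "nat \<Rightarrow> (nat \<Rightarrow> real) \<Rightarrow> (nat \<Rightarrow> real) \<Rightarrow> bool" where
  "forchheimer_data N a \<alpha> \<longleftrightarrow>
     1 \<le> N \<and> \<alpha> 0 = 0 \<and> (\<forall>i<N. \<alpha> i < \<alpha> (Suc i)) \<and>
     0 < a 0 \<and> 0 < a N \<and> (\<forall>i\<in>{1..<N}. 0 \<le> a i)"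

definition exp_a :: "nat \<Rightarrow> (nat \<Rightarrow> real) \<Rightarrow> real" where
  "exp_a N \<alpha> = \<alpha> N / (\<alpha> N + 1)"

definition exp_beta :: "nat \<Rightarrow> (nat \<Rightarrow> real) \<Rightarrow> real" where
  "exp_beta N \<alpha> = 2 - exp_a N \<alpha>"

definition exp_lambda :: "nat \<Rightarrow> (nat \<Rightarrow> real) \<Rightarrow> real" where
  "exp_lambda N \<alpha> = exp_beta N \<alpha> / (exp_beta N \<alpha> - 1)"

section \<open>Lebesgue and Bochner norms\<close>

text \<open>All norms take values in \<^typ>\<open>ennreal\<close>, so that a norm is \<open>\<infinity>\<close> for a measurable function
  outside the space. The real power is only used with positive exponents.\<close>

definition epowr :: "ennreal \<Rightarrow> real \<Rightarrow> ennreal" where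
  "epowr x p = (if x = \<infinity> then \<infinity> else ennreal (enn2real x powr p))"

definition elp_norm :: "'b measure \<Rightarrow> ennreal \<Rightarrow> ('b \<Rightarrow> ennreal) \<Rightarrow> ennreal" where
  "elp_norm M q u =
     (if q = \<infinity> then esssup M u
      else epowr (\<integral>\<^sup>+x. epowr (u x) (enn2real q) \<partial>M) (1 / enn2real q))"

definition lp_norm :: "'b measure \<Rightarrow> ennreal \<Rightarrow> ('b \<Rightarrow> 'c::real_normed_vector) \<Rightarrow> ennreal" where
  "lp_norm M q u = elp_norm M q (\<lambda>x. ennreal (norm (u x)))"

text \<open>The norm of \<open>L\<^sup>p(0,T; L\<^sup>q(M))\<close>; the time variable is the first argument of \<open>u\<close>.\<close>

definition bochner_norm ::
    "real \<Rightarrow> ennreal \<Rightarrow> 'b measure \<Rightarrow> ennreal \<Rightarrow> (real \<Rightarrow> 'b \<Rightarrow> 'c::real_normed_vector) \<Rightarrow> ennreal" where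
  "bochner_norm T p M q u = elp_norm (lebesgue_on {0<..<T}) p (\<lambda>t. lp_norm M q (u t))"

definition L2_inner :: "'b measure \<Rightarrow> ('b \<Rightarrow> 'c::real_inner) \<Rightarrow> ('b \<Rightarrow> 'c) \<Rightarrow> real" where
  "L2_inner M u v = (\<integral>x. u x \<bullet> v x \<partial>M)"

section \<open>Surface measure\<close>

text \<open>Hausdorff measure of integer dimension \<open>n \<ge> 1\<close>, normalised so that it agrees with Lebesgue
  measure in dimension \<open>n\<close>. Boundedness of the covering sets is required because
  \<^const>\<open>diameter\<close> is only meaningful for bounded sets.\<close>

definition hausdorff_pre :: "nat \<Rightarrow> real \<Rightarrow> 'a::metric_space set \<Rightarrow> ennreal" where
  "hausdorff_pre n \<delta> A =
     (INF U \<in> {U :: nat \<Rightarrow> 'a set. A \<subseteq> (\<Union>i. U i) \<and> (\<forall>i. bounded (U i) \<and> diameter (U i) \<le> \<delta>)}.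
        \<Sum>i. ennreal (unit_ball_vol (real n) * (diameter (U i) / 2) ^ n))"

definition hausdorff_outer :: "nat \<Rightarrow> 'a::metric_space set \<Rightarrow> ennreal" where
  "hausdorff_outer n A = (SUP \<delta>\<in>{0<..}. hausdorff_pre n \<delta> A)"

definition hausdorff_measure :: "nat \<Rightarrow> 'a::metric_space measure" where
  "hausdorff_measure n = measure_of UNIV (sets borel) (hausdorff_outer n)"

definition surface_measure :: "'a::euclidean_space set \<Rightarrow> 'a measure" where
  "surface_measure S = restrict_space (hausdorff_measure (DIM('a) - 1)) S"

section \<open>Derivatives and smooth functions\<close>

definition pderivative :: "'a::euclidean_space \<Rightarrow> ('a \<Rightarrow> real) \<Rightarrow> 'a \<Rightarrow> real" where
  "pderivative b u x = frechet_derivative u (at x) b"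

text \<open>Pointwise gradient. For a function that is polynomial on each element of a triangulation it is
  meaningful in the element interiors, hence almost everywhere; for continuous piecewise polynomials
  it is there the weak gradient.\<close>

definition grad :: "('a::euclidean_space \<Rightarrow> real) \<Rightarrow> 'a \<Rightarrow> 'a" where
  "grad u x = (\<Sum>b\<in>Basis. pderivative b u x *\<^sub>R b)"

text \<open>\<open>C\<^sup>k\<close> functions on an open set \<open>S\<close>.\<close>

primrec Ck_on :: "nat \<Rightarrow> 'a::euclidean_space set \<Rightarrow> ('a \<Rightarrow> real) \<Rightarrow> bool" where
  "Ck_on 0 S u \<longleftrightarrow> continuous_on S u"
| "Ck_on (Suc k) S u \<longleftrightarrow>
     (\<forall>x\<in>S. u differentiable (at x)) \<and> (\<forall>b\<in>Basis. Ck_on k S (pderivative b u))"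

text \<open>On a set that need not be open, smoothness means having a \<open>C\<^sup>\<infinity>\<close> extension to an open
  neighbourhood.\<close>

definition smooth_on :: "'a::euclidean_space set \<Rightarrow> ('a \<Rightarrow> real) \<Rightarrow> bool" where
  "smooth_on S u \<longleftrightarrow>
     (\<exists>U v. open U \<and> S \<subseteq> U \<and> (\<forall>k. Ck_on k U v) \<and> (\<forall>x\<in>S. v x = u x))"

section \<open>Sobolev spaces\<close>

definition multi_indices :: "nat \<Rightarrow> ('a::euclidean_space \<Rightarrow> nat) set" where
  "multi_indices s = {\<mu>. (\<forall>b. b \<notin> Basis \<longrightarrow> \<mu> b = 0) \<and> sum \<mu> Basis \<le> s}"

text \<open>Only applied to smooth functions, for which the order of differentiation is irrelevant; the
  choice picks some order in which each \<open>b\<close> occurs \<open>\<mu> b\<close> times.\<close>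

definition mderivative :: "('a::euclidean_space \<Rightarrow> nat) \<Rightarrow> ('a \<Rightarrow> real) \<Rightarrow> 'a \<Rightarrow> real" where
  "mderivative \<mu> u =
     foldr pderivative (SOME bs. set bs \<subseteq> Basis \<and> (\<forall>b\<in>Basis. count_list bs b = \<mu> b)) u"

definition test_function :: "'a::euclidean_space set \<Rightarrow> ('a \<Rightarrow> real) \<Rightarrow> bool" where
  "test_function \<Omega> \<eta> \<longleftrightarrow>
     (\<forall>k. Ck_on k UNIV \<eta>) \<and> (\<exists>S. compact S \<and> S \<subseteq> \<Omega> \<and> (\<forall>x. x \<notin> S \<longrightarrow> \<eta> x = 0))"

definition locally_integrable :: "'a::euclidean_space set \<Rightarrow> ('a \<Rightarrow> real) \<Rightarrow> bool" where
  "locally_integrable \<Omega> u \<longleftrightarrow> (\<forall>S. compact S \<and> S \<subseteq> \<Omega> \<longrightarrow> integrable (lebesgue_on S) u)"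

definition weak_derivative ::
    "'a::euclidean_space set \<Rightarrow> ('a \<Rightarrow> nat) \<Rightarrow> ('a \<Rightarrow> real) \<Rightarrow> ('a \<Rightarrow> real) \<Rightarrow> bool" where
  "weak_derivative \<Omega> \<mu> u v \<longleftrightarrow>
     locally_integrable \<Omega> u \<and> locally_integrable \<Omega> v \<and>
     (\<forall>\<eta>. test_function \<Omega> \<eta> \<longrightarrow>
        L2_inner (lebesgue_on \<Omega>) u (mderivative \<mu> \<eta>) =
        (-1) ^ sum \<mu> Basis * L2_inner (lebesgue_on \<Omega>) v \<eta>)"

text \<open>Weak derivatives are unique almost everywhere, so the infimum ranges over a single value, or
  over the empty set, in which case the norm is \<open>\<infinity>\<close>.\<close>

definition sobolev_norm ::
    "'a::euclidean_space set \<Rightarrow> nat \<Rightarrow> ennreal \<Rightarrow> ('a \<Rightarrow> real) \<Rightarrow> ennreal" where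
  "sobolev_norm \<Omega> s q u =
     (INF v \<in> {v. \<forall>\<mu>\<in>multi_indices s. weak_derivative \<Omega> \<mu> u (v \<mu>)}.
        if q = \<infinity> then (SUP \<mu>\<in>multi_indices s. lp_norm (lebesgue_on \<Omega>) \<infinity> (v \<mu>))
        else epowr (\<Sum>\<mu>\<in>multi_indices s. epowr (lp_norm (lebesgue_on \<Omega>) q (v \<mu>)) (enn2real q))
               (1 / enn2real q))"

definition sobolev_space :: "'a::euclidean_space set \<Rightarrow> nat \<Rightarrow> ennreal \<Rightarrow> ('a \<Rightarrow> real) set" where
  "sobolev_space \<Omega> s q = {u. sobolev_norm \<Omega> s q u < \<infinity>}"

section \<open>Domain, meshes and mixed element spaces\<close>

text \<open>The last condition says that \<open>\<Omega>\<close> lies on one side of its boundary (no slits or punctures); it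
  holds for every Lipschitz domain and makes boundary values on \<open>frontier \<Omega>\<close> single-valued.\<close>

definition bounded_domain :: "'a::euclidean_space set \<Rightarrow> bool" where
  "bounded_domain \<Omega> \<longleftrightarrow>
     open \<Omega> \<and> connected \<Omega> \<and> bounded \<Omega> \<and> \<Omega> \<noteq> {} \<and> interior (closure \<Omega>) = \<Omega>"

text \<open>\<^const>\<open>triangulation\<close> is the library notion: finitely many simplices, any two of which
  meet in a common (possibly empty) face.\<close>

definition mesh_of :: "'a::euclidean_space set \<Rightarrow> 'a set set \<Rightarrow> bool" where
  "mesh_of \<Omega> \<T> \<longleftrightarrow>
     triangulation \<T> \<and> (\<forall>E\<in>\<T>. int DIM('a) simplex E) \<and> \<Union>\<T> = closure \<Omega>"

text \<open>Every element of \<open>\<T> h\<close> has diameter at most \<open>h\<close> and inradius at least \<open>\<gamma> h\<close>, with \<open>\<gamma>\<close>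
  independent of \<open>h\<close>.\<close>

definition quasiuniform_family ::
    "'a::euclidean_space set \<Rightarrow> real \<Rightarrow> real set \<Rightarrow> (real \<Rightarrow> 'a set set) \<Rightarrow> bool" where
  "quasiuniform_family \<Omega> \<gamma> H \<T> \<longleftrightarrow>
     (\<forall>h\<in>H. 0 < h \<and> mesh_of \<Omega> (\<T> h) \<and> Max (diameter ` \<T> h) = h \<and>
        (\<forall>E\<in>\<T> h. \<exists>x. ball x (\<gamma> * h) \<subseteq> E))"

definition polynomials :: "nat \<Rightarrow> ('a::euclidean_space \<Rightarrow> real) set" where
  "polynomials k =
     {p. \<exists>c. p = (\<lambda>x. \<Sum>\<mu>\<in>multi_indices k. c \<mu> * (\<Prod>b\<in>Basis. (x \<bullet> b) ^ \<mu> b))}"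

text \<open>No condition across or on the faces of the elements, which form a null set.\<close>

definition piecewise_polynomials :: "nat \<Rightarrow> 'a::euclidean_space set set \<Rightarrow> ('a \<Rightarrow> real) set" where
  "piecewise_polynomials k \<T> = {u. \<forall>E\<in>\<T>. \<exists>p\<in>polynomials k. \<forall>x\<in>interior E. u x = p x}"

definition M_space :: "nat \<Rightarrow> 'a::euclidean_space set set \<Rightarrow> ('a \<Rightarrow> 'a) set" where
  "M_space k \<T> = {z. \<forall>b\<in>Basis. (\<lambda>x. z x \<bullet> b) \<in> piecewise_polynomials k \<T>}"

text \<open>The scalar space approximates \<open>H\<^sup>1(\<Omega>)\<close> and is the range of \<open>\<pi>\<close>, which is stable in the
  \<open>H\<^sup>1(\<Omega>)\<close> norm: its elements are those piecewise polynomials that lie in \<open>H\<^sup>1(\<Omega>)\<close>. Continuity on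
  \<open>closure \<Omega>\<close> selects the representative of the class whose restriction to the boundary is the
  trace.\<close>

definition R_space :: "'a::euclidean_space set \<Rightarrow> nat \<Rightarrow> 'a set set \<Rightarrow> ('a \<Rightarrow> real) set" where
  "R_space \<Omega> k \<T> =
     {r \<in> piecewise_polynomials k \<T>. r \<in> sobolev_space \<Omega> 1 2 \<and> continuous_on (closure \<Omega>) r}"

definition is_L2_projection ::
    "'a::euclidean_space set \<Rightarrow> nat \<Rightarrow> 'a set set \<Rightarrow> (('a \<Rightarrow> real) \<Rightarrow> 'a \<Rightarrow> real) \<Rightarrow> bool" where
  "is_L2_projection \<Omega> k \<T> \<pi>h \<longleftrightarrow>
     (\<forall>u\<in>sobolev_space \<Omega> 1 2.
        \<pi>h u \<in> R_space \<Omega> k \<T> \<and>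
        (\<forall>r\<in>R_space \<Omega> k \<T>. L2_inner (lebesgue_on \<Omega>) (\<lambda>x. \<pi>h u x - u x) r = 0))"

text \<open>The bounds are trivially true when the norm on the right-hand side is infinite, so the
  restriction to \<open>u\<close> in the respective Sobolev space is implicit.\<close>

definition projection_bounds ::
    "'a::euclidean_space set \<Rightarrow> nat \<Rightarrow> real \<Rightarrow> real \<Rightarrow> real \<Rightarrow> (('a \<Rightarrow> real) \<Rightarrow> 'a \<Rightarrow> real) \<Rightarrow> bool" where
  "projection_bounds \<Omega> k C0 C1 h \<pi>h \<longleftrightarrow>
     (\<forall>u\<in>sobolev_space \<Omega> 1 2.
        (\<forall>s\<in>{0, 1}. sobolev_norm \<Omega> s 2 (\<pi>h u) \<le> ennreal C0 * sobolev_norm \<Omega> s 2 u) \<and>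
        (\<forall>s\<le>k+1. \<forall>q\<ge>1. lp_norm (lebesgue_on \<Omega>) q (\<lambda>x. \<pi>h u x - u x)
           \<le> ennreal (C1 * h ^ s) * sobolev_norm \<Omega> s q u))"

section \<open>Data and the semidiscrete problem\<close>

abbreviation time_deriv :: "(real \<Rightarrow> 'a \<Rightarrow> real) \<Rightarrow> real \<Rightarrow> 'a \<Rightarrow> real" where
  "time_deriv u t x \<equiv> deriv (\<lambda>s. u s x) t"

definition admissible_phi :: "'a::euclidean_space set \<Rightarrow> real \<Rightarrow> real \<Rightarrow> ('a \<Rightarrow> real) \<Rightarrow> bool" where
  "admissible_phi \<Omega> \<phi>lo \<phi>hi \<phi> \<longleftrightarrow> Ck_on 1 \<Omega> \<phi> \<and> (\<forall>x\<in>\<Omega>. \<phi>lo < \<phi> x \<and> \<phi> x < \<phi>hi)"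

text \<open>Continuity down to \<open>t = 0\<close> gives \<open>\<psi>(0)\<close> its meaning.\<close>

definition admissible_psi :: "'a::euclidean_space set \<Rightarrow> real \<Rightarrow> (real \<Rightarrow> 'a \<Rightarrow> real) \<Rightarrow> bool" where
  "admissible_psi \<Omega> T \<psi> \<longleftrightarrow>
     smooth_on (frontier \<Omega> \<times> {0<..<T}) (\<lambda>(x, t). \<psi> t x) \<and>
     continuous_on (frontier \<Omega> \<times> {0..<T}) (\<lambda>(x, t). \<psi> t x)"

definition admissible_f :: "'a::euclidean_space set \<Rightarrow> real \<Rightarrow> (real \<Rightarrow> 'a \<Rightarrow> real) \<Rightarrow> bool" where
  "admissible_f \<Omega> T f \<longleftrightarrow>
     (\<lambda>(x, t). f t x) \<in> borel_measurable (lebesgue_on (\<Omega> \<times> {0<..<T})) \<and>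
     (\<forall>t\<in>{0<..<T}. f t \<in> borel_measurable (lebesgue_on \<Omega>) \<and> lp_norm (lebesgue_on \<Omega>) 2 (f t) < \<infinity>)"

definition semidiscrete_solution ::
    "(real \<Rightarrow> real) \<Rightarrow> 'a::euclidean_space set \<Rightarrow> real \<Rightarrow> ('a \<Rightarrow> real) \<Rightarrow> nat \<Rightarrow> 'a set set \<Rightarrow>
     (('a \<Rightarrow> real) \<Rightarrow> 'a \<Rightarrow> real) \<Rightarrow> ('a \<Rightarrow> real) \<Rightarrow> (real \<Rightarrow> 'a \<Rightarrow> real) \<Rightarrow> (real \<Rightarrow> 'a \<Rightarrow> real) \<Rightarrow>
     (real \<Rightarrow> 'a \<Rightarrow> real) \<Rightarrow> (real \<Rightarrow> 'a \<Rightarrow> 'a) \<Rightarrow> bool" where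
  "semidiscrete_solution K \<Omega> T \<phi> k \<T> \<pi>h \<rho>0 \<psi> f \<rho>h mh \<longleftrightarrow>
     (\<forall>x\<in>closure \<Omega>. \<rho>h 0 x = \<pi>h \<rho>0 x \<and>
        continuous_on {0..<T} (\<lambda>t. \<rho>h t x) \<and> (\<lambda>t. \<rho>h t x) differentiable_on {0<..<T}) \<and>
     (\<forall>t\<in>{0<..<T}.
        mh t \<in> M_space k \<T> \<and> \<rho>h t \<in> R_space \<Omega> k \<T> \<and>
        (\<forall>z\<in>M_space k \<T>.
           L2_inner (lebesgue_on \<Omega>) (mh t) z +
           L2_inner (lebesgue_on \<Omega>) (\<lambda>x. K (norm (grad (\<rho>h t) x)) *\<^sub>R grad (\<rho>h t) x) z = 0) \<and>
        (\<forall>r\<in>R_space \<Omega> k \<T>.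
           L2_inner (lebesgue_on \<Omega>) (\<lambda>x. \<phi> x * time_deriv \<rho>h t x) r
             - L2_inner (lebesgue_on \<Omega>) (mh t) (grad r) =
           L2_inner (lebesgue_on \<Omega>) (f t) r
             - L2_inner (surface_measure (frontier \<Omega>)) (\<psi> t) r))"

definition data_A ::
    "real \<Rightarrow> 'a::euclidean_space set \<Rightarrow> real \<Rightarrow> (real \<Rightarrow> 'a \<Rightarrow> real) \<Rightarrow> (real \<Rightarrow> 'a \<Rightarrow> real) \<Rightarrow> ennreal" where
  "data_A lam \<Omega> T \<psi> f =
     1 + epowr (bochner_norm T \<infinity> (surface_measure (frontier \<Omega>)) \<infinity> \<psi>) lam
       + (bochner_norm T 2 (lebesgue_on \<Omega>) 2 f)\<^sup>2"

definition data_B ::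
    "real \<Rightarrow> real \<Rightarrow> 'a::euclidean_space set \<Rightarrow> real \<Rightarrow> ('a \<Rightarrow> real) \<Rightarrow> (real \<Rightarrow> 'a \<Rightarrow> real) \<Rightarrow>
     (real \<Rightarrow> 'a \<Rightarrow> real) \<Rightarrow> ennreal" where
  "data_B \<beta> lam \<Omega> T \<rho>0 \<psi> f =
     (lp_norm (lebesgue_on \<Omega>) 2 \<rho>0)\<^sup>2
     + epowr (lp_norm (lebesgue_on \<Omega>) (ennreal \<beta>) (grad \<rho>0)) \<beta>
     + lp_norm (surface_measure (frontier \<Omega>)) 2 (\<psi> 0) *
       lp_norm (surface_measure (frontier \<Omega>)) 2 \<rho>0
     + epowr (bochner_norm T \<infinity> (surface_measure (frontier \<Omega>)) \<infinity> (time_deriv \<psi>)) lam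
     + data_A lam \<Omega> T \<psi> f"

end

theory Submission
  imports Defs
begin

text \<open>In nodal coordinates the semidiscrete problem is a system of ordinary differential equations.
  Testing with \<open>\<rho>\<^sub>h\<close> and using \<open>c\<^sub>1 \<xi>\<^sup>\<beta> - c\<^sub>2 \<le> K(\<xi>) \<xi>\<^sup>2\<close> gives the first estimate by Gronwall, once the
  boundary term is absorbed by Young's inequality and a trace inequality in \<open>W\<^sup>1\<^sup>,\<^sup>1\<close>. The constant of
  the latter is independent of the mesh because \<open>\<Gamma>\<close> is a union of facets of one fixed mesh, and
  continuous piecewise polynomials on any other mesh are absolutely continuous on almost every line
  transversal to such a facet.

  Testing with \<open>\<rho>\<^sub>h\<^sub>,\<^sub>t\<close> turns the flux term into the derivative of an energy whose density
  is a primitive of \<open>K(\<xi>) \<xi>\<close>; the boundary term is integrated by parts in time, which leaves \<open>\<psi>\<^sub>t\<close>. The initial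
  energy needs \<open>\<nabla>\<pi>\<rho>\<^sup>0\<close> in \<open>L\<^sup>\<beta>\<close>: on each element an inverse estimate for polynomials bounds it by
  \<open>h\<^sup>-\<^sup>1 (\<pi>\<rho>\<^sup>0 - \<rho>\<^sup>0)\<close>, which the approximation property of \<open>\<pi>\<close> controls, and by the oscillation of
  \<open>\<rho>\<^sup>0\<close>, which a Poincare inequality on the inscribed ball controls. Finally \<open>m\<^sub>h\<close> is the
  \<open>L\<^sup>2\<close> projection of the flux, whose square is at most \<open>c\<^sub>2\<^sup>2 (1 + |\<nabla>\<rho>\<^sub>h|\<^sup>\<beta>)\<close> since
  \<open>2 (\<beta> - 1) < \<beta>\<close>.\<close>

abbreviation Lmeas :: "'a::euclidean_space set \<Rightarrow> ('a \<Rightarrow> 'b::topological_space) set" where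
 "Lmeas A \<equiv> borel_measurable (lebesgue_on A)"

abbreviation time_integral :: "real \<Rightarrow> (real \<Rightarrow> real) \<Rightarrow> ennreal" where
 "time_integral T q \<equiv> \<integral>\<^sup>+t. ennreal (q t) \<partial>lebesgue_on {0<..<T}"

abbreviation W11 :: "'a::euclidean_space set \<Rightarrow> ('a \<Rightarrow> real) \<Rightarrow> ennreal" where
 "W11 A u \<equiv> \<integral>\<^sup>+x. ennreal (\<bar>u x\<bar> + norm (grad u x)) \<partial>lebesgue_on A"

locale power_law_flux =
 fixes K :: "real \<Rightarrow> real" and \<beta> c1 c2 :: real
 assumes beta: "1 < \<beta>" "\<beta> < 2"
  and c1_pos: "0 < c1" and c2_pos: "0 < c2"
  and K_cont: "continuous_on {0..} K"
  and K_nonneg: "\<And>\<xi>. 0 \<le> \<xi> ==> 0 \<le> K \<xi>"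
  and flux_mono: "\<And>\<xi> \<zeta>. 0 \<le> \<xi> ==> \<xi> \<le> \<zeta> ==> K \<xi> * \<xi> \<le> K \<zeta> * \<zeta>"
  and flux_upper: "\<And>\<xi>. 0 \<le> \<xi> ==> K \<xi> * \<xi> \<le> c2 * \<xi> powr (\<beta> - 1)"
  and flux_lower: "\<And>\<xi>. 0 \<le> \<xi> ==> c1 * \<xi> powr \<beta> - c2 \<le> K \<xi> * \<xi>\<^sup>2"

lemma forchheimer_power_law_flux:
 assumes data: "forchheimer_data N a \<alpha>"
 shows "\<exists>c1 c2. power_law_flux (forchheimer_K N a \<alpha>) (exp_beta N \<alpha>) c1 c2"
proof -
 define g where "g = forchheimer_g N a \<alpha>"
 define p where "p = \<alpha> N"
 define \<beta> where "\<beta> = exp_beta N \<alpha>"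
 have N1: "1 \<le> N" and \<alpha>0: "\<alpha> 0 = 0" and a0: "0 < a 0" and aN: "0 < a N"
  and step: "\<And>i. i < N ==> \<alpha> i < \<alpha> (Suc i)"
  and anonneg0: "\<And>i. i \<in> {1..<N} ==> 0 \<le> a i"
  using data unfolding forchheimer_data_def by auto
 have anonneg: "0 \<le> a i" if "i \<le> N" for i
  using that a0 aN anonneg0[of i] by (cases "i = 0"; cases "i = N") auto
 have \<alpha>mono: "\<alpha> i \<le> \<alpha> j" if "i \<le> j" "j \<le> N" for i j
  using that
 proof (induction j rule: dec_induct)
  case (step n)
  then show ?case using \<open>\<And>i. i < N ==> \<alpha> i < \<alpha> (Suc i)\<close>[of n] by auto
 qed simp
 have \<alpha>pos: "0 < \<alpha> i" if "1 \<le> i" "i \<le> N" for i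
  using \<alpha>mono[of 1 i] step[of 0] that N1 \<alpha>0 by auto
 have \<alpha>nonneg: "0 \<le> \<alpha> i" if "1 \<le> i" "i \<le> N" for i
  using \<alpha>pos[OF that] by simp
 have p: "0 < p" using \<alpha>pos[of N] N1 by (simp add: p_def)
 have \<beta>: "\<beta> - 1 = 1 / (p + 1)" "1 < \<beta>" "\<beta> < 2"
  using p by (auto simp: \<beta>_def exp_beta_def exp_a_def p_def[symmetric] field_simps)
 have \<beta>p: "0 < \<beta> - 1" "0 \<le> \<beta> - 1" using \<beta>(2) by auto
 have p\<beta>: "(p + 1) * (\<beta> - 1) = 1" unfolding \<beta>(1) using p by simp
 have g_ge: "a 0 + a N * s powr p \<le> g s" if "0 \<le> s" for s
 proof -
  have "(\<Sum>i\<in>{N}. a i * s powr \<alpha> i) \<le> (\<Sum>i=1..N. a i * s powr \<alpha> i)"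
   using N1 anonneg by (intro sum_mono2) auto
  then show ?thesis by (simp add: g_def forchheimer_g_def p_def)
 qed
 have g_pos: "a 0 \<le> g s" if "0 \<le> s" for s
 proof -
  have "0 \<le> a N * s powr p" using aN by simp
  then show ?thesis using g_ge[OF that] by linarith
 qed
 have g_mono: "g s \<le> g t" if "0 \<le> s" "s \<le> t" for s t
  unfolding g_def forchheimer_g_def using that anonneg \<alpha>nonneg
  by (intro add_left_mono sum_mono mult_left_mono powr_mono2) auto
 have g_cont: "continuous_on {0..} g"
  unfolding g_def forchheimer_g_def
  by (intro continuous_on_add continuous_on_const continuous_on_sum continuous_on_mult
    continuous_on_powr' continuous_on_id) (use \<alpha>pos in auto)
 define A where "A = a 0 + (\<Sum>i=1..N. a i)"
 have A: "0 < A"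
  using a0 anonneg by (auto simp: A_def intro!: add_pos_nonneg sum_nonneg)
 have g_le: "g s \<le> A * (max 1 s) powr p" if "0 \<le> s" for s
 proof -
  have "g s \<le> g (max 1 s)" using that by (intro g_mono) auto
  also have "\<dots> \<le> a 0 * (max 1 s) powr p + (\<Sum>i=1..N. a i * (max 1 s) powr p)"
   unfolding g_def forchheimer_g_def
  proof (intro add_mono sum_mono mult_left_mono)
   have "1 \<le> (max 1 s) powr p" using p by (intro ge_one_powr_ge_zero) auto
   then show "a 0 \<le> a 0 * (max 1 s) powr p" using a0 by simp
   show "(max 1 s) powr \<alpha> i \<le> (max 1 s) powr p" if "i \<in> {1..N}" for i
    using \<alpha>mono[of i N] that by (intro powr_mono) (auto simp: p_def)
  qed (use anonneg in auto)
  also have "\<dots> = A * (max 1 s) powr p" by (simp add: A_def sum_distrib_right[symmetric] distrib_right)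
  finally show ?thesis .
 qed
 have G_mono: "a 0 * (t - s) \<le> t * g t - s * g s" if "0 \<le> s" "s \<le> t" for s t
 proof -
  have "a 0 * (t - s) \<le> g t * (t - s)" using g_pos[of t] that by (intro mult_right_mono) auto
  also have "\<dots> \<le> t * g t - s * g s"
   using mult_left_mono[OF g_mono[OF that] that(1)] by (simp add: algebra_simps)
  finally show ?thesis .
 qed
 have ex1: "\<exists>!s. 0 \<le> s \<and> s * g s = \<xi>" if "0 \<le> \<xi>" for \<xi>
 proof -
  have "\<exists>s\<ge>0. s \<le> \<xi> / a 0 \<and> s * g s = \<xi>"
  proof (rule IVT')
   show "\<xi> \<le> \<xi> / a 0 * g (\<xi> / a 0)"
    using mult_left_mono[OF g_pos[of "\<xi> / a 0"], of "\<xi> / a 0"] that a0 by simp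
   show "continuous_on {0..\<xi> / a 0} (\<lambda>s. s * g s)"
    by (intro continuous_intros continuous_on_subset[OF g_cont]) auto
  qed (use that a0 in auto)
  moreover have "s = t" if "0 \<le> s" "0 \<le> t" "s * g s = t * g t" for s t
  proof (rule ccontr)
   assume "s \<noteq> t"
   then consider "s < t" | "t < s" by linarith
   then show False
   proof cases
    case 1
    then have "0 < a 0 * (t - s)" using a0 by simp
    with 1 show False using G_mono[of s t] that by linarith
   next
    case 2
    then have "0 < a 0 * (s - t)" using a0 by simp
    with 2 show False using G_mono[of t s] that by linarith
   qed
  qed
  ultimately show ?thesis by metis
 qed
 define \<sigma> where "\<sigma> \<xi> = (THE s. 0 \<le> s \<and> s * g s = \<xi>)" for \<xi>
 have \<sigma>: "0 \<le> \<sigma> \<xi>" "\<sigma> \<xi> * g (\<sigma> \<xi>) = \<xi>" if "0 \<le> \<xi>" for \<xi>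
  using theI'[OF ex1[OF that]] by (auto simp: \<sigma>_def)
 define K where "K = forchheimer_K N a \<alpha>"
 have K_eq: "K \<xi> = 1 / g (\<sigma> \<xi>)" for \<xi>
  by (simp add: K_def forchheimer_K_def \<sigma>_def g_def)
 have K\<sigma>: "K \<xi> * \<xi> = \<sigma> \<xi>" if "0 \<le> \<xi>" for \<xi>
  using \<sigma>[OF that] g_pos[of "\<sigma> \<xi>"] a0 by (simp add: K_eq field_simps)
 have \<sigma>mono: "\<sigma> \<xi> \<le> \<sigma> \<zeta> \<and> a 0 * (\<sigma> \<zeta> - \<sigma> \<xi>) \<le> \<zeta> - \<xi>" if "0 \<le> \<xi>" "\<xi> \<le> \<zeta>" for \<xi> \<zeta>
 proof -
  have "\<sigma> \<xi> \<le> \<sigma> \<zeta>"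
  proof (rule ccontr)
   assume "\<not> ?thesis"
   then have "a 0 * (\<sigma> \<xi> - \<sigma> \<zeta>) \<le> \<xi> - \<zeta>" "0 < a 0 * (\<sigma> \<xi> - \<sigma> \<zeta>)"
    using G_mono[of "\<sigma> \<zeta>" "\<sigma> \<xi>"] \<sigma>[of \<zeta>] \<sigma>[of \<xi>] that a0 by auto
   then show False using that by linarith
  qed
  then show ?thesis using G_mono[of "\<sigma> \<xi>" "\<sigma> \<zeta>"] \<sigma>[of \<zeta>] \<sigma>[of \<xi>] that by auto
 qed
 have lip: "\<bar>\<sigma> \<xi> - \<sigma> \<zeta>\<bar> \<le> (1 / a 0) * \<bar>\<xi> - \<zeta>\<bar>" if "0 \<le> \<xi>" "0 \<le> \<zeta>" for \<xi> \<zeta>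
  using \<sigma>mono[of \<xi> \<zeta>] \<sigma>mono[of \<zeta> \<xi>] that a0 by (cases "\<xi> \<le> \<zeta>") (auto simp: field_simps)
 have \<sigma>cont: "continuous_on {0..} \<sigma>"
 proof -
  have "(1 / a 0)-lipschitz_on {0..} \<sigma>"
   using lip a0 by (intro lipschitz_onI) (auto simp: dist_real_def)
  then show ?thesis by (rule lipschitz_on_continuous_on)
 qed
 have Kcont: "continuous_on {0..} K"
 proof -
  have "continuous_on {0..} (\<lambda>\<xi>. g (\<sigma> \<xi>))"
   using \<sigma> by (intro continuous_on_compose2[OF g_cont \<sigma>cont]) auto
  moreover have "g (\<sigma> \<xi>) \<noteq> 0" if "0 \<le> \<xi>" for \<xi>
   using g_pos[of "\<sigma> \<xi>"] \<sigma>[OF that] a0 by simp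
  ultimately show ?thesis unfolding K_eq by (intro continuous_intros) auto
 qed
 have up: "\<sigma> \<xi> \<le> a N powr (-(\<beta> - 1)) * \<xi> powr (\<beta> - 1)" if "0 \<le> \<xi>" for \<xi>
 proof -
  let ?s = "\<sigma> \<xi>"
  have s0: "0 \<le> ?s" using \<sigma>(1)[OF that] .
  have "a N * ?s powr p \<le> g ?s" using g_ge[OF s0] a0 by linarith
  then have "?s * (a N * ?s powr p) \<le> \<xi>" using mult_left_mono[of _ _ ?s] s0 \<sigma>(2)[OF that] by metis
  moreover have "?s * ?s powr p = ?s powr (p + 1)" using s0
   by (cases "?s = 0") (auto simp: powr_add)
  ultimately have "?s powr (p + 1) \<le> \<xi> / a N" using aN
   by (simp add: pos_le_divide_eq) (metis mult.commute mult.left_commute)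
  then have "(?s powr (p + 1)) powr (\<beta> - 1) \<le> (\<xi> / a N) powr (\<beta> - 1)"
   using \<beta>p by (intro powr_mono2) auto
  moreover have "(?s powr (p + 1)) powr (\<beta> - 1) = ?s"
   using s0 by (simp add: powr_powr p\<beta>)
  ultimately show ?thesis using that aN by (simp add: powr_divide powr_minus_divide del: minus_diff_eq)
 qed
 define c where "c = A powr (-(\<beta> - 1))"
 have c: "0 < c" using A by (simp add: c_def)
 have low: "c * \<xi> powr (\<beta> - 1) - 1 \<le> \<sigma> \<xi>" if "0 \<le> \<xi>" for \<xi>
 proof -
  let ?s = "max 1 (\<sigma> \<xi>)"
  have s0: "0 \<le> \<sigma> \<xi>" using \<sigma>(1)[OF that] .
  have "\<sigma> \<xi> * g (\<sigma> \<xi>) \<le> ?s * (A * ?s powr p)"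
   using g_le[OF s0] g_pos[OF s0] a0 by (intro mult_mono) auto
  then have "\<xi> \<le> ?s * (A * ?s powr p)" using \<sigma>(2)[OF that] by simp
  also have "\<dots> = A * ?s powr (p + 1)" by (simp add: powr_add)
  finally have "\<xi> powr (\<beta> - 1) \<le> (A * ?s powr (p + 1)) powr (\<beta> - 1)"
   using \<beta>p that by (intro powr_mono2) auto
  also have "\<dots> = A powr (\<beta> - 1) * ?s"
   using A by (simp add: powr_mult powr_powr p\<beta>)
  finally have "c * \<xi> powr (\<beta> - 1) \<le> ?s"
   using A by (simp add: c_def powr_minus_divide pos_divide_le_eq mult.commute del: minus_diff_eq)
  then show ?thesis using s0 by linarith
 qed
 define D where "D = (2 / c) powr (1 / (\<beta> - 1))"
 have D: "0 < D" using c by (simp add: D_def)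
 have lowK: "(c / 2) * \<xi> powr \<beta> - D \<le> K \<xi> * \<xi>\<^sup>2" if \<xi>: "0 \<le> \<xi>" for \<xi>
 proof -
  have pw: "\<xi> powr \<beta> = \<xi> powr (\<beta> - 1) * \<xi>" using \<xi> powr_add[of \<xi> "\<beta> - 1" 1]
   by (cases "\<xi> = 0") auto
  have "\<xi> \<le> (c / 2) * \<xi> powr \<beta> + D"
  proof (cases "2 / c \<le> \<xi> powr (\<beta> - 1)")
   case True
   then have "1 \<le> (c / 2) * \<xi> powr (\<beta> - 1)" using c by (simp add: field_simps)
   then have "\<xi> \<le> (c / 2) * \<xi> powr (\<beta> - 1) * \<xi>"
    using mult_right_mono[OF _ \<xi>, of 1 "(c / 2) * \<xi> powr (\<beta> - 1)"] by simp
   then show ?thesis using D pw by simp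
  next
   case False
   then have "(\<xi> powr (\<beta> - 1)) powr (1 / (\<beta> - 1)) \<le> D" unfolding D_def
    using \<beta>p by (intro powr_mono2) auto
   then have "\<xi> \<le> D" using \<xi> \<beta>p by (simp add: powr_powr)
   moreover have "0 \<le> (c / 2) * \<xi> powr \<beta>" using c by simp
   ultimately show ?thesis by linarith
  qed
  moreover have "(c * \<xi> powr (\<beta> - 1) - 1) * \<xi> \<le> K \<xi> * \<xi>\<^sup>2"
   using mult_right_mono[OF low[OF \<xi>] \<xi>] K\<sigma>[OF \<xi>] by (simp add: power2_eq_square mult.assoc[symmetric])
  ultimately show ?thesis using pw by (simp add: algebra_simps)
 qed
 have "power_law_flux K \<beta> (c / 2) (max D (a N powr (-(\<beta> - 1))))"
 proof
  show "K \<xi> * \<xi> \<le> max D (a N powr (-(\<beta> - 1))) * \<xi> powr (\<beta> - 1)" if "0 \<le> \<xi>" for \<xi>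
   using up[OF that] K\<sigma>[OF that] mult_right_mono[OF max.cobounded2, of "\<xi> powr (\<beta> - 1)" "a N powr (-(\<beta> - 1))" D]
   by simp
  show "c / 2 * \<xi> powr \<beta> - max D (a N powr (-(\<beta> - 1))) \<le> K \<xi> * \<xi>\<^sup>2" if "0 \<le> \<xi>" for \<xi>
   using lowK[OF that] by linarith
  show "0 \<le> K \<xi>" if "0 \<le> \<xi>" for \<xi>
   using g_pos[of "\<sigma> \<xi>"] \<sigma>[OF that] a0 by (simp add: K_eq)
  show "K \<xi> * \<xi> \<le> K \<zeta> * \<zeta>" if "0 \<le> \<xi>" "\<xi> \<le> \<zeta>" for \<xi> \<zeta>
   using \<sigma>mono[OF that] K\<sigma>[of \<xi>] K\<sigma>[of \<zeta>] that by simp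
  show "0 < max D (a N powr (-(\<beta> - 1)))" using D by simp
  show "continuous_on {0..} K" by (rule Kcont)
  show "1 < \<beta>" "\<beta> < 2" by (fact \<beta>)+
  show "0 < c / 2" using c by simp
 qed
 then show ?thesis by (auto simp: K_def \<beta>_def)
qed

section \<open>Gradients and polynomials\<close>

lemma grad_inner_derivative:
 assumes "(u has_derivative D) (at x)"
 shows "D y = grad u x \<bullet> y" and "pderivative b u x = D b"
proof -
 have D: "frechet_derivative u (at x) = D" using frechet_derivative_at[OF assms] by simp
 interpret D: bounded_linear D using assms by (rule has_derivative_bounded_linear)
 have "D y = D (\<Sum>b\<in>Basis. (y \<bullet> b) *\<^sub>R b)" by (simp add: euclidean_representation)
 also have "\<dots> = (\<Sum>b\<in>Basis. (y \<bullet> b) * D b)" by (simp add: D.sum D.scaleR)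
 finally show "D y = grad u x \<bullet> y"
  by (simp add: grad_def pderivative_def D inner_sum_left) (simp add: inner_commute mult.commute)
 show "pderivative b u x = D b" by (simp add: pderivative_def D)
qed

lemma has_derivative_grad:
 assumes "u differentiable (at x)"
 shows "(u has_derivative (\<lambda>y. grad u x \<bullet> y)) (at x)"
proof -
 obtain D where D: "(u has_derivative D) (at x)" using assms by (auto simp: differentiable_def)
 have "D = (\<lambda>y. grad u x \<bullet> y)" using grad_inner_derivative(1)[OF D] by auto
 with D show ?thesis by simp
qed

lemma grad_inner_Basis: "b \<in> Basis ==> grad u x \<bullet> b = pderivative b u x"
 by (simp add: grad_def inner_sum_left_Basis)

lemma grad_eqI:
 assumes "(u has_derivative (\<lambda>y. g \<bullet> y)) (at x)"
 shows "grad u x = g"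
 by (rule euclidean_eqI) (rule grad_inner_derivative(1)[OF assms, symmetric])

lemma grad_transform_open:
 assumes "open S" "x \<in> S" "\<And>y. y \<in> S ==> u y = v y" "v differentiable (at x)"
 shows "u differentiable (at x)" "grad u x = grad v x"
proof -
 have "(u has_derivative (\<lambda>y. grad v x \<bullet> y)) (at x)"
  using has_derivative_transform_within_open[OF has_derivative_grad[OF assms(4)] assms(1,2)] assms(3)
  by simp
 then show "u differentiable (at x)" "grad u x = grad v x"
  by (auto simp: differentiable_def intro: grad_eqI)
qed

lemma grad_lincomb:
 assumes "\<And>i. i \<in> J ==> e i differentiable (at x)"
 shows "(\<lambda>y. \<Sum>i\<in>J. c i * e i y) differentiable (at x)"
  and "grad (\<lambda>y. \<Sum>i\<in>J. c i * e i y) x = (\<Sum>i\<in>J. c i *\<^sub>R grad (e i) x)"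
proof -
 have "((\<lambda>y. \<Sum>i\<in>J. c i * e i y) has_derivative (\<lambda>y. \<Sum>i\<in>J. c i * (grad (e i) x \<bullet> y))) (at x)"
  using has_derivative_grad[OF assms] by (intro has_derivative_sum has_derivative_mult_right)
 then have "((\<lambda>y. \<Sum>i\<in>J. c i * e i y) has_derivative (\<lambda>y. (\<Sum>i\<in>J. c i *\<^sub>R grad (e i) x) \<bullet> y)) (at x)"
  by (simp add: inner_sum_left)
 then show "(\<lambda>y. \<Sum>i\<in>J. c i * e i y) differentiable (at x)"
  and "grad (\<lambda>y. \<Sum>i\<in>J. c i * e i y) x = (\<Sum>i\<in>J. c i *\<^sub>R grad (e i) x)"
  by (auto simp: differentiable_def intro: grad_eqI)
qed

lemma finite_multi_indices [simp]: "finite (multi_indices k :: ('a::euclidean_space \<Rightarrow> nat) set)"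
proof (rule finite_subset)
 show "multi_indices k \<subseteq> {\<mu>. \<forall>x::'a. (x \<in> Basis \<longrightarrow> \<mu> x \<in> {..k}) \<and> (x \<notin> Basis \<longrightarrow> \<mu> x = 0)}"
  unfolding multi_indices_def
 proof (intro subsetI CollectI allI conjI impI; elim CollectE conjE)
  fix \<mu> :: "'a \<Rightarrow> nat" and x :: 'a
  assume "x \<in> Basis" "sum \<mu> Basis \<le> k"
  then show "\<mu> x \<in> {..k}" using member_le_sum[of x Basis \<mu>] by simp
 qed auto
qed (rule finite_set_of_finite_funs; simp)

definition monomial :: "('a::euclidean_space \<Rightarrow> nat) \<Rightarrow> 'a \<Rightarrow> real" where
 "monomial \<mu> x = (\<Prod>b\<in>Basis. (x \<bullet> b) ^ \<mu> b)"

lemma polynomials_iff: "p \<in> polynomials k \<longleftrightarrow> (\<exists>c. \<forall>x. p x = (\<Sum>\<mu>\<in>multi_indices k. c \<mu> * monomial \<mu> x))"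
 by (auto simp: polynomials_def monomial_def fun_eq_iff)

lemma monomial_in_polynomials:
 assumes "\<mu> \<in> multi_indices k" shows "monomial \<mu> \<in> polynomials k"
proof -
 have "\<forall>x. monomial \<mu> x = (\<Sum>\<nu>\<in>multi_indices k. (if \<nu> = \<mu> then 1 else 0) * monomial \<nu> x)"
  using assms by (simp add: if_distrib[of "\<lambda>t. t * _"] sum.delta cong: if_cong)
 then show ?thesis unfolding polynomials_iff by (rule exI[of _ "\<lambda>\<nu>. if \<nu> = \<mu> then 1 else 0"])
qed

lemma polynomials_lincomb:
 assumes "\<And>i. i \<in> I ==> p i \<in> polynomials k"
 shows "(\<lambda>x. \<Sum>i\<in>I. c i * p i x) \<in> polynomials k"
proof -
 obtain d where d: "\<And>i x. i \<in> I ==> p i x = (\<Sum>\<mu>\<in>multi_indices k. d i \<mu> * monomial \<mu> x)"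
  using assms unfolding polynomials_iff by metis
 have "\<forall>x. (\<Sum>i\<in>I. c i * p i x) = (\<Sum>\<mu>\<in>multi_indices k. (\<Sum>i\<in>I. c i * d i \<mu>) * monomial \<mu> x)"
  by (simp add: d sum_distrib_left sum_distrib_right mult.assoc sum.swap[of _ I])
 then show ?thesis unfolding polynomials_iff by (rule exI[of _ "\<lambda>\<mu>. \<Sum>i\<in>I. c i * d i \<mu>"])
qed

lemma polynomials_mono: "k \<le> l ==> p \<in> polynomials k ==> p \<in> polynomials l"
proof -
 assume kl: "k \<le> l" and p: "p \<in> polynomials k"
 obtain c where c: "p = (\<lambda>x. \<Sum>\<mu>\<in>multi_indices k. c \<mu> * monomial \<mu> x)"
  using p by (auto simp: polynomials_iff fun_eq_iff)
 show ?thesis unfolding c using kl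
  by (intro polynomials_lincomb monomial_in_polynomials) (auto simp: multi_indices_def)
qed

lemma const_in_polynomials: "(\<lambda>x. c) \<in> polynomials k"
proof -
 have "(\<lambda>x. \<Sum>i\<in>{()}. c * monomial (\<lambda>_. 0) x) \<in> polynomials k"
  by (intro polynomials_lincomb monomial_in_polynomials) (auto simp: multi_indices_def)
 then show ?thesis by (simp add: monomial_def)
qed

lemma polynomials_add:
 assumes "p \<in> polynomials k" "q \<in> polynomials k"
 shows "(\<lambda>x. p x + q x) \<in> polynomials k"
proof -
 have "(\<lambda>x. \<Sum>b\<in>{True, False}. 1 * (if b then p else q) x) \<in> polynomials k"
  using assms by (intro polynomials_lincomb) auto
 then show ?thesis by simp
qed

lemma monomial_add: "monomial (\<lambda>b. \<mu> b + \<nu> b) x = monomial \<mu> x * monomial \<nu> x"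
 by (simp add: monomial_def power_add prod.distrib)

lemma polynomials_mult:
 assumes "p \<in> polynomials k" "q \<in> polynomials l"
 shows "(\<lambda>x. p x * q x) \<in> polynomials (k + l)"
proof -
 obtain c where c: "\<And>x. p x = (\<Sum>\<mu>\<in>multi_indices k. c \<mu> * monomial \<mu> x)"
  using assms by (auto simp: polynomials_iff)
 obtain d where d: "\<And>x. q x = (\<Sum>\<mu>\<in>multi_indices l. d \<mu> * monomial \<mu> x)"
  using assms by (auto simp: polynomials_iff)
 have "p x * q x = (\<Sum>\<mu>\<in>multi_indices k. c \<mu> * (\<Sum>\<nu>\<in>multi_indices l. d \<nu> * monomial (\<lambda>b. \<mu> b + \<nu> b) x))" for x
  unfolding c d sum_distrib_right
  by (intro sum.cong refl) (simp add: monomial_add sum_distrib_left mult_ac)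
 moreover have "(\<lambda>x. \<Sum>\<mu>\<in>multi_indices k. c \<mu> * (\<Sum>\<nu>\<in>multi_indices l. d \<nu> * monomial (\<lambda>b. \<mu> b + \<nu> b) x)) \<in> polynomials (k + l)"
  by (intro polynomials_lincomb monomial_in_polynomials)
    (auto simp: multi_indices_def sum.distrib intro: add_mono)
 ultimately show ?thesis by simp
qed

lemma coordinate_in_polynomials:
 assumes "b \<in> Basis" shows "(\<lambda>x. x \<bullet> b) \<in> polynomials 1"
proof -
 let ?\<mu> = "\<lambda>b'. if b' = b then 1 else 0 :: nat"
 have "monomial ?\<mu> = (\<lambda>x. x \<bullet> b)"
  using assms by (auto simp: monomial_def fun_eq_iff if_distrib[of "\<lambda>n. _ ^ n"] prod.delta cong: if_cong)
 moreover have "monomial ?\<mu> \<in> polynomials 1"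
  using assms by (intro monomial_in_polynomials) (auto simp: multi_indices_def)
 ultimately show ?thesis by simp
qed

lemma polynomials_power: "p \<in> polynomials k ==> (\<lambda>x. p x ^ n) \<in> polynomials (n * k)"
proof (induction n)
 case 0
 then show ?case by (simp add: const_in_polynomials)
next
 case (Suc n)
 then show ?case using polynomials_mult[of p k "\<lambda>x. p x ^ n" "n * k"] by simp
qed

lemma polynomials_prod:
 "finite I ==> (\<And>i. i \<in> I ==> p i \<in> polynomials (k i)) ==>
  (\<lambda>x. \<Prod>i\<in>I. p i x) \<in> polynomials (sum k I)"
proof (induction I rule: finite_induct)
 case empty
 then show ?case by (simp add: const_in_polynomials)
next
 case (insert i I)
 then show ?case using polynomials_mult[of "p i" "k i" "\<lambda>x. \<Prod>i\<in>I. p i x" "sum k I"] by simp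
qed

lemma polynomials_affine:
 assumes "p \<in> polynomials k"
 shows "(\<lambda>y. p (x0 + h *\<^sub>R y)) \<in> polynomials k"
proof -
 obtain c where c: "\<And>x. p x = (\<Sum>\<mu>\<in>multi_indices k. c \<mu> * monomial \<mu> x)"
  using assms by (auto simp: polynomials_iff)
 have aff: "(\<lambda>y::'a. (x0 + h *\<^sub>R y) \<bullet> b) \<in> polynomials 1" if "b \<in> Basis" for b
  using polynomials_add[OF const_in_polynomials[of "x0 \<bullet> b"]
    polynomials_lincomb[of "{b}" "\<lambda>b x. x \<bullet> b" 1 "\<lambda>_. h"]] coordinate_in_polynomials[OF that]
  by (simp add: inner_add_left)
 have "(\<lambda>y. monomial \<mu> (x0 + h *\<^sub>R y)) \<in> polynomials k" if \<mu>: "\<mu> \<in> multi_indices k" for \<mu>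
 proof -
  have "(\<lambda>y. \<Prod>b\<in>Basis. ((x0 + h *\<^sub>R y) \<bullet> b) ^ \<mu> b) \<in> polynomials (\<Sum>b\<in>Basis. \<mu> b * 1)"
   by (intro polynomials_prod polynomials_power aff) auto
  then show ?thesis using \<mu> unfolding monomial_def
   by (elim polynomials_mono[rotated]) (simp add: multi_indices_def)
 qed
 then show ?thesis unfolding c by (intro polynomials_lincomb)
qed

lemma monomial_has_derivative:
 assumes b: "b \<in> Basis"
 shows "monomial \<mu> differentiable (at x)"
  and "pderivative b (monomial \<mu>) x = real (\<mu> b) * monomial (\<mu>(b := \<mu> b - 1)) x"
proof -
 have der: "(monomial \<mu> has_derivative
   (\<lambda>y. \<Sum>i\<in>Basis. (real (\<mu> i) * (y \<bullet> i) * (x \<bullet> i) ^ (\<mu> i - 1)) * (\<Prod>j\<in>Basis - {i}. (x \<bullet> j) ^ \<mu> j))) (at x)"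
  unfolding monomial_def[abs_def]
  by (intro has_derivative_prod has_derivative_power has_derivative_inner_left has_derivative_ident)
 then show "monomial \<mu> differentiable (at x)" by (auto simp: differentiable_def)
 have "pderivative b (monomial \<mu>) x
   = (\<Sum>i\<in>Basis. (real (\<mu> i) * (b \<bullet> i) * (x \<bullet> i) ^ (\<mu> i - 1)) * (\<Prod>j\<in>Basis - {i}. (x \<bullet> j) ^ \<mu> j))"
  by (rule grad_inner_derivative(2)[OF der])
 also have "\<dots> = (\<Sum>i\<in>Basis. if i = b then real (\<mu> b) * (x \<bullet> b) ^ (\<mu> b - 1) * (\<Prod>j\<in>Basis - {b}. (x \<bullet> j) ^ \<mu> j) else 0)"
  using b by (intro sum.cong) (auto simp: inner_Basis)
 also have "\<dots> = real (\<mu> b) * ((x \<bullet> b) ^ (\<mu> b - 1) * (\<Prod>j\<in>Basis - {b}. (x \<bullet> j) ^ \<mu> j))"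
  using b by (simp add: mult.assoc)
 also have "\<dots> = real (\<mu> b) * monomial (\<mu>(b := \<mu> b - 1)) x"
 proof -
  have "(\<Prod>j\<in>Basis - {b}. (x \<bullet> j) ^ (\<mu>(b := \<mu> b - 1)) j) = (\<Prod>j\<in>Basis - {b}. (x \<bullet> j) ^ \<mu> j)"
   by (intro prod.cong) auto
  then show ?thesis unfolding monomial_def
   using b prod.remove[of Basis b "\<lambda>j. (x \<bullet> j) ^ (\<mu>(b := \<mu> b - 1)) j"] by simp
 qed
 finally show "pderivative b (monomial \<mu>) x = real (\<mu> b) * monomial (\<mu>(b := \<mu> b - 1)) x" .
qed

lemma polynomials_differentiable:
 fixes p :: "'a::euclidean_space \<Rightarrow> real"
 assumes "p \<in> polynomials k"
 shows "p differentiable (at x)"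
proof -
 obtain c where c: "p = (\<lambda>x. \<Sum>\<mu>\<in>multi_indices k. c \<mu> * monomial \<mu> x)"
  using assms by (auto simp: polynomials_iff fun_eq_iff)
 obtain b :: 'a where "b \<in> Basis" using nonempty_Basis by blast
 show ?thesis unfolding c using monomial_has_derivative(1)[OF \<open>b \<in> Basis\<close>] by (intro grad_lincomb)
qed

lemma polynomials_continuous_on:
 assumes "p \<in> polynomials k" shows "continuous_on S p"
 by (intro continuous_at_imp_continuous_on ballI differentiable_imp_continuous_within
   polynomials_differentiable[OF assms])

lemma pderivative_in_polynomials:
 fixes p :: "'a::euclidean_space \<Rightarrow> real"
 assumes p: "p \<in> polynomials k" and b: "b \<in> Basis"
 shows "pderivative b p \<in> polynomials k"
proof -
 obtain c where c: "p = (\<lambda>x. \<Sum>\<mu>\<in>multi_indices k. c \<mu> * monomial \<mu> x)"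
  using p by (auto simp: polynomials_iff fun_eq_iff)
 have "pderivative b p x = (\<Sum>\<mu>\<in>multi_indices k. (c \<mu> * real (\<mu> b)) * monomial (\<mu>(b := \<mu> b - 1)) x)" for x
 proof -
  have "pderivative b p x = grad p x \<bullet> b" using b by (simp add: grad_inner_Basis)
  also have "\<dots> = (\<Sum>\<mu>\<in>multi_indices k. c \<mu> * pderivative b (monomial \<mu>) x)"
   unfolding c using monomial_has_derivative(1)[OF b] b
   by (subst grad_lincomb) (auto simp: inner_sum_left grad_inner_Basis)
  finally show ?thesis by (simp add: monomial_has_derivative(2)[OF b] mult.assoc)
 qed
 then have "pderivative b p = (\<lambda>x. \<Sum>\<mu>\<in>multi_indices k. (c \<mu> * real (\<mu> b)) * monomial (\<mu>(b := \<mu> b - 1)) x)"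
  by auto
 also have "\<dots> \<in> polynomials k"
 proof (intro polynomials_lincomb monomial_in_polynomials)
  fix \<mu> :: "'a \<Rightarrow> nat" assume "\<mu> \<in> multi_indices k"
  moreover have "sum (\<mu>(b := \<mu> b - 1)) Basis \<le> sum \<mu> Basis" by (intro sum_mono) auto
  ultimately show "\<mu>(b := \<mu> b - 1) \<in> multi_indices k" using b by (auto simp: multi_indices_def)
 qed
 finally show ?thesis .
qed

section \<open>Meshes and piecewise polynomials\<close>

locale mesh =
 fixes \<Omega> :: "'a::euclidean_space set" and \<T> :: "'a set set"
 assumes domain: "bounded_domain \<Omega>" and mesh: "mesh_of \<Omega> \<T>"
begin

definition core :: "'a set" where "core = (\<Union>E\<in>\<T>. interior E)"

lemma finite_mesh: "finite \<T>" and Union_mesh: "\<Union>\<T> = closure \<Omega>"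
 using mesh by (auto simp: mesh_of_def triangulation_def)

lemma domain_open: "open \<Omega>" and domain_bounded: "bounded \<Omega>" and domain_nonempty: "\<Omega> \<noteq> {}"
 and interior_closure_domain: "interior (closure \<Omega>) = \<Omega>"
 using domain by (auto simp: bounded_domain_def)

lemma element_vertices:
 assumes "E \<in> \<T>"
 obtains C where "\<not> affine_dependent C" "card C = Suc DIM('a)" "E = convex hull C"
 using mesh assms by (auto simp: mesh_of_def simplex_def)

lemma element:
 assumes "E \<in> \<T>"
 shows "convex E" "compact E" "interior E \<noteq> {}" "closure (interior E) = E" "E \<subseteq> closure \<Omega>"
  "interior E \<subseteq> \<Omega>" "negligible (frontier E)"
proof -
 obtain C where C: "\<not> affine_dependent C" "card C = Suc DIM('a)" "E = convex hull C"
  using element_vertices[OF assms] .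
 show conv: "convex E" by (simp add: C)
 show comp: "compact E" using C by (simp add: finite_imp_compact_convex_hull aff_independent_finite)
 show int: "interior E \<noteq> {}" using C by (simp add: interior_convex_hull_eq_empty)
 show "closure (interior E) = E"
  using convex_closure_interior[OF conv int] comp by (simp add: compact_imp_closed)
 show "E \<subseteq> closure \<Omega>" using assms Union_mesh by blast
 then show "interior E \<subseteq> \<Omega>" using interior_mono interior_closure_domain by blast
 show "negligible (frontier E)" using conv by (rule negligible_convex_frontier)
qed

lemma element_interiors_disjoint:
 assumes "E \<in> \<T>" "F \<in> \<T>" "E \<noteq> F" shows "interior E \<inter> interior F = {}"
proof -
 have f: "E \<inter> F face_of E" "F \<inter> E face_of F"
  using mesh assms by (auto simp: mesh_of_def triangulation_def)
 show ?thesis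
 proof (cases "E \<inter> F = E")
  case False
  then show ?thesis using face_of_disjoint_interior[OF f(1)] interior_subset by blast
 next
  case True
  then have "F \<inter> E \<noteq> F" using assms by auto
  then show ?thesis using face_of_disjoint_interior[OF f(2)] interior_subset by blast
 qed
qed

lemma core_open: "open core" and core_subset: "core \<subseteq> \<Omega>"
 using element(6) by (auto simp: core_def)

lemma core_lmeasurable: "core \<in> lmeasurable"
 using core_open core_subset domain_bounded bounded_subset by (intro lmeasurable_open) auto

lemma finite_measure_core: "finite_measure (lebesgue_on core)"
 by (rule finite_measure_lebesgue_on[OF core_lmeasurable])

lemma negligible_frontiers: "negligible (\<Union>E\<in>\<T>. frontier E)"
 using finite_mesh element(7) by (intro negligible_Union) auto

lemma closure_minus_core: "closure \<Omega> - core \<subseteq> (\<Union>E\<in>\<T>. frontier E)"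
proof
 fix x assume x: "x \<in> closure \<Omega> - core"
 then obtain E where "E \<in> \<T>" "x \<in> E" using Union_mesh by auto
 then show "x \<in> (\<Union>E\<in>\<T>. frontier E)"
  using x closure_subset[of E] by (auto simp: core_def frontier_def)
qed

lemma AE_core: "AE x in lebesgue. x \<in> \<Omega> \<longleftrightarrow> x \<in> core"
proof -
 have "negligible (\<Omega> - core)"
  using closure_minus_core closure_subset by (intro negligible_subset[OF negligible_frontiers]) blast
 then have "\<Omega> - core \<in> null_sets lebesgue" by (simp add: negligible_iff_null_sets)
 then have "AE x in lebesgue. x \<notin> \<Omega> - core" by (rule AE_not_in)
 then show ?thesis by eventually_elim (use core_subset in auto)
qed

lemma nn_integral_core: "(\<integral>\<^sup>+x. f x \<partial>lebesgue_on \<Omega>) = (\<integral>\<^sup>+x. f x \<partial>lebesgue_on core)"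
proof -
 have s: "\<Omega> \<in> sets lebesgue" "core \<in> sets lebesgue"
  using domain_open core_open by (auto intro: borel_open)
 have "AE x in lebesgue. f x * indicator \<Omega> x = f x * indicator core x"
  using AE_core by eventually_elim (auto simp: indicator_def)
 then show ?thesis using s by (simp add: nn_integral_restrict_space nn_integral_cong_AE)
qed

lemma integral_core:
 fixes f :: "'a \<Rightarrow> real"
 shows "(\<integral>x. f x \<partial>lebesgue_on \<Omega>) = (\<integral>x. f x \<partial>lebesgue_on core)"
proof -
 have s: "\<Omega> \<in> sets lebesgue" "core \<in> sets lebesgue"
  using domain_open core_open by (auto intro: borel_open)
 let ?f = "\<lambda>x. indicator \<Omega> x *\<^sub>R f x" and ?g = "\<lambda>x. indicator core x *\<^sub>R f x"
 have ae: "AE x in lebesgue. ?f x = ?g x"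
  using AE_core by eventually_elim (auto simp: indicator_def)
 then have ae': "AE x in lebesgue. ?g x = ?f x" by eventually_elim (rule sym)
 have "integral\<^sup>L lebesgue ?f = integral\<^sup>L lebesgue ?g"
 proof (cases "?f \<in> borel_measurable lebesgue")
  case True
  then show ?thesis using ae borel_measurable_AE[OF True ae] by (intro integral_cong_AE)
 next
  case False
  then have "?g \<notin> borel_measurable lebesgue" using borel_measurable_AE[OF _ ae'] by blast
  then have "\<not> integrable lebesgue ?f" "\<not> integrable lebesgue ?g"
   using False borel_measurable_integrable by blast+
  then show ?thesis by (metis not_integrable_integral_eq)
 qed
 then show ?thesis using s by (simp add: integral_restrict_space)
qed

lemma L2_inner_core: "L2_inner (lebesgue_on \<Omega>) u v = L2_inner (lebesgue_on core) u v"
 unfolding L2_inner_def by (rule integral_core)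

lemma measurable_core: "continuous_on core f ==> f \<in> Lmeas core"
 using core_open by (intro continuous_imp_measurable_on_sets_lebesgue) (auto intro: borel_open)

lemma piecewise_polynomial_at:
 assumes "u \<in> piecewise_polynomials k \<T>" "x \<in> core"
 obtains E p where "E \<in> \<T>" "x \<in> interior E" "p \<in> polynomials k" "\<forall>y\<in>interior E. u y = p y"
proof -
 obtain E where E: "E \<in> \<T>" "x \<in> interior E" using assms(2) by (auto simp: core_def)
 then obtain p where "p \<in> polynomials k" "\<forall>y\<in>interior E. u y = p y"
  using assms(1) by (auto simp: piecewise_polynomials_def)
 with E show thesis using that by blast
qed

lemma piecewise_polynomial_differentiable:
 assumes "u \<in> piecewise_polynomials k \<T>" "x \<in> core"
 shows "u differentiable (at x)"
proof -
 obtain E p where "E \<in> \<T>" "x \<in> interior E" "p \<in> polynomials k" "\<forall>y\<in>interior E. u y = p y"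
  using piecewise_polynomial_at[OF assms] .
 then show ?thesis
  by (intro grad_transform_open(1)[OF open_interior _ _ polynomials_differentiable]) auto
qed

lemma piecewise_polynomial_continuous_on:
 assumes "u \<in> piecewise_polynomials k \<T>" shows "continuous_on core u"
 by (rule continuous_at_imp_continuous_on)
   (blast intro: differentiable_imp_continuous_within piecewise_polynomial_differentiable[OF assms])

lemma piecewise_polynomial_bounded:
 assumes u: "u \<in> piecewise_polynomials k \<T>"
 obtains B where "0 \<le> B" "\<And>x. x \<in> core ==> \<bar>u x\<bar> \<le> B"
proof -
 have "bounded (u ` interior E)" if E: "E \<in> \<T>" for E
 proof -
  obtain p where p: "p \<in> polynomials k" "\<And>y. y \<in> interior E ==> u y = p y"
   using u E by (auto simp: piecewise_polynomials_def)
  have "bounded (p ` E)"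
   using element(2)[OF E] polynomials_continuous_on[OF p(1)]
   by (intro compact_imp_bounded compact_continuous_image)
  moreover have "u ` interior E \<subseteq> p ` E" using p(2) interior_subset by fastforce
  ultimately show ?thesis by (rule bounded_subset)
 qed
 then have "bounded (\<Union>E\<in>\<T>. u ` interior E)" using finite_mesh by (intro bounded_Union) auto
 then obtain B where "0 < B" "\<forall>y\<in>(\<Union>E\<in>\<T>. u ` interior E). norm y \<le> B" by (auto simp: bounded_pos)
 then show thesis by (intro that[of B]) (auto simp: core_def)
qed

lemma piecewise_polynomials_lincomb:
 assumes "\<And>i. i \<in> J ==> u i \<in> piecewise_polynomials k \<T>"
 shows "(\<lambda>x. \<Sum>i\<in>J. c i * u i x) \<in> piecewise_polynomials k \<T>"
 unfolding piecewise_polynomials_def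
proof (intro CollectI ballI)
 fix E assume E: "E \<in> \<T>"
 obtain p where p: "\<And>i. i \<in> J ==> p i \<in> polynomials k" "\<And>i x. i \<in> J ==> x \<in> interior E ==> u i x = p i x"
 proof -
  have "\<forall>i\<in>J. \<exists>p. p \<in> polynomials k \<and> (\<forall>x\<in>interior E. u i x = p x)"
   using assms E unfolding piecewise_polynomials_def by blast
  then obtain p where "\<forall>i\<in>J. p i \<in> polynomials k \<and> (\<forall>x\<in>interior E. u i x = p i x)"
   unfolding bchoice_iff by blast
  then show thesis using that by blast
 qed
 then show "\<exists>p\<in>polynomials k. \<forall>x\<in>interior E. (\<Sum>i\<in>J. c i * u i x) = p x"
  by (intro bexI[of _ "\<lambda>x. \<Sum>i\<in>J. c i * p i x"] polynomials_lincomb) auto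
qed

lemma grad_in_M_space:
 assumes u: "u \<in> piecewise_polynomials k \<T>" shows "grad u \<in> M_space k \<T>"
 unfolding M_space_def piecewise_polynomials_def
proof (intro CollectI ballI)
 fix b :: 'a and E assume b: "b \<in> Basis" and E: "E \<in> \<T>"
 obtain p where p: "p \<in> polynomials k" "\<And>y. y \<in> interior E ==> u y = p y"
  using u E by (auto simp: piecewise_polynomials_def)
 have "grad u x \<bullet> b = pderivative b p x" if "x \<in> interior E" for x
  using grad_transform_open(2)[of "interior E" x u p] that p polynomials_differentiable[OF p(1)] b
  by (simp add: grad_inner_Basis)
 then show "\<exists>q\<in>polynomials k. \<forall>x\<in>interior E. grad u x \<bullet> b = q x"
  using pderivative_in_polynomials[OF p(1) b] by blast
qed

lemma M_space_continuous_on: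
 assumes "z \<in> M_space k \<T>" shows "continuous_on core z"
 using assms piecewise_polynomial_continuous_on unfolding M_space_def
 by (subst continuous_on_componentwise) auto

lemma M_space_bounded:
 assumes z: "z \<in> M_space k \<T>"
 obtains B where "0 \<le> B" "\<And>x. x \<in> core ==> norm (z x) \<le> B"
proof -
 have "\<exists>B. 0 \<le> B \<and> (\<forall>x\<in>core. \<bar>z x \<bullet> b\<bar> \<le> B)" if "b \<in> Basis" for b
 proof -
  have "(\<lambda>x. z x \<bullet> b) \<in> piecewise_polynomials k \<T>" using z that by (simp add: M_space_def)
  then show ?thesis by (rule piecewise_polynomial_bounded) blast
 qed
 then obtain B where B: "\<And>b. b \<in> Basis ==> 0 \<le> B b" "\<And>b x. b \<in> Basis ==> x \<in> core ==> \<bar>z x \<bullet> b\<bar> \<le> B b"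
  by metis
 have "norm (z x) \<le> sum B Basis" if "x \<in> core" for x
  using norm_le_l1[of "z x"] sum_mono[of Basis "\<lambda>b. \<bar>z x \<bullet> b\<bar>" B] B(2)[OF _ that] by auto
 then show thesis using B(1) by (intro that[of "sum B Basis"] sum_nonneg)
qed

end

section \<open>Finite-dimensional spaces of functions\<close>

lemma subspace_lincomb:
 fixes V :: "('x \<Rightarrow> real) set"
 assumes V: "\<And>u v c. u \<in> V ==> v \<in> V ==> (\<lambda>x. u x + c * v x) \<in> V"
  and "u \<in> V" "\<And>j. j < n ==> e j \<in> V"
 shows "(\<lambda>x. u x + (\<Sum>j<(n::nat). c j * e j x)) \<in> V"
 using assms(3)
proof (induction n)
 case 0
 then show ?case using assms(2) by simp
next
 case (Suc n)
 then show ?case using V[of "\<lambda>x. u x + (\<Sum>j<n. c j * e j x)" "e n" "c n"] by (simp add: add.assoc)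
qed

lemma functional_lincomb:
 fixes V :: "('x \<Rightarrow> real) set"
 assumes V: "\<And>u v c. u \<in> V ==> v \<in> V ==> (\<lambda>x. u x + c * v x) \<in> V"
  and l: "\<And>u v c. u \<in> V ==> v \<in> V ==> l (\<lambda>x. u x + c * v x) = l u + c * (l v :: real)"
  and "u \<in> V" "\<And>j. j < n ==> e j \<in> V"
 shows "l (\<lambda>x. u x + (\<Sum>j<(n::nat). c j * e j x)) = l u + (\<Sum>j<n. c j * l (e j))"
 using assms(4)
proof (induction n)
 case 0
 then show ?case by simp
next
 case (Suc n)
 have "(\<lambda>x. u x + (\<Sum>j<n. c j * e j x)) \<in> V"
  using Suc assms(3) by (intro subspace_lincomb V) auto
 then show ?case using Suc l[of "\<lambda>x. u x + (\<Sum>j<n. c j * e j x)" "e n" "c n"] by (simp add: add.assoc)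
qed

text \<open>Gram--Schmidt with point values or integrals in place of an inner product: the induction runs
 over the number of spanning functions, splitting \<open>V\<close> as a smaller space plus one function.\<close>

lemma dual_basis_exists:
 fixes m :: "'i \<Rightarrow> 'x \<Rightarrow> real" and \<Lambda> :: "(('x \<Rightarrow> real) \<Rightarrow> real) set"
 assumes "finite I"
  and V: "\<And>u v c. u \<in> V ==> v \<in> V ==> (\<lambda>x. u x + c * v x) \<in> V"
  and V0: "(\<lambda>x. 0) \<in> V"
  and span: "\<And>u. u \<in> V ==> \<exists>a. \<forall>x\<in>X. u x = (\<Sum>i\<in>I. a i * m i x)"
  and lin: "\<And>l u v c. l \<in> \<Lambda> ==> u \<in> V ==> v \<in> V ==> l (\<lambda>x. u x + c * v x) = l u + c * l v"
  and loc: "\<And>l u v. l \<in> \<Lambda> ==> u \<in> V ==> v \<in> V ==> (\<And>x. x \<in> X ==> u x = v x) ==> l u = l v"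
  and sep: "\<And>u x. u \<in> V ==> (\<And>l. l \<in> \<Lambda> ==> l u = 0) ==> x \<in> X ==> u x = 0"
 shows "\<exists>(n::nat) l e. (\<forall>j<n. l j \<in> \<Lambda> \<and> e j \<in> V) \<and> (\<forall>i<n. \<forall>j<n. l i (e j) = of_bool (i = j)) \<and>
      (\<forall>u\<in>V. \<forall>x\<in>X. u x = (\<Sum>j<n. l j u * e j x))"
 using assms
proof (induction I arbitrary: V rule: finite_induct)
 case empty
 then show ?case by (intro exI[of _ "0::nat"]) auto
next
 case (insert i I)
 note V = insert.prems(1) and V0 = insert.prems(2) and span = insert.prems(3)
  and lin = insert.prems(4) and loc = insert.prems(5) and sep = insert.prems(6)
 define V' where "V' = {u \<in> V. \<exists>a. \<forall>x\<in>X. u x = (\<Sum>i\<in>I. a i * m i x)}"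
 have V'closed: "(\<lambda>x. u x + c * v x) \<in> V'" if uv: "u \<in> V'" "v \<in> V'" for u v c
 proof -
  obtain a b where "\<forall>x\<in>X. u x = (\<Sum>i\<in>I. a i * m i x)" "\<forall>x\<in>X. v x = (\<Sum>i\<in>I. b i * m i x)"
   using uv by (auto simp: V'_def)
  then have "\<forall>x\<in>X. u x + c * v x = (\<Sum>i\<in>I. (a i + c * b i) * m i x)"
   by (simp add: distrib_right sum.distrib sum_distrib_left mult.assoc)
  then have "\<exists>a. \<forall>x\<in>X. u x + c * v x = (\<Sum>i\<in>I. a i * m i x)"
   by (rule exI[of _ "\<lambda>i. a i + c * b i"])
  then show ?thesis using V uv by (auto simp: V'_def)
 qed
 have V'V: "u \<in> V" if "u \<in> V'" for u using that by (simp add: V'_def)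
 have zero': "(\<lambda>x. 0) \<in> V'"
  using V0 by (auto simp: V'_def intro!: exI[of _ "\<lambda>_. 0"])
 obtain n l e where le: "\<And>j. j < n ==> l j \<in> \<Lambda>" "\<And>j. j < n ==> e j \<in> V'"
  and bi: "\<And>i j. i < n ==> j < n ==> l i (e j) = of_bool (i = j)"
  and rep: "\<And>u x. u \<in> V' ==> x \<in> X ==> u x = (\<Sum>j<(n::nat). l j u * e j x)"
 proof -
  have "\<exists>(n::nat) l e. (\<forall>j<n. l j \<in> \<Lambda> \<and> e j \<in> V') \<and> (\<forall>i<n. \<forall>j<n. l i (e j) = of_bool (i = j)) \<and>
      (\<forall>u\<in>V'. \<forall>x\<in>X. u x = (\<Sum>j<n. l j u * e j x))"
  proof (rule insert.IH)
   show "\<exists>a. \<forall>x\<in>X. u x = (\<Sum>i\<in>I. a i * m i x)" if "u \<in> V'" for u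
    using that by (simp add: V'_def)
   show "l (\<lambda>x. u x + c * v x) = l u + c * l v" if "l \<in> \<Lambda>" "u \<in> V'" "v \<in> V'" for l u v c
    using that V'V lin by blast
   show "l u = l v" if "l \<in> \<Lambda>" "u \<in> V'" "v \<in> V'" "\<And>x. x \<in> X ==> u x = v x" for l u v
    by (rule loc) (use that V'V in auto)
   show "u x = 0" if "u \<in> V'" "\<And>l. l \<in> \<Lambda> ==> l u = 0" "x \<in> X" for u x
    by (rule sep) (use that V'V in auto)
  qed (use V'closed zero' in auto)
  then show thesis using that by blast
 qed
 show ?case
 proof (cases "V \<subseteq> V'")
  case True
  then show ?thesis using le bi rep V'V by (intro exI[of _ n] exI[of _ l] exI[of _ e]) blast
 next
  case False
  then obtain w0 where w0: "w0 \<in> V" "w0 \<notin> V'" by auto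
  define w where "w = (\<lambda>x. w0 x + (\<Sum>j<n. (- l j w0) * e j x))"
  have eV: "e j \<in> V" if "j < n" for j using le(2)[OF that] V'V by blast
  have wV: "w \<in> V" unfolding w_def by (intro subspace_lincomb V w0 eV)
  have linw: "l' (\<lambda>x. u x + (\<Sum>j<n. c j * e j x)) = l' u + (\<Sum>j<n. c j * l' (e j))"
   if "l' \<in> \<Lambda>" "u \<in> V" for l' u c
   by (rule functional_lincomb[where V = V]) (use V lin eV that in auto)
  have lw: "l j w = 0" if "j < n" for j
  proof -
   have "(\<Sum>i<n. - l i w0 * l j (e i)) = (\<Sum>i<n. if i = j then - l j w0 else 0)"
    by (intro sum.cong) (use bi that in auto)
   then show ?thesis unfolding w_def linw[OF le(1)[OF that] w0(1)] using that by simp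
  qed
  have "\<exists>l'\<in>\<Lambda>. l' w \<noteq> 0"
  proof (rule ccontr)
   assume "\<not> ?thesis"
   then have w_zero: "w x = 0" if "x \<in> X" for x using sep[OF wV _ that] by blast
   have "(\<lambda>x. 0 + (\<Sum>j<n. l j w0 * e j x)) \<in> V'"
    by (rule subspace_lincomb) (use V'closed zero' le in auto)
   then obtain a where "\<forall>x\<in>X. (\<Sum>j<n. l j w0 * e j x) = (\<Sum>i\<in>I. a i * m i x)"
    by (auto simp: V'_def)
   moreover have "w0 x = (\<Sum>j<n. l j w0 * e j x)" if "x \<in> X" for x
    using w_zero[OF that] by (simp add: w_def sum_negf)
   ultimately have "w0 \<in> V'" using w0 by (auto simp: V'_def)
   then show False using w0 by simp
  qed
  then obtain l' where l': "l' \<in> \<Lambda>" "l' w \<noteq> 0" by blast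
  define e' where "e' = (\<lambda>x. 0 + (1 / l' w) * w x)"
  have e'V: "e' \<in> V" unfolding e'_def by (intro V V0 wV)
  have l0: "l'' (\<lambda>x. 0) = 0" if "l'' \<in> \<Lambda>" for l''
   using lin[OF that V0 V0, of 1] by simp
  have l'e': "l' e' = 1"
   unfolding e'_def lin[OF l'(1) V0 wV] using l' l0 by simp
  have le': "l j e' = 0" if "j < n" for j
   unfolding e'_def lin[OF le(1)[OF that] V0 wV] using le that lw l0 by simp
  define E where "E j = (if j < n then (\<lambda>x. e j x + (- l' (e j)) * e' x) else e')" for j
  define L where "L j = (if j < n then l j else l')" for j
  have dec: "\<exists>t. \<forall>x\<in>X. u x = t * w x + (\<Sum>j<n. l j u * e j x)" if u: "u \<in> V" for u
  proof -
   obtain a where a: "\<forall>x\<in>X. u x = (\<Sum>i\<in>insert i I. a i * m i x)" using span[OF u] by blast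
   obtain b where b: "\<forall>x\<in>X. w0 x = (\<Sum>i\<in>insert i I. b i * m i x)" using span[OF w0(1)] by blast
   have bi0: "b i \<noteq> 0"
   proof
    assume "b i = 0"
    then have "w0 \<in> V'" using b w0 insert.hyps by (auto simp: V'_def)
    then show False using w0 by simp
   qed
   define t where "t = a i / b i"
   define v where "v = (\<lambda>x. u x + (- t) * w0 x)"
   have vV: "v \<in> V" unfolding v_def by (intro V u w0)
   have "\<forall>x\<in>X. v x = (\<Sum>i\<in>I. (a i - t * b i) * m i x)"
   proof
    fix x assume x: "x \<in> X"
    have "v x = (a i * m i x + (\<Sum>i\<in>I. a i * m i x)) - t * (b i * m i x + (\<Sum>i\<in>I. b i * m i x))"
     using a b x insert.hyps by (simp add: v_def)
    also have "\<dots> = (\<Sum>i\<in>I. a i * m i x) - t * (\<Sum>i\<in>I. b i * m i x)"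
     using bi0 by (simp add: t_def distrib_left)
    also have "\<dots> = (\<Sum>i\<in>I. (a i - t * b i) * m i x)"
     by (simp add: left_diff_distrib sum_subtractf sum_distrib_left mult.assoc)
    finally show "v x = (\<Sum>i\<in>I. (a i - t * b i) * m i x)" .
   qed
   then have vV': "v \<in> V'" using vV by (auto simp: V'_def)
   have lv: "l j v = l j u - t * l j w0" if "j < n" for j
    unfolding v_def lin[OF le(1)[OF that] u w0(1)] by simp
   have "\<forall>x\<in>X. u x = t * w x + (\<Sum>j<n. l j u * e j x)"
   proof
    fix x assume x: "x \<in> X"
    have "u x = v x + t * w0 x" by (simp add: v_def)
    also have "v x = (\<Sum>j<n. (l j u - t * l j w0) * e j x)"
     using rep[OF vV' x] lv by simp
    finally show "u x = t * w x + (\<Sum>j<n. l j u * e j x)"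
     by (simp add: w_def algebra_simps sum_subtractf sum_distrib_left sum_negf)
   qed
   then show ?thesis by blast
  qed
  show ?thesis
  proof (intro exI[of _ "Suc n"] exI[of _ L] exI[of _ E] conjI allI impI ballI)
   fix j assume "j < Suc n"
   show "L j \<in> \<Lambda>" using le l' by (simp add: L_def)
   show "E j \<in> V" using e'V eV V[OF eV e'V, of j "- l' (e j)"] by (auto simp: E_def)
  next
   fix i j assume "i < Suc n" "j < Suc n"
   then have "i < n \<or> i = n" "j < n \<or> j = n" by auto
   then show "L i (E j) = of_bool (i = j)"
    using lin[OF le(1) eV e'V, of i j "- l' (e j)"] lin[OF l'(1) eV e'V, of j "- l' (e j)"] bi le' l'e'
    by (auto simp: L_def E_def)
  next
   fix u x assume u: "u \<in> V" and x: "x \<in> X"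
   obtain t where t: "\<forall>x\<in>X. u x = t * w x + (\<Sum>j<n. l j u * e j x)" using dec[OF u] by blast
   have tw: "(\<lambda>x. 0 + t * w x) \<in> V" by (intro V V0 wV)
   have "l' u = l' (\<lambda>x. (0 + t * w x) + (\<Sum>j<n. l j u * e j x))"
    using t by (intro loc[OF l'(1) u subspace_lincomb] V tw eV) auto
   also have "\<dots> = t * l' w + (\<Sum>j<n. l j u * l' (e j))"
    using linw[OF l'(1) tw] lin[OF l'(1) V0 wV, of t] l0[OF l'(1)] by simp
   finally have lu: "l' u = t * l' w + (\<Sum>j<n. l j u * l' (e j))" .
   have "(\<Sum>j<Suc n. L j u * E j x) = (\<Sum>j<n. l j u * (e j x - l' (e j) * e' x)) + l' u * e' x"
    by (simp add: L_def E_def)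
   also have "\<dots> = (\<Sum>j<n. l j u * e j x) - (\<Sum>j<n. l j u * l' (e j)) * e' x + l' u * e' x"
    by (simp add: right_diff_distrib sum_subtractf sum_distrib_right mult.assoc)
   also have "\<dots> = (\<Sum>j<n. l j u * e j x) + t * (l' w * e' x)"
    unfolding lu by (simp add: algebra_simps)
   also have "l' w * e' x = w x" using l' by (simp add: e'_def)
   finally show "u x = (\<Sum>j<Suc n. L j u * E j x)" using t x by simp
  qed
 qed
qed

section \<open>The trace inequality\<close>

lemma emeasure_hausdorff_le: "emeasure (hausdorff_measure n) A \<le> hausdorff_outer n A"
 unfolding hausdorff_measure_def by (simp add: emeasure_measure_of_conv)

lemma sets_hausdorff [simp]: "sets (hausdorff_measure n) = sets borel"
 and space_hausdorff [simp]: "space (hausdorff_measure n) = UNIV"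
 unfolding hausdorff_measure_def using sets.sigma_sets_eq[of "borel :: 'a measure"]
 by (simp_all add: space_measure_of_conv)

lemma hausdorff_outer_mono: "A \<subseteq> B ==> hausdorff_outer n A \<le> hausdorff_outer n B"
 unfolding hausdorff_outer_def hausdorff_pre_def
 by (intro SUP_mono' INF_superset_mono) auto

lemma hausdorff_pre_finite_cover:
 fixes A :: "'a::metric_space set"
 assumes n: "1 \<le> n" and I: "finite I" and A: "A \<subseteq> (\<Union>i\<in>I. U i)"
  and U: "\<And>i. i \<in> I ==> bounded (U i) \<and> diameter (U i) \<le> D" and D: "0 \<le> D" "D \<le> \<delta>"
 shows "hausdorff_pre n \<delta> A \<le> ennreal (real (card I) * (unit_ball_vol (real n) * (D / 2) ^ n))"
proof -
 obtain f where f: "bij_betw f {0..<card I} I" using ex_bij_betw_nat_finite[OF I] by blast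
 define V where "V i = (if i < card I then U (f i) else {})" for i
 have fI: "f i \<in> I" if "i < card I" for i using f that by (auto simp: bij_betw_def)
 have "A \<subseteq> (\<Union>i. V i)"
 proof
  fix x assume "x \<in> A"
  then obtain i where i: "i \<in> I" "x \<in> U i" using A by blast
  then have "i \<in> f ` {0..<card I}" by (simp add: bij_betw_imp_surj_on[OF f])
  then obtain j where "j < card I" "f j = i" by auto
  then show "x \<in> (\<Union>i. V i)" using i by (auto simp: V_def intro!: exI[of _ j])
 qed
 moreover have "bounded (V i) \<and> diameter (V i) \<le> \<delta>" for i
  using U[OF fI] D by (fastforce simp: V_def diameter_empty)
 ultimately have "hausdorff_pre n \<delta> A \<le> (\<Sum>i. ennreal (unit_ball_vol (real n) * (diameter (V i) / 2) ^ n))"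
  unfolding hausdorff_pre_def by (intro INF_lower2[of V]) auto
 also have "\<dots> = (\<Sum>i<card I. ennreal (unit_ball_vol (real n) * (diameter (V i) / 2) ^ n))"
  using n by (intro suminf_finite) (auto simp: V_def diameter_empty)
 also have "\<dots> \<le> (\<Sum>i<card I. ennreal (unit_ball_vol (real n) * (D / 2) ^ n))"
  using U[OF fI] D
  by (intro sum_mono ennreal_leI mult_left_mono power_mono divide_right_mono diameter_ge_0)
    (auto simp: V_def unit_ball_vol_nonneg diameter_ge_0)
 also have "\<dots> = ennreal (real (card I) * (unit_ball_vol (real n) * (D / 2) ^ n))"
  using D by (simp add: ennreal_mult ennreal_of_nat_eq_real_of_nat unit_ball_vol_nonneg)
 finally show ?thesis .
qed

text \<open>An affine chart \<open>y \<mapsto> p + L y\<close> with inverse \<open>x \<mapsto> R (x - p)\<close>. The hyperplane \<open>co b = 0\<close> is cut into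
 cells of side \<open>1 / m\<close>, and each cell is the bottom of a brick in the direction \<open>L b\<close>.\<close>

locale affine_chart =
 fixes p :: "'a::euclidean_space" and L R :: "'a \<Rightarrow> 'a" and b :: 'a and \<kappa> :: real
 assumes linL: "linear L" and linR: "linear R" and RL: "\<And>y. R (L y) = y" and LR: "\<And>x. L (R x) = x"
  and b: "b \<in> Basis" and dim2: "2 \<le> DIM('a)"
  and \<kappa>: "0 < \<kappa>" "\<And>y. norm (L y) \<le> \<kappa> * norm y"
begin

definition co :: "'a \<Rightarrow> 'a \<Rightarrow> real" where "co c x = R (x - p) \<bullet> c"

definition cell :: "nat \<Rightarrow> ('a \<Rightarrow> nat) \<Rightarrow> 'a set" where
 "cell m i = {x. co b x = 0 \<and> (\<forall>c\<in>Basis - {b}. real (i c) / real m \<le> co c x \<and> co c x < (real (i c) + 1) / real m)}"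

definition brick :: "nat \<Rightarrow> ('a \<Rightarrow> nat) \<Rightarrow> 'a set" where
 "brick m i = {x. 0 \<le> co b x \<and> co b x < 1 / real m \<and>
   (\<forall>c\<in>Basis - {b}. real (i c) / real m \<le> co c x \<and> co c x < (real (i c) + 1) / real m)}"

lemma continuous_co: "continuous_on A (co c)"
 unfolding co_def[abs_def] by (intro continuous_intros linear_continuous_on_compose[OF _ linR])

lemma co_measurable [measurable]: "co c \<in> borel_measurable borel"
 by (intro borel_measurable_continuous_onI continuous_co)

lemma co_translate: "co c (x + t *\<^sub>R L b) = co c x + t * (b \<bullet> c)"
proof -
 have "R (x + t *\<^sub>R L b - p) = R (x - p) + t *\<^sub>R b"
  using linear_add[OF linR, of "x - p" "t *\<^sub>R L b"] linear_scale[OF linR, of t "L b"] RL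
  by (simp add: algebra_simps)
 then show ?thesis by (simp add: co_def inner_add_left)
qed

lemma cell_subset_brick: "1 \<le> m ==> cell m i \<subseteq> brick m i"
 by (auto simp: cell_def brick_def)

lemma brick_measurable [measurable]: "brick m i \<in> sets borel" "cell m i \<in> sets borel"
 unfolding brick_def cell_def by measurable

lemma brick_dist:
 assumes "1 \<le> m" "x \<in> brick m i" "y \<in> brick m i"
 shows "dist x y \<le> \<kappa> * real DIM('a) / real m"
proof -
 have "\<bar>(R (x - p) - R (y - p)) \<bullet> c\<bar> \<le> 1 / real m" if "c \<in> Basis" for c
  using assms that by (cases "c = b") (auto simp: brick_def co_def inner_diff_left add_divide_distrib abs_le_iff dest!: bspec[of _ _ c])
 then have "norm (R (x - p) - R (y - p)) \<le> real DIM('a) / real m"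
  using norm_le_l1[of "R (x - p) - R (y - p)"]
   sum_bounded_above[of Basis "\<lambda>c. \<bar>(R (x - p) - R (y - p)) \<bullet> c\<bar>" "1 / real m"] by simp
 then have "\<kappa> * norm (R (x - p) - R (y - p)) \<le> \<kappa> * (real DIM('a) / real m)"
  using \<kappa>(1) by (intro mult_left_mono) auto
 moreover have "x - y = L (R (x - p) - R (y - p))"
  by (simp add: linear_diff[OF linL] LR)
 ultimately show ?thesis
  using \<kappa>(2)[of "R (x - p) - R (y - p)"] by (simp add: dist_norm)
qed

lemma brick_diameter:
 assumes "1 \<le> m"
 shows "bounded (brick m i)" "diameter (cell m i) \<le> \<kappa> * real DIM('a) / real m"
  "bounded (cell m i)"
proof -
 show "bounded (brick m i)"
  unfolding bounded_two_points using brick_dist[OF assms] by blast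
 then show "bounded (cell m i)" using cell_subset_brick[OF assms] by (rule bounded_subset)
 show "diameter (cell m i) \<le> \<kappa> * real DIM('a) / real m"
  using \<kappa> brick_dist[OF assms, of _ i] cell_subset_brick[OF assms, of i]
  by (intro diameter_le) (auto simp: dist_norm subset_iff)
qed

lemma cell_refine:
 assumes "1 \<le> m" "1 \<le> M"
 shows "cell m i \<subseteq> (\<Union>j\<in>(Basis - {b}) \<rightarrow>\<^sub>E {0..<M}. cell (m * M) (\<lambda>c. i c * M + j c))"
proof
 fix x assume x: "x \<in> cell m i"
 define j where "j = (\<lambda>c\<in>Basis - {b}. nat \<lfloor>(co c x - real (i c) / real m) * (real m * real M)\<rfloor>)"
 have mM: "0 < real m * real M" "0 < real m" "0 < real M" using assms by auto
 have *: "j c < M \<and> real (i c * M + j c) / real (m * M) \<le> co c x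
   \<and> co c x < (real (i c * M + j c) + 1) / real (m * M)" if c: "c \<in> Basis - {b}" for c
 proof -
  define t where "t = (co c x - real (i c) / real m) * (real m * real M)"
  have cx: "real (i c) / real m \<le> co c x" "co c x < (real (i c) + 1) / real m"
   using x c by (auto simp: cell_def)
  have t0: "0 \<le> t" using cx mM by (simp add: t_def)
  have "co c x - real (i c) / real m < 1 / real m" using cx by (simp add: add_divide_distrib)
  then have "t < (1 / real m) * (real m * real M)"
   unfolding t_def using mM by (intro mult_strict_right_mono) auto
  then have tM: "t < real M" using mM by simp
  have jt: "real (j c) \<le> t" "t < real (j c) + 1"
   using t0 c by (auto simp: j_def t_def[symmetric])
  have "co c x * (real m * real M) = real (i c) * real M + t"
   using mM by (simp add: t_def algebra_simps)
  then have "real (i c * M + j c) \<le> co c x * real (m * M)" "co c x * real (m * M) < real (i c * M + j c) + 1"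
   using jt by auto
  moreover have "j c < M" using jt tM by linarith
  ultimately show ?thesis using mM by (simp add: pos_divide_le_eq pos_less_divide_eq)
 qed
 have "j \<in> (Basis - {b}) \<rightarrow>\<^sub>E {0..<M}" using * by (auto simp: j_def)
 moreover have "x \<in> cell (m * M) (\<lambda>c. i c * M + j c)" using x * by (auto simp: cell_def)
 ultimately show "x \<in> (\<Union>j\<in>(Basis - {b}) \<rightarrow>\<^sub>E {0..<M}. cell (m * M) (\<lambda>c. i c * M + j c))" by blast
qed

definition hconst :: real where
 "hconst = unit_ball_vol (real (DIM('a) - 1)) * (\<kappa> * real DIM('a) / 2) ^ (DIM('a) - 1)"

lemma hconst_nonneg: "0 \<le> hconst"
 using \<kappa> by (auto simp: hconst_def unit_ball_vol_nonneg)

lemma hausdorff_outer_cell: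
 assumes "1 \<le> m"
 shows "hausdorff_outer (DIM('a) - 1) (cell m i) \<le> ennreal (hconst / real m ^ (DIM('a) - 1))"
 unfolding hausdorff_outer_def
proof (rule SUP_least)
 fix \<delta> :: real assume "\<delta> \<in> {0<..}"
 then have \<delta>: "0 < \<delta>" by simp
 let ?n = "DIM('a) - 1"
 obtain M :: nat where M: "\<kappa> * real DIM('a) / \<delta> < real M" using reals_Archimedean2 by blast
 moreover have "0 < \<kappa> * real DIM('a) / \<delta>" using \<kappa> \<delta> by simp
 ultimately have M1: "1 \<le> M" by (cases M) auto
 define D where "D = \<kappa> * real DIM('a) / real (m * M)"
 let ?I = "(Basis - {b}) \<rightarrow>\<^sub>E {0..<M}"
 have card: "card ?I = M ^ ?n" using b by (simp add: card_PiE)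
 have "\<kappa> * real DIM('a) / real M \<le> \<delta>" using M \<delta> M1 by (simp add: field_simps)
 moreover have "D \<le> \<kappa> * real DIM('a) / real M"
  unfolding D_def using assms M1 \<kappa> by (intro divide_left_mono) auto
 ultimately have D\<delta>: "D \<le> \<delta>" by simp
 have D0: "0 \<le> D" using \<kappa> by (simp add: D_def)
 have mM: "1 \<le> m * M" using assms M1 by simp
 have "hausdorff_pre ?n \<delta> (cell m i) \<le> ennreal (real (card ?I) * (unit_ball_vol (real ?n) * (D / 2) ^ ?n))"
 proof (rule hausdorff_pre_finite_cover[OF _ _ cell_refine[OF assms M1]])
  show "1 \<le> ?n" using dim2 by simp
  show "finite ?I" by (intro finite_PiE) auto
  show "bounded (cell (m * M) (\<lambda>c. i c * M + j c)) \<and> diameter (cell (m * M) (\<lambda>c. i c * M + j c)) \<le> D" for j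
   using brick_diameter[OF mM] by (simp add: D_def)
 qed (use D0 D\<delta> in auto)
 also have "real (card ?I) * (unit_ball_vol (real ?n) * (D / 2) ^ ?n) = hconst / real m ^ ?n"
 proof -
  have "(D / 2) ^ ?n = (\<kappa> * real DIM('a) / 2) ^ ?n / (real m ^ ?n * real M ^ ?n)"
   by (simp add: D_def power_divide power_mult_distrib)
  then show ?thesis using M1 by (simp add: card hconst_def)
 qed
 finally show "hausdorff_pre ?n \<delta> (cell m i) \<le> ennreal (hconst / real m ^ ?n)" .
qed

lemma brick_volume:
 assumes m: "1 \<le> m"
 shows "emeasure lborel (brick m i) = ennreal (1 / real m ^ DIM('a)) * emeasure lborel (brick 1 (\<lambda>_. 0))"
proof -
 define w where "w = (\<Sum>c\<in>Basis. (if c = b then 0 else real (i c) / real m) *\<^sub>R c)"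
 define d where "d = p - (1 / real m) *\<^sub>R p + L w"
 have m0: "0 < real m" using m by simp
 have w: "w \<bullet> c = (if c = b then 0 else real (i c) / real m)" if "c \<in> Basis" for c
  using that by (simp add: w_def inner_sum_left_Basis)
 have co: "co c (real m *\<^sub>R (x - d)) = real m * (co c x - w \<bullet> c)" for c x
 proof -
  have "real m *\<^sub>R (x - d) - p = real m *\<^sub>R ((x - p) - L w)"
   using m0 by (simp add: d_def algebra_simps)
  then have "R (real m *\<^sub>R (x - d) - p) = real m *\<^sub>R (R (x - p) - w)"
   by (simp only: linear_scale[OF linR] linear_diff[OF linR] RL)
  then show ?thesis by (simp add: co_def inner_diff_left)
 qed
 have iff: "x \<in> brick m i \<longleftrightarrow> real m *\<^sub>R (x - d) \<in> brick 1 (\<lambda>_. 0)" for x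
 proof -
  have h: "r / real m \<le> t \<and> t < (r + 1) / real m \<longleftrightarrow> 0 \<le> real m * (t - r / real m) \<and> real m * (t - r / real m) < 1"
   for r t :: real
   using m0 by (auto simp: right_diff_distrib pos_divide_le_eq pos_less_divide_eq mult.commute)
  have "x \<in> brick m i \<longleftrightarrow> (0 \<le> real m * (co b x - 0) \<and> real m * (co b x - 0) < 1) \<and>
    (\<forall>c\<in>Basis - {b}. 0 \<le> real m * (co c x - real (i c) / real m) \<and> real m * (co c x - real (i c) / real m) < 1)"
   unfolding brick_def mem_Collect_eq h using h[of 0 "co b x"] by simp blast
  also have "\<dots> \<longleftrightarrow> real m *\<^sub>R (x - d) \<in> brick 1 (\<lambda>_. 0)"
   unfolding brick_def mem_Collect_eq co using b by (simp add: w)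
  finally show ?thesis .
 qed
 have "brick m i = (\<lambda>x. (1 / real m) *\<^sub>R x + d) ` brick 1 (\<lambda>_. 0)"
 proof (intro set_eqI iffI)
  fix x assume "x \<in> brick m i"
  then have "real m *\<^sub>R (x - d) \<in> brick 1 (\<lambda>_. 0)" by (simp only: iff)
  moreover have "x = (1 / real m) *\<^sub>R (real m *\<^sub>R (x - d)) + d" using m0 by simp
  ultimately show "x \<in> (\<lambda>x. (1 / real m) *\<^sub>R x + d) ` brick 1 (\<lambda>_. 0)" by blast
 next
  fix x assume "x \<in> (\<lambda>x. (1 / real m) *\<^sub>R x + d) ` brick 1 (\<lambda>_. 0)"
  then obtain y where y: "y \<in> brick 1 (\<lambda>_. 0)" "x = (1 / real m) *\<^sub>R y + d" by blast
  then have "real m *\<^sub>R (x - d) = y" using m0 by simp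
  then show "x \<in> brick m i" using y(1) by (simp only: iff)
 qed
 then have "emeasure lebesgue (brick m i) = ennreal (1 / real m ^ DIM('a)) * emeasure lebesgue (brick 1 (\<lambda>_. 0))"
  using m0 by (simp add: emeasure_lebesgue_affine power_one_over)
 then show ?thesis by simp
qed

lemma brick_volume_pos: "0 < emeasure lborel (brick 1 (\<lambda>_. 0))" "emeasure lborel (brick 1 (\<lambda>_. 0)) < \<infinity>"
proof -
 show "emeasure lborel (brick 1 (\<lambda>_. 0)) < \<infinity>"
  using emeasure_bounded_finite[OF brick_diameter(1)[of 1]] by simp
 let ?U = "{x. \<forall>c\<in>Basis. 0 < co c x \<and> co c x < 1}"
 have "?U = (\<Inter>c\<in>Basis. {x. 0 < co c x} \<inter> {x. co c x < 1})" by auto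
 then have "open ?U" by (auto intro!: open_INT open_Int open_Collect_less continuous_co continuous_on_const)
 moreover have "p + L (\<Sum>c\<in>Basis. (1/2) *\<^sub>R c) \<in> ?U"
  by (auto simp: co_def RL inner_sum_left_Basis)
 ultimately have "\<not> negligible ?U" using open_not_negligible by blast
 moreover have "?U \<subseteq> brick 1 (\<lambda>_. 0)" using b by (auto simp: brick_def less_imp_le)
 ultimately have "\<not> negligible (brick 1 (\<lambda>_. 0))" using negligible_subset by blast
 then have "emeasure lebesgue (brick 1 (\<lambda>_. 0)) \<noteq> 0"
  by (subst negligible_iff_emeasure0[symmetric]) auto
 then show "0 < emeasure lborel (brick 1 (\<lambda>_. 0))" by (simp add: zero_less_iff_neq_zero)
qed

lemma brick_disjoint:
 assumes "1 \<le> m" "i \<in> (Basis - {b}) \<rightarrow>\<^sub>E A" "j \<in> (Basis - {b}) \<rightarrow>\<^sub>E A" "i \<noteq> j"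
 shows "brick m i \<inter> brick m j = {}"
proof (rule ccontr)
 assume "\<not> ?thesis"
 then obtain x where x: "x \<in> brick m i" "x \<in> brick m j" by blast
 have "i c = j c" if c: "c \<in> Basis - {b}" for c
 proof -
  have "real (i c) / real m < (real (j c) + 1) / real m" "real (j c) / real m < (real (i c) + 1) / real m"
   using x c by (auto simp: brick_def intro: le_less_trans)
  then show ?thesis using assms(1) by (auto simp: divide_less_cancel)
 qed
 then have "i = j" using PiE_ext[OF assms(2,3)] by blast
 then show False using assms by simp
qed

end

context affine_chart
begin

definition facet :: "'a set" where
 "facet = {x. co b x = 0 \<and> (\<forall>c\<in>Basis. 0 \<le> co c x) \<and> (\<Sum>c\<in>Basis. co c x) \<le> 1 - 1 / real DIM('a)}"

definition height :: real where "height = 1 / (2 * real DIM('a))"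

definition trace_const :: real where
 "trace_const = hconst / (measure lborel (brick 1 (\<lambda>_. 0)) * height)"

lemma prism_subset:
 assumes m: "1 \<le> m" "2 * real DIM('a) ^ 2 \<le> real m"
  and i: "facet \<inter> cell m i \<noteq> {}" and x: "x \<in> brick m i" and t: "0 \<le> t" "t \<le> height"
 shows "(\<forall>c\<in>Basis. 0 \<le> co c (x + t *\<^sub>R L b)) \<and> (\<Sum>c\<in>Basis. co c (x + t *\<^sub>R L b)) \<le> 1"
proof -
 let ?d = "real DIM('a)"
 obtain y where y: "y \<in> facet" "y \<in> cell m i" using i by blast
 have d: "2 \<le> ?d" using dim2 by simp
 have m0: "0 < real m" using m by simp
 have cc: "co c (x + t *\<^sub>R L b) = co c x + (if c = b then t else 0)" if "c \<in> Basis" for c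
  using that b by (simp add: co_translate inner_Basis)
 have nonneg: "0 \<le> co c x" if "c \<in> Basis" for c
 proof (cases "c = b")
  case False
  then have "real (i c) / real m \<le> co c x" using x that by (auto simp: brick_def)
  moreover have "0 \<le> real (i c) / real m" by simp
  ultimately show ?thesis by linarith
 qed (use x in \<open>auto simp: brick_def\<close>)
 have "(\<Sum>c\<in>Basis. co c x) = co b x + (\<Sum>c\<in>Basis - {b}. co c x)"
  using b by (simp add: sum.remove)
 also have "\<dots> \<le> 1 / real m + (\<Sum>c\<in>Basis - {b}. co c y + 1 / real m)"
 proof (intro add_mono sum_mono)
  show "co b x \<le> 1 / real m" using x by (simp add: brick_def)
  fix c assume "c \<in> Basis - {b}"
  then have "co c x < (real (i c) + 1) / real m" "real (i c) / real m \<le> co c y"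
   using x y by (auto simp: brick_def cell_def)
  then show "co c x \<le> co c y + 1 / real m" by (simp add: add_divide_distrib)
 qed
 also have "\<dots> = ?d / real m + (\<Sum>c\<in>Basis. co c y)"
 proof -
  have "(\<Sum>c\<in>Basis - {b}. co c y + 1 / real m) = (\<Sum>c\<in>Basis. co c y) + (?d - 1) / real m"
   using b y(2) dim2 by (simp add: sum.distrib sum.remove[of Basis b] cell_def of_nat_diff)
  then show ?thesis by (simp add: diff_divide_distrib)
 qed
 also have "\<dots> \<le> ?d / real m + (1 - 1 / ?d)" using y by (simp add: facet_def)
 finally have s: "(\<Sum>c\<in>Basis. co c x) \<le> ?d / real m + (1 - 1 / ?d)" .
 have "(\<Sum>c\<in>Basis. co c (x + t *\<^sub>R L b)) = (\<Sum>c\<in>Basis. co c x) + t"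
  using b by (simp add: cc sum.distrib)
 moreover have "?d / real m \<le> 1 / (2 * ?d)"
  using m(2) m0 d by (simp add: field_simps power2_eq_square)
 moreover have "height = 1 / (2 * ?d)" "1 / ?d = 1 / (2 * ?d) + 1 / (2 * ?d)"
  by (auto simp: height_def)
 ultimately have "(\<Sum>c\<in>Basis. co c (x + t *\<^sub>R L b)) \<le> 1" using s t by linarith
 then show ?thesis using nonneg cc t by auto
qed

lemma facet_cells:
 assumes m: "1 \<le> m" and x: "x \<in> facet"
 shows "\<exists>i\<in>(Basis - {b}) \<rightarrow>\<^sub>E {0..<m}. x \<in> cell m i"
proof -
 define i where "i = (\<lambda>c\<in>Basis - {b}. nat \<lfloor>co c x * real m\<rfloor>)"
 have m0: "0 < real m" using m by simp
 have *: "i c < m \<and> real (i c) / real m \<le> co c x \<and> co c x < (real (i c) + 1) / real m"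
  if c: "c \<in> Basis - {b}" for c
 proof -
  have x0: "\<And>c. c \<in> Basis ==> 0 \<le> co c x" using x by (simp add: facet_def)
  have "co c x \<le> (\<Sum>c\<in>Basis. co c x)" using c x0 by (intro member_le_sum) auto
  also have "\<dots> \<le> 1 - 1 / real DIM('a)" using x by (simp add: facet_def)
  also have "\<dots> < 1" by simp
  finally have c1: "co c x * real m < real m" using m0 by simp
  have "0 \<le> co c x * real m" using x0 c m0 by simp
  then have i: "real (i c) \<le> co c x * real m" "co c x * real m < real (i c) + 1"
   using c by (auto simp: i_def)
  then have "i c < m" using c1 by linarith
  then show ?thesis using i m0 by (simp add: pos_divide_le_eq pos_less_divide_eq)
 qed
 have "i \<in> (Basis - {b}) \<rightarrow>\<^sub>E {0..<m}" using * by (auto simp: i_def)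
 moreover have "x \<in> cell m i" using x * by (auto simp: cell_def facet_def)
 ultimately show ?thesis by blast
qed

lemma translation_integral_le:
 fixes g :: "'a \<Rightarrow> ennreal"
 assumes m: "1 \<le> m" and [measurable]: "P \<in> sets borel" "g \<in> borel_measurable borel"
  and P: "\<And>x. x \<in> P ==> 0 \<le> co b x \<and> co b x < 1 / real m"
 shows "(\<integral>\<^sup>+x. indicator P x * (\<integral>\<^sup>+t. g (x + t *\<^sub>R L b) * indicator {0..h} t \<partial>lborel) \<partial>lborel)
   \<le> ennreal (1 / real m) * (\<integral>\<^sup>+x. g x \<partial>lborel)"
proof -
 have Fubini_swap: "(\<integral>\<^sup>+t. (\<integral>\<^sup>+x. F x t \<partial>lborel) \<partial>lborel) = (\<integral>\<^sup>+x. (\<integral>\<^sup>+t. F x t \<partial>lborel) \<partial>lborel)"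
  if "(\<lambda>(x, t). F x t) \<in> borel_measurable (lborel \<Otimes>\<^sub>M lborel)" for F :: "'a \<Rightarrow> real \<Rightarrow> ennreal"
  using lborel_pair.Fubini[OF that] by simp
 have "(\<integral>\<^sup>+x. indicator P x * (\<integral>\<^sup>+t. g (x + t *\<^sub>R L b) * indicator {0..h} t \<partial>lborel) \<partial>lborel)
   = (\<integral>\<^sup>+x. (\<integral>\<^sup>+t. indicator P x * (g (x + t *\<^sub>R L b) * indicator {0..h} t) \<partial>lborel) \<partial>lborel)"
  by (intro nn_integral_cong nn_integral_cmult[symmetric]) auto
 also have "\<dots> = (\<integral>\<^sup>+t. (\<integral>\<^sup>+x. indicator P x * (g (x + t *\<^sub>R L b) * indicator {0..h} t) \<partial>lborel) \<partial>lborel)"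
  by (intro Fubini_swap[symmetric]) measurable
 also have "\<dots> = (\<integral>\<^sup>+t. (\<integral>\<^sup>+z. indicator P (z - t *\<^sub>R L b) * (g z * indicator {0..h} t) \<partial>lborel) \<partial>lborel)"
 proof (rule nn_integral_cong)
  fix t :: real
  have "(\<integral>\<^sup>+z. indicator P (z - t *\<^sub>R L b) * (g z * indicator {0..h} t) \<partial>lborel)
    = (\<integral>\<^sup>+z. indicator P (z - t *\<^sub>R L b) * (g z * indicator {0..h} t) \<partial>distr lborel borel ((+) (t *\<^sub>R L b)))"
   by (simp add: lborel_distr_plus)
  also have "\<dots> = (\<integral>\<^sup>+x. indicator P x * (g (x + t *\<^sub>R L b) * indicator {0..h} t) \<partial>lborel)"
   by (subst nn_integral_distr) (auto simp: add.commute)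
  finally show "(\<integral>\<^sup>+x. indicator P x * (g (x + t *\<^sub>R L b) * indicator {0..h} t) \<partial>lborel)
    = (\<integral>\<^sup>+z. indicator P (z - t *\<^sub>R L b) * (g z * indicator {0..h} t) \<partial>lborel)" by simp
 qed
 also have "\<dots> = (\<integral>\<^sup>+z. (\<integral>\<^sup>+t. indicator P (z - t *\<^sub>R L b) * (g z * indicator {0..h} t) \<partial>lborel) \<partial>lborel)"
  by (intro Fubini_swap) measurable
 also have "\<dots> \<le> (\<integral>\<^sup>+z. ennreal (1 / real m) * g z \<partial>lborel)"
 proof (rule nn_integral_mono)
  fix z :: 'a
  have "(\<integral>\<^sup>+t. indicator P (z - t *\<^sub>R L b) * (g z * indicator {0..h} t) \<partial>lborel)
    \<le> (\<integral>\<^sup>+t. g z * indicator {co b z - 1 / real m..co b z} t \<partial>lborel)"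
  proof (intro nn_integral_mono)
   fix t
   show "indicator P (z - t *\<^sub>R L b) * (g z * indicator {0..h} t) \<le> g z * indicator {co b z - 1 / real m..co b z} t"
   proof (cases "z - t *\<^sub>R L b \<in> P")
    case True
    have "co b (z - t *\<^sub>R L b) = co b z - t" using co_translate[of b z "-t"] b by simp
    then have "t \<in> {co b z - 1 / real m..co b z}" using P[OF True] by auto
    then show ?thesis by (auto simp: indicator_def)
   qed simp
  qed
  also have "\<dots> = g z * ennreal (1 / real m)"
   by (simp add: nn_integral_cmult_indicator)
  finally show "(\<integral>\<^sup>+t. indicator P (z - t *\<^sub>R L b) * (g z * indicator {0..h} t) \<partial>lborel) \<le> ennreal (1 / real m) * g z"
   by (simp add: mult.commute)
 qed
 also have "\<dots> = ennreal (1 / real m) * (\<integral>\<^sup>+x. g x \<partial>lborel)" by (intro nn_integral_cmult) auto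
 finally show ?thesis .
qed

text \<open>Sum over the cells of the facet: on a cell, \<open>u\<close> is up to \<open>\<epsilon>\<close> bounded by its values on the brick
 above it, and the values on the layer of bricks are controlled through the line property.\<close>

lemma facet_trace:
 fixes u :: "'a \<Rightarrow> real" and g :: "'a \<Rightarrow> ennreal"
 assumes E: "compact E"
  and chart: "\<And>x. (\<forall>c\<in>Basis. 0 \<le> co c x) \<and> (\<Sum>c\<in>Basis. co c x) \<le> 1 ==> x \<in> E"
  and \<Gamma>: "closed \<Gamma>" and u: "continuous_on E u" and g: "g \<in> borel_measurable borel"
  and line: "AE x in lborel. (\<forall>t\<in>{0..height}. x + t *\<^sub>R L b \<in> E) \<longrightarrow>
    ennreal (height * \<bar>u x\<bar>) \<le> (\<integral>\<^sup>+t. g (x + t *\<^sub>R L b) * indicator {0..height} t \<partial>lborel)"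
 shows "(\<integral>\<^sup>+x. ennreal \<bar>u x\<bar> * indicator facet x \<partial>surface_measure \<Gamma>) \<le> ennreal trace_const * (\<integral>\<^sup>+x. g x \<partial>lborel)"
  (is "?lhs \<le> ?rhs")
proof (rule ennreal_le_epsilon)
 fix e0 :: real assume "0 < e0"
 define \<epsilon> where "\<epsilon> = e0 / (hconst + 1)"
 have \<epsilon>: "0 < \<epsilon>" "hconst * \<epsilon> \<le> e0" using \<open>0 < e0\<close> hconst_nonneg by (auto simp: \<epsilon>_def field_simps)
 let ?d = "DIM('a)" let ?n = "DIM('a) - 1"
 define v0 where "v0 = measure lborel (brick 1 (\<lambda>_. 0))"
 have v0e: "emeasure lborel (brick 1 (\<lambda>_. 0)) = ennreal v0"
  unfolding v0_def using brick_volume_pos by (intro emeasure_eq_ennreal_measure) auto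
 have v0: "0 < v0" using brick_volume_pos(1) unfolding v0e by simp
 have h0: "0 < height" by (simp add: height_def)
 obtain \<delta> where \<delta>: "0 < \<delta>" "\<And>x y. x \<in> E ==> y \<in> E ==> dist y x < \<delta> ==> dist (u y) (u x) < \<epsilon>"
  using compact_uniformly_continuous[OF u E] \<epsilon>(1) unfolding uniformly_continuous_on_def by metis
 obtain m :: nat where mm: "max (2 * real ?d ^ 2) (\<kappa> * real ?d / \<delta>) < real m" using reals_Archimedean2 by blast
 have m: "1 \<le> m" "2 * real ?d ^ 2 \<le> real m"
 proof -
  show "2 * real ?d ^ 2 \<le> real m" using mm by simp
  moreover have "0 < 2 * real ?d ^ 2" by simp
  ultimately have "0 < real m" by linarith
  then show "1 \<le> m" by simp
 qed
 have m0: "0 < real m" using m by simp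
 have md: "\<kappa> * real ?d / real m < \<delta>" using mm m0 \<delta>(1) by (simp add: field_simps)
 define I where "I = {i \<in> (Basis - {b}) \<rightarrow>\<^sub>E {0..<m}. facet \<inter> cell m i \<noteq> {}}"
 have fin: "finite ((Basis - {b}) \<rightarrow>\<^sub>E {0..<m} :: ('a \<Rightarrow> nat) set)" by (intro finite_PiE) auto
 have finI: "finite I" using fin by (simp add: I_def)
 have cardI: "card I \<le> m ^ ?n"
  using card_mono[OF fin, of I] b by (simp add: I_def card_PiE)
 have inE: "x + t *\<^sub>R L b \<in> E" if "i \<in> I" "x \<in> brick m i" "0 \<le> t" "t \<le> height" for i x t
  using that by (intro chart prism_subset[OF m]) (auto simp: I_def)
 have brickE: "brick m i \<subseteq> E" if "i \<in> I" for i using inE[OF that, of _ 0] h0 by auto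
 define P where "P = (\<Union>i\<in>I. brick m i)"
 have Pm [measurable]: "P \<in> sets borel" unfolding P_def using finI by (intro sets.finite_UN) auto
 define s where "s i = (INF y\<in>brick m i. ennreal (\<bar>u y\<bar> + \<epsilon>))" for i
 define W where "W y = ennreal (indicator E y *\<^sub>R \<bar>u y\<bar>)" for y
 have Wm [measurable]: "W \<in> borel_measurable borel"
  unfolding W_def[abs_def] using E u
  by (intro measurable_compose[OF _ measurable_ennreal] borel_measurable_continuous_on_indicator continuous_intros)
    (auto intro: borel_compact)
 have step1: "ennreal \<bar>u x\<bar> * indicator facet x \<le> (\<Sum>i\<in>I. s i * indicator (cell m i) x)" for x
 proof (cases "x \<in> facet")
  case True
  then obtain i where i: "i \<in> I" "x \<in> cell m i" using facet_cells[OF m(1) True] by (auto simp: I_def)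
  then have xb: "x \<in> brick m i" using cell_subset_brick[OF m(1)] by blast
  have "ennreal \<bar>u x\<bar> \<le> s i" unfolding s_def
  proof (rule INF_greatest)
   fix y assume y: "y \<in> brick m i"
   have "dist x y < \<delta>" using brick_dist[OF m(1) xb y] md by linarith
   then have "dist (u x) (u y) < \<epsilon>" using xb y brickE[OF i(1)] by (intro \<delta>(2)) auto
   then show "ennreal \<bar>u x\<bar> \<le> ennreal (\<bar>u y\<bar> + \<epsilon>)" by (intro ennreal_leI) (auto simp: dist_real_def)
  qed
  then have "ennreal \<bar>u x\<bar> * indicator facet x \<le> s i * indicator (cell m i) x" using i True by simp
  also have "\<dots> \<le> (\<Sum>i\<in>I. s i * indicator (cell m i) x)"
   using finI i(1) by (intro member_le_sum) auto
  finally show ?thesis .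
 qed simp
 have cellS: "(\<integral>\<^sup>+x. indicator (cell m i) x \<partial>surface_measure \<Gamma>) \<le> ennreal (hconst / real m ^ ?n)" for i
 proof -
  have "(\<integral>\<^sup>+x. indicator (cell m i) x \<partial>surface_measure \<Gamma>)
    = (\<integral>\<^sup>+x. indicator (cell m i) x * indicator \<Gamma> x \<partial>(hausdorff_measure ?n :: 'a measure))"
   unfolding surface_measure_def using \<Gamma>
   by (intro nn_integral_restrict_space) (auto intro: borel_closed)
  also have "\<dots> = (\<integral>\<^sup>+x. indicator (cell m i \<inter> \<Gamma>) x \<partial>(hausdorff_measure ?n :: 'a measure))"
   by (simp only: indicator_inter_arith)
  also have "\<dots> = emeasure (hausdorff_measure ?n) (cell m i \<inter> \<Gamma>)"
   using \<Gamma> by (intro nn_integral_indicator) (auto simp: borel_closed)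
  also have "\<dots> \<le> hausdorff_outer ?n (cell m i \<inter> \<Gamma>)" by (rule emeasure_hausdorff_le)
  also have "\<dots> \<le> hausdorff_outer ?n (cell m i)" by (intro hausdorff_outer_mono) auto
  also have "\<dots> \<le> ennreal (hconst / real m ^ ?n)" by (rule hausdorff_outer_cell[OF m(1)])
  finally show ?thesis .
 qed
 have cellm: "(indicator (cell m i) :: 'a \<Rightarrow> ennreal) \<in> borel_measurable (surface_measure \<Gamma>)" for i
 proof -
  have "(indicator (cell m i) :: 'a \<Rightarrow> ennreal) \<in> borel_measurable (hausdorff_measure ?n)"
   by (intro borel_measurable_indicator) simp
  then show ?thesis unfolding surface_measure_def by (rule measurable_restrict_space1)
 qed
 have vol: "emeasure lborel (brick m i) = ennreal (v0 / real m ^ ?d)" for i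
  unfolding brick_volume[OF m(1)] v0e using v0 by (simp add: ennreal_mult'[symmetric])
 have d1: "real m ^ ?d = real m * real m ^ ?n" using dim2 by (simp add: power_eq_if)
 have step3: "s i * ennreal (hconst / real m ^ ?n)
   \<le> ennreal (hconst * real m / v0) * (\<integral>\<^sup>+y. (W y + ennreal \<epsilon>) * indicator (brick m i) y \<partial>lborel)"
  if i: "i \<in> I" for i
 proof -
  have "hconst / real m ^ ?n = (hconst * real m / v0) * (v0 / real m ^ ?d)"
   using v0 m0 by (simp add: d1)
  then have "s i * ennreal (hconst / real m ^ ?n) = s i * (ennreal (hconst * real m / v0) * ennreal (v0 / real m ^ ?d))"
   using v0 m0 hconst_nonneg by (simp add: ennreal_mult[symmetric])
  also have "\<dots> = ennreal (hconst * real m / v0) * (s i * emeasure lborel (brick m i))"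
   by (simp add: vol mult.left_commute)
  also have "s i * emeasure lborel (brick m i) = (\<integral>\<^sup>+y. s i * indicator (brick m i) y \<partial>lborel)"
   by (simp add: nn_integral_cmult_indicator)
  also have "\<dots> \<le> (\<integral>\<^sup>+y. (W y + ennreal \<epsilon>) * indicator (brick m i) y \<partial>lborel)"
  proof (intro nn_integral_mono)
   fix y
   show "s i * indicator (brick m i) y \<le> (W y + ennreal \<epsilon>) * indicator (brick m i) y"
   proof (cases "y \<in> brick m i")
    case True
    then have "y \<in> E" using brickE[OF i] by blast
    then have "W y + ennreal \<epsilon> = ennreal (\<bar>u y\<bar> + \<epsilon>)" using \<epsilon> by (simp add: W_def)
    moreover have "s i \<le> ennreal (\<bar>u y\<bar> + \<epsilon>)" unfolding s_def using True by (rule INF_lower)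
    ultimately show ?thesis by (intro mult_right_mono) auto
   qed simp
  qed
  finally show ?thesis by (simp add: mult_left_mono)
 qed
 have Pdis: "indicator P y = (\<Sum>i\<in>I. indicator (brick m i) y :: ennreal)" for y
  unfolding P_def using finI brick_disjoint[OF m(1)]
  by (intro indicator_UN_disjoint) (auto simp: disjoint_family_on_def I_def)
 have volP: "emeasure lborel P \<le> ennreal (v0 / real m)"
 proof -
  have "emeasure lborel P \<le> (\<Sum>i\<in>I. emeasure lborel (brick m i))"
   unfolding P_def using finI by (intro emeasure_subadditive_finite) auto
  also have "\<dots> = ennreal (real (card I) * (v0 / real m ^ ?d))"
   using v0 by (simp add: vol) (simp add: ennreal_of_nat_eq_real_of_nat ennreal_mult[symmetric])
  also have "\<dots> \<le> ennreal (real m ^ ?n * (v0 / real m ^ ?d))"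
   using v0 cardI by (intro ennreal_leI mult_right_mono) (auto simp flip: of_nat_power)
  also have "real m ^ ?n * (v0 / real m ^ ?d) = v0 / real m" using m0 by (simp add: d1)
  finally show ?thesis .
 qed
 have WP: "ennreal height * (\<integral>\<^sup>+y. W y * indicator P y \<partial>lborel) \<le> ennreal (1 / real m) * (\<integral>\<^sup>+x. g x \<partial>lborel)"
 proof -
  have "ennreal height * (\<integral>\<^sup>+y. W y * indicator P y \<partial>lborel) = (\<integral>\<^sup>+y. ennreal height * (W y * indicator P y) \<partial>lborel)"
   by (intro nn_integral_cmult[symmetric]) auto
  also have "\<dots> \<le> (\<integral>\<^sup>+x. indicator P x * (\<integral>\<^sup>+t. g (x + t *\<^sub>R L b) * indicator {0..height} t \<partial>lborel) \<partial>lborel)"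
  proof (rule nn_integral_mono_AE, use line in eventually_elim)
   case (elim x)
   show ?case
   proof (cases "x \<in> P")
    case True
    then obtain i where i: "i \<in> I" "x \<in> brick m i" by (auto simp: P_def)
    then have "\<forall>t\<in>{0..height}. x + t *\<^sub>R L b \<in> E" using inE by auto
    with elim have "ennreal (height * \<bar>u x\<bar>) \<le> (\<integral>\<^sup>+t. g (x + t *\<^sub>R L b) * indicator {0..height} t \<partial>lborel)" by blast
    moreover have "x \<in> E" using i brickE by blast
    ultimately show ?thesis using True h0 by (simp add: W_def ennreal_mult)
   qed simp
  qed
  also have "\<dots> \<le> ennreal (1 / real m) * (\<integral>\<^sup>+x. g x \<partial>lborel)"
   by (intro translation_integral_le[OF m(1) Pm g]) (auto simp: P_def brick_def)
  finally show ?thesis .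
 qed
 have "?lhs \<le> (\<integral>\<^sup>+x. (\<Sum>i\<in>I. s i * indicator (cell m i) x) \<partial>surface_measure \<Gamma>)"
  by (intro nn_integral_mono step1)
 also have "\<dots> = (\<Sum>i\<in>I. s i * (\<integral>\<^sup>+x. indicator (cell m i) x \<partial>surface_measure \<Gamma>))"
  using cellm by (simp add: nn_integral_sum nn_integral_cmult)
 also have "\<dots> \<le> (\<Sum>i\<in>I. s i * ennreal (hconst / real m ^ ?n))"
  by (intro sum_mono mult_left_mono cellS) auto
 also have "\<dots> \<le> (\<Sum>i\<in>I. ennreal (hconst * real m / v0) * (\<integral>\<^sup>+y. (W y + ennreal \<epsilon>) * indicator (brick m i) y \<partial>lborel))"
  by (intro sum_mono step3)
 also have "\<dots> = ennreal (hconst * real m / v0) * (\<integral>\<^sup>+y. (\<Sum>i\<in>I. (W y + ennreal \<epsilon>) * indicator (brick m i) y) \<partial>lborel)"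
  by (simp add: nn_integral_sum sum_distrib_left)
 also have "(\<integral>\<^sup>+y. (\<Sum>i\<in>I. (W y + ennreal \<epsilon>) * indicator (brick m i) y) \<partial>lborel)
   = (\<integral>\<^sup>+y. W y * indicator P y + ennreal \<epsilon> * indicator P y \<partial>lborel)"
 proof (rule nn_integral_cong)
  fix y :: 'a
  have "(\<Sum>i\<in>I. (W y + ennreal \<epsilon>) * indicator (brick m i) y) = (W y + ennreal \<epsilon>) * indicator P y"
   unfolding Pdis by (rule sum_distrib_left[symmetric])
  then show "(\<Sum>i\<in>I. (W y + ennreal \<epsilon>) * indicator (brick m i) y)
    = W y * indicator P y + ennreal \<epsilon> * indicator P y" by (simp only: distrib_right)
 qed
 also have "\<dots> = (\<integral>\<^sup>+y. W y * indicator P y \<partial>lborel) + ennreal \<epsilon> * emeasure lborel P"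
  by (subst nn_integral_add) (auto simp: nn_integral_cmult_indicator)
 also have "\<dots> \<le> ennreal (1 / (real m * height)) * (\<integral>\<^sup>+x. g x \<partial>lborel) + ennreal (\<epsilon> * v0 / real m)"
 proof (rule add_mono)
  have "(\<integral>\<^sup>+y. W y * indicator P y \<partial>lborel) = ennreal (1 / height) * (ennreal height * (\<integral>\<^sup>+y. W y * indicator P y \<partial>lborel))"
   using h0 by (simp add: mult.assoc[symmetric] ennreal_mult[symmetric])
  also have "\<dots> \<le> ennreal (1 / height) * (ennreal (1 / real m) * (\<integral>\<^sup>+x. g x \<partial>lborel))"
   by (intro mult_left_mono WP) simp
  also have "\<dots> = ennreal (1 / (real m * height)) * (\<integral>\<^sup>+x. g x \<partial>lborel)"
  proof -
   have "ennreal (1 / (real m * height)) = ennreal (1 / height) * ennreal (1 / real m)"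
    using ennreal_mult[of "1 / height" "1 / real m"] h0 by (simp add: mult.commute)
   then show ?thesis by (simp only: mult.assoc)
  qed
  finally show "(\<integral>\<^sup>+y. W y * indicator P y \<partial>lborel) \<le> ennreal (1 / (real m * height)) * (\<integral>\<^sup>+x. g x \<partial>lborel)" .
  have "ennreal \<epsilon> * emeasure lborel P \<le> ennreal \<epsilon> * ennreal (v0 / real m)"
   by (rule mult_left_mono[OF volP]) simp
  then show "ennreal \<epsilon> * emeasure lborel P \<le> ennreal (\<epsilon> * v0 / real m)"
   using ennreal_mult[of \<epsilon> "v0 / real m"] \<epsilon>(1) v0 by simp
 qed
 finally have "?lhs \<le> ennreal (hconst * real m / v0) *
   (ennreal (1 / (real m * height)) * (\<integral>\<^sup>+x. g x \<partial>lborel) + ennreal (\<epsilon> * v0 / real m))"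
  by (simp add: mult_left_mono)
 also have "\<dots> = ennreal trace_const * (\<integral>\<^sup>+x. g x \<partial>lborel) + ennreal (hconst * \<epsilon>)"
 proof -
  have "ennreal (hconst * real m / v0) * ennreal (1 / (real m * height)) = ennreal trace_const"
   "ennreal (hconst * real m / v0) * ennreal (\<epsilon> * v0 / real m) = ennreal (hconst * \<epsilon>)"
   unfolding trace_const_def v0_def[symmetric] using m0 v0 h0 \<epsilon> hconst_nonneg
   by (simp_all add: ennreal_mult[symmetric])
  then show ?thesis by (simp add: distrib_left mult.assoc[symmetric])
 qed
 also have "\<dots> \<le> ennreal trace_const * (\<integral>\<^sup>+x. g x \<partial>lborel) + ennreal e0"
  using \<epsilon> by (intro add_left_mono ennreal_leI)
 finally show "?lhs \<le> ?rhs + ennreal e0" .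
qed

end

lemma AE_interval_witness:
 fixes a b :: real
 assumes "AE t in lborel. P t" "a < b"
 shows "\<exists>t\<in>{a<..<b}. P t"
proof (rule ccontr)
 assume no: "\<not> ?thesis"
 have "AE t in lborel. t \<notin> {a<..<b}" using assms(1) by eventually_elim (use no in blast)
 then have "emeasure lborel {a<..<b} = 0"
  using AE_iff_measurable[of "{a<..<b}" lborel "\<lambda>t. t \<notin> {a<..<b}"] by (simp add: greaterThanLessThan_def greaterThan_def lessThan_def Collect_conj_eq)
 then show False using assms(2) by simp
qed

lemma finite_line_frontier:
 fixes E :: "'a::euclidean_space set"
 assumes E: "convex E" "compact E" and v: "v \<noteq> 0"
  and ae: "AE t in lborel. x + t *\<^sub>R v \<notin> frontier E"
 shows "finite {t\<in>{0..H}. x + t *\<^sub>R v \<in> frontier E}"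
proof -
 define J where "J = {0..H} \<inter> (\<lambda>t. x + t *\<^sub>R v) -` E"
 have cont: "continuous_on {0..H} (\<lambda>t. x + t *\<^sub>R v)" by (intro continuous_intros)
 have "closed J" unfolding J_def Int_commute[of "{0..H}"] using E(2)
  by (subst Int_commute) (intro continuous_closed_preimage cont compact_imp_closed; simp)
 then have "compact J" unfolding J_def
  by (metis bounded_Int bounded_closed_interval compact_eq_bounded_closed)
 moreover have "convex J" unfolding J_def
 proof (intro convexI)
  fix s t p q :: real assume st: "s \<in> {0..H} \<inter> (\<lambda>t. x + t *\<^sub>R v) -` E" "t \<in> {0..H} \<inter> (\<lambda>t. x + t *\<^sub>R v) -` E"
   and pq: "0 \<le> p" "0 \<le> q" "p + q = 1"
  have "p *\<^sub>R s + q *\<^sub>R t \<in> {0..H}" using st pq convexD[OF convex_closed_interval[of 0 H]] by blast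
  moreover have "x + (p *\<^sub>R s + q *\<^sub>R t) *\<^sub>R v = p *\<^sub>R (x + s *\<^sub>R v) + q *\<^sub>R (x + t *\<^sub>R v)"
   using scaleR_add_left[of p q x] pq by (simp add: algebra_simps)
  moreover have "p *\<^sub>R (x + s *\<^sub>R v) + q *\<^sub>R (x + t *\<^sub>R v) \<in> E"
   using st pq E(1) by (auto intro: convexD)
  ultimately show "p *\<^sub>R s + q *\<^sub>R t \<in> {0..H} \<inter> (\<lambda>t. x + t *\<^sub>R v) -` E" by auto
 qed
 ultimately obtain a b where J: "J = {a..b}"
  using connected_compact_interval_1 convex_connected by blast
 have "{t\<in>{0..H}. x + t *\<^sub>R v \<in> frontier E} \<subseteq> {a, b}"
 proof (rule subsetI, rule ccontr)
  fix t assume t: "t \<in> {t\<in>{0..H}. x + t *\<^sub>R v \<in> frontier E}" and "t \<notin> {a, b}"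
  have clE: "closed E" using E(2) by (rule compact_imp_closed)
  then have "t \<in> J" using t by (auto simp: J_def frontier_def)
  then have ab: "a < t" "t < b" using J \<open>t \<notin> {a, b}\<close> by auto
  obtain s where s: "s \<in> {a<..<t}" "x + s *\<^sub>R v \<notin> frontier E"
   using AE_interval_witness[OF ae ab(1)] by blast
  have "s \<in> J" "b \<in> J" using s ab J by auto
  then have sE: "x + s *\<^sub>R v \<in> interior E" and bE: "x + b *\<^sub>R v \<in> closure E"
   using s(2) closure_subset[of E] by (auto simp: J_def frontier_def)
  have "x + t *\<^sub>R v \<in> open_segment (x + s *\<^sub>R v) (x + b *\<^sub>R v)"
  proof -
   define u where "u = (t - s) / (b - s)"
   have u: "0 < u" "u < 1" using s ab by (auto simp: u_def)
   have "s + u * (b - s) = t" using s ab by (simp add: u_def)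
   then have "(1 - u) *\<^sub>R (x + s *\<^sub>R v) + u *\<^sub>R (x + b *\<^sub>R v) = x + t *\<^sub>R v"
    by (auto simp: algebra_simps simp flip: scaleR_add_left)
   moreover have "x + s *\<^sub>R v \<noteq> x + b *\<^sub>R v" using v s ab by auto
   ultimately show ?thesis using u by (auto simp: in_segment intro!: exI[of _ u])
  qed
  then have "x + t *\<^sub>R v \<in> interior E"
   using in_interior_closure_convex_segment[OF E(1) sE bE] by blast
  then show False using t by (auto simp: frontier_def)
 qed
 then show ?thesis using finite_subset by blast
qed

context mesh
begin

lemma line_estimate:
 fixes u :: "'a \<Rightarrow> real"
 assumes u: "u \<in> piecewise_polynomials k \<T>" "continuous_on (closure \<Omega>) u"
  and v: "v \<noteq> 0" and H: "0 < H"
 shows "AE x in lborel. (\<forall>t\<in>{0..H}. x + t *\<^sub>R v \<in> closure \<Omega>) \<longrightarrow>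
    ennreal (H * \<bar>u x\<bar>) \<le> (\<integral>\<^sup>+t. indicator core (x + t *\<^sub>R v) *
     ennreal (\<bar>u (x + t *\<^sub>R v)\<bar> + H * norm v * norm (grad u (x + t *\<^sub>R v))) * indicator {0..H} t \<partial>lborel)"
proof -
 define N where "N = (\<Union>E\<in>\<T>. frontier E)"
 have Nclosed: "closed N" unfolding N_def using finite_mesh by (intro closed_UN) auto
 then have [measurable]: "N \<in> sets borel" by (rule borel_closed)
 have "N \<in> null_sets lebesgue" using negligible_frontiers by (simp add: N_def negligible_iff_null_sets)
 then have Nnull: "emeasure lborel N = 0" by auto
 have [measurable]: "core \<in> sets borel" using core_open by (rule borel_open)
 have "(\<integral>\<^sup>+x. (\<integral>\<^sup>+t. indicator N (x + t *\<^sub>R v) \<partial>lborel) \<partial>lborel)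
   = (\<integral>\<^sup>+t. (\<integral>\<^sup>+x. indicator N (x + t *\<^sub>R v) \<partial>lborel) \<partial>(lborel :: real measure))"
  by (intro lborel_pair.Fubini'[symmetric]) measurable
 also have "\<dots> = (\<integral>\<^sup>+(t::real). 0 \<partial>lborel)"
 proof (rule nn_integral_cong)
  fix t :: real
  have "(\<integral>\<^sup>+x. indicator N (x + t *\<^sub>R v) \<partial>lborel) = (\<integral>\<^sup>+x. indicator N x \<partial>distr lborel borel ((+) (t *\<^sub>R v)))"
   by (subst nn_integral_distr) (auto simp: add.commute)
  also have "\<dots> = 0" using Nnull by (simp add: lborel_distr_plus)
  finally show "(\<integral>\<^sup>+x. indicator N (x + t *\<^sub>R v) \<partial>lborel) = 0" .
 qed
 finally have "(\<integral>\<^sup>+x. (\<integral>\<^sup>+(t::real). indicator N (x + t *\<^sub>R v) \<partial>lborel) \<partial>lborel) = 0" by simp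
 then have "AE x in lborel. (\<integral>\<^sup>+(t::real). indicator N (x + t *\<^sub>R v) \<partial>lborel) = 0"
  by (subst (asm) nn_integral_0_iff_AE) measurable
 then show ?thesis
 proof eventually_elim
  case (elim x)
  have "AE t in lborel. (indicator N (x + t *\<^sub>R v) :: ennreal) = 0"
   using elim by (subst (asm) nn_integral_0_iff_AE) auto
  then have ae: "AE t in lborel. x + t *\<^sub>R v \<notin> N" by eventually_elim (auto simp: indicator_def split: if_splits)
  show ?case
  proof
   assume seg: "\<forall>t\<in>{0..H}. x + t *\<^sub>R v \<in> closure \<Omega>"
   define Z where "Z = {t\<in>{0..H}. x + t *\<^sub>R v \<in> N}"
   have "finite {t\<in>{0..H}. x + t *\<^sub>R v \<in> frontier E}" if E: "E \<in> \<T>" for E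
   proof (rule finite_line_frontier)
    show "AE t in lborel. x + t *\<^sub>R v \<notin> frontier E"
     using ae by eventually_elim (use E in \<open>auto simp: N_def\<close>)
   qed (use element[OF E] v in auto)
   moreover have "Z = (\<Union>E\<in>\<T>. {t\<in>{0..H}. x + t *\<^sub>R v \<in> frontier E})" by (auto simp: Z_def N_def)
   ultimately have finZ: "finite Z" using finite_mesh by auto
   have inC: "x + t *\<^sub>R v \<in> core" if "t \<in> {0..H}" "t \<notin> Z" for t
    using that seg subsetD[OF closure_minus_core, of "x + t *\<^sub>R v"] by (auto simp: Z_def N_def)
   define D where "D t = indicator core (x + t *\<^sub>R v) *\<^sub>R (grad u (x + t *\<^sub>R v) \<bullet> v)" for t
   have gradM: "grad u \<in> M_space k \<T>" by (rule grad_in_M_space[OF u(1)])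
   have gm: "(\<lambda>z. indicator core z *\<^sub>R grad u z) \<in> borel_measurable borel"
    using M_space_continuous_on[OF gradM] by (intro borel_measurable_continuous_on_indicator) auto
   have um: "(\<lambda>z. indicator core z *\<^sub>R u z) \<in> borel_measurable borel"
    using piecewise_polynomial_continuous_on[OF u(1)] by (intro borel_measurable_continuous_on_indicator) auto
   have lm: "(\<lambda>t. x + t *\<^sub>R v) \<in> borel \<rightarrow>\<^sub>M borel" by measurable
   note gm' = measurable_compose[OF lm gm] and um' = measurable_compose[OF lm um]
   have Dm [measurable]: "D \<in> borel_measurable borel"
   proof -
    have "D = (\<lambda>t. (indicator core (x + t *\<^sub>R v) *\<^sub>R grad u (x + t *\<^sub>R v)) \<bullet> v)" by (auto simp: D_def)
    also have "\<dots> \<in> borel_measurable borel" using gm' by (intro borel_measurable_inner) auto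
    finally show ?thesis .
   qed
   obtain B where B: "0 \<le> B" "\<And>z. z \<in> core ==> norm (grad u z) \<le> B" using M_space_bounded[OF gradM] by blast
   have Db: "\<bar>D t\<bar> \<le> B * norm v" for t
   proof (cases "x + t *\<^sub>R v \<in> core")
    case True
    have "\<bar>grad u (x + t *\<^sub>R v) \<bullet> v\<bar> \<le> norm (grad u (x + t *\<^sub>R v)) * norm v" by (rule Cauchy_Schwarz_ineq2)
    also have "\<dots> \<le> B * norm v" using B(2)[OF True] by (intro mult_right_mono) auto
    finally show ?thesis using True by (simp add: D_def)
   qed (use B in \<open>simp add: D_def\<close>)
   define Q where "Q = (\<integral>\<^sup>+t. ennreal \<bar>D t\<bar> * indicator {0..H} t \<partial>lborel)"
   have step: "ennreal \<bar>u x\<bar> \<le> ennreal \<bar>u (x + t *\<^sub>R v)\<bar> + Q" if t: "t \<in> {0..H}" for t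
   proof -
    have int: "set_integrable lborel {0..t} D" unfolding set_integrable_def
    proof (rule integrableI_bounded_set[where A = "{0..t}" and B = "B * norm v"])
     show "AE s in lborel. s \<in> {0..t} \<longrightarrow> norm (indicator {0..t} s *\<^sub>R D s) \<le> B * norm v"
      using Db B by (auto simp: indicator_def)
    qed (use t in \<open>auto simp: indicator_def\<close>)
    have "((\<lambda>s. D s) has_integral (u (x + t *\<^sub>R v) - u (x + 0 *\<^sub>R v))) {0..t}"
    proof (rule fundamental_theorem_of_calculus_interior_strong[OF finZ])
     show "continuous_on {0..t} (\<lambda>s. u (x + s *\<^sub>R v))"
      using seg t by (intro continuous_on_compose2[OF u(2)] continuous_intros) auto
     fix s assume s: "s \<in> {0<..<t} - Z"
     then have c: "x + s *\<^sub>R v \<in> core" using inC t by auto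
     have "((\<lambda>s. u (x + s *\<^sub>R v)) has_derivative (\<lambda>h. grad u (x + s *\<^sub>R v) \<bullet> (h *\<^sub>R v))) (at s)"
      using has_derivative_grad[OF piecewise_polynomial_differentiable[OF u(1) c]]
      by (intro has_derivative_compose[of "\<lambda>s. x + s *\<^sub>R v" "\<lambda>h. h *\<^sub>R v" s UNIV u]) (auto intro!: derivative_eq_intros)
     then show "((\<lambda>s. u (x + s *\<^sub>R v)) has_vector_derivative D s) (at s)"
      using c by (simp add: has_vector_derivative_def D_def)
    qed (use t in auto)
    then have "integral {0..t} D = u (x + t *\<^sub>R v) - u x" by (simp add: integral_unique)
    then have eq: "(LINT s:{0..t}|lborel. D s) = u (x + t *\<^sub>R v) - u x"
     using set_borel_integral_eq_integral(2)[OF int] by simp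
    have "ennreal \<bar>u (x + t *\<^sub>R v) - u x\<bar> \<le> (\<integral>\<^sup>+s. norm (indicator {0..t} s *\<^sub>R D s) \<partial>lborel)"
     using integral_norm_bound_ennreal[OF int[unfolded set_integrable_def]] eq
     unfolding set_lebesgue_integral_def by simp
    also have "\<dots> \<le> Q" unfolding Q_def using t by (intro nn_integral_mono) (auto simp: indicator_def)
    finally have "ennreal \<bar>u (x + t *\<^sub>R v) - u x\<bar> \<le> Q" .
    moreover have "ennreal \<bar>u x\<bar> \<le> ennreal \<bar>u (x + t *\<^sub>R v)\<bar> + ennreal \<bar>u (x + t *\<^sub>R v) - u x\<bar>"
    proof -
     have "\<bar>u x\<bar> \<le> \<bar>u (x + t *\<^sub>R v)\<bar> + \<bar>u (x + t *\<^sub>R v) - u x\<bar>" by linarith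
     from ennreal_leI[OF this] show ?thesis by simp
    qed
    ultimately show ?thesis by (meson add_left_mono order_trans)
   qed
   let ?U = "\<lambda>t. ennreal \<bar>indicator core (x + t *\<^sub>R v) *\<^sub>R u (x + t *\<^sub>R v)\<bar>"
   have "ennreal (H * \<bar>u x\<bar>) = (\<integral>\<^sup>+t. ennreal \<bar>u x\<bar> * indicator {0..H} t \<partial>lborel)"
    using H by (simp add: nn_integral_cmult_indicator ennreal_mult mult.commute)
   also have "\<dots> \<le> (\<integral>\<^sup>+t. (?U t + Q) * indicator {0..H} t \<partial>lborel)"
   proof (rule nn_integral_mono_AE, use ae in eventually_elim)
    case (elim t)
    show ?case
    proof (cases "t \<in> {0..H}")
     case True
     then have "x + t *\<^sub>R v \<in> core" using elim inC by (auto simp: Z_def)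
     then show ?thesis using step[OF True] True by simp
    qed simp
   qed
   also have "\<dots> = (\<integral>\<^sup>+t. ?U t * indicator {0..H} t \<partial>lborel) + Q * ennreal H"
    using H um' by (simp add: distrib_right nn_integral_add nn_integral_cmult_indicator)
   also have "Q * ennreal H = (\<integral>\<^sup>+t. ennreal H * (ennreal \<bar>D t\<bar> * indicator {0..H} t) \<partial>lborel)"
    unfolding Q_def by (subst nn_integral_cmult) (auto simp: mult.commute)
   also have "(\<integral>\<^sup>+t. ?U t * indicator {0..H} t \<partial>lborel) + \<dots>
     = (\<integral>\<^sup>+t. ?U t * indicator {0..H} t + ennreal H * (ennreal \<bar>D t\<bar> * indicator {0..H} t) \<partial>lborel)"
    using um' by (intro nn_integral_add[symmetric]) auto
   also have "\<dots> \<le> (\<integral>\<^sup>+t. indicator core (x + t *\<^sub>R v) *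
     ennreal (\<bar>u (x + t *\<^sub>R v)\<bar> + H * norm v * norm (grad u (x + t *\<^sub>R v))) * indicator {0..H} t \<partial>lborel)"
   proof (rule nn_integral_mono)
    fix t
    show "?U t * indicator {0..H} t + ennreal H * (ennreal \<bar>D t\<bar> * indicator {0..H} t)
      \<le> indicator core (x + t *\<^sub>R v) *
     ennreal (\<bar>u (x + t *\<^sub>R v)\<bar> + H * norm v * norm (grad u (x + t *\<^sub>R v))) * indicator {0..H} t"
    proof (cases "x + t *\<^sub>R v \<in> core \<and> t \<in> {0..H}")
     case True
     have "H * \<bar>D t\<bar> \<le> H * (norm v * norm (grad u (x + t *\<^sub>R v)))"
      using True H Cauchy_Schwarz_ineq2[of "grad u (x + t *\<^sub>R v)" v]
      by (intro mult_left_mono) (auto simp: D_def mult.commute)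
     then show ?thesis using True H
      by (simp add: ennreal_mult[symmetric] ennreal_plus[symmetric] del: ennreal_plus)
    qed (auto simp: D_def)
   qed
   finally show "ennreal (H * \<bar>u x\<bar>) \<le> (\<integral>\<^sup>+t. indicator core (x + t *\<^sub>R v) *
     ennreal (\<bar>u (x + t *\<^sub>R v)\<bar> + H * norm v * norm (grad u (x + t *\<^sub>R v))) * indicator {0..H} t \<partial>lborel)" .
  qed
 qed
qed

end

lemma vertex_chart:
 fixes C :: "'a::euclidean_space set"
 assumes C: "\<not> affine_dependent C" "card C = Suc DIM('a)" and c: "c1 \<in> C" "c0 \<in> C" "c1 \<noteq> c0"
  and dim2: "2 \<le> DIM('a)"
 shows "\<exists>L R b \<kappa>. affine_chart L R b \<kappa> \<and>
   (\<forall>x. (\<forall>c\<in>Basis. 0 \<le> affine_chart.co c1 R c x) \<and> (\<Sum>c\<in>Basis. affine_chart.co c1 R c x) \<le> 1 \<longrightarrow> x \<in> convex hull C) \<and>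
   (\<forall>\<mu>. (\<forall>c\<in>C. 0 \<le> \<mu> c) \<and> sum \<mu> C = 1 \<and> \<mu> c0 = 0 \<and> 1 / real DIM('a) \<le> \<mu> c1 \<longrightarrow>
    (\<Sum>c\<in>C. \<mu> c *\<^sub>R c) \<in> affine_chart.facet c1 R b)"
proof -
 have finC: "finite C" using C(2) by (metis card.infinite nat.distinct(1))
 have "card (Basis :: 'a set) = card (C - {c1})" using C c by simp
 then obtain \<theta> where \<theta>: "bij_betw \<theta> (Basis :: 'a set) (C - {c1})"
  using finite_same_card_bij[of Basis "C - {c1}"] finC by auto
 define \<theta>' where "\<theta>' = the_inv_into Basis \<theta>"
 have \<theta>': "\<theta>' c \<in> Basis" "\<theta> (\<theta>' c) = c" if "c \<in> C - {c1}" for c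
  using \<theta> that by (auto simp: \<theta>'_def bij_betw_def the_inv_into_into f_the_inv_into_f)
 have \<theta>'\<theta>: "\<theta>' (\<theta> d) = d" if "d \<in> Basis" for d
  using \<theta> that by (simp add: \<theta>'_def bij_betw_def the_inv_into_f_f)
 have reind: "(\<Sum>d\<in>Basis. F (\<theta> d)) = (\<Sum>c\<in>C - {c1}. F c)" for F :: "'a \<Rightarrow> 'b::comm_monoid_add"
  by (rule sum.reindex_bij_betw[OF \<theta>])
 define L where "L y = (\<Sum>d\<in>Basis. (y \<bullet> d) *\<^sub>R (\<theta> d - c1))" for y
 have linL: "linear L"
  unfolding L_def by (intro linearI) (simp_all add: inner_add_left scaleR_add_left sum.distrib scaleR_sum_right)
 define U where "U y c = (if c = c1 then 1 - (\<Sum>d\<in>Basis. y \<bullet> d) else y \<bullet> \<theta>' c)" for y c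
 have sumU: "sum (U y) C = 1" "(\<Sum>c\<in>C. U y c *\<^sub>R c) = c1 + L y" for y
 proof -
  have *: "(\<Sum>c\<in>C - {c1}. G (y \<bullet> \<theta>' c) c) = (\<Sum>d\<in>Basis. G (y \<bullet> d) (\<theta> d))" for G :: "real \<Rightarrow> 'a \<Rightarrow> 'b::comm_monoid_add"
   by (subst reind[symmetric]) (auto simp: \<theta>'\<theta>)
  show "sum (U y) C = 1"
   using finC c *[of "\<lambda>r _. r"] by (simp add: U_def sum.remove[of C c1])
  have "(\<Sum>c\<in>C. U y c *\<^sub>R c) = (1 - (\<Sum>d\<in>Basis. y \<bullet> d)) *\<^sub>R c1 + (\<Sum>d\<in>Basis. (y \<bullet> d) *\<^sub>R \<theta> d)"
   using finC c *[of "\<lambda>r c. r *\<^sub>R c"] by (simp add: U_def sum.remove[of C c1])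
  also have "\<dots> = c1 + L y"
   by (simp add: L_def scaleR_diff_left scaleR_diff_right sum_subtractf scaleR_sum_left)
  finally show "(\<Sum>c\<in>C. U y c *\<^sub>R c) = c1 + L y" .
 qed
 have inj: "y = 0" if y: "L y = 0" for y
 proof (rule ccontr)
  assume "y \<noteq> 0"
  then obtain d where d: "d \<in> Basis" "y \<bullet> d \<noteq> 0" using euclidean_all_zero_iff by blast
  define V where "V c = U y c - (if c = c1 then 1 else 0)" for c
  have "sum V C = 0" using sumU(1)[of y] finC c by (simp add: V_def sum_subtractf)
  moreover have "(\<Sum>c\<in>C. V c *\<^sub>R c) = 0"
  proof -
   have "(\<Sum>c\<in>C. V c *\<^sub>R c) = (\<Sum>c\<in>C. U y c *\<^sub>R c) - (\<Sum>c\<in>C. if c = c1 then c else 0)"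
    by (auto simp: V_def scaleR_diff_left sum_subtractf intro!: sum.cong)
   then show ?thesis using sumU(2)[of y] y finC c by simp
  qed
  moreover have "\<theta> d \<in> C" "V (\<theta> d) \<noteq> 0"
   using d \<theta> \<theta>'\<theta>[OF d(1)] by (auto simp: V_def U_def bij_betw_def)
  ultimately show False using C(1) finC unfolding affine_dependent_explicit_finite[OF finC] by blast
 qed
 then have "inj L" using linear_injective_0[OF linL] by blast
 then obtain R where R: "linear R" "\<forall>x. R (L x) = x" "\<forall>x. L (R x) = x"
  using linear_injective_isomorphism[OF linL] by blast
 obtain \<kappa> where \<kappa>: "0 < \<kappa>" "\<forall>x. norm (L x) \<le> norm x * \<kappa>"
  using bounded_linear.pos_bounded[OF linear_conv_bounded_linear[THEN iffD1, OF linL]] by blast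
 let ?b = "\<theta>' c0"
 have ch: "affine_chart L R ?b \<kappa>"
 proof (rule affine_chart.intro)
  show "?b \<in> Basis" using \<theta>'(1)[of c0] c by simp
  show "norm (L y) \<le> \<kappa> * norm y" for y using \<kappa>(2) by (simp add: mult.commute)
  show "R (L y) = y" for y using R(2) by blast
  show "L (R y) = y" for y using R(3) by blast
 qed (fact linL R(1) \<kappa>(1) dim2)+
 have co: "affine_chart.co c1 R d (c1 + L y) = y \<bullet> d" for d y
  using R by (simp add: affine_chart.co_def[OF ch])
 have 1: "x \<in> convex hull C"
  if x: "\<forall>d\<in>Basis. 0 \<le> affine_chart.co c1 R d x" "(\<Sum>d\<in>Basis. affine_chart.co c1 R d x) \<le> 1" for x
 proof -
  define y where "y = R (x - c1)"
  have xy: "x = c1 + L y" using R by (simp add: y_def)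
  have "\<forall>c\<in>C. 0 \<le> U y c" using x \<theta>' unfolding xy co by (auto simp: U_def)
  then show ?thesis unfolding convex_hull_finite[OF finC] using sumU[of y] xy by blast
 qed
 have 2: "(\<Sum>c\<in>C. \<mu> c *\<^sub>R c) \<in> affine_chart.facet c1 R ?b"
  if \<mu>: "\<forall>c\<in>C. 0 \<le> \<mu> c" "sum \<mu> C = 1" "\<mu> c0 = 0" "1 / real DIM('a) \<le> \<mu> c1" for \<mu>
 proof -
  define y where "y = (\<Sum>d\<in>Basis. \<mu> (\<theta> d) *\<^sub>R d)"
  have yd: "y \<bullet> d = \<mu> (\<theta> d)" if "d \<in> Basis" for d using that by (simp add: y_def inner_sum_left_Basis)
  have s: "(\<Sum>d\<in>Basis. \<mu> (\<theta> d)) = 1 - \<mu> c1"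
   using reind[of \<mu>] \<mu>(2) finC c by (simp add: sum.remove[of C c1])
  have "U y c = \<mu> c" if "c \<in> C" for c
   using that \<theta>' s by (auto simp: U_def yd)
  then have "(\<Sum>c\<in>C. \<mu> c *\<^sub>R c) = (\<Sum>c\<in>C. U y c *\<^sub>R c)" by (intro sum.cong) auto
  then have xy: "(\<Sum>c\<in>C. \<mu> c *\<^sub>R c) = c1 + L y" using sumU(2) by simp
  have \<theta>C: "\<theta> d \<in> C" if "d \<in> Basis" for d using \<theta> that by (auto simp: bij_betw_def)
  show ?thesis unfolding affine_chart.facet_def[OF ch] xy mem_Collect_eq co
   using \<mu> s \<theta>'[of c0] c yd \<theta>C by auto
 qed
 show ?thesis using ch 1 2 by blast
qed

lemma simplex_frontier_weights:
 fixes C :: "'a::euclidean_space set"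
 assumes C: "card C = Suc DIM('a)" and x: "x \<in> frontier (convex hull C)"
 shows "\<exists>c0\<in>C. \<exists>c1\<in>C. c1 \<noteq> c0 \<and> (\<exists>\<mu>. (\<forall>c\<in>C. 0 \<le> \<mu> c) \<and> sum \<mu> C = 1 \<and> \<mu> c0 = 0 \<and>
  1 / real DIM('a) \<le> \<mu> c1 \<and> x = (\<Sum>c\<in>C. \<mu> c *\<^sub>R c))"
proof -
 have finC: "finite C" using C by (metis card.infinite nat.distinct(1))
 obtain c0 where c0: "c0 \<in> C" "x \<in> convex hull (C - {c0})"
  using x unfolding frontier_of_convex_hull[OF C] by blast
 then obtain w where w: "\<forall>c\<in>C - {c0}. 0 \<le> w c" "sum w (C - {c0}) = 1" "(\<Sum>c\<in>C - {c0}. w c *\<^sub>R c) = x"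
  using finC by (auto simp: convex_hull_finite)
 define \<mu> where "\<mu> c = (if c = c0 then 0 else w c)" for c
 have \<mu>: "\<forall>c\<in>C. 0 \<le> \<mu> c" "\<mu> c0 = 0" using w by (auto simp: \<mu>_def)
 have \<mu>w: "sum \<mu> (C - {c0}) = 1" "(\<Sum>c\<in>C - {c0}. \<mu> c *\<^sub>R c) = x"
 proof -
  have "sum \<mu> (C - {c0}) = sum w (C - {c0})"
   "(\<Sum>c\<in>C - {c0}. \<mu> c *\<^sub>R c) = (\<Sum>c\<in>C - {c0}. w c *\<^sub>R c)"
   by (intro sum.cong; auto simp: \<mu>_def)+
  then show "sum \<mu> (C - {c0}) = 1" "(\<Sum>c\<in>C - {c0}. \<mu> c *\<^sub>R c) = x"
   using w(2,3) by auto
 qed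
 have sums: "sum \<mu> C = 1" "x = (\<Sum>c\<in>C. \<mu> c *\<^sub>R c)"
  using \<mu>w sum.remove[OF finC c0(1), of \<mu>] sum.remove[OF finC c0(1), of "\<lambda>c. \<mu> c *\<^sub>R c"] \<mu>(2) by auto
 have "\<exists>c1\<in>C - {c0}. 1 / real DIM('a) \<le> \<mu> c1"
 proof (rule ccontr)
  assume no: "\<not> ?thesis"
  have card: "card (C - {c0}) = DIM('a)" using C c0 by simp
  have ne: "C - {c0} \<noteq> {}" using card by (metis DIM_positive card.empty less_numeral_extra(3))
  have "sum \<mu> (C - {c0}) < (\<Sum>c\<in>C - {c0}. 1 / real DIM('a))"
   using no finC ne by (intro sum_strict_mono) (auto simp: not_le)
  also have "\<dots> = 1" by (simp add: card)
  finally show False using \<mu>w by simp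
 qed
 then show ?thesis using c0(1) \<mu> sums by blast
qed

context mesh
begin

lemma surface_measurable:
 assumes "closed \<Gamma>" "continuous_on \<Gamma> u"
 shows "u \<in> borel_measurable (surface_measure \<Gamma>)"
proof -
 have "sets (surface_measure \<Gamma>) = sets (restrict_space borel \<Gamma>)"
  unfolding surface_measure_def by (rule sets_restrict_space_cong) simp
 then show ?thesis
  using borel_measurable_continuous_on_restrict[OF assms(2)]
  by (simp cong: measurable_cong_sets)
qed

lemma frontier_subset: "frontier \<Omega> \<subseteq> (\<Union>E\<in>\<T>. frontier E)"
proof -
 have "frontier \<Omega> \<subseteq> closure \<Omega> - core"
  using core_subset domain_open by (auto simp: frontier_def interior_open)
 then show ?thesis using closure_minus_core by blast
qed

lemma trace_inequality:
 assumes dim2: "2 \<le> DIM('a)"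
 shows "\<exists>Ct\<ge>0. \<forall>\<T>' k u. mesh_of \<Omega> \<T>' \<longrightarrow> u \<in> piecewise_polynomials k \<T>' \<longrightarrow> continuous_on (closure \<Omega>) u \<longrightarrow>
   (\<integral>\<^sup>+x. ennreal \<bar>u x\<bar> \<partial>surface_measure (frontier \<Omega>))
    \<le> ennreal Ct * W11 \<Omega> u"
proof -
 let ?\<Gamma> = "frontier \<Omega>"
 let ?chart = "\<lambda>E p L R b \<kappa>. affine_chart L R b \<kappa> \<and>
   (\<forall>x. (\<forall>c\<in>Basis. 0 \<le> affine_chart.co p R c x) \<and> (\<Sum>c\<in>Basis. affine_chart.co p R c x) \<le> 1 \<longrightarrow> x \<in> E)"
 define bound where "bound A Ct \<longleftrightarrow> (\<forall>\<T>' k u. mesh_of \<Omega> \<T>' \<longrightarrow> u \<in> piecewise_polynomials k \<T>' \<longrightarrow> continuous_on (closure \<Omega>) u \<longrightarrow>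
   (\<integral>\<^sup>+x. ennreal \<bar>u x\<bar> * indicator A x \<partial>surface_measure ?\<Gamma>)
    \<le> ennreal Ct * W11 \<Omega> u)" for A Ct
 have single: "affine_chart.facet p R b \<in> sets borel \<and> (\<exists>Ct\<ge>0. bound (affine_chart.facet p R b) Ct)"
  if E: "E \<in> \<T>" and good: "?chart E p L R b \<kappa>" for E p L R b \<kappa>
 proof -
  interpret chart: affine_chart p L R b \<kappa> using good by blast
  define v where "v = L b"
  define M where "M = max 1 (chart.height * norm v)"
  have v: "v \<noteq> 0"
  proof
   assume "v = 0"
   then have "b = 0" using chart.RL[of b] linear_0[OF chart.linR] by (simp add: v_def)
   then show False using chart.b by simp
  qed
  have h0: "0 < chart.height" by (simp add: chart.height_def)
  have tc0: "0 \<le> chart.trace_const"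
   using chart.hconst_nonneg h0 by (simp add: chart.trace_const_def)
  have "(\<integral>\<^sup>+x. ennreal \<bar>u x\<bar> * indicator chart.facet x \<partial>surface_measure ?\<Gamma>)
    \<le> ennreal (chart.trace_const * M) * W11 \<Omega> u"
   if mesh': "mesh_of \<Omega> \<T>'" and u: "u \<in> piecewise_polynomials k \<T>'" "continuous_on (closure \<Omega>) u" for \<T>' k u
  proof -
   interpret m': mesh \<Omega> \<T>' using domain mesh' by unfold_locales
   define g where "g z = indicator m'.core z * ennreal (\<bar>u z\<bar> + chart.height * norm v * norm (grad u z))" for z
   have co: "m'.core \<in> sets borel" using m'.core_open by (rule borel_open)
   have cu: "continuous_on m'.core (\<lambda>z. \<bar>u z\<bar> + chart.height * norm v * norm (grad u z))"
    using m'.piecewise_polynomial_continuous_on[OF u(1)] m'.M_space_continuous_on[OF m'.grad_in_M_space[OF u(1)]]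
    by (intro continuous_intros)
   have gm: "g \<in> borel_measurable borel"
   proof -
    have "g = (\<lambda>z. ennreal (indicator m'.core z *\<^sub>R (\<bar>u z\<bar> + chart.height * norm v * norm (grad u z))))"
     by (auto simp: g_def indicator_def)
    also have "\<dots> \<in> borel_measurable borel"
     using borel_measurable_continuous_on_indicator[OF co cu]
     by (rule measurable_compose) simp
    finally show ?thesis .
   qed
   have "(\<integral>\<^sup>+x. ennreal \<bar>u x\<bar> * indicator chart.facet x \<partial>surface_measure ?\<Gamma>)
     \<le> ennreal chart.trace_const * (\<integral>\<^sup>+x. g x \<partial>lborel)"
   proof (rule chart.facet_trace[OF element(2)[OF E] _ _ _ gm])
    show "continuous_on E u" using u(2) element(5)[OF E] by (rule continuous_on_subset)
    show "AE x in lborel. (\<forall>t\<in>{0..chart.height}. x + t *\<^sub>R L b \<in> E) \<longrightarrow>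
      ennreal (chart.height * \<bar>u x\<bar>) \<le> (\<integral>\<^sup>+t. g (x + t *\<^sub>R L b) * indicator {0..chart.height} t \<partial>lborel)"
     using m'.line_estimate[OF u v h0]
     by eventually_elim (use element(5)[OF E] in \<open>auto simp: g_def v_def\<close>)
   qed (use good in auto)
   also have "(\<integral>\<^sup>+x. g x \<partial>lborel) \<le> ennreal M * W11 \<Omega> u"
   proof -
    have "(\<integral>\<^sup>+x. g x \<partial>lborel) = (\<integral>\<^sup>+x. g x \<partial>lebesgue)"
     using gm by (simp add: nn_integral_completion)
    also have "\<dots> \<le> (\<integral>\<^sup>+x. ennreal M * ennreal (\<bar>u x\<bar> + norm (grad u x)) * indicator m'.core x \<partial>lebesgue)"
    proof (rule nn_integral_mono)
     fix z
     have "\<bar>u z\<bar> + (chart.height * norm v) * norm (grad u z) \<le> M * \<bar>u z\<bar> + M * norm (grad u z)"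
      unfolding M_def by (intro add_mono mult_right_mono) (auto simp: mult_le_cancel_right1)
     then have "ennreal (\<bar>u z\<bar> + chart.height * norm v * norm (grad u z)) \<le> ennreal (M * (\<bar>u z\<bar> + norm (grad u z)))"
      by (intro ennreal_leI) (simp add: distrib_left)
     then show "g z \<le> ennreal M * ennreal (\<bar>u z\<bar> + norm (grad u z)) * indicator m'.core z"
      by (auto simp: g_def indicator_def ennreal_mult M_def)
    qed
    also have "\<dots> = (\<integral>\<^sup>+x. ennreal M * ennreal (\<bar>u x\<bar> + norm (grad u x)) \<partial>lebesgue_on m'.core)"
     using co by (subst nn_integral_restrict_space) auto
    also have "\<dots> = ennreal M * (\<integral>\<^sup>+x. ennreal (\<bar>u x\<bar> + norm (grad u x)) \<partial>lebesgue_on m'.core)"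
    proof (rule nn_integral_cmult)
     have "continuous_on m'.core (\<lambda>z. \<bar>u z\<bar> + norm (grad u z))"
      using m'.piecewise_polynomial_continuous_on[OF u(1)] m'.M_space_continuous_on[OF m'.grad_in_M_space[OF u(1)]]
      by (intro continuous_intros)
     then show "(\<lambda>x. ennreal (\<bar>u x\<bar> + norm (grad u x))) \<in> borel_measurable (lebesgue_on m'.core)"
      by (rule measurable_compose[OF m'.measurable_core]) simp
    qed
    finally show ?thesis by (simp add: m'.nn_integral_core)
   qed
   finally show ?thesis using tc0 by (simp add: mult_left_mono ennreal_mult M_def mult.assoc)
  qed
  then have "bound chart.facet (chart.trace_const * M)" unfolding bound_def by blast
  moreover have "0 \<le> chart.trace_const * M" using tc0 by (simp add: M_def)
  moreover have "chart.facet \<in> sets borel" unfolding chart.facet_def by measurable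
  ultimately show ?thesis by blast
 qed
 have "\<forall>E\<in>\<T>. \<exists>C. \<not> affine_dependent C \<and> card C = Suc DIM('a) \<and> E = convex hull C"
  using element_vertices by metis
 then obtain vert where vert: "\<And>E. E \<in> \<T> ==> \<not> affine_dependent (vert E)"
  "\<And>E. E \<in> \<T> ==> card (vert E) = Suc DIM('a)" "\<And>E. E \<in> \<T> ==> E = convex hull (vert E)"
  unfolding bchoice_iff by blast
 have finV: "finite (vert E)" if "E \<in> \<T>" for E
  using vert(2)[OF that] by (metis card.infinite nat.distinct(1))
 let ?P = "\<lambda>E c1 c0 \<mu>. (\<forall>c\<in>vert E. 0 \<le> \<mu> c) \<and> sum \<mu> (vert E) = 1 \<and> \<mu> c0 = 0 \<and> 1 / real DIM('a) \<le> \<mu> c1"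
 define S where "S = (SIGMA E:\<T>. {(c1, c0). c1 \<in> vert E \<and> c0 \<in> vert E \<and> c1 \<noteq> c0})"
 have finS: "finite S" unfolding S_def
 proof (intro finite_SigmaI finite_mesh)
  fix E assume "E \<in> \<T>"
  then have "finite (vert E \<times> vert E)" using finV by blast
  then show "finite {(c1, c0). c1 \<in> vert E \<and> c0 \<in> vert E \<and> c1 \<noteq> c0}"
   by (rule rev_finite_subset) auto
 qed
 have "\<forall>s\<in>S. \<exists>A. A \<in> sets borel \<and> (\<exists>Ct\<ge>0. bound A Ct) \<and>
   (\<forall>\<mu>. ?P (fst s) (fst (snd s)) (snd (snd s)) \<mu> \<longrightarrow> (\<Sum>c\<in>vert (fst s). \<mu> c *\<^sub>R c) \<in> A)"
 proof
  fix s assume "s \<in> S"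
  then obtain E c1 c0 where s: "s = (E, c1, c0)" "E \<in> \<T>" "c1 \<in> vert E" "c0 \<in> vert E" "c1 \<noteq> c0"
   by (auto simp: S_def)
  obtain L R b \<kappa> where ch: "?chart E c1 L R b \<kappa>"
   and f: "\<forall>\<mu>. ?P E c1 c0 \<mu> \<longrightarrow> (\<Sum>c\<in>vert E. \<mu> c *\<^sub>R c) \<in> affine_chart.facet c1 R b"
   using vertex_chart[OF vert(1,2)[OF s(2)] s(3-5) dim2] unfolding vert(3)[OF s(2), symmetric] by blast
  show "\<exists>A. A \<in> sets borel \<and> (\<exists>Ct\<ge>0. bound A Ct) \<and>
   (\<forall>\<mu>. ?P (fst s) (fst (snd s)) (snd (snd s)) \<mu> \<longrightarrow> (\<Sum>c\<in>vert (fst s). \<mu> c *\<^sub>R c) \<in> A)"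
   using single[OF s(2) ch] f by (intro exI[of _ "affine_chart.facet c1 R b"]) (simp add: s(1))
 qed
 then obtain A where A: "\<forall>s\<in>S. A s \<in> sets borel \<and> (\<exists>Ct\<ge>0. bound (A s) Ct) \<and>
   (\<forall>\<mu>. ?P (fst s) (fst (snd s)) (snd (snd s)) \<mu> \<longrightarrow> (\<Sum>c\<in>vert (fst s). \<mu> c *\<^sub>R c) \<in> A s)"
  unfolding bchoice_iff by blast
 then have "\<forall>s\<in>S. \<exists>Ct. 0 \<le> Ct \<and> bound (A s) Ct" by blast
 then obtain Ct where Ct: "\<forall>s\<in>S. 0 \<le> Ct s \<and> bound (A s) (Ct s)" unfolding bchoice_iff by blast
 have cover: "\<exists>s\<in>S. x \<in> A s" if x\<Gamma>: "x \<in> ?\<Gamma>" for x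
 proof -
  obtain E where E: "E \<in> \<T>" "x \<in> frontier E" using x\<Gamma> frontier_subset by blast
  then obtain c0 c1 \<mu> where "c0 \<in> vert E" "c1 \<in> vert E" "c1 \<noteq> c0" "?P E c1 c0 \<mu>" "x = (\<Sum>c\<in>vert E. \<mu> c *\<^sub>R c)"
   using simplex_frontier_weights[OF vert(2)[OF E(1)], of x] vert(3)[OF E(1)] by auto
  then have "(E, c1, c0) \<in> S" "x \<in> A (E, c1, c0)" using A E(1) by (force simp: S_def)+
  then show ?thesis by blast
 qed
 have "(\<integral>\<^sup>+x. ennreal \<bar>u x\<bar> \<partial>surface_measure ?\<Gamma>)
    \<le> ennreal (sum Ct S) * W11 \<Omega> u"
  if u: "mesh_of \<Omega> \<T>'" "u \<in> piecewise_polynomials k \<T>'" "continuous_on (closure \<Omega>) u" for \<T>' k u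
 proof -
  have "continuous_on ?\<Gamma> u" using u(3) by (rule continuous_on_subset) (simp add: frontier_def)
  then have um: "(\<lambda>x. ennreal \<bar>u x\<bar>) \<in> borel_measurable (surface_measure ?\<Gamma>)"
   by (intro measurable_compose[OF surface_measurable measurable_ennreal] continuous_intros) auto
  have Am: "(indicator (A s) :: 'a \<Rightarrow> ennreal) \<in> borel_measurable (surface_measure ?\<Gamma>)" if "s \<in> S" for s
  proof -
   have "(indicator (A s) :: 'a \<Rightarrow> ennreal) \<in> borel_measurable (hausdorff_measure (DIM('a) - 1))"
    using A that by (intro borel_measurable_indicator) simp
   then show ?thesis unfolding surface_measure_def by (rule measurable_restrict_space1)
  qed
  have "(\<integral>\<^sup>+x. ennreal \<bar>u x\<bar> \<partial>surface_measure ?\<Gamma>) \<le> (\<integral>\<^sup>+x. (\<Sum>s\<in>S. ennreal \<bar>u x\<bar> * indicator (A s) x) \<partial>surface_measure ?\<Gamma>)"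
  proof (rule nn_integral_mono)
   fix x assume "x \<in> space (surface_measure ?\<Gamma>)"
   then have "x \<in> ?\<Gamma>" by (simp add: surface_measure_def space_restrict_space)
   then obtain s where s: "s \<in> S" "x \<in> A s" using cover by blast
   then have "ennreal \<bar>u x\<bar> = ennreal \<bar>u x\<bar> * indicator (A s) x" by simp
   also have "\<dots> \<le> (\<Sum>s\<in>S. ennreal \<bar>u x\<bar> * indicator (A s) x)"
    using finS s(1) by (intro member_le_sum) auto
   finally show "ennreal \<bar>u x\<bar> \<le> (\<Sum>s\<in>S. ennreal \<bar>u x\<bar> * indicator (A s) x)" .
  qed
  also have "\<dots> = (\<Sum>s\<in>S. \<integral>\<^sup>+x. ennreal \<bar>u x\<bar> * indicator (A s) x \<partial>surface_measure ?\<Gamma>)"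
   using um Am by (intro nn_integral_sum borel_measurable_times_ennreal)
  also have "\<dots> \<le> (\<Sum>s\<in>S. ennreal (Ct s) * W11 \<Omega> u)"
   using Ct u unfolding bound_def by (intro sum_mono) blast
  also have "\<dots> = ennreal (sum Ct S) * W11 \<Omega> u"
   using Ct by (simp add: sum_distrib_right[symmetric] sum_ennreal)
  finally show ?thesis .
 qed
 moreover have "0 \<le> sum Ct S" using Ct by (intro sum_nonneg) auto
 ultimately show ?thesis by blast
qed

end

section \<open>Parametric integrals and a Gronwall inequality\<close>

lemma borel_measurable_derivative:
 fixes f :: "real \<Rightarrow> real"
 assumes "\<And>t. t \<in> {0<..<T} ==> (f has_real_derivative f' t) (at t)"
 shows "f' \<in> Lmeas {0<..<T}"
proof -
 define g where "g t = indicator {0<..<T} t *\<^sub>R f t" for t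
 have "continuous_on {0<..<T} f"
  using assms by (meson DERIV_isCont continuous_at_imp_continuous_on)
 then have [measurable]: "g \<in> borel_measurable borel"
  unfolding g_def[abs_def] by (intro borel_measurable_continuous_on_indicator) auto
 define q where "q n t = real (Suc n) * (g (t + 1 / real (Suc n)) - g t)" for n t
 have qm: "q n \<in> Lmeas {0<..<T}" for n
 proof -
  have "q n \<in> borel_measurable borel" unfolding q_def[abs_def] by measurable
  then have "q n \<in> borel_measurable lebesgue" by (simp add: measurable_completion)
  then show ?thesis by (rule measurable_restrict_space1)
 qed
 have "(\<lambda>n. q n t) \<longlonglongrightarrow> f' t" if t: "t \<in> space (lebesgue_on {0<..<T})" for t
 proof -
  have t': "0 < t" "t < T" using t by auto
  have "((\<lambda>h. (f (t + h) - f t) / h) \<longlongrightarrow> f' t) (at 0)" using assms[of t] t' by (simp add: DERIV_def)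
  moreover have "filterlim (\<lambda>n. 1 / real (Suc n)) (at 0) sequentially"
   using LIMSEQ_Suc[OF lim_1_over_n] by (intro filterlim_atI) (auto simp: eventually_sequentially)
  ultimately have "(\<lambda>n. (f (t + 1 / real (Suc n)) - f t) / (1 / real (Suc n))) \<longlonglongrightarrow> f' t"
   by (rule filterlim_compose)
  moreover have "\<forall>\<^sub>F n in sequentially. (f (t + 1 / real (Suc n)) - f t) / (1 / real (Suc n)) = q n t"
  proof -
   have "\<forall>\<^sub>F n in sequentially. 1 / real (Suc n) < T - t"
    using LIMSEQ_Suc[OF lim_1_over_n] t' by (intro order_tendstoD(2)[where a = "T - t"]) auto
   then show ?thesis
   proof eventually_elim
    case (elim n)
    have "0 < t + 1 / real (Suc n)" using t' by (intro add_pos_pos) auto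
    then have "t + 1 / real (Suc n) \<in> {0<..<T}" "t \<in> {0<..<T}" using t' elim by (auto simp del: of_nat_Suc)
    then show ?case by (simp add: q_def g_def)
   qed
  qed
  ultimately show ?thesis by (rule Lim_transform_eventually)
 qed
 then show ?thesis using qm by (rule borel_measurable_LIMSEQ_real)
qed

lemma continuous_param_integral:
 fixes g :: "real \<Rightarrow> 'b \<Rightarrow> real"
 assumes "finite_measure M" and t: "t \<in> A" and d: "0 < d"
  and meas: "\<And>s. s \<in> A ==> g s \<in> borel_measurable M"
  and bound: "\<And>s. s \<in> A ==> \<bar>s - t\<bar> < d ==> AE x in M. \<bar>g s x\<bar> \<le> B"
  and cont: "AE x in M. continuous (at t within A) (\<lambda>s. g s x)"
 shows "continuous (at t within A) (\<lambda>s. \<integral>x. g s x \<partial>M)"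
 unfolding continuous_within_sequentially
proof (intro allI impI, elim conjE)
 interpret finite_measure M by fact
 fix s :: "nat \<Rightarrow> real" assume s: "\<forall>n. s n \<in> A" "s \<longlonglongrightarrow> t"
 have "\<forall>\<^sub>F n in sequentially. \<bar>s n - t\<bar> < d"
  using s(2) d by (auto simp: tendsto_iff dist_real_def)
 then obtain N where N: "\<And>n. N \<le> n ==> \<bar>s n - t\<bar> < d" by (auto simp: eventually_sequentially)
 have "(\<lambda>n. \<integral>x. g (s (n + N)) x \<partial>M) \<longlonglongrightarrow> (\<integral>x. g t x \<partial>M)"
 proof (rule integral_dominated_convergence[where w = "\<lambda>_. B"])
  show "AE x in M. (\<lambda>n. g (s (n + N)) x) \<longlonglongrightarrow> g t x"
   using cont
  proof eventually_elim
   case (elim x)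
   then have "((\<lambda>s. g s x) \<circ> s) \<longlonglongrightarrow> g t x" using s unfolding continuous_within_sequentially by blast
   then show ?case using LIMSEQ_ignore_initial_segment[of "(\<lambda>s. g s x) \<circ> s" "g t x" N] by simp
  qed
  show "AE x in M. norm (g (s (n + N)) x) \<le> B" for n
   using bound[of "s (n + N)"] s N[of "n + N"] by simp
 qed (use meas s t in auto)
 then show "((\<lambda>s. \<integral>x. g s x \<partial>M) \<circ> s) \<longlonglongrightarrow> (\<integral>x. g t x \<partial>M)"
  unfolding o_def by (rule LIMSEQ_offset)
qed

lemma has_derivative_param_integral:
 fixes g :: "real \<Rightarrow> 'b \<Rightarrow> real"
 assumes "finite_measure M" and d: "0 < d"
  and int: "\<And>s. \<bar>s - t\<bar> < d ==> integrable M (g s)"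
  and lip: "\<And>s. \<bar>s - t\<bar> < d ==> AE x in M. \<bar>g s x - g t x\<bar> \<le> B * \<bar>s - t\<bar>"
  and der: "AE x in M. ((\<lambda>s. g s x) has_real_derivative g' x) (at t)"
  and meas': "g' \<in> borel_measurable M"
 shows "((\<lambda>s. \<integral>x. g s x \<partial>M) has_real_derivative (\<integral>x. g' x \<partial>M)) (at t)"
 unfolding has_field_derivative_iff tendsto_at_iff_sequentially
proof (intro allI impI)
 interpret finite_measure M by fact
 fix s :: "nat \<Rightarrow> real" assume s: "\<forall>n. s n \<in> UNIV - {t}" "s \<longlonglongrightarrow> t"
 have "\<forall>\<^sub>F n in sequentially. \<bar>s n - t\<bar> < d"
  using s(2) d by (auto simp: tendsto_iff dist_real_def)
 then obtain N where N: "\<And>n. N \<le> n ==> \<bar>s n - t\<bar> < d" by (auto simp: eventually_sequentially)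
 let ?s = "\<lambda>n. s (n + N)"
 have sn: "\<bar>?s n - t\<bar> < d" "?s n \<noteq> t" for n using N[of "n + N"] s by auto
 have it: "integrable M (g t)" using int[of t] d by simp
 have "(\<lambda>n. \<integral>x. (g (?s n) x - g t x) / (?s n - t) \<partial>M) \<longlonglongrightarrow> (\<integral>x. g' x \<partial>M)"
 proof (rule integral_dominated_convergence[where w = "\<lambda>_. B"])
  show "AE x in M. (\<lambda>n. (g (?s n) x - g t x) / (?s n - t)) \<longlonglongrightarrow> g' x"
   using der
  proof eventually_elim
   case (elim x)
   then have "((\<lambda>r. (g r x - g t x) / (r - t)) \<circ> s) \<longlonglongrightarrow> g' x"
    using s unfolding has_field_derivative_iff tendsto_at_iff_sequentially by blast
   then show ?case
    using LIMSEQ_ignore_initial_segment[of "(\<lambda>r. (g r x - g t x) / (r - t)) \<circ> s" "g' x" N] by simp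
  qed
  show "AE x in M. norm ((g (?s n) x - g t x) / (?s n - t)) \<le> B" for n
   using lip[OF sn(1)] by eventually_elim (use sn(2) in \<open>simp add: divide_le_eq\<close>)
  show "(\<lambda>x. (g (?s n) x - g t x) / (?s n - t)) \<in> borel_measurable M" for n
   using int[OF sn(1)] it by (intro borel_measurable_divide borel_measurable_diff) auto
 qed (use meas' in auto)
 moreover have "(\<integral>x. (g (?s n) x - g t x) / (?s n - t) \<partial>M) = ((\<integral>x. g (?s n) x \<partial>M) - (\<integral>x. g t x \<partial>M)) / (?s n - t)" for n
  using int[OF sn(1)] it by simp
 ultimately have "(\<lambda>n. ((\<integral>x. g (?s n) x \<partial>M) - (\<integral>x. g t x \<partial>M)) / (?s n - t)) \<longlonglongrightarrow> (\<integral>x. g' x \<partial>M)" by (simp only:)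
 then show "((\<lambda>y. ((\<integral>x. g y x \<partial>M) - (\<integral>x. g t x \<partial>M)) / (y - t)) \<circ> s) \<longlonglongrightarrow> (\<integral>x. g' x \<partial>M)"
  unfolding o_def by (rule LIMSEQ_offset)
qed

text \<open>No measurability of \<open>F\<close> is needed: the positive part \<open>R\<close> of what \<open>F\<close> has to dominate is
 measurable by itself.\<close>

lemma gronwall_integral:
 fixes E E' p q F :: "real \<Rightarrow> real"
 assumes T: "0 < T" and \<kappa>: "0 \<le> \<kappa>" and B: "0 \<le> B" and Lw: "0 \<le> Lw"
  and cont: "continuous_on {0..<T} E"
  and der: "\<And>t. t \<in> {0<..<T} ==> (E has_real_derivative E' t) (at t)"
  and pm: "p \<in> Lmeas {0<..<T}" and p0: "\<And>t. t \<in> {0<..<T} ==> 0 \<le> p t"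
  and qm: "q \<in> Lmeas {0<..<T}" and q0: "\<And>t. t \<in> {0<..<T} ==> 0 \<le> q t"
  and Qb: "time_integral T q \<le> ennreal Qb" "0 \<le> Qb"
  and F0: "\<And>t. t \<in> {0<..<T} ==> 0 \<le> F t"
  and Fb: "time_integral T F \<le> ennreal Fb" "0 \<le> Fb"
  and ineq: "\<And>t. t \<in> {0<..<T} ==> E' t + p t \<le> B + \<kappa> * E t + q t + F t"
  and low: "\<And>t. t \<in> {0<..<T} ==> - Lw \<le> E t"
 shows "\<And>t. t \<in> {0<..<T} ==> exp (- \<kappa> * t) * E t \<le> E 0 + B * T + Qb + Fb"
  and "time_integral T p \<le> ennreal (exp (\<kappa> * T) * (E 0 + B * T + Qb + Fb + Lw))"
proof -
 let ?I = "\<lambda>s. {0<..<s::real}"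
 define R where "R t = max 0 (E' t + p t - B - \<kappa> * E t - q t)" for t
 define e where "e t = exp (- \<kappa> * t) * E t" for t
 define e' where "e' t = exp (- \<kappa> * t) * (E' t - \<kappa> * E t)" for t
 define V where "V t = exp (- \<kappa> * t) * (B + q t + R t)" for t
 have E'm: "E' \<in> Lmeas (?I T)" using der by (rule borel_measurable_derivative)
 have Em: "E \<in> Lmeas (?I T)"
  by (intro continuous_imp_measurable_on_sets_lebesgue continuous_on_subset[OF cont]) auto
 have expm: "(\<lambda>t. exp (- \<kappa> * t)) \<in> Lmeas (?I T)"
  by (intro continuous_imp_measurable_on_sets_lebesgue continuous_intros) auto
 have Rm: "R \<in> Lmeas (?I T)"
  unfolding R_def[abs_def] by (intro borel_measurable_max borel_measurable_diff borel_measurable_add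
    borel_measurable_times E'm pm Em qm borel_measurable_const)
 have Vm: "V \<in> Lmeas (?I T)"
  unfolding V_def[abs_def] by (intro borel_measurable_add borel_measurable_times expm qm Rm borel_measurable_const)
 have R0: "0 \<le> R t" for t by (simp add: R_def)
 have RF: "R t \<le> F t" if "t \<in> ?I T" for t using ineq[OF that] F0[OF that] by (auto simp: R_def)
 have exp1: "exp (- \<kappa> * t) \<le> 1" if "0 \<le> t" for t using \<kappa> that by simp
 have V0: "0 \<le> V t" if "t \<in> ?I T" for t using B q0[OF that] R0[of t] by (simp add: V_def)
 define Z where "Z = B * T + Qb + Fb"
 have Z0: "0 \<le> Z" using B T Qb Fb by (simp add: Z_def)
 have Vint: "time_integral T V \<le> ennreal Z"
 proof -
  have "time_integral T V \<le> (\<integral>\<^sup>+t. (ennreal B + ennreal (q t)) + ennreal (R t) \<partial>lebesgue_on (?I T))"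
  proof (rule nn_integral_mono)
   fix t assume "t \<in> space (lebesgue_on (?I T))"
   then have t: "t \<in> ?I T" by simp
   have "V t \<le> 1 * (B + q t + R t)" unfolding V_def
    using exp1[of t] t B q0[OF t] R0[of t] by (intro mult_right_mono) auto
   then have "ennreal (V t) \<le> ennreal (B + q t + R t)" by (intro ennreal_leI) simp
   then show "ennreal (V t) \<le> (ennreal B + ennreal (q t)) + ennreal (R t)"
    using B q0[OF t] R0[of t] by simp
  qed
  also have "\<dots> = (\<integral>\<^sup>+t. ennreal B + ennreal (q t) \<partial>lebesgue_on (?I T)) + time_integral T R"
   using qm Rm by (intro nn_integral_add) auto
  also have "\<dots> = (ennreal B * ennreal T + time_integral T q) + time_integral T R"
   using qm T by (subst nn_integral_add) (auto simp: emeasure_restrict_space)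
  also have "\<dots> \<le> (ennreal B * ennreal T + ennreal Qb) + ennreal Fb"
  proof (intro add_mono order_refl Qb)
   have "time_integral T R \<le> time_integral T F"
    using RF by (intro nn_integral_mono ennreal_leI) auto
   then show "time_integral T R \<le> ennreal Fb" using Fb(1) by (rule order_trans)
  qed
  also have "\<dots> = ennreal Z" using B T Qb Fb by (simp add: Z_def ennreal_mult)
  finally show ?thesis .
 qed
 have main: "e s \<le> E 0 + Z \<and>
   (\<integral>\<^sup>+t. ennreal (p t) * indicator (?I s) t \<partial>lebesgue_on (?I T)) \<le> ennreal (exp (\<kappa> * T) * (E 0 + Z + Lw))"
  if s: "s \<in> ?I T" for s
 proof -
  have sub: "?I s \<subseteq> ?I T" using s by auto
  let ?Z = "\<lambda>t. if t \<in> ?I s then V t - e' t else 0"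
  have FTC: "(e' has_integral e s - e 0) {0..s}"
  proof (rule fundamental_theorem_of_calculus_interior)
   show "continuous_on {0..s} e" unfolding e_def
    using s by (intro continuous_intros continuous_on_subset[OF cont]) auto
   fix t assume "t \<in> {0<..<s}"
   then have "t \<in> ?I T" using s by auto
   from der[OF this] have "(e has_real_derivative e' t) (at t)"
    unfolding e_def[abs_def] e'_def by (auto intro!: derivative_eq_intros simp: algebra_simps)
   then show "(e has_vector_derivative e' t) (at t)" by (simp add: has_real_derivative_iff_has_vector_derivative)
  qed (use s in auto)
  then have FTC': "(e' has_integral e s - e 0) (?I s)" by (simp add: has_integral_Icc_iff_Ioo)
  have Vms: "V \<in> Lmeas (?I s)"
   using Vm sub by (metis measurable_restrict_mono)
  have Vs: "time_integral s V \<le> ennreal Z"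
  proof -
   have "time_integral s V \<le> time_integral T V"
    using sub by (simp add: nn_integral_restrict_space) (intro nn_integral_mono, auto simp: indicator_def)
   then show ?thesis using Vint by (rule order_trans)
  qed
  have Vi: "integrable (lebesgue_on (?I s)) V"
  proof (rule integrableI_nonneg[OF Vms])
   show "AE x in lebesgue_on (?I s). 0 \<le> V x" using V0 sub by (intro AE_I2) auto
   show "(\<integral>\<^sup>+x. ennreal (V x) \<partial>lebesgue_on (?I s)) < \<infinity>"
    using Vs by (rule le_less_trans) simp
  qed
  define iv where "iv = (\<integral>t. V t \<partial>lebesgue_on (?I s))"
  have ivZ: "iv \<le> Z"
  proof -
   have "ennreal iv = time_integral s V"
    unfolding iv_def using V0 sub by (intro nn_integral_eq_integral[OF Vi, symmetric] AE_I2) auto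
   also note Vs
   finally show ?thesis using Z0 by (simp add: ennreal_le_iff)
  qed
  have "(V has_integral iv) (?I s)" unfolding iv_def using Vi by (intro has_integral_integral_lebesgue_on) auto
  then have "((\<lambda>t. V t - e' t) has_integral iv - (e s - e 0)) (?I s)" using FTC' by (rule has_integral_diff)
  then have W_int: "(?Z has_integral iv - (e s - e 0)) (?I s)"
   by (rule has_integral_eq[rotated]) auto
  have pW: "exp (- \<kappa> * t) * p t \<le> V t - e' t" if t: "t \<in> ?I s" for t
  proof -
   have "E' t + p t - B - \<kappa> * E t - q t \<le> R t" by (simp add: R_def)
   then have "exp (- \<kappa> * t) * p t \<le> exp (- \<kappa> * t) * ((B + q t + R t) - (E' t - \<kappa> * E t))"
    by (intro mult_left_mono) auto
   then show ?thesis by (simp add: V_def e'_def right_diff_distrib)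
  qed
  have p0': "0 \<le> exp (- \<kappa> * t) * p t" if "t \<in> ?I s" for t using p0[of t] that sub by auto
  have W: "(\<integral>\<^sup>+t. indicator (?I s) t * ennreal (?Z t) \<partial>lebesgue) = ennreal (iv - (e s - e 0))"
  proof -
   have nn: "0 \<le> (?Z t)" for t
    using order_trans[OF p0' pW, of t] by simp
   have "(\<integral>\<^sup>+t. ennreal (?Z t) * indicator (?I s) t \<partial>lborel) = ennreal (iv - (e s - e 0))"
    by (rule nn_integral_has_integral_lebesgue'[OF nn W_int])
   then show ?thesis by (simp only: nn_integral_completion mult.commute[of "indicator _ _"])
  qed
  have ge0: "0 \<le> iv - (e s - e 0)"
  proof (rule has_integral_nonneg)
   show "((\<lambda>t. V t - e' t) has_integral iv - (e s - e 0)) (?I s)" by fact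
   show "0 \<le> V t - e' t" if "t \<in> ?I s" for t using pW[OF that] p0'[OF that] by linarith
  qed
  have e0: "e 0 = E 0" by (simp add: e_def)
  have eLw: "- Lw \<le> e s"
  proof -
   have "exp (- \<kappa> * s) * (- Lw) \<le> e s" unfolding e_def using low[OF s] by (intro mult_left_mono) auto
   moreover have "exp (- \<kappa> * s) * Lw \<le> Lw" using exp1[of s] s Lw by (intro mult_left_le_one_le) auto
   ultimately show ?thesis by simp
  qed
  have "(\<integral>\<^sup>+t. ennreal (p t) * indicator (?I s) t \<partial>lebesgue_on (?I T)) = (\<integral>\<^sup>+t. ennreal (p t) * indicator (?I s) t * indicator (?I T) t \<partial>lebesgue)"
   by (rule nn_integral_restrict_space) auto
  also have "\<dots> \<le> (\<integral>\<^sup>+t. ennreal (exp (\<kappa> * T)) * (indicator (?I s) t * ennreal (?Z t)) \<partial>lebesgue)"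
  proof (rule nn_integral_mono)
   fix t
   show "ennreal (p t) * indicator (?I s) t * indicator (?I T) t
    \<le> ennreal (exp (\<kappa> * T)) * (indicator (?I s) t * ennreal (?Z t))"
   proof (cases "t \<in> ?I s")
    case True
    have pt: "0 \<le> p t" using p0[of t] True sub by blast
    have "\<kappa> * t \<le> \<kappa> * T" using True s \<kappa> by (intro mult_left_mono) auto
    then have "1 \<le> exp (\<kappa> * T) * exp (- \<kappa> * t)" by (simp add: exp_add[symmetric])
    then have "p t \<le> exp (\<kappa> * T) * exp (- \<kappa> * t) * p t" using pt by (simp add: mult_le_cancel_right1)
    also have "\<dots> \<le> exp (\<kappa> * T) * (V t - e' t)" using pW[OF True] by (simp add: mult.assoc)
    finally have "ennreal (p t) \<le> ennreal (exp (\<kappa> * T) * (V t - e' t))" by (rule ennreal_leI)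
    also have "\<dots> = ennreal (exp (\<kappa> * T)) * ennreal (V t - e' t)"
     using pW[OF True] p0'[OF True] by (intro ennreal_mult) auto
    finally have *: "ennreal (p t) \<le> ennreal (exp (\<kappa> * T)) * ennreal (V t - e' t)" .
    have "t \<in> ?I T" using True sub by blast
    then show ?thesis using * True by simp
   qed simp
  qed
  also have "\<dots> = ennreal (exp (\<kappa> * T)) * ennreal (iv - (e s - e 0))"
  proof (subst nn_integral_cmult)
   have "(\<lambda>t. V t - e' t) \<in> Lmeas (?I s)"
   proof (intro borel_measurable_diff Vms)
    have "e' \<in> Lmeas (?I T)"
     unfolding e'_def[abs_def] by (intro borel_measurable_times borel_measurable_diff expm E'm Em borel_measurable_const)
    then show "e' \<in> Lmeas (?I s)" using sub by (metis measurable_restrict_mono)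
   qed
   then have "?Z \<in> borel_measurable lebesgue"
    by (subst borel_measurable_if) auto
   then show "(\<lambda>t. indicator (?I s) t * ennreal (?Z t)) \<in> borel_measurable lebesgue"
    by (intro borel_measurable_times_ennreal borel_measurable_indicator measurable_compose[OF _ measurable_ennreal]) auto
  qed (simp only: W)
  also have "\<dots> = ennreal (exp (\<kappa> * T) * (iv - (e s - e 0)))" using ge0 by (simp add: ennreal_mult)
  also have "\<dots> \<le> ennreal (exp (\<kappa> * T) * (E 0 + Z + Lw))"
   using ivZ e0 eLw by (intro ennreal_leI mult_left_mono) auto
  finally show ?thesis using ge0 ivZ e0 by simp
 qed
 show "exp (- \<kappa> * t) * E t \<le> E 0 + B * T + Qb + Fb" if "t \<in> {0<..<T}" for t
  using main[OF that] by (simp add: e_def Z_def)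
 show "time_integral T p \<le> ennreal (exp (\<kappa> * T) * (E 0 + B * T + Qb + Fb + Lw))"
 proof -
  define s where "s n = T - T / real (n + 2)" for n :: nat
  let ?sup = "\<lambda>t. SUP n. ennreal (p t) * indicator (?I (s n)) t"
  have sT: "s n \<in> ?I T" for n
  proof -
   have "T / real (n + 2) < T / 1" using T by (intro divide_strict_left_mono) auto
   then show ?thesis using T by (simp add: s_def)
  qed
  have smono: "s n \<le> s (Suc n)" for n using T by (auto simp: s_def intro!: divide_left_mono)
  have ssup: "(?sup t) = ennreal (p t)" if t: "t \<in> ?I T" for t
  proof (rule antisym)
   show "(?sup t) \<le> ennreal (p t)"
    by (rule SUP_least) (auto simp: indicator_def)
   obtain n :: nat where "T / (T - t) < real n" using reals_Archimedean2 by blast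
   then have "T < real n * (T - t)" using t by (simp add: pos_divide_less_eq)
   also have "\<dots> \<le> real (n + 2) * (T - t)" using t by (intro mult_right_mono) auto
   finally have "T / real (n + 2) < T - t" by (simp add: divide_less_eq mult.commute)
   then have "t \<in> ?I (s n)" using t by (simp add: s_def)
   then have "ennreal (p t) = ennreal (p t) * indicator (?I (s n)) t" by simp
   also have "\<dots> \<le> (?sup t)" by (rule SUP_upper) simp
   finally show "ennreal (p t) \<le> (?sup t)" .
  qed
  have "time_integral T p = (\<integral>\<^sup>+t. (?sup t) \<partial>lebesgue_on (?I T))"
   using ssup by (intro nn_integral_cong) auto
  also have "\<dots> = (SUP n. \<integral>\<^sup>+t. ennreal (p t) * indicator (?I (s n)) t \<partial>lebesgue_on (?I T))"
  proof (rule nn_integral_monotone_convergence_SUP)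
   show "incseq (\<lambda>n t. ennreal (p t) * indicator (?I (s n)) t)"
    using smono by (intro incseq_SucI le_funI) (auto simp: indicator_def intro: less_le_trans)
   show "(\<lambda>t. ennreal (p t) * indicator (?I (s n)) t) \<in> Lmeas (?I T)" for n
    by (intro borel_measurable_times_ennreal measurable_compose[OF pm measurable_ennreal]
      measurable_restrict_space1[OF borel_measurable_indicator]) simp
  qed
  also have "\<dots> \<le> ennreal (exp (\<kappa> * T) * (E 0 + Z + Lw))"
   using main[OF sT] by (intro SUP_least) blast
  finally show ?thesis by (simp add: Z_def add.assoc)
 qed
qed

section \<open>The energy density\<close>

context power_law_flux
begin

definition lam :: real where "lam = \<beta> / (\<beta> - 1)"

definition energy :: "real \<Rightarrow> real" where "energy \<xi> = integral {0..\<xi>} (\<lambda>\<tau>. K \<tau> * \<tau>)"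

lemma flux_continuous_on: "A \<subseteq> {0..} ==> continuous_on A (\<lambda>\<tau>. K \<tau> * \<tau>)"
 by (intro continuous_intros continuous_on_subset[OF K_cont])

lemma energy_diff:
 assumes "0 \<le> \<xi>" "\<xi> \<le> \<zeta>"
 shows "K \<xi> * \<xi> * (\<zeta> - \<xi>) \<le> energy \<zeta> - energy \<xi>" "energy \<zeta> - energy \<xi> \<le> K \<zeta> * \<zeta> * (\<zeta> - \<xi>)"
proof -
 have i: "(\<lambda>\<tau>. K \<tau> * \<tau>) integrable_on {a..b}" if "0 \<le> a" for a b
  using that by (intro integrable_continuous_real flux_continuous_on) auto
 have eq: "energy \<zeta> - energy \<xi> = integral {\<xi>..\<zeta>} (\<lambda>\<tau>. K \<tau> * \<tau>)"
  using Henstock_Kurzweil_Integration.integral_combine[OF assms i] by (simp add: energy_def)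
 have "integral {\<xi>..\<zeta>} (\<lambda>\<tau>. K \<xi> * \<xi>) \<le> integral {\<xi>..\<zeta>} (\<lambda>\<tau>. K \<tau> * \<tau>)"
  using assms flux_mono by (intro integral_le i integrable_const_ivl) auto
 then show "K \<xi> * \<xi> * (\<zeta> - \<xi>) \<le> energy \<zeta> - energy \<xi>" using assms eq by (simp add: mult_ac)
 have "integral {\<xi>..\<zeta>} (\<lambda>\<tau>. K \<tau> * \<tau>) \<le> integral {\<xi>..\<zeta>} (\<lambda>\<tau>. K \<zeta> * \<zeta>)"
  using assms flux_mono by (intro integral_le i integrable_const_ivl) auto
 then show "energy \<zeta> - energy \<xi> \<le> K \<zeta> * \<zeta> * (\<zeta> - \<xi>)" using assms eq by (simp add: mult_ac)
qed

lemma energy_0 [simp]: "energy 0 = 0" by (simp add: energy_def)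

lemma energy_upper: "0 \<le> \<xi> ==> energy \<xi> \<le> c2 * \<xi> powr \<beta>"
proof -
 assume \<xi>: "0 \<le> \<xi>"
 have "energy \<xi> \<le> (K \<xi> * \<xi>) * \<xi>" using energy_diff(2)[OF _ \<xi>] by simp
 also have "\<dots> \<le> (c2 * \<xi> powr (\<beta> - 1)) * \<xi>" using flux_upper[OF \<xi>] \<xi> by (intro mult_right_mono)
 also have "\<dots> = c2 * \<xi> powr \<beta>" using \<xi> powr_add[of \<xi> "\<beta> - 1" 1] by (cases "\<xi> = 0") auto
 finally show ?thesis .
qed

lemma energy_nonneg: "0 \<le> \<xi> ==> 0 \<le> energy \<xi>"
 using energy_diff(1)[of 0 \<xi>] by simp

lemma energy_lower: "0 \<le> \<xi> ==> c1 * 2 powr (- \<beta>) * \<xi> powr \<beta> - c2 \<le> energy \<xi>"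
proof -
 assume \<xi>: "0 \<le> \<xi>"
 have "(\<xi> / 2) powr \<beta> = 2 powr (- \<beta>) * \<xi> powr \<beta>" using \<xi> by (simp add: powr_divide powr_minus_divide)
 then have "c1 * 2 powr (- \<beta>) * \<xi> powr \<beta> - c2 = c1 * (\<xi> / 2) powr \<beta> - c2" by simp
 also have "\<dots> \<le> K (\<xi> / 2) * (\<xi> / 2)\<^sup>2" using \<xi> by (intro flux_lower) simp
 also have "\<dots> = K (\<xi> / 2) * (\<xi> / 2) * (\<xi> - \<xi> / 2)" by (simp add: power2_eq_square)
 also have "\<dots> \<le> energy \<xi> - energy (\<xi> / 2)" using \<xi> by (intro energy_diff) auto
 also have "\<dots> \<le> energy \<xi>" using energy_nonneg[of "\<xi> / 2"] \<xi> by simp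
 finally show ?thesis .
qed

lemma energy_lipschitz:
 assumes "0 \<le> \<xi>" "\<xi> \<le> r" "0 \<le> \<zeta>" "\<zeta> \<le> r"
 shows "\<bar>energy \<xi> - energy \<zeta>\<bar> \<le> K r * r * \<bar>\<xi> - \<zeta>\<bar>"
proof -
 have *: "\<bar>energy \<xi> - energy \<zeta>\<bar> \<le> K r * r * \<bar>\<xi> - \<zeta>\<bar>" if "0 \<le> \<xi>" "\<xi> \<le> \<zeta>" "\<zeta> \<le> r" for \<xi> \<zeta>
 proof -
  have "0 \<le> K \<xi> * \<xi> * (\<zeta> - \<xi>)" using that K_nonneg by simp
  moreover have "K \<zeta> * \<zeta> * (\<zeta> - \<xi>) \<le> K r * r * (\<zeta> - \<xi>)"
   using that flux_mono[of \<zeta> r] by (intro mult_right_mono) auto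
  ultimately show ?thesis using energy_diff[OF that(1,2)] that by simp
 qed
 show ?thesis using *[of \<xi> \<zeta>] *[of \<zeta> \<xi>] assms by (cases "\<xi> \<le> \<zeta>") (auto simp: abs_minus_commute)
qed

lemma energy_norm_has_derivative:
 fixes y :: "'v::euclidean_space"
 shows "((\<lambda>z. energy (norm z)) has_derivative (\<lambda>z. K (norm y) * (y \<bullet> z))) (at y)"
proof (cases "y = 0")
 case False
 have "(energy has_real_derivative K (norm y) * norm y) (at (norm y) within {0..norm y + 1})"
  unfolding energy_def[abs_def] using False
  by (intro integral_has_real_derivative flux_continuous_on) auto
 moreover have "at (norm y) within {0..norm y + 1} = at (norm y)"
  using False by (intro at_within_interior) (auto simp: interior_atLeastAtMost_real)
 ultimately have "(energy has_derivative (\<lambda>h. K (norm y) * norm y * h)) (at (norm y))"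
  by (simp add: has_field_derivative_def)
 from has_derivative_compose[OF has_derivative_norm[OF False] this]
 have "((\<lambda>z. energy (norm z)) has_derivative (\<lambda>z. K (norm y) * norm y * (z \<bullet> sgn y))) (at y)" .
 moreover have "K (norm y) * norm y * (z \<bullet> sgn y) = K (norm y) * (y \<bullet> z)" for z
  using False by (simp add: sgn_div_norm inner_commute)
 ultimately show ?thesis by simp
next
 case True
 have "((\<lambda>z::'v. K (norm z) * norm z) \<longlongrightarrow> 0) (at 0)"
 proof -
  have "continuous_on UNIV (\<lambda>z::'v. K (norm z) * norm z)"
   by (intro continuous_intros continuous_on_compose2[OF K_cont]) auto
  then have "isCont (\<lambda>z::'v. K (norm z) * norm z) 0" by (simp add: continuous_on_eq_continuous_at)
  then show ?thesis by (simp add: isCont_def)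
 qed
 note lim = this
 have e2: "\<forall>\<^sub>F z in at (0::'v). norm (energy (norm z)) / norm z \<le> K (norm z) * norm z"
 proof (rule always_eventually, rule allI)
  fix z :: 'v
  have "energy (norm z) \<le> K (norm z) * norm z * norm z" using energy_diff(2)[of 0 "norm z"] by simp
  then show "norm (energy (norm z)) / norm z \<le> K (norm z) * norm z"
   using energy_nonneg[of "norm z"] K_nonneg[of "norm z"] by (cases "z = 0") (auto simp: pos_divide_le_eq)
 qed
 have e1: "\<forall>\<^sub>F z in at (0::'v). 0 \<le> norm (energy (norm z)) / norm z" by simp
 have "((\<lambda>z::'v. norm (energy (norm z)) / norm z) \<longlongrightarrow> 0) (at 0)"
  by (rule tendsto_sandwich[OF e1 e2 tendsto_const lim])
 then show ?thesis using True by (simp add: has_derivative_at)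
qed

lemma boundary_young:
 assumes Ct: "0 \<le> Ct" and \<epsilon>: "0 < \<epsilon>"
 shows "\<exists>D\<ge>0. \<forall>m\<ge>0. \<forall>u\<ge>0. \<forall>\<xi>\<ge>0. m * Ct * (u + \<xi>) \<le> D * (1 + m powr lam) + u\<^sup>2 / 2 + \<epsilon> * \<xi> powr \<beta>"
proof -
 define \<delta> where "\<delta> = (\<beta> * \<epsilon>) powr (1 / \<beta>)"
 have lam: "1 < lam" "1 / lam + 1 / \<beta> = 1" "2 < lam" using beta by (auto simp: lam_def field_simps)
 have \<delta>: "0 < \<delta>" "\<delta> powr \<beta> = \<beta> * \<epsilon>" using beta \<epsilon> by (auto simp: \<delta>_def powr_powr)
 define D where "D = (Ct / \<delta>) powr lam / lam + Ct\<^sup>2 / 2"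
 have D0: "0 \<le> D" using lam by (simp add: D_def)
 have "m * Ct * (u + \<xi>) \<le> D * (1 + m powr lam) + u\<^sup>2 / 2 + \<epsilon> * \<xi> powr \<beta>"
  if m: "0 \<le> m" and u: "0 \<le> u" and \<xi>: "0 \<le> \<xi>" for m u \<xi>
 proof -
  have "(m * Ct / \<delta>) * (\<delta> * \<xi>) \<le> (m * Ct / \<delta>) powr lam / lam + (\<delta> * \<xi>) powr \<beta> / \<beta>"
   using lam beta m Ct \<delta> \<xi> by (intro Youngs_inequality) auto
  moreover have "(\<delta> * \<xi>) powr \<beta> / \<beta> = \<epsilon> * \<xi> powr \<beta>" using \<delta> \<xi> beta by (simp add: powr_mult)
  moreover have "(m * Ct / \<delta>) powr lam = m powr lam * (Ct / \<delta>) powr lam"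
   using m Ct \<delta> powr_mult[of m "Ct / \<delta>" lam] by simp
  moreover have "(m * Ct / \<delta>) * (\<delta> * \<xi>) = m * Ct * \<xi>" using \<delta> by simp
  ultimately have 1: "m * Ct * \<xi> \<le> (Ct / \<delta>) powr lam / lam * m powr lam + \<epsilon> * \<xi> powr \<beta>" by (simp add: mult.commute)
  have 2: "m * Ct * u \<le> (Ct\<^sup>2 / 2) * m\<^sup>2 + u\<^sup>2 / 2"
   using sum_squares_bound[of "m * Ct" u] by (simp add: power_mult_distrib mult_ac)
  have m2: "m\<^sup>2 \<le> 1 + m powr lam"
  proof (cases "m \<le> 1")
   case True
   then have "m\<^sup>2 \<le> 1" using m by (simp add: power_le_one)
   moreover have "0 \<le> m powr lam" by simp
   ultimately show ?thesis by linarith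
  next
   case False
   then have "m powr 2 \<le> m powr lam" using lam by (intro powr_mono) auto
   then show ?thesis using False by (simp add: powr_numeral)
  qed
  have "(Ct\<^sup>2 / 2) * m\<^sup>2 \<le> (Ct\<^sup>2 / 2) * (1 + m powr lam)" using m2 by (intro mult_left_mono) auto
  moreover have "(Ct / \<delta>) powr lam / lam * m powr lam \<le> (Ct / \<delta>) powr lam / lam * (1 + m powr lam)"
   using lam by (intro mult_left_mono) auto
  ultimately show ?thesis using 1 2 by (simp add: D_def distrib_left distrib_right)
 qed
 then show ?thesis using D0 by blast
qed

end

section \<open>The energy estimates\<close>

lemma integrable_bounded:
 assumes "finite_measure N" "f \<in> borel_measurable N" "\<And>x. x \<in> space N ==> \<bar>f x\<bar> \<le> (B::real)"
 shows "integrable N f"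
 using finite_measure.integrable_const_bound[OF assms(1) _ assms(2), of B] assms(3) by (auto intro: AE_I2)

text \<open>\<open>M\<close> and \<open>S\<close> stand for Lebesgue measure on the domain and for surface measure on its boundary;
 \<open>U a\<close> and \<open>G a\<close> are the discrete function with coefficients \<open>a\<close> and its gradient.\<close>

locale discrete_space = power_law_flux K \<beta> c1 c2
 for K \<beta> c1 c2 +
 fixes M S :: "'b measure" and J :: "'j set" and e :: "'j \<Rightarrow> 'b \<Rightarrow> real" and w :: "'j \<Rightarrow> 'b \<Rightarrow> 'v::euclidean_space"
  and \<phi> :: "'b \<Rightarrow> real" and \<phi>lo \<phi>hi Ct D T Be :: real
 assumes finM: "finite_measure M" and finS: "finite_measure S" and finJ: "finite J"
  and e_meas: "\<And>j. j \<in> J ==> e j \<in> borel_measurable M"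
  and e_measS: "\<And>j. j \<in> J ==> e j \<in> borel_measurable S"
  and w_meas: "\<And>j. j \<in> J ==> w j \<in> borel_measurable M"
  and e_bound: "\<And>j x. j \<in> J ==> x \<in> space M ==> \<bar>e j x\<bar> \<le> Be"
  and e_boundS: "\<And>j x. j \<in> J ==> x \<in> space S ==> \<bar>e j x\<bar> \<le> Be"
  and w_bound: "\<And>j x. j \<in> J ==> x \<in> space M ==> norm (w j x) \<le> Be"
  and \<phi>_meas: "\<phi> \<in> borel_measurable M" and \<phi>lo: "0 < \<phi>lo"
  and \<phi>_bounds: "\<And>x. x \<in> space M ==> \<phi>lo \<le> \<phi> x \<and> \<phi> x \<le> \<phi>hi"
  and \<phi>lohi: "\<phi>lo \<le> \<phi>hi"
  and Ct: "0 \<le> Ct" and T: "0 < T" and D: "0 \<le> D" and Be: "0 \<le> Be"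
  and boundary_young': "\<And>m u \<xi>. 0 \<le> m ==> 0 \<le> u ==> 0 \<le> \<xi> ==>
   m * Ct * (u + \<xi>) \<le> D * (1 + m powr (\<beta> / (\<beta> - 1))) + u\<^sup>2 / 2 + (c1 * 2 powr (- \<beta>) / 2) * \<xi> powr \<beta>"
  and trace: "\<And>a. (\<integral>x. \<bar>\<Sum>j\<in>J. a j * e j x\<bar> \<partial>S)
   \<le> Ct * (\<integral>x. \<bar>\<Sum>j\<in>J. a j * e j x\<bar> + norm (\<Sum>j\<in>J. a j *\<^sub>R w j x) \<partial>M)"
begin

abbreviation "I \<equiv> {0<..<T}"
definition U :: "('j \<Rightarrow> real) \<Rightarrow> 'b \<Rightarrow> real" where "U a x = (\<Sum>j\<in>J. a j * e j x)"
definition G :: "('j \<Rightarrow> real) \<Rightarrow> 'b \<Rightarrow> 'v" where "G a x = (\<Sum>j\<in>J. a j *\<^sub>R w j x)"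
definition sz :: "('j \<Rightarrow> real) \<Rightarrow> real" where "sz a = (\<Sum>j\<in>J. \<bar>a j\<bar>)"
definition \<mu> :: real where "\<mu> = measure M (space M)"
definition ch :: real where "ch = c1 * 2 powr (- \<beta>)"

lemma U_measurable: "U a \<in> borel_measurable M" "U a \<in> borel_measurable S"
proof -
 show "U a \<in> borel_measurable M" unfolding U_def[abs_def]
  by (intro borel_measurable_sum borel_measurable_times borel_measurable_const e_meas)
 show "U a \<in> borel_measurable S" unfolding U_def[abs_def]
  by (intro borel_measurable_sum borel_measurable_times borel_measurable_const e_measS)
qed

lemma G_measurable: "G a \<in> borel_measurable M"
 unfolding G_def[abs_def] by (intro borel_measurable_sum borel_measurable_scaleR borel_measurable_const w_meas)

lemma sz_nonneg: "0 \<le> sz a" by (auto simp: sz_def intro: sum_nonneg)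

lemma U_bound: "x \<in> space M ==> \<bar>U a x\<bar> \<le> sz a * Be" "x \<in> space S ==> \<bar>U a x\<bar> \<le> sz a * Be"
proof -
 have "\<bar>U a x\<bar> \<le> sz a * Be" if "\<And>j. j \<in> J ==> \<bar>e j x\<bar> \<le> Be"
 proof -
  have "\<bar>U a x\<bar> \<le> (\<Sum>j\<in>J. \<bar>a j * e j x\<bar>)" unfolding U_def by (rule sum_abs)
  also have "\<dots> \<le> (\<Sum>j\<in>J. \<bar>a j\<bar> * Be)" unfolding abs_mult using that by (intro sum_mono mult_left_mono) auto
  finally show ?thesis by (simp add: sz_def sum_distrib_right)
 qed
 then show "x \<in> space M ==> \<bar>U a x\<bar> \<le> sz a * Be" "x \<in> space S ==> \<bar>U a x\<bar> \<le> sz a * Be"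
  using e_bound e_boundS by blast+
qed

lemma G_bound: "x \<in> space M ==> norm (G a x) \<le> sz a * Be"
proof -
 assume x: "x \<in> space M"
 have "norm (G a x) \<le> (\<Sum>j\<in>J. norm (a j *\<^sub>R w j x))" unfolding G_def by (rule norm_sum)
 also have "\<dots> \<le> (\<Sum>j\<in>J. \<bar>a j\<bar> * Be)" unfolding norm_scaleR using w_bound x by (intro sum_mono mult_left_mono) auto
 finally show ?thesis by (simp add: sz_def sum_distrib_right)
qed

lemma U_diff: "U a x - U b x = U (\<lambda>j. a j - b j) x" and G_diff: "G a x - G b x = G (\<lambda>j. a j - b j) x"
 by (simp_all add: U_def G_def sum_subtractf left_diff_distrib scaleR_diff_left)

lemma functional_bounded:
 assumes F: "continuous_on UNIV (F :: real \<times> 'v \<Rightarrow> real)" and "0 \<le> r"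
 shows "\<exists>B\<ge>0. \<forall>a x. x \<in> space M \<longrightarrow> sz a \<le> r \<longrightarrow> \<bar>F (U a x, G a x)\<bar> \<le> B"
proof -
 let ?C = "cball (0::real) (r * Be) \<times> cball (0::'v) (r * Be)"
 have "compact (F ` ?C)"
  by (intro compact_continuous_image continuous_on_subset[OF F] compact_Times compact_cball) simp
 then obtain B where B: "0 < B" "\<forall>y\<in>F ` ?C. norm y \<le> B" using compact_imp_bounded bounded_pos by metis
 have "\<bar>F (U a x, G a x)\<bar> \<le> B" if x: "x \<in> space M" and a: "sz a \<le> r" for a x
 proof -
  have "sz a * Be \<le> r * Be" using a Be by (intro mult_right_mono) auto
  then have "(U a x, G a x) \<in> ?C" using U_bound(1)[OF x, of a] G_bound[OF x, of a] by auto
  then show ?thesis using B(2) by (metis image_eqI real_norm_def)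
 qed
 then show ?thesis using B(1) less_imp_le by blast
qed

lemma functional_measurable:
 assumes F: "continuous_on UNIV (F :: real \<times> 'v \<Rightarrow> real)"
 shows "(\<lambda>x. F (U a x, G a x)) \<in> borel_measurable M"
 by (intro measurable_compose[OF borel_measurable_Pair[OF U_measurable(1) G_measurable] borel_measurable_continuous_onI[OF F]])

lemma functional_integrable:
 assumes F: "continuous_on UNIV (F :: real \<times> 'v \<Rightarrow> real)"
 shows "integrable M (\<lambda>x. F (U a x, G a x))" and "integrable M (\<lambda>x. \<phi> x * F (U a x, G a x))"
proof -
 obtain B where B: "0 \<le> B" "\<And>x. x \<in> space M ==> \<bar>F (U a x, G a x)\<bar> \<le> B"
  using functional_bounded[OF F sz_nonneg[of a]] by blast
 show "integrable M (\<lambda>x. F (U a x, G a x))"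
  using B(2) by (rule integrable_bounded[OF finM functional_measurable[OF F]])
 show "integrable M (\<lambda>x. \<phi> x * F (U a x, G a x))"
 proof (rule integrable_bounded[OF finM])
  show "(\<lambda>x. \<phi> x * F (U a x, G a x)) \<in> borel_measurable M"
   by (intro borel_measurable_times \<phi>_meas functional_measurable[OF F])
  show "\<bar>\<phi> x * F (U a x, G a x)\<bar> \<le> \<phi>hi * B" if "x \<in> space M" for x
   unfolding abs_mult using B that \<phi>_bounds[OF that] \<phi>lo by (intro mult_mono) auto
 qed
qed

lemma powr_norm_continuous: "continuous_on UNIV (\<lambda>z :: real \<times> 'v. norm (snd z) powr \<beta>)"
 using beta by (intro continuous_on_powr' continuous_intros) auto

lemma U2_integrable: "integrable M (\<lambda>x. (U a x)\<^sup>2)" "integrable M (\<lambda>x. \<phi> x * (U a x)\<^sup>2)"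
 and GB_integrable: "integrable M (\<lambda>x. norm (G a x) powr \<beta>)"
proof -
 have F: "continuous_on UNIV (\<lambda>z :: real \<times> 'v. (fst z)\<^sup>2)" by (intro continuous_intros)
 show "integrable M (\<lambda>x. (U a x)\<^sup>2)" "integrable M (\<lambda>x. \<phi> x * (U a x)\<^sup>2)"
  "integrable M (\<lambda>x. norm (G a x) powr \<beta>)"
  using functional_integrable[OF F, of a] functional_integrable(1)[OF powr_norm_continuous, of a] by simp_all
qed

lemma U_abs_integrable: "integrable M (\<lambda>x. \<bar>U a x\<bar> + norm (G a x))"
proof -
 have F: "continuous_on UNIV (\<lambda>z :: real \<times> 'v. \<bar>fst z\<bar> + norm (snd z))" by (intro continuous_intros)
 show ?thesis using functional_integrable(1)[OF F, of a] by simp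
qed

lemma energy_continuous: "continuous_on UNIV (\<lambda>z :: real \<times> 'v. energy (norm (snd z)))"
proof -
 have "continuous_on UNIV (\<lambda>y :: 'v. energy (norm y))"
  using energy_norm_has_derivative has_derivative_continuous
  by (blast intro: continuous_at_imp_continuous_on)
 then show ?thesis by (rule continuous_on_compose2[OF _ continuous_on_snd[OF continuous_on_id]]) auto
qed

lemma energy_integrable: "integrable M (\<lambda>x. energy (norm (G a x)))"
 using functional_integrable(1)[OF energy_continuous, of a] by simp

lemma flux_inner_continuous: "continuous_on UNIV (\<lambda>y :: 'v. K (norm y))"
 by (intro continuous_on_compose2[OF K_cont] continuous_intros) auto

lemma KG_bounded_integrable: "integrable M (\<lambda>x. K (norm (G a x)) * (G a x \<bullet> G b x))"
proof (rule integrable_bounded[OF finM])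
 show "(\<lambda>x. K (norm (G a x)) * (G a x \<bullet> G b x)) \<in> borel_measurable M"
  by (intro borel_measurable_times borel_measurable_inner G_measurable
    measurable_compose[OF G_measurable borel_measurable_continuous_onI[OF flux_inner_continuous]])
 fix x assume x: "x \<in> space M"
 have "\<bar>K (norm (G a x)) * (G a x \<bullet> G b x)\<bar> \<le> K (norm (G a x)) * (norm (G a x) * norm (G b x))"
  unfolding abs_mult using K_nonneg[of "norm (G a x)"] Cauchy_Schwarz_ineq2[of "G a x" "G b x"]
  by (auto intro!: mult_left_mono)
 also have "\<dots> = (K (norm (G a x)) * norm (G a x)) * norm (G b x)" by simp
 also have "\<dots> \<le> (K (sz a * Be) * (sz a * Be)) * (sz b * Be)"
  using flux_mono[of "norm (G a x)" "sz a * Be"] G_bound[OF x, of a] G_bound[OF x, of b] K_nonneg[of "norm (G a x)"]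
   K_nonneg[of "sz a * Be"] sz_nonneg[of a] Be
  by (intro mult_mono[where a = "K (norm (G a x)) * norm (G a x)"]) auto
 finally show "\<bar>K (norm (G a x)) * (G a x \<bullet> G b x)\<bar> \<le> (K (sz a * Be) * (sz a * Be)) * (sz b * Be)" .
qed

lemma \<mu>_nonneg: "0 \<le> \<mu>" by (simp add: \<mu>_def)

lemma integral_const_\<mu>: "(\<integral>x. c \<partial>M) = \<mu> * (c::real)" and integrable_const_M: "integrable M (\<lambda>x. c::real)"
 using finite_measure.integrable_const[OF finM] by (auto simp: \<mu>_def)

lemma ch: "0 < ch" "ch \<le> c1"
proof -
 have "2 powr (- \<beta>) \<le> (2::real) powr 0" using beta by (intro powr_mono) auto
 then show "ch \<le> c1" using c1_pos by (simp add: ch_def mult_le_cancel_left1)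
qed (use c1_pos in \<open>simp add: ch_def\<close>)

lemma boundary_term:
 assumes m: "0 \<le> m" and h: "AE x in S. \<bar>h x\<bar> \<le> m"
 shows "\<bar>\<integral>x. h x * U a x \<partial>S\<bar> \<le> D * (1 + m powr lam) * \<mu> + (\<integral>x. (U a x)\<^sup>2 \<partial>M) / 2 + ch / 2 * (\<integral>x. norm (G a x) powr \<beta> \<partial>M)"
proof -
 have iU: "integrable S (\<lambda>x. m * \<bar>U a x\<bar>)"
  using integrable_bounded[OF finS U_measurable(2) U_bound(2)] by auto
 have "\<bar>\<integral>x. h x * U a x \<partial>S\<bar> \<le> (\<integral>x. m * \<bar>U a x\<bar> \<partial>S)"
 proof (cases "integrable S (\<lambda>x. h x * U a x)")
  case True
  have "\<bar>\<integral>x. h x * U a x \<partial>S\<bar> \<le> (\<integral>x. \<bar>h x * U a x\<bar> \<partial>S)" by (rule integral_abs_bound)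
  also have "\<dots> \<le> (\<integral>x. m * \<bar>U a x\<bar> \<partial>S)"
  proof (rule integral_mono_AE)
   show "AE x in S. \<bar>h x * U a x\<bar> \<le> m * \<bar>U a x\<bar>"
    using h by eventually_elim (simp add: abs_mult mult_right_mono)
  qed (use True iU in auto)
  finally show ?thesis .
 next
  case False
  then show ?thesis using m by (simp add: not_integrable_integral_eq)
 qed
 also have "\<dots> = m * (\<integral>x. \<bar>U a x\<bar> \<partial>S)" by simp
 also have "\<dots> \<le> m * (Ct * (\<integral>x. \<bar>U a x\<bar> + norm (G a x) \<partial>M))"
  using trace[of a] m by (intro mult_left_mono) (auto simp: U_def G_def)
 also have "\<dots> = (\<integral>x. m * Ct * (\<bar>U a x\<bar> + norm (G a x)) \<partial>M)" by simp
 also have "\<dots> \<le> (\<integral>x. D * (1 + m powr lam) + (U a x)\<^sup>2 / 2 + ch / 2 * norm (G a x) powr \<beta> \<partial>M)"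
 proof (rule integral_mono)
  show "integrable M (\<lambda>x. D * (1 + m powr lam) + (U a x)\<^sup>2 / 2 + ch / 2 * norm (G a x) powr \<beta>)"
   using integrable_const_M U2_integrable(1)[of a] GB_integrable[of a] by auto
  show "integrable M (\<lambda>x. m * Ct * (\<bar>U a x\<bar> + norm (G a x)))" using U_abs_integrable[of a] by auto
  show "m * Ct * (\<bar>U a x\<bar> + norm (G a x)) \<le> D * (1 + m powr lam) + (U a x)\<^sup>2 / 2 + ch / 2 * norm (G a x) powr \<beta>" for x
   using boundary_young'[OF m, of "\<bar>U a x\<bar>" "norm (G a x)"] by (simp add: ch_def lam_def)
 qed
 also have "\<dots> = D * (1 + m powr lam) * \<mu> + (\<integral>x. (U a x)\<^sup>2 \<partial>M) / 2 + ch / 2 * (\<integral>x. norm (G a x) powr \<beta> \<partial>M)"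
  using integrable_const_M U2_integrable(1)[of a] GB_integrable[of a] by (simp add: integral_const_\<mu>[unfolded \<mu>_def] \<mu>_def)
 finally show ?thesis .
qed

definition X :: "real \<Rightarrow> real \<Rightarrow> real \<Rightarrow> real" where "X R0 m Fb = R0 + 1 + m powr lam + Fb"

definition A1 :: real where
 "A1 = exp (2 / \<phi>lo * T) * (\<phi>hi / 2 + (c2 * \<mu> + D * \<mu>) * T + 1)"

definition A2 :: real where
 "A2 = 2 * \<phi>lo * ((c2 + ch / 2) + D * \<mu> + 1 / 2 + (D * \<mu> + A1 / \<phi>lo) * T + c2 * \<mu> + D * \<mu> + A1 / \<phi>lo)
   + 2 * \<phi>lo * ch * A1 / c1 + 1"

lemma A1_nonneg: "0 \<le> A1"
 unfolding A1_def using \<phi>lo \<phi>lohi c2_pos D T \<mu>_nonneg by (intro mult_nonneg_nonneg add_nonneg_nonneg) auto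

end

locale discrete_solution = discrete_space K \<beta> c1 c2 M S J e w \<phi> \<phi>lo \<phi>hi Ct D T Be
 for K \<beta> c1 c2 and M S :: "'b measure" and J :: "'j set" and e and w :: "'j \<Rightarrow> 'b \<Rightarrow> 'v::euclidean_space"
  and \<phi> \<phi>lo \<phi>hi Ct D T Be +
 fixes c c' :: "real \<Rightarrow> 'j \<Rightarrow> real" and \<psi> f :: "real \<Rightarrow> 'b \<Rightarrow> real" and m Fb :: real
 assumes c_cont: "\<And>j. j \<in> J ==> continuous_on {0..<T} (\<lambda>t. c t j)"
  and c_der: "\<And>j t. j \<in> J ==> t \<in> {0<..<T} ==> ((\<lambda>t. c t j) has_real_derivative c' t j) (at t)"
  and m: "0 \<le> m" and \<psi>_bound: "AE x in S. \<forall>t\<in>{0..<T}. \<bar>\<psi> t x\<bar> \<le> m"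
  and \<psi>_meas: "\<And>t. t \<in> {0..<T} ==> \<psi> t \<in> borel_measurable S"
  and \<psi>_cont: "AE x in S. continuous_on {0..<T} (\<lambda>t. \<psi> t x)"
  and f_meas: "\<And>t. t \<in> {0<..<T} ==> f t \<in> borel_measurable M"
  and f_int: "\<And>t. t \<in> {0<..<T} ==> integrable M (\<lambda>x. (f t x)\<^sup>2)"
  and Fb: "(\<integral>\<^sup>+t. ennreal (\<integral>x. (f t x)\<^sup>2 \<partial>M) \<partial>lebesgue_on {0<..<T}) \<le> ennreal Fb" "0 \<le> Fb"
  and equation: "\<And>t a. t \<in> {0<..<T} ==>
    (\<integral>x. \<phi> x * U (c' t) x * U a x \<partial>M) + (\<integral>x. K (norm (G (c t) x)) * (G (c t) x \<bullet> G a x) \<partial>M)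
     = (\<integral>x. f t x * U a x \<partial>M) - (\<integral>x. \<psi> t x * U a x \<partial>S)"
begin

lemma local_bound:
 assumes t: "t \<in> {0..<T}"
 shows "\<exists>d>0. \<exists>r\<ge>0. \<forall>s\<in>{0..<T}. \<bar>s - t\<bar> < d \<longrightarrow> sz (c s) \<le> r"
proof -
 have "continuous_on {0..<T} (\<lambda>s. sz (c s))"
  unfolding sz_def using c_cont by (intro continuous_intros)
 then obtain d where d: "0 < d" "\<forall>s\<in>{0..<T}. dist s t < d \<longrightarrow> dist (sz (c s)) (sz (c t)) < 1"
  using t unfolding continuous_on_iff by (metis zero_less_one)
 have "sz (c s) \<le> sz (c t) + 1" if "s \<in> {0..<T}" "\<bar>s - t\<bar> < d" for s
  using d(2) that by (fastforce simp: dist_real_def)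
 then show ?thesis using d(1) sz_nonneg[of "c t"] by (intro exI[of _ d] conjI exI[of _ "sz (c t) + 1"]) auto
qed

lemma local_lipschitz:
 assumes t: "t \<in> I"
 shows "\<exists>d>0. \<exists>r\<ge>0. \<forall>s. \<bar>s - t\<bar> < d \<longrightarrow> s \<in> I \<and> sz (c s) \<le> r \<and> sz (\<lambda>j. c s j - c t j) \<le> r * \<bar>s - t\<bar>"
proof -
 obtain d1 r1 where 1: "0 < d1" "0 \<le> r1" "\<And>s. s \<in> {0..<T} ==> \<bar>s - t\<bar> < d1 ==> sz (c s) \<le> r1"
  using local_bound[of t] t by auto
 have "\<forall>\<^sub>F s in at t. \<forall>j\<in>J. \<bar>c s j - c t j\<bar> \<le> (\<bar>c' t j\<bar> + 1) * \<bar>s - t\<bar>"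
 proof (intro eventually_ball_finite finJ ballI)
  fix j assume "j \<in> J"
  then have "((\<lambda>s. (c s j - c t j) / (s - t)) \<longlongrightarrow> c' t j) (at t)"
   using c_der t by (simp add: has_field_derivative_iff)
  then have "\<forall>\<^sub>F s in at t. dist ((c s j - c t j) / (s - t)) (c' t j) < 1" by (rule tendstoD) simp
  then show "\<forall>\<^sub>F s in at t. \<bar>c s j - c t j\<bar> \<le> (\<bar>c' t j\<bar> + 1) * \<bar>s - t\<bar>"
   using eventually_neq_at_within[of t]
  proof eventually_elim
   case (elim s)
   then have "\<bar>(c s j - c t j) / (s - t)\<bar> \<le> \<bar>c' t j\<bar> + 1" unfolding dist_real_def by linarith
   then show ?case using elim(2) by (simp only: abs_divide) (simp add: pos_divide_le_eq)
  qed
 qed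
 then obtain d2 where 2: "0 < d2" "\<And>s j. s \<noteq> t ==> dist s t < d2 ==> j \<in> J ==> \<bar>c s j - c t j\<bar> \<le> (\<bar>c' t j\<bar> + 1) * \<bar>s - t\<bar>"
  unfolding eventually_at by auto
 define r2 where "r2 = (\<Sum>j\<in>J. \<bar>c' t j\<bar> + 1)"
 have r2: "0 \<le> r2" by (auto simp: r2_def intro: sum_nonneg)
 define d where "d = min (min d1 d2) (min t (T - t))"
 have "s \<in> I \<and> sz (c s) \<le> max r1 r2 \<and> sz (\<lambda>j. c s j - c t j) \<le> max r1 r2 * \<bar>s - t\<bar>" if s: "\<bar>s - t\<bar> < d" for s
 proof -
  have sT: "s \<in> I" using s by (auto simp: d_def)
  moreover have "sz (c s) \<le> r1" using 1(3)[of s] sT s by (simp add: d_def)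
  moreover have "sz (\<lambda>j. c s j - c t j) \<le> r2 * \<bar>s - t\<bar>"
  proof (cases "s = t")
   case False
   then have "sz (\<lambda>j. c s j - c t j) \<le> (\<Sum>j\<in>J. (\<bar>c' t j\<bar> + 1) * \<bar>s - t\<bar>)"
    unfolding sz_def using 2(2) s by (intro sum_mono) (auto simp: d_def dist_real_def)
   then show ?thesis by (simp add: r2_def sum_distrib_right)
  qed (simp add: sz_def)
  moreover have "r2 * \<bar>s - t\<bar> \<le> max r1 r2 * \<bar>s - t\<bar>" by (intro mult_right_mono) auto
  ultimately show ?thesis by (auto intro: order_trans)
 qed
 moreover have "0 < d" using 1 2 t by (auto simp: d_def)
 moreover have "0 \<le> max r1 r2" using r2 by simp
 ultimately show ?thesis by blast
qed

lemma U_continuous: "continuous_on {0..<T} (\<lambda>t. U (c t) x)" and G_continuous: "continuous_on {0..<T} (\<lambda>t. G (c t) x)"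
 unfolding U_def G_def using c_cont by (auto intro!: continuous_intros)

lemma U_derivative: "t \<in> I ==> ((\<lambda>s. U (c s) x) has_real_derivative U (c' t) x) (at t)"
 unfolding U_def using c_der by (auto intro!: derivative_eq_intros sum.cong)

lemma G_derivative: "t \<in> I ==> ((\<lambda>s. G (c s) x) has_vector_derivative G (c' t) x) (at t)"
 unfolding G_def using c_der
 by (intro has_vector_derivative_sum) (auto intro!: derivative_eq_intros)

lemma functional_continuous:
 assumes F: "continuous_on UNIV (F :: real \<times> 'v \<Rightarrow> real)"
 shows "continuous_on {0..<T} (\<lambda>t. \<integral>x. F (U (c t) x, G (c t) x) \<partial>M)"
  and "continuous_on {0..<T} (\<lambda>t. \<integral>x. \<phi> x * F (U (c t) x, G (c t) x) \<partial>M)"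
proof -
 have *: "continuous (at t within {0..<T}) (\<lambda>t. \<integral>x. \<eta> x * F (U (c t) x, G (c t) x) \<partial>M)"
  if t: "t \<in> {0..<T}" and \<eta>: "\<eta> \<in> borel_measurable M" "\<And>x. x \<in> space M ==> \<bar>\<eta> x\<bar> \<le> h" "0 \<le> h" for t \<eta> h
 proof -
  obtain d r where d: "0 < d" "0 \<le> r" "\<And>s. s \<in> {0..<T} ==> \<bar>s - t\<bar> < d ==> sz (c s) \<le> r"
   using local_bound[OF t] by blast
  obtain B where B: "0 \<le> B" "\<And>a x. x \<in> space M ==> sz a \<le> r ==> \<bar>F (U a x, G a x)\<bar> \<le> B"
   using functional_bounded[OF F d(2)] by blast
  show ?thesis
  proof (rule continuous_param_integral[OF finM t d(1)])
   show "(\<lambda>x. \<eta> x * F (U (c s) x, G (c s) x)) \<in> borel_measurable M" for s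
    by (intro borel_measurable_times \<eta>(1) functional_measurable[OF F])
   show "AE x in M. \<bar>\<eta> x * F (U (c s) x, G (c s) x)\<bar> \<le> h * B" if "s \<in> {0..<T}" "\<bar>s - t\<bar> < d" for s
    unfolding abs_mult using B d(3)[OF that] \<eta> by (intro AE_I2 mult_mono) auto
   show "AE x in M. continuous (at t within {0..<T}) (\<lambda>s. \<eta> x * F (U (c s) x, G (c s) x))"
   proof (rule AE_I2)
    fix x
    have "continuous_on {0..<T} (\<lambda>s. F (U (c s) x, G (c s) x))"
     by (rule continuous_on_compose2[OF F]) (auto intro!: continuous_on_Pair U_continuous G_continuous)
    then have "continuous_on {0..<T} (\<lambda>s. \<eta> x * F (U (c s) x, G (c s) x))" by (intro continuous_intros)
    then show "continuous (at t within {0..<T}) (\<lambda>s. \<eta> x * F (U (c s) x, G (c s) x))"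
     using t by (simp add: continuous_on_eq_continuous_within)
   qed
  qed
 qed
 show "continuous_on {0..<T} (\<lambda>t. \<integral>x. \<phi> x * F (U (c t) x, G (c t) x) \<partial>M)"
  unfolding continuous_on_eq_continuous_within
  using *[OF _ \<phi>_meas, of _ \<phi>hi] \<phi>_bounds \<phi>lo \<phi>lohi by (auto simp: abs_le_iff) (smt (verit))+
 show "continuous_on {0..<T} (\<lambda>t. \<integral>x. F (U (c t) x, G (c t) x) \<partial>M)"
  unfolding continuous_on_eq_continuous_within
  using *[of _ "\<lambda>_. 1" 1] by auto
qed

definition u2 :: "real \<Rightarrow> real" where "u2 t = (\<integral>x. (U (c t) x)\<^sup>2 \<partial>M)"
definition gB :: "real \<Rightarrow> real" where "gB t = (\<integral>x. norm (G (c t) x) powr \<beta> \<partial>M)"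
definition E1 :: "real \<Rightarrow> real" where "E1 t = (\<integral>x. \<phi> x * (U (c t) x)\<^sup>2 \<partial>M) / 2"
definition F2 :: "real \<Rightarrow> real" where "F2 t = (\<integral>x. (f t x)\<^sup>2 \<partial>M)"

lemma u2_nonneg: "0 \<le> u2 t" and gB_nonneg: "0 \<le> gB t" and F2_nonneg: "0 \<le> F2 t"
 by (auto simp: u2_def gB_def F2_def)

lemma E1_bounds: "\<phi>lo / 2 * u2 t \<le> E1 t" "E1 t \<le> \<phi>hi / 2 * u2 t"
proof -
 have "(\<integral>x. \<phi>lo * (U (c t) x)\<^sup>2 \<partial>M) \<le> (\<integral>x. \<phi> x * (U (c t) x)\<^sup>2 \<partial>M)"
  using U2_integrable[of "c t"] \<phi>_bounds by (intro integral_mono mult_right_mono) auto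
 then show "\<phi>lo / 2 * u2 t \<le> E1 t" by (simp add: E1_def u2_def)
 have "(\<integral>x. \<phi> x * (U (c t) x)\<^sup>2 \<partial>M) \<le> (\<integral>x. \<phi>hi * (U (c t) x)\<^sup>2 \<partial>M)"
  using U2_integrable[of "c t"] \<phi>_bounds by (intro integral_mono mult_right_mono) auto
 then show "E1 t \<le> \<phi>hi / 2 * u2 t" by (simp add: E1_def u2_def)
qed

lemma E1_continuous: "continuous_on {0..<T} E1" and gB_continuous: "continuous_on {0..<T} gB"
 and u2_continuous: "continuous_on {0..<T} u2"
proof -
 have F: "continuous_on UNIV (\<lambda>z :: real \<times> 'v. (fst z)\<^sup>2)" by (intro continuous_intros)
 show "continuous_on {0..<T} E1" "continuous_on {0..<T} u2"
  unfolding E1_def[abs_def] u2_def[abs_def] using functional_continuous[OF F] by (auto intro!: continuous_intros)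
 show "continuous_on {0..<T} gB"
  unfolding gB_def[abs_def] using functional_continuous(1)[OF powr_norm_continuous] by simp
qed

lemma f_term:
 assumes t: "t \<in> I" and \<epsilon>: "0 < \<epsilon>"
 shows "\<bar>\<integral>x. f t x * U a x \<partial>M\<bar> \<le> F2 t / (2 * \<epsilon>) + \<epsilon> / 2 * (\<integral>x. (U a x)\<^sup>2 \<partial>M)"
proof -
 have i: "integrable M (\<lambda>x. (f t x)\<^sup>2 / (2 * \<epsilon>) + \<epsilon> / 2 * (U a x)\<^sup>2)"
  using f_int[OF t] U2_integrable(1)[of a] by auto
 have "\<bar>\<integral>x. f t x * U a x \<partial>M\<bar> \<le> (\<integral>x. \<bar>f t x * U a x\<bar> \<partial>M)" by (rule integral_abs_bound)
 also have "\<dots> \<le> (\<integral>x. (f t x)\<^sup>2 / (2 * \<epsilon>) + \<epsilon> / 2 * (U a x)\<^sup>2 \<partial>M)"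
 proof (rule integral_mono')
  fix x
  have "0 \<le> (\<bar>f t x\<bar> - \<epsilon> * \<bar>U a x\<bar>)\<^sup>2 / (2 * \<epsilon>)" using \<epsilon> by simp
  also have "\<dots> = (f t x)\<^sup>2 / (2 * \<epsilon>) + \<epsilon> / 2 * (U a x)\<^sup>2 - \<bar>f t x * U a x\<bar>"
   using \<epsilon> by (simp add: power2_diff power_mult_distrib abs_mult field_simps power2_eq_square)
  finally show "\<bar>f t x * U a x\<bar> \<le> (f t x)\<^sup>2 / (2 * \<epsilon>) + \<epsilon> / 2 * (U a x)\<^sup>2" by simp
  then show "0 \<le> (f t x)\<^sup>2 / (2 * \<epsilon>) + \<epsilon> / 2 * (U a x)\<^sup>2" by (rule order_trans[OF abs_ge_zero])
 qed (rule i)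
 also have "\<dots> = F2 t / (2 * \<epsilon>) + \<epsilon> / 2 * (\<integral>x. (U a x)\<^sup>2 \<partial>M)"
  unfolding F2_def using f_int[OF t] U2_integrable(1)[of a]
  by (subst Bochner_Integration.integral_add) auto
 finally show ?thesis .
qed

lemma \<psi>_bound_at: "t \<in> {0..<T} ==> AE x in S. \<bar>\<psi> t x\<bar> \<le> m"
 using \<psi>_bound by eventually_elim auto

lemma E1_derivative:
 assumes t: "t \<in> I"
 shows "(E1 has_real_derivative (\<integral>x. \<phi> x * U (c' t) x * U (c t) x \<partial>M)) (at t)"
proof -
 obtain d r where d: "0 < d" "0 \<le> r" and
  dr: "\<And>s. \<bar>s - t\<bar> < d ==> s \<in> I \<and> sz (c s) \<le> r \<and> sz (\<lambda>j. c s j - c t j) \<le> r * \<bar>s - t\<bar>"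
  using local_lipschitz[OF t] by blast
 have "((\<lambda>s. \<integral>x. \<phi> x * (U (c s) x)\<^sup>2 \<partial>M) has_real_derivative (\<integral>x. 2 * (\<phi> x * U (c' t) x * U (c t) x) \<partial>M)) (at t)"
 proof (rule has_derivative_param_integral[OF finM d(1)])
  show "integrable M (\<lambda>x. \<phi> x * (U (c s) x)\<^sup>2)" for s by (rule U2_integrable)
  show "AE x in M. ((\<lambda>s. \<phi> x * (U (c s) x)\<^sup>2) has_real_derivative 2 * (\<phi> x * U (c' t) x * U (c t) x)) (at t)"
   using U_derivative[OF t] by (intro AE_I2) (auto intro!: derivative_eq_intros)
  show "(\<lambda>x. 2 * (\<phi> x * U (c' t) x * U (c t) x)) \<in> borel_measurable M"
   by (intro borel_measurable_times borel_measurable_const \<phi>_meas U_measurable)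
  show "AE x in M. \<bar>\<phi> x * (U (c s) x)\<^sup>2 - \<phi> x * (U (c t) x)\<^sup>2\<bar> \<le> (\<phi>hi * (2 * r * Be * (r * Be))) * \<bar>s - t\<bar>"
   if s: "\<bar>s - t\<bar> < d" for s
  proof (rule AE_I2)
   fix x assume x: "x \<in> space M"
   have bd: "\<bar>U (c s) x\<bar> \<le> r * Be" "\<bar>U (c t) x\<bar> \<le> r * Be"
    using U_bound(1)[OF x, of "c s"] U_bound(1)[OF x, of "c t"] dr[OF s] dr[of t] d Be
    by (auto intro: order_trans mult_right_mono)
   have "\<bar>U (c s) x - U (c t) x\<bar> \<le> r * \<bar>s - t\<bar> * Be"
    unfolding U_diff using U_bound(1)[OF x, of "\<lambda>j. c s j - c t j"] dr[OF s] Be by (meson mult_right_mono order_trans)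
   moreover have "\<bar>U (c s) x + U (c t) x\<bar> \<le> 2 * r * Be" using bd by linarith
   ultimately have "\<bar>U (c s) x + U (c t) x\<bar> * \<bar>U (c s) x - U (c t) x\<bar> \<le> (2 * r * Be) * (r * \<bar>s - t\<bar> * Be)"
    using d Be by (intro mult_mono) auto
   moreover have "\<bar>\<phi> x * (U (c s) x)\<^sup>2 - \<phi> x * (U (c t) x)\<^sup>2\<bar> = \<phi> x * (\<bar>U (c s) x + U (c t) x\<bar> * \<bar>U (c s) x - U (c t) x\<bar>)"
    using \<phi>_bounds[OF x] \<phi>lo
    by (simp add: right_diff_distrib[symmetric] abs_mult[symmetric] power2_eq_square square_diff_square_factored[symmetric]) (simp add: abs_mult)
   moreover have "\<phi> x * (\<bar>U (c s) x + U (c t) x\<bar> * \<bar>U (c s) x - U (c t) x\<bar>)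
     \<le> \<phi>hi * (\<bar>U (c s) x + U (c t) x\<bar> * \<bar>U (c s) x - U (c t) x\<bar>)"
    using \<phi>_bounds[OF x] by (intro mult_right_mono) auto
   moreover have "\<phi>hi * (\<bar>U (c s) x + U (c t) x\<bar> * \<bar>U (c s) x - U (c t) x\<bar>) \<le> \<phi>hi * ((2 * r * Be) * (r * \<bar>s - t\<bar> * Be))"
    using calculation(1) \<phi>lo \<phi>lohi by (intro mult_left_mono) auto
   ultimately show "\<bar>\<phi> x * (U (c s) x)\<^sup>2 - \<phi> x * (U (c t) x)\<^sup>2\<bar> \<le> (\<phi>hi * (2 * r * Be * (r * Be))) * \<bar>s - t\<bar>"
    by (simp add: mult_ac)
  qed
 qed
 from DERIV_cdivide[OF this, of 2] show ?thesis unfolding E1_def[abs_def] by simp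
qed

lemma first_estimate:
 defines "R0 \<equiv> u2 0"
 shows "\<And>t. t \<in> I ==> u2 t \<le> 2 / \<phi>lo * A1 * X R0 m Fb"
  and "time_integral T gB \<le> ennreal (2 / c1 * A1 * X R0 m Fb)"
proof -
 define \<kappa> where "\<kappa> = 2 / \<phi>lo"
 define B where "B = c2 * \<mu> + D * (1 + m powr lam) * \<mu>"
 have \<kappa>: "0 \<le> \<kappa>" using \<phi>lo by (simp add: \<kappa>_def)
 have B: "0 \<le> B" using c2_pos D \<mu>_nonneg by (simp add: B_def)
 have R0: "0 \<le> R0" by (simp add: R0_def u2_nonneg)
 have gm: "gB \<in> Lmeas I"
  by (intro continuous_imp_measurable_on_sets_lebesgue continuous_on_subset[OF gB_continuous]) auto
 have ineq: "(\<integral>x. \<phi> x * U (c' t) x * U (c t) x \<partial>M) + c1 / 2 * gB t \<le> B + \<kappa> * E1 t + 0 + F2 t" if t: "t \<in> I" for t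
 proof -
  have "c1 * gB t - c2 * \<mu> = (\<integral>x. c1 * norm (G (c t) x) powr \<beta> - c2 \<partial>M)"
   using GB_integrable[of "c t"] integrable_const_M by (simp add: gB_def \<mu>_def mult.commute)
  also have "\<dots> \<le> (\<integral>x. K (norm (G (c t) x)) * (G (c t) x \<bullet> G (c t) x) \<partial>M)"
  proof (rule integral_mono)
   show "c1 * norm (G (c t) x) powr \<beta> - c2 \<le> K (norm (G (c t) x)) * (G (c t) x \<bullet> G (c t) x)" for x
    using flux_lower[of "norm (G (c t) x)"] by (simp add: power2_norm_eq_inner)
  qed (use GB_integrable[of "c t"] integrable_const_M KG_bounded_integrable in auto)
  finally have 1: "c1 * gB t - c2 * \<mu> \<le> (\<integral>x. K (norm (G (c t) x)) * (G (c t) x \<bullet> G (c t) x) \<partial>M)" .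
  have 2: "\<bar>\<integral>x. f t x * U (c t) x \<partial>M\<bar> \<le> F2 t / 2 + u2 t / 2" using f_term[OF t, of 1 "c t"] by (simp add: u2_def)
  have "AE x in S. \<bar>\<psi> t x\<bar> \<le> m" using \<psi>_bound_at[of t] t by auto
  from boundary_term[OF m this, of "c t"]
  have 3: "\<bar>\<integral>x. \<psi> t x * U (c t) x \<partial>S\<bar> \<le> D * (1 + m powr lam) * \<mu> + u2 t / 2 + ch / 2 * gB t"
   by (simp add: u2_def gB_def)
  have 4: "ch / 2 * gB t \<le> c1 / 2 * gB t" using ch gB_nonneg by (intro mult_right_mono) auto
  have 5: "u2 t \<le> \<kappa> * E1 t" using E1_bounds(1)[of t] \<phi>lo by (simp add: \<kappa>_def field_simps)
  show ?thesis using equation[OF t, of "c t"] 1 2 3 4 5 F2_nonneg[of t] unfolding B_def abs_le_iff by linarith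
 qed
 have pm: "(\<lambda>t. c1 / 2 * gB t) \<in> Lmeas I"
  using gm by (intro borel_measurable_times) auto
 have FbF2: "time_integral T F2 \<le> ennreal Fb" using Fb(1) by (simp add: F2_def)
 have E1_nonneg: "- 0 \<le> E1 t" for t
  using E1_bounds(1)[of t] mult_nonneg_nonneg[OF _ u2_nonneg[of t], of "\<phi>lo / 2"] \<phi>lo by simp
 have p0: "0 \<le> c1 / 2 * gB t" for t using c1_pos gB_nonneg[of t] by simp
 note gw = gronwall_integral[where p = "\<lambda>t. c1 / 2 * gB t" and q = "\<lambda>_. 0" and Qb = 0 and F = F2 and Fb = Fb and Lw = 0 and B = B,
   OF T \<kappa> B order_refl E1_continuous E1_derivative pm p0 _ _ _ _ F2_nonneg FbF2 Fb(2) ineq E1_nonneg]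
 define A0 where "A0 = \<phi>hi / 2 + (c2 * \<mu> + D * \<mu>) * T + 1"
 have X: "R0 \<le> X R0 m Fb" "1 + m powr lam \<le> X R0 m Fb" "Fb \<le> X R0 m Fb" "1 \<le> X R0 m Fb"
  using R0 Fb(2) by (auto simp: X_def)
 have bnd: "E1 0 + B * T + 0 + Fb \<le> A0 * X R0 m Fb"
 proof -
  have "E1 0 \<le> \<phi>hi / 2 * X R0 m Fb"
  proof -
   have "\<phi>hi / 2 * u2 0 \<le> \<phi>hi / 2 * X R0 m Fb"
    using X(1) \<phi>lo \<phi>lohi unfolding R0_def by (intro mult_left_mono) auto
   then show ?thesis using E1_bounds(2)[of 0] by linarith
  qed
  moreover have "B \<le> (c2 * \<mu> + D * \<mu>) * X R0 m Fb"
  proof -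
   have "c2 * \<mu> * 1 \<le> c2 * \<mu> * X R0 m Fb" using X(4) c2_pos \<mu>_nonneg by (intro mult_left_mono) auto
   moreover have "D * \<mu> * (1 + m powr lam) \<le> D * \<mu> * X R0 m Fb" using X(2) D \<mu>_nonneg by (intro mult_left_mono) auto
   ultimately show ?thesis by (simp add: B_def algebra_simps)
  qed
  then have "B * T \<le> (c2 * \<mu> + D * \<mu>) * X R0 m Fb * T" using T by (intro mult_right_mono) auto
  ultimately show ?thesis using X(3) by (simp add: A0_def algebra_simps)
 qed
 have A1: "A1 = exp (\<kappa> * T) * A0" by (simp add: A1_def A0_def \<kappa>_def)
 have A0X: "0 \<le> A0 * X R0 m Fb" using bnd E1_nonneg[of 0] B T Fb(2) by (intro order_trans[OF _ bnd]) auto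
 show "u2 t \<le> 2 / \<phi>lo * A1 * X R0 m Fb" if t: "t \<in> I" for t
 proof -
  have "exp (- \<kappa> * t) * E1 t \<le> E1 0 + B * T + 0 + Fb" by (rule gw(1)) (use t in auto)
  then have "exp (- \<kappa> * t) * E1 t \<le> A0 * X R0 m Fb" using bnd by linarith
  then have "exp (\<kappa> * t) * (exp (- \<kappa> * t) * E1 t) \<le> exp (\<kappa> * t) * (A0 * X R0 m Fb)" by (intro mult_left_mono) auto
  also have "\<dots> \<le> exp (\<kappa> * T) * (A0 * X R0 m Fb)" using t \<kappa> A0X by (intro mult_right_mono) (auto intro: mult_left_mono)
  finally have "E1 t \<le> A1 * X R0 m Fb" by (simp add: A1 exp_minus mult.assoc[symmetric])
  then have "\<phi>lo / 2 * u2 t \<le> A1 * X R0 m Fb" using E1_bounds(1)[of t] by linarith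
  then show ?thesis using \<phi>lo by (simp add: field_simps)
 qed
 have "(\<integral>\<^sup>+t. ennreal (c1 / 2 * gB t) \<partial>lebesgue_on I) \<le> ennreal (exp (\<kappa> * T) * (A0 * X R0 m Fb))"
  using gw(2) bnd by (auto elim!: order_trans intro!: ennreal_leI)
 moreover have "time_integral T gB
   = ennreal (2 / c1) * (\<integral>\<^sup>+t. ennreal (c1 / 2 * gB t) \<partial>lebesgue_on I)"
 proof -
  have "ennreal (gB t) = ennreal (2 / c1) * ennreal (c1 / 2 * gB t)" for t
   using c1_pos gB_nonneg[of t] by (subst ennreal_mult[symmetric]) auto
  then show ?thesis using pm by (simp only: nn_integral_cmult[OF measurable_compose[OF pm measurable_ennreal]])
 qed
 ultimately have "time_integral T gB \<le> ennreal (2 / c1) * ennreal (A1 * X R0 m Fb)"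
  by (simp add: A1 mult.assoc mult_left_mono)
 then show "time_integral T gB \<le> ennreal (2 / c1 * A1 * X R0 m Fb)"
  using c1_pos A0X by (simp add: A1 ennreal_mult[symmetric] mult.assoc)
qed

end

locale discrete_solution_smooth = discrete_solution K \<beta> c1 c2 M S J e w \<phi> \<phi>lo \<phi>hi Ct D T Be c c' \<psi> f m Fb
 for K \<beta> c1 c2 and M S :: "'b measure" and J :: "'j set" and e and w :: "'j \<Rightarrow> 'b \<Rightarrow> 'v::euclidean_space"
  and \<phi> \<phi>lo \<phi>hi Ct D T Be c c' \<psi> f m Fb +
 fixes \<psi>' :: "real \<Rightarrow> 'b \<Rightarrow> real" and m' :: real
 assumes m': "0 \<le> m'" and \<psi>'_bound: "AE x in S. \<forall>t\<in>{0<..<T}. \<bar>\<psi>' t x\<bar> \<le> m'"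
  and \<psi>'_meas: "\<And>t. t \<in> {0<..<T} ==> \<psi>' t \<in> borel_measurable S"
  and \<psi>_der: "AE x in S. \<forall>t\<in>{0<..<T}. ((\<lambda>s. \<psi> s x) has_real_derivative \<psi>' t x) (at t)"
begin

definition a2 :: "real \<Rightarrow> real" where "a2 t = (\<integral>x. (U (c' t) x)\<^sup>2 \<partial>M)"
definition E2 :: "real \<Rightarrow> real" where
 "E2 t = (\<integral>x. energy (norm (G (c t) x)) \<partial>M) + (\<integral>x. \<psi> t x * U (c t) x \<partial>S)"
definition Y :: real where "Y = X (u2 0) m Fb + gB 0 + m' powr lam"

lemma a2_nonneg: "0 \<le> a2 t" by (simp add: a2_def)

lemma a2_measurable: "a2 \<in> Lmeas I"
proof -
 have ee: "integrable M (\<lambda>x. e i x * e j x)" if "i \<in> J" "j \<in> J" for i j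
 proof (rule integrable_bounded[OF finM])
  show "\<bar>e i x * e j x\<bar> \<le> Be * Be" if "x \<in> space M" for x
   unfolding abs_mult using e_bound[OF \<open>i \<in> J\<close> that] e_bound[OF \<open>j \<in> J\<close> that] by (intro mult_mono) auto
 qed (use e_meas that in auto)
 have "a2 t = (\<Sum>i\<in>J. \<Sum>j\<in>J. c' t i * c' t j * (\<integral>x. e i x * e j x \<partial>M))" for t
 proof -
  have "(U (c' t) x)\<^sup>2 = (\<Sum>i\<in>J. \<Sum>j\<in>J. c' t i * c' t j * (e i x * e j x))" for x
   unfolding U_def power2_eq_square sum_product by (simp add: mult_ac)
  then show ?thesis unfolding a2_def using ee by (simp add: Bochner_Integration.integral_sum)
 qed
 then have "a2 = (\<lambda>t. \<Sum>i\<in>J. \<Sum>j\<in>J. c' t i * c' t j * (\<integral>x. e i x * e j x \<partial>M))" by auto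
 also have "\<dots> \<in> Lmeas I"
  using borel_measurable_derivative[OF c_der]
  by (intro borel_measurable_sum borel_measurable_times borel_measurable_const) auto
 finally show ?thesis .
qed

lemma E2_continuous: "continuous_on {0..<T} E2"
 unfolding E2_def[abs_def]
proof (rule continuous_on_add)
 show "continuous_on {0..<T} (\<lambda>t. \<integral>x. energy (norm (G (c t) x)) \<partial>M)"
  using functional_continuous(1)[OF energy_continuous] by simp
 show "continuous_on {0..<T} (\<lambda>t. \<integral>x. \<psi> t x * U (c t) x \<partial>S)"
  unfolding continuous_on_eq_continuous_within
 proof
  fix t assume t: "t \<in> {0..<T}"
  obtain d r where d: "0 < d" "0 \<le> r" "\<And>s. s \<in> {0..<T} ==> \<bar>s - t\<bar> < d ==> sz (c s) \<le> r"
   using local_bound[OF t] by blast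
  show "continuous (at t within {0..<T}) (\<lambda>t. \<integral>x. \<psi> t x * U (c t) x \<partial>S)"
  proof (rule continuous_param_integral[OF finS t d(1)])
   show "(\<lambda>x. \<psi> s x * U (c s) x) \<in> borel_measurable S" if "s \<in> {0..<T}" for s
    by (intro borel_measurable_times \<psi>_meas[OF that] U_measurable)
   show "AE x in S. \<bar>\<psi> s x * U (c s) x\<bar> \<le> m * (r * Be)" if s: "s \<in> {0..<T}" "\<bar>s - t\<bar> < d" for s
    using \<psi>_bound AE_space
   proof eventually_elim
    case (elim x)
    have "\<bar>U (c s) x\<bar> \<le> r * Be"
     using U_bound(2)[OF elim(2), of "c s"] mult_right_mono[OF d(3)[OF s] Be] by linarith
    then show ?case unfolding abs_mult using elim(1) s m by (intro mult_mono) auto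
   qed
   show "AE x in S. continuous (at t within {0..<T}) (\<lambda>s. \<psi> s x * U (c s) x)"
    using \<psi>_cont
   proof eventually_elim
    case (elim x)
    then have "continuous_on {0..<T} (\<lambda>s. \<psi> s x * U (c s) x)"
     by (intro continuous_on_mult U_continuous)
    then show ?case using t by (simp add: continuous_on_eq_continuous_within)
   qed
  qed
 qed
qed

lemma E2_derivative:
 assumes t: "t \<in> I"
 shows "(E2 has_real_derivative ((\<integral>x. K (norm (G (c t) x)) * (G (c t) x \<bullet> G (c' t) x) \<partial>M)
   + ((\<integral>x. \<psi>' t x * U (c t) x \<partial>S) + (\<integral>x. \<psi> t x * U (c' t) x \<partial>S)))) (at t)"
 unfolding E2_def[abs_def]
proof (rule DERIV_add)
 obtain d r where d: "0 < d" "0 \<le> r" and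
  dr: "\<And>s. \<bar>s - t\<bar> < d ==> s \<in> I \<and> sz (c s) \<le> r \<and> sz (\<lambda>j. c s j - c t j) \<le> r * \<bar>s - t\<bar>"
  using local_lipschitz[OF t] by blast
 have szb: "sz (c s) * Be \<le> r * Be" if "\<bar>s - t\<bar> < d" for s using dr[OF that] Be by (intro mult_right_mono) auto
 have szd: "sz (\<lambda>j. c s j - c t j) * Be \<le> r * \<bar>s - t\<bar> * Be" if "\<bar>s - t\<bar> < d" for s
  using dr[OF that] Be by (intro mult_right_mono) auto
 have tt: "\<bar>t - t\<bar> < d" using d by simp
 have rB: "0 \<le> r * Be" using d Be by simp
 show "((\<lambda>t. \<integral>x. energy (norm (G (c t) x)) \<partial>M) has_real_derivative
   (\<integral>x. K (norm (G (c t) x)) * (G (c t) x \<bullet> G (c' t) x) \<partial>M)) (at t)"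
 proof (rule has_derivative_param_integral[OF finM d(1) energy_integrable])
  show "AE x in M. ((\<lambda>s. energy (norm (G (c s) x))) has_real_derivative K (norm (G (c t) x)) * (G (c t) x \<bullet> G (c' t) x)) (at t)"
  proof (rule AE_I2)
   fix x
   have "((\<lambda>s. G (c s) x) has_derivative (\<lambda>h. h *\<^sub>R G (c' t) x)) (at t)"
    using G_derivative[OF t] by (simp add: has_vector_derivative_def)
   from has_derivative_compose[OF this energy_norm_has_derivative]
   have "((\<lambda>s. energy (norm (G (c s) x))) has_derivative (\<lambda>h. K (norm (G (c t) x)) * (G (c t) x \<bullet> (h *\<^sub>R G (c' t) x)))) (at t)" .
   then show "((\<lambda>s. energy (norm (G (c s) x))) has_real_derivative K (norm (G (c t) x)) * (G (c t) x \<bullet> G (c' t) x)) (at t)"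
    unfolding has_field_derivative_def by (rule has_derivative_eq_rhs) (auto simp: mult_ac)
  qed
  show "(\<lambda>x. K (norm (G (c t) x)) * (G (c t) x \<bullet> G (c' t) x)) \<in> borel_measurable M"
   using KG_bounded_integrable by (rule borel_measurable_integrable)
  show "AE x in M. \<bar>energy (norm (G (c s) x)) - energy (norm (G (c t) x))\<bar>
    \<le> (K (r * Be) * (r * Be) * (r * Be)) * \<bar>s - t\<bar>" if s: "\<bar>s - t\<bar> < d" for s
  proof (rule AE_I2)
   fix x assume x: "x \<in> space M"
   have "norm (G (c s) x) \<le> r * Be" "norm (G (c t) x) \<le> r * Be"
    using G_bound[OF x, of "c s"] G_bound[OF x, of "c t"] szb[OF s] szb[OF tt] by linarith+
   then have "\<bar>energy (norm (G (c s) x)) - energy (norm (G (c t) x))\<bar> \<le> K (r * Be) * (r * Be) * \<bar>norm (G (c s) x) - norm (G (c t) x)\<bar>"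
    by (intro energy_lipschitz) auto
   also have "\<dots> \<le> K (r * Be) * (r * Be) * (r * \<bar>s - t\<bar> * Be)"
   proof (rule mult_left_mono)
    have "norm (G (c s) x - G (c t) x) \<le> r * \<bar>s - t\<bar> * Be"
     unfolding G_diff using G_bound[OF x, of "\<lambda>j. c s j - c t j"] szd[OF s] by linarith
    then show "\<bar>norm (G (c s) x) - norm (G (c t) x)\<bar> \<le> r * \<bar>s - t\<bar> * Be"
     using norm_triangle_ineq3[of "G (c s) x" "G (c t) x"] by linarith
    show "0 \<le> K (r * Be) * (r * Be)" using K_nonneg[OF rB] rB by simp
   qed
   finally show "\<bar>energy (norm (G (c s) x)) - energy (norm (G (c t) x))\<bar>
     \<le> (K (r * Be) * (r * Be) * (r * Be)) * \<bar>s - t\<bar>"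
    by (simp add: mult_ac)
  qed
 qed
 have "((\<lambda>t. \<integral>x. \<psi> t x * U (c t) x \<partial>S) has_real_derivative (\<integral>x. \<psi>' t x * U (c t) x + \<psi> t x * U (c' t) x \<partial>S)) (at t)"
 proof (rule has_derivative_param_integral[OF finS d(1)])
  have Ut: "\<bar>U (c s) x\<bar> \<le> r * Be" if "\<bar>s - t\<bar> < d" "x \<in> space S" for s x
   using U_bound(2)[OF that(2), of "c s"] szb[OF that(1)] by linarith
  show "integrable S (\<lambda>x. \<psi> s x * U (c s) x)" if s: "\<bar>s - t\<bar> < d" for s
  proof (rule finite_measure.integrable_const_bound[OF finS, where B = "m * (r * Be)"])
   show "AE x in S. norm (\<psi> s x * U (c s) x) \<le> m * (r * Be)"
    using \<psi>_bound AE_space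
   proof eventually_elim
    case (elim x)
    have "\<bar>\<psi> s x\<bar> \<le> m" using elim(1) dr[OF s] by auto
    then show ?case unfolding real_norm_def abs_mult using Ut[OF s elim(2)] m by (intro mult_mono) auto
   qed
   show "(\<lambda>x. \<psi> s x * U (c s) x) \<in> borel_measurable S"
    using dr[OF s] by (intro borel_measurable_times \<psi>_meas U_measurable) auto
  qed
  show "AE x in S. ((\<lambda>s. \<psi> s x * U (c s) x) has_real_derivative \<psi>' t x * U (c t) x + \<psi> t x * U (c' t) x) (at t)"
   using \<psi>_der
  proof eventually_elim
   case (elim x)
   then have "((\<lambda>s. \<psi> s x) has_real_derivative \<psi>' t x) (at t)" using t by blast
   from DERIV_mult[OF this U_derivative[OF t, of x]] show ?case by (simp add: add.commute mult.commute)
  qed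
  show "(\<lambda>x. \<psi>' t x * U (c t) x + \<psi> t x * U (c' t) x) \<in> borel_measurable S"
   using t by (intro borel_measurable_add borel_measurable_times \<psi>'_meas \<psi>_meas U_measurable) auto
  show "AE x in S. \<bar>\<psi> s x * U (c s) x - \<psi> t x * U (c t) x\<bar> \<le> (m' * (r * Be) + m * (r * Be)) * \<bar>s - t\<bar>"
   if s: "\<bar>s - t\<bar> < d" for s
   using \<psi>_bound \<psi>_der \<psi>'_bound AE_space
  proof eventually_elim
   case (elim x)
   have "norm (\<psi> s x - \<psi> t x) \<le> m' * norm (s - t)"
   proof (rule field_differentiable_bound[of "I"])
    show "((\<lambda>s. \<psi> s x) has_field_derivative \<psi>' z x) (at z within I)" if "z \<in> I" for z
     using elim(2) that by (auto intro: has_field_derivative_at_within)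
   qed (use elim(3) dr[OF s] t in auto)
   then have 1: "\<bar>(\<psi> s x - \<psi> t x) * U (c s) x\<bar> \<le> (m' * \<bar>s - t\<bar>) * (r * Be)"
    unfolding abs_mult using Ut[OF s elim(4)] m' by (intro mult_mono) auto
   have "\<bar>U (c s) x - U (c t) x\<bar> \<le> r * \<bar>s - t\<bar> * Be"
    unfolding U_diff using U_bound(2)[OF elim(4), of "\<lambda>j. c s j - c t j"] szd[OF s] by linarith
   moreover have "\<bar>\<psi> t x\<bar> \<le> m" using elim(1) t by auto
   ultimately have 2: "\<bar>\<psi> t x * (U (c s) x - U (c t) x)\<bar> \<le> m * (r * \<bar>s - t\<bar> * Be)"
    unfolding abs_mult using m by (intro mult_mono) auto
   have "\<psi> s x * U (c s) x - \<psi> t x * U (c t) x = (\<psi> s x - \<psi> t x) * U (c s) x + \<psi> t x * (U (c s) x - U (c t) x)"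
    by (simp add: algebra_simps)
   then have "\<bar>\<psi> s x * U (c s) x - \<psi> t x * U (c t) x\<bar> \<le> (m' * \<bar>s - t\<bar>) * (r * Be) + m * (r * \<bar>s - t\<bar> * Be)"
    using 1 2 by linarith
   then show ?case by (simp add: algebra_simps)
  qed
 qed
 moreover have "(\<integral>x. \<psi>' t x * U (c t) x + \<psi> t x * U (c' t) x \<partial>S) = (\<integral>x. \<psi>' t x * U (c t) x \<partial>S) + (\<integral>x. \<psi> t x * U (c' t) x \<partial>S)"
 proof (rule Bochner_Integration.integral_add)
  have bi: "integrable S (\<lambda>x. h x * U a x)" if h: "h \<in> borel_measurable S" "AE x in S. \<bar>h x\<bar> \<le> q" "0 \<le> q" for h a q
  proof (rule finite_measure.integrable_const_bound[OF finS, where B = "q * (sz a * Be)"])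
   show "AE x in S. norm (h x * U a x) \<le> q * (sz a * Be)"
    using h(2) AE_space
    by eventually_elim (use U_bound(2) h(3) in \<open>auto simp: abs_mult intro!: mult_mono\<close>)
  qed (intro borel_measurable_times h U_measurable)
  have "AE x in S. \<bar>\<psi>' t x\<bar> \<le> m'" using \<psi>'_bound by eventually_elim (use t in auto)
  then show "integrable S (\<lambda>x. \<psi>' t x * U (c t) x)" using bi[OF \<psi>'_meas[OF t] _ m'] by blast
  have "AE x in S. \<bar>\<psi> t x\<bar> \<le> m" using \<psi>_bound_at[of t] t by auto
  then show "integrable S (\<lambda>x. \<psi> t x * U (c' t) x)" using bi[OF \<psi>_meas _ m, of t] t by auto
 qed
 ultimately show "((\<lambda>t. \<integral>x. \<psi> t x * U (c t) x \<partial>S) has_real_derivative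
   ((\<integral>x. \<psi>' t x * U (c t) x \<partial>S) + (\<integral>x. \<psi> t x * U (c' t) x \<partial>S))) (at t)" by simp
qed

lemma E2_lower:
 assumes t: "t \<in> {0..<T}"
 shows "ch / 2 * gB t - c2 * \<mu> - D * (1 + m powr lam) * \<mu> - u2 t / 2 \<le> E2 t"
proof -
 have "ch * gB t - c2 * \<mu> = (\<integral>x. ch * norm (G (c t) x) powr \<beta> - c2 \<partial>M)"
  using GB_integrable[of "c t"] integrable_const_M by (simp add: gB_def \<mu>_def mult.commute)
 also have "\<dots> \<le> (\<integral>x. energy (norm (G (c t) x)) \<partial>M)"
  using GB_integrable[of "c t"] integrable_const_M energy_integrable energy_lower
  by (intro integral_mono) (auto simp: ch_def)
 finally show ?thesis using boundary_term[OF m \<psi>_bound_at[OF t], of "c t"]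
  unfolding E2_def u2_def[symmetric] gB_def[symmetric] abs_le_iff by linarith
qed

lemma E2_initial: "E2 0 \<le> (c2 + ch / 2) * gB 0 + D * (1 + m powr lam) * \<mu> + u2 0 / 2"
proof -
 have "(\<integral>x. energy (norm (G (c 0) x)) \<partial>M) \<le> (\<integral>x. c2 * norm (G (c 0) x) powr \<beta> \<partial>M)"
  using GB_integrable[of "c 0"] energy_integrable energy_upper by (intro integral_mono) auto
 also have "\<dots> = c2 * gB 0" by (simp add: gB_def)
 finally show ?thesis using boundary_term[OF m \<psi>_bound_at[of 0], of "c 0"] T
  unfolding E2_def u2_def[symmetric] gB_def[symmetric] abs_le_iff by (simp add: distrib_right)
qed

text \<open>The Gronwall lemma is applied to \<open>2 * \<phi>lo * E2\<close>, so that the possibly non-measurable function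
 \<open>F2\<close> enters with coefficient one.\<close>

lemma second_estimate:
 shows "\<And>t. t \<in> I ==> gB t \<le> 1 / (ch * \<phi>lo) * A2 * Y"
  and "time_integral T a2 \<le> ennreal (1 / \<phi>lo\<^sup>2 * A2 * Y)"
proof -
 let ?X = "X (u2 0) m Fb"
 define b where "b = D * (1 + m' powr lam) * \<mu> + A1 / \<phi>lo * ?X"
 define B where "B = 2 * \<phi>lo * b"
 define L where "L = c2 * \<mu> + D * (1 + m powr lam) * \<mu> + A1 / \<phi>lo * ?X"
 define Qb where "Qb = \<phi>lo * ch * (2 / c1 * A1 * ?X)"
 have X: "u2 0 \<le> ?X" "1 + m powr lam \<le> ?X" "Fb \<le> ?X" "1 \<le> ?X" "?X \<le> Y" "1 + m' powr lam \<le> Y" "gB 0 \<le> Y"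
  using u2_nonneg[of 0] gB_nonneg[of 0] Fb(2) by (auto simp: X_def Y_def)
 have b0: "0 \<le> b" "0 \<le> B" "0 \<le> L" "0 \<le> Qb"
  using D \<mu>_nonneg A1_nonneg \<phi>lo X(4) c2_pos c1_pos ch by (auto simp: b_def B_def L_def Qb_def)
 have u2X: "u2 t / 2 \<le> A1 / \<phi>lo * ?X" if "t \<in> I" for t using first_estimate(1)[OF that] by (simp add: field_simps)
 have gm: "gB \<in> Lmeas I"
  by (intro continuous_imp_measurable_on_sets_lebesgue continuous_on_subset[OF gB_continuous]) auto
 have ineq: "2 * \<phi>lo * ((\<integral>x. K (norm (G (c t) x)) * (G (c t) x \<bullet> G (c' t) x) \<partial>M)
   + ((\<integral>x. \<psi>' t x * U (c t) x \<partial>S) + (\<integral>x. \<psi> t x * U (c' t) x \<partial>S))) + \<phi>lo\<^sup>2 * a2 t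
   \<le> B + 0 * (2 * \<phi>lo * E2 t) + \<phi>lo * ch * gB t + F2 t" if t: "t \<in> I" for t
 proof -
  have 1: "\<bar>\<integral>x. f t x * U (c' t) x \<partial>M\<bar> \<le> F2 t / (2 * \<phi>lo) + \<phi>lo / 2 * a2 t"
   using f_term[OF t \<phi>lo, of "c' t"] by (simp add: a2_def)
  have "AE x in S. \<bar>\<psi>' t x\<bar> \<le> m'" using \<psi>'_bound by eventually_elim (use t in auto)
  from boundary_term[OF m' this, of "c t"]
  have 2: "\<bar>\<integral>x. \<psi>' t x * U (c t) x \<partial>S\<bar> \<le> b + ch / 2 * gB t"
   using u2X[OF t] unfolding u2_def[symmetric] gB_def[symmetric] b_def by linarith
  have 3: "\<phi>lo * a2 t \<le> (\<integral>x. \<phi> x * U (c' t) x * U (c' t) x \<partial>M)"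
  proof -
   have "(\<integral>x. \<phi>lo * (U (c' t) x)\<^sup>2 \<partial>M) \<le> (\<integral>x. \<phi> x * (U (c' t) x)\<^sup>2 \<partial>M)"
    using U2_integrable[of "c' t"] \<phi>_bounds by (intro integral_mono mult_right_mono) auto
   then show ?thesis by (simp add: a2_def power2_eq_square mult.assoc)
  qed
  let ?E = "(\<integral>x. K (norm (G (c t) x)) * (G (c t) x \<bullet> G (c' t) x) \<partial>M)
   + ((\<integral>x. \<psi>' t x * U (c t) x \<partial>S) + (\<integral>x. \<psi> t x * U (c' t) x \<partial>S))"
  have "?E + \<phi>lo / 2 * a2 t \<le> b + ch / 2 * gB t + F2 t / (2 * \<phi>lo)"
   using equation[OF t, of "c' t"] 1 2 3 unfolding abs_le_iff by (simp add: field_simps)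
  then have "(2 * \<phi>lo) * (?E + \<phi>lo / 2 * a2 t) \<le> (2 * \<phi>lo) * (b + ch / 2 * gB t + F2 t / (2 * \<phi>lo))"
   using \<phi>lo by (intro mult_left_mono) auto
  then show ?thesis using \<phi>lo by (simp add: B_def distrib_left power2_eq_square)
 qed
 have der: "((\<lambda>t. 2 * \<phi>lo * E2 t) has_real_derivative 2 * \<phi>lo * ((\<integral>x. K (norm (G (c t) x)) * (G (c t) x \<bullet> G (c' t) x) \<partial>M)
   + ((\<integral>x. \<psi>' t x * U (c t) x \<partial>S) + (\<integral>x. \<psi> t x * U (c' t) x \<partial>S)))) (at t)" if "t \<in> I" for t
  by (intro DERIV_cmult E2_derivative that)
 have cont: "continuous_on {0..<T} (\<lambda>t. 2 * \<phi>lo * E2 t)" by (intro continuous_intros E2_continuous)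
 have pm: "(\<lambda>t. \<phi>lo\<^sup>2 * a2 t) \<in> Lmeas I"
  using a2_measurable by (intro borel_measurable_times) auto
 have qm: "(\<lambda>t. \<phi>lo * ch * gB t) \<in> Lmeas I"
  using gm by (intro borel_measurable_times) auto
 have qQ: "(\<integral>\<^sup>+t. ennreal (\<phi>lo * ch * gB t) \<partial>lebesgue_on I) \<le> ennreal Qb"
 proof -
  have "(\<integral>\<^sup>+t. ennreal (\<phi>lo * ch * gB t) \<partial>lebesgue_on I) = (\<integral>\<^sup>+t. ennreal (\<phi>lo * ch) * ennreal (gB t) \<partial>lebesgue_on I)"
   using \<phi>lo ch gB_nonneg by (simp add: ennreal_mult)
  also have "\<dots> = ennreal (\<phi>lo * ch) * time_integral T gB"
   by (rule nn_integral_cmult[OF measurable_compose[OF gm measurable_ennreal]])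
  also have "\<dots> \<le> ennreal (\<phi>lo * ch) * ennreal (2 / c1 * A1 * ?X)"
   by (intro mult_left_mono first_estimate(2)) simp
  also have "\<dots> = ennreal Qb" unfolding Qb_def using \<phi>lo ch A1_nonneg c1_pos X(4) by (subst ennreal_mult[symmetric]) auto
  finally show ?thesis .
 qed
 have FbF2: "time_integral T F2 \<le> ennreal Fb" using Fb(1) by (simp add: F2_def)
 have lowE: "ch / 2 * gB t - L \<le> E2 t" if "t \<in> I" for t
  using E2_lower[of t] u2X[OF that] that unfolding L_def by auto
 have low: "- (2 * \<phi>lo * L) \<le> 2 * \<phi>lo * E2 t" if "t \<in> I" for t
 proof -
  have "0 \<le> ch / 2 * gB t" using ch gB_nonneg[of t] by simp
  then have "- L \<le> E2 t" using lowE[OF that] by linarith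
  then have "2 * \<phi>lo * (- L) \<le> 2 * \<phi>lo * E2 t" using \<phi>lo by (intro mult_left_mono) auto
  then show ?thesis by simp
 qed
 have p0: "0 \<le> \<phi>lo\<^sup>2 * a2 t" and q0: "0 \<le> \<phi>lo * ch * gB t" for t
  using a2_nonneg[of t] gB_nonneg[of t] \<phi>lo ch by auto
 have L0: "0 \<le> 2 * \<phi>lo * L" using \<phi>lo b0 by simp
 note gw = gronwall_integral[where p = "\<lambda>t. \<phi>lo\<^sup>2 * a2 t" and q = "\<lambda>t. \<phi>lo * ch * gB t" and Qb = Qb and F = F2 and Fb = Fb,
   OF T order_refl b0(2) L0 cont der pm p0 qm q0 qQ b0(4) F2_nonneg FbF2 Fb(2) ineq low]
 define Z where "Z = 2 * \<phi>lo * E2 0 + B * T + Qb + Fb"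
 have ZL: "Z + 2 * \<phi>lo * L \<le> A2 * Y"
 proof -
  have DX: "D * (1 + m powr lam) * \<mu> \<le> D * \<mu> * Y"
   using mult_left_mono[of "1 + m powr lam" Y "D * \<mu>"] X D \<mu>_nonneg by (simp add: mult_ac)
  have DX': "D * (1 + m' powr lam) * \<mu> \<le> D * \<mu> * Y"
   using mult_left_mono[of "1 + m' powr lam" Y "D * \<mu>"] X D \<mu>_nonneg by (simp add: mult_ac)
  have AX: "A1 / \<phi>lo * ?X \<le> A1 / \<phi>lo * Y" using X(5) A1_nonneg \<phi>lo by (intro mult_left_mono) auto
  have "(c2 + ch / 2) * gB 0 \<le> (c2 + ch / 2) * Y" using X(7) c2_pos ch by (intro mult_left_mono) auto
  then have 1: "E2 0 \<le> (c2 + ch / 2) * Y + D * \<mu> * Y + 1 / 2 * Y" using E2_initial DX X(1,5) by linarith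
  have "b \<le> (D * \<mu> + A1 / \<phi>lo) * Y" using DX' AX by (simp add: b_def distrib_right)
  then have 2: "b * T \<le> (D * \<mu> + A1 / \<phi>lo) * T * Y" using T mult_right_mono[of b "(D * \<mu> + A1 / \<phi>lo) * Y" T] by (simp add: mult_ac)
  have "c2 * \<mu> * 1 \<le> c2 * \<mu> * Y" using X c2_pos \<mu>_nonneg by (intro mult_left_mono) auto
  then have 3: "L \<le> (c2 * \<mu> + D * \<mu> + A1 / \<phi>lo) * Y" using DX AX by (simp add: L_def distrib_right)
  have "2 * \<phi>lo * ch * A1 / c1 * ?X \<le> 2 * \<phi>lo * ch * A1 / c1 * Y"
   using X(5) \<phi>lo ch A1_nonneg c1_pos by (intro mult_left_mono) auto
  then have 4: "Qb \<le> 2 * \<phi>lo * ch * A1 / c1 * Y" by (simp add: Qb_def mult_ac)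
  have 5: "Fb \<le> Y" using X by linarith
  have "Z + 2 * \<phi>lo * L = 2 * \<phi>lo * (E2 0 + b * T + L) + Qb + Fb" by (simp add: Z_def B_def algebra_simps)
  also have "\<dots> \<le> 2 * \<phi>lo * (((c2 + ch / 2) * Y + D * \<mu> * Y + 1 / 2 * Y) + (D * \<mu> + A1 / \<phi>lo) * T * Y + (c2 * \<mu> + D * \<mu> + A1 / \<phi>lo) * Y)
    + 2 * \<phi>lo * ch * A1 / c1 * Y + Y"
   using 1 2 3 4 5 \<phi>lo by (intro add_mono mult_left_mono) auto
  also have "\<dots> = A2 * Y" by (simp add: A2_def algebra_simps)
  finally show ?thesis .
 qed
 show "gB t \<le> 1 / (ch * \<phi>lo) * A2 * Y" if t: "t \<in> I" for t
 proof -
  have "exp (- 0 * t) * (2 * \<phi>lo * E2 t) \<le> Z" unfolding Z_def by (rule gw(1)) (use t in auto)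
  then have "2 * \<phi>lo * E2 t \<le> Z" by simp
  moreover have "2 * \<phi>lo * (ch / 2 * gB t - L) \<le> 2 * \<phi>lo * E2 t" using lowE[OF t] \<phi>lo by (intro mult_left_mono) auto
  ultimately have "\<phi>lo * ch * gB t \<le> A2 * Y" using ZL by (simp add: right_diff_distrib)
  then show ?thesis using \<phi>lo ch by (simp add: field_simps)
 qed
 have pint: "(\<integral>\<^sup>+t. ennreal (\<phi>lo\<^sup>2 * a2 t) \<partial>lebesgue_on I) \<le> ennreal (A2 * Y)"
  using gw(2) ZL by (auto simp: Z_def elim!: order_trans intro!: ennreal_leI)
 have "time_integral T a2
   = ennreal (1 / \<phi>lo\<^sup>2) * (\<integral>\<^sup>+t. ennreal (\<phi>lo\<^sup>2 * a2 t) \<partial>lebesgue_on I)"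
 proof -
  have "ennreal (a2 t) = ennreal (1 / \<phi>lo\<^sup>2) * ennreal (\<phi>lo\<^sup>2 * a2 t)" for t
   using \<phi>lo a2_nonneg[of t] by (subst ennreal_mult[symmetric]) auto
  then show ?thesis by (simp only: nn_integral_cmult[OF measurable_compose[OF pm measurable_ennreal]])
 qed
 also have "\<dots> \<le> ennreal (1 / \<phi>lo\<^sup>2) * ennreal (A2 * Y)" by (intro mult_left_mono pint) simp
 also have "\<dots> = ennreal (1 / \<phi>lo\<^sup>2 * (A2 * Y))"
  by (rule ennreal_mult'[symmetric]) simp
 finally show "time_integral T a2 \<le> ennreal (1 / \<phi>lo\<^sup>2 * A2 * Y)" by (simp only: mult.assoc)
qed

end

section \<open>Sobolev spaces\<close>

lemma multi_index_1_cases: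
 assumes "\<mu> \<in> multi_indices 1"
 shows "\<mu> = (\<lambda>_. 0) \<or> (\<exists>b\<in>Basis. \<mu> = (\<lambda>c. if c = b then 1 else 0))"
proof (cases "\<forall>b\<in>Basis. \<mu> b = 0")
 case True
 then have "\<mu> = (\<lambda>_. 0)" using assms by (auto simp: multi_indices_def)
 then show ?thesis ..
next
 case False
 then obtain b where b: "b \<in> Basis" "\<mu> b \<noteq> 0" by blast
 have s: "\<mu> b + sum \<mu> (Basis - {b}) \<le> 1"
  using assms b by (simp add: multi_indices_def sum.remove)
 then have 1: "\<mu> b = 1" and "sum \<mu> (Basis - {b}) = 0" using b by linarith+
 from this(2) have 0: "\<forall>c\<in>Basis - {b}. \<mu> c = 0" by simp
 have "\<mu> c = (if c = b then 1 else 0)" for c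
  using 0 1 assms by (cases "c = b"; cases "c \<in> Basis") (auto simp: multi_indices_def)
 then have "\<mu> = (\<lambda>c. if c = b then 1 else 0)" by (rule ext)
 then show ?thesis using b by blast
qed

lemma mderivative_0: "mderivative (\<lambda>_. 0) u = u"
proof -
 have "(SOME bs. set bs \<subseteq> Basis \<and> (\<forall>b\<in>Basis. count_list bs b = 0)) = ([] :: 'a list)"
 proof (rule some_equality)
  fix bs :: "'a list" assume bs: "set bs \<subseteq> Basis \<and> (\<forall>b\<in>Basis. count_list bs b = 0)"
  have "x \<notin> set bs" for x using bs by (metis count_list_0_iff subsetD)
  then show "bs = []" by (cases bs) auto
 qed simp
 then show ?thesis by (simp add: mderivative_def)
qed

lemma mderivative_unit:
 assumes b: "b \<in> Basis" shows "mderivative (\<lambda>c. if c = b then 1 else 0) u = pderivative b u"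
proof -
 have "(SOME bs. set bs \<subseteq> Basis \<and> (\<forall>c\<in>Basis. count_list bs c = (if c = b then 1 else 0))) = [b]"
 proof (rule some_equality)
  fix bs assume bs: "set bs \<subseteq> Basis \<and> (\<forall>c\<in>Basis. count_list bs c = (if c = b then 1 else 0))"
  have sub: "x = b" if "x \<in> set bs" for x
  proof (rule ccontr)
   assume "x \<noteq> b"
   then have "count_list bs x = 0" using bs that by auto
   then show False using that by (simp add: count_list_0_iff)
  qed
  have cb: "count_list bs b = 1" using bs b by auto
  show "bs = [b]"
  proof (cases bs)
   case (Cons x xs)
   then have "x = b" using sub by simp
   then have "b \<notin> set xs" using cb Cons by (simp add: count_list_0_iff)
   then have "xs = []" using sub Cons by (cases xs) auto
   then show ?thesis using Cons \<open>x = b\<close> by simp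
  qed (use cb in simp)
 qed (use b in auto)
 then show ?thesis by (simp add: mderivative_def)
qed

lemma pderivative_zero_off:
 assumes "closed S" "\<And>x. x \<notin> S ==> w x = 0" "x \<notin> S"
 shows "pderivative b w x = 0"
proof -
 have "((\<lambda>_. 0) has_derivative (\<lambda>_. 0)) (at x)" by simp
 then have "(w has_derivative (\<lambda>_. 0)) (at x)"
  by (rule has_derivative_transform_within_open[of _ _ _ _ "- S"]) (use assms in auto)
 from grad_inner_derivative(2)[OF this] show ?thesis .
qed

lemma test_function_mderivative:
 assumes \<eta>: "test_function \<Omega> \<eta>" and \<mu>: "\<mu> \<in> multi_indices 1"
 shows "\<exists>S. compact S \<and> S \<subseteq> \<Omega> \<and> continuous_on UNIV (mderivative \<mu> \<eta>) \<and> (\<forall>x. x \<notin> S \<longrightarrow> mderivative \<mu> \<eta> x = 0)"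
proof -
 obtain S where S: "compact S" "S \<subseteq> \<Omega>" "\<forall>x. x \<notin> S \<longrightarrow> \<eta> x = 0"
  using \<eta> by (auto simp: test_function_def)
 have C: "Ck_on 0 UNIV \<eta>" "Ck_on (Suc 0) UNIV \<eta>" using \<eta> unfolding test_function_def by blast+
 from multi_index_1_cases[OF \<mu>] show ?thesis
 proof
  assume "\<mu> = (\<lambda>_. 0)"
  then show ?thesis using S C by (intro exI[of _ S]) (simp add: mderivative_0)
 next
  assume "\<exists>b\<in>Basis. \<mu> = (\<lambda>c. if c = b then 1 else 0)"
  then obtain b where b: "b \<in> Basis" "\<mu> = (\<lambda>c. if c = b then 1 else 0)" by blast
  have "mderivative \<mu> \<eta> = pderivative b \<eta>" using b by (simp add: mderivative_unit)
  then show ?thesis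
   using S C b pderivative_zero_off[OF compact_imp_closed[OF S(1)], of \<eta>] by (intro exI[of _ S]) auto
 qed
qed

lemma integrable_compactly_supported:
 assumes u: "locally_integrable \<Omega> u" and \<Omega>: "open \<Omega>"
  and \<zeta>: "compact S" "S \<subseteq> \<Omega>" "continuous_on UNIV \<zeta>" "\<forall>x. x \<notin> S \<longrightarrow> \<zeta> x = 0"
 shows "integrable (lebesgue_on \<Omega>) (\<lambda>x. u x * \<zeta> x)"
proof -
 have Ss: "S \<in> sets lebesgue" "\<Omega> \<in> sets lebesgue"
  using lmeasurable_compact[OF \<zeta>(1)] \<Omega> by (auto simp: fmeasurableD intro: borel_open)
 have uS: "integrable (lebesgue_on S) u" using u \<zeta> by (auto simp: locally_integrable_def)
 obtain B where B: "\<forall>x\<in>S. norm (\<zeta> x) \<le> B"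
  using compact_imp_bounded[OF compact_continuous_image[OF continuous_on_subset[OF \<zeta>(3), of S] \<zeta>(1)]]
  by (auto simp: bounded_iff)
 have "integrable (lebesgue_on S) (\<lambda>x. u x * \<zeta> x)"
 proof (rule Bochner_Integration.integrable_bound[OF integrable_mult_left[OF uS, of B]])
  show "(\<lambda>x. u x * \<zeta> x) \<in> Lmeas S"
   by (intro borel_measurable_times borel_measurable_integrable[OF uS] continuous_imp_measurable_on_sets_lebesgue
     continuous_on_subset[OF \<zeta>(3)] Ss) simp
  show "AE x in lebesgue_on S. norm (u x * \<zeta> x) \<le> norm (u x * B)"
  proof (rule AE_I2)
   fix x assume "x \<in> space (lebesgue_on S)"
   then have "norm (\<zeta> x) \<le> norm B" using B by force
   then show "norm (u x * \<zeta> x) \<le> norm (u x * B)" unfolding norm_mult by (rule mult_left_mono) simp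
  qed
 qed
 then have "integrable lebesgue (\<lambda>x. indicator S x *\<^sub>R (u x * \<zeta> x))"
  using Ss by (simp add: integrable_restrict_space)
 moreover have "(\<lambda>x. indicator S x *\<^sub>R (u x * \<zeta> x)) = (\<lambda>x. indicator \<Omega> x *\<^sub>R (u x * \<zeta> x))"
  using \<zeta> by (auto simp: fun_eq_iff indicator_def)
 ultimately show ?thesis using Ss by (simp add: integrable_restrict_space)
qed

lemma weak_derivative_lincomb:
 assumes \<Omega>: "open \<Omega>" and \<mu>: "\<mu> \<in> multi_indices 1"
  and u: "weak_derivative \<Omega> \<mu> u1 v1" "weak_derivative \<Omega> \<mu> u2 v2"
 shows "weak_derivative \<Omega> \<mu> (\<lambda>x. u1 x + c * u2 x) (\<lambda>x. v1 x + c * v2 x)"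
proof -
 have li: "locally_integrable \<Omega> u1" "locally_integrable \<Omega> v1" "locally_integrable \<Omega> u2" "locally_integrable \<Omega> v2"
  using u by (auto simp: weak_derivative_def)
 have "locally_integrable \<Omega> (\<lambda>x. u1 x + c * u2 x)" "locally_integrable \<Omega> (\<lambda>x. v1 x + c * v2 x)"
  using li by (auto simp: locally_integrable_def)
 moreover have "L2_inner (lebesgue_on \<Omega>) (\<lambda>x. u1 x + c * u2 x) (mderivative \<mu> \<eta>) =
    (-1) ^ sum \<mu> Basis * L2_inner (lebesgue_on \<Omega>) (\<lambda>x. v1 x + c * v2 x) \<eta>" if \<eta>: "test_function \<Omega> \<eta>" for \<eta>
 proof -
  have lin: "L2_inner (lebesgue_on \<Omega>) (\<lambda>x. f x + c * g x) \<zeta> = L2_inner (lebesgue_on \<Omega>) f \<zeta> + c * L2_inner (lebesgue_on \<Omega>) g \<zeta>"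
   if "locally_integrable \<Omega> f" "locally_integrable \<Omega> g"
    "\<exists>S. compact S \<and> S \<subseteq> \<Omega> \<and> continuous_on UNIV \<zeta> \<and> (\<forall>x. x \<notin> S \<longrightarrow> \<zeta> x = 0)" for f g \<zeta>
  proof -
   have "integrable (lebesgue_on \<Omega>) (\<lambda>x. f x * \<zeta> x)" "integrable (lebesgue_on \<Omega>) (\<lambda>x. g x * \<zeta> x)"
    using integrable_compactly_supported[OF _ \<Omega>] that by blast+
   then show ?thesis by (simp add: L2_inner_def distrib_right mult.assoc)
  qed
  have \<eta>0: "\<exists>S. compact S \<and> S \<subseteq> \<Omega> \<and> continuous_on UNIV \<eta> \<and> (\<forall>x. x \<notin> S \<longrightarrow> \<eta> x = 0)"
   using test_function_mderivative[OF \<eta>, of "\<lambda>_. 0"] by (simp add: mderivative_0 multi_indices_def)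
  show ?thesis
   using lin[OF li(1,3) test_function_mderivative[OF \<eta> \<mu>]] lin[OF li(2,4) \<eta>0] u \<eta>
   by (simp add: weak_derivative_def algebra_simps)
 qed
 ultimately show ?thesis by (simp add: weak_derivative_def)
qed

lemma locally_integrable_measurable:
 assumes \<Omega>: "open (\<Omega> :: 'a::euclidean_space set)" and u: "locally_integrable \<Omega> u"
 shows "u \<in> Lmeas \<Omega>"
proof -
 obtain D where D: "countable D" "D \<subseteq> Pow \<Omega>" "\<And>X. X \<in> D ==> \<exists>a b. X = cbox a b" "\<Union>D = \<Omega>"
  using open_countable_Union_open_cbox[OF \<Omega>] by metis
 show ?thesis
 proof (rule measurable_piecewise_restrict[OF D(1)])
  fix X assume X: "X \<in> D"
  then obtain a b where ab: "X = cbox a b" using D by blast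
  have Xs: "X \<subseteq> \<Omega>" using D X by blast
  show "X \<inter> space (lebesgue_on \<Omega>) \<in> sets (lebesgue_on \<Omega>)"
   using Xs ab \<Omega> by (auto simp: sets_restrict_space_iff borel_open Int_absorb2)
  have "integrable (lebesgue_on X) u" using u Xs ab by (auto simp: locally_integrable_def compact_cbox)
  moreover have "restrict_space (lebesgue_on \<Omega>) X = lebesgue_on X"
   using Xs ab \<Omega> by (simp add: restrict_restrict_space Int_absorb1 borel_open)
  ultimately show "u \<in> borel_measurable (restrict_space (lebesgue_on \<Omega>) X)"
   by (simp only: borel_measurable_integrable)
 qed (use D in auto)
qed

lemma epowr_ennreal: "0 \<le> x ==> epowr (ennreal x) p = ennreal (x powr p)"
 by (simp add: epowr_def)

lemma epowr_less_top: "epowr x p < \<infinity> \<longleftrightarrow> x < \<infinity>"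
 by (auto simp: epowr_def less_top)

lemma epowr_inverse: assumes "0 < p" shows "epowr (epowr x (1 / p)) p = x"
 using assms by (cases x) (auto simp: epowr_def powr_powr)

lemma epowr_lp_norm:
 assumes "0 < q"
 shows "epowr (lp_norm M (ennreal q) u) q = (\<integral>\<^sup>+x. ennreal (norm (u x) powr q) \<partial>M)"
 using assms by (simp add: lp_norm_def elp_norm_def epowr_inverse epowr_ennreal)

lemma epowr_two: "epowr x 2 = x\<^sup>2"
 by (cases x) (auto simp: epowr_def powr_numeral ennreal_power)

lemma lp_norm_2_squared: "(lp_norm M 2 u)\<^sup>2 = (\<integral>\<^sup>+x. ennreal ((norm (u x))\<^sup>2) \<partial>M)"
 using epowr_lp_norm[of 2 M u] by (simp add: epowr_two powr_numeral)

lemma lp_norm_2_less_top: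
 fixes u :: "'b \<Rightarrow> real"
 shows "lp_norm M 2 u < top \<longleftrightarrow> (\<integral>\<^sup>+x. ennreal ((u x)\<^sup>2) \<partial>M) < top"
 using lp_norm_2_squared[of M u] epowr_less_top[of "lp_norm M 2 u" 2] by (simp add: epowr_two)

lemma sobolev_space_1_2:
 "u \<in> sobolev_space \<Omega> 1 2 \<longleftrightarrow>
  (\<exists>v. \<forall>\<mu>\<in>multi_indices 1. weak_derivative \<Omega> \<mu> u (v \<mu>) \<and> lp_norm (lebesgue_on \<Omega>) 2 (v \<mu>) < \<infinity>)"
proof -
 have "sobolev_norm \<Omega> 1 2 u < \<infinity> \<longleftrightarrow> (\<exists>v. (\<forall>\<mu>\<in>multi_indices 1. weak_derivative \<Omega> \<mu> u (v \<mu>)) \<and>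
   (\<Sum>\<mu>\<in>multi_indices 1. epowr (lp_norm (lebesgue_on \<Omega>) 2 (v \<mu>)) 2) < \<infinity>)"
 proof -
  have "(2::ennreal) \<noteq> \<infinity>" by simp
  then show ?thesis unfolding sobolev_norm_def
   by (simp only: if_False INF_less_iff epowr_less_top mem_Collect_eq Bex_def enn2real_numeral)
 qed
 also have "\<dots> \<longleftrightarrow> (\<exists>v. \<forall>\<mu>\<in>multi_indices 1. weak_derivative \<Omega> \<mu> u (v \<mu>) \<and> lp_norm (lebesgue_on \<Omega>) 2 (v \<mu>) < \<infinity>)"
 proof -
  have "(\<Sum>\<mu>\<in>multi_indices 1. epowr (lp_norm (lebesgue_on \<Omega>) 2 (v \<mu>)) 2) < \<infinity>
    \<longleftrightarrow> (\<forall>\<mu>\<in>multi_indices 1. lp_norm (lebesgue_on \<Omega>) 2 (v \<mu>) < \<infinity>)" for v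
   using epowr_less_top by (simp add: less_top)
  then show ?thesis by (auto simp: ball_conj_distrib)
 qed
 finally show ?thesis by (simp add: sobolev_space_def)
qed

lemma sobolev_space_lincomb:
 assumes \<Omega>: "open \<Omega>" and u: "u1 \<in> sobolev_space \<Omega> 1 2" "u2 \<in> sobolev_space \<Omega> 1 2"
 shows "(\<lambda>x. u1 x + c * u2 x) \<in> sobolev_space \<Omega> 1 2"
proof -
 obtain v1 where v1: "\<forall>\<mu>\<in>multi_indices 1. weak_derivative \<Omega> \<mu> u1 (v1 \<mu>) \<and> lp_norm (lebesgue_on \<Omega>) 2 (v1 \<mu>) < \<infinity>"
  using u(1) unfolding sobolev_space_1_2 by blast
 obtain v2 where v2: "\<forall>\<mu>\<in>multi_indices 1. weak_derivative \<Omega> \<mu> u2 (v2 \<mu>) \<and> lp_norm (lebesgue_on \<Omega>) 2 (v2 \<mu>) < \<infinity>"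
  using u(2) unfolding sobolev_space_1_2 by blast
 have "weak_derivative \<Omega> \<mu> (\<lambda>x. u1 x + c * u2 x) (\<lambda>x. v1 \<mu> x + c * v2 \<mu> x) \<and> lp_norm (lebesgue_on \<Omega>) 2 (\<lambda>x. v1 \<mu> x + c * v2 \<mu> x) < \<infinity>"
  if \<mu>: "\<mu> \<in> multi_indices 1" for \<mu>
 proof
  show "weak_derivative \<Omega> \<mu> (\<lambda>x. u1 x + c * u2 x) (\<lambda>x. v1 \<mu> x + c * v2 \<mu> x)"
   using v1 v2 \<mu> by (intro weak_derivative_lincomb[OF \<Omega> \<mu>]) auto
  have m: "v1 \<mu> \<in> Lmeas \<Omega>" "v2 \<mu> \<in> Lmeas \<Omega>"
   using v1 v2 \<mu> by (auto simp: weak_derivative_def intro!: locally_integrable_measurable[OF \<Omega>])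
  have "(\<integral>\<^sup>+x. ennreal ((v1 \<mu> x + c * v2 \<mu> x)\<^sup>2) \<partial>lebesgue_on \<Omega>)
    \<le> (\<integral>\<^sup>+x. 2 * ennreal ((v1 \<mu> x)\<^sup>2) + ennreal (2 * c\<^sup>2) * ennreal ((v2 \<mu> x)\<^sup>2) \<partial>lebesgue_on \<Omega>)"
  proof (rule nn_integral_mono)
   fix x
   have "(v1 \<mu> x + c * v2 \<mu> x)\<^sup>2 \<le> 2 * (v1 \<mu> x)\<^sup>2 + (2 * c\<^sup>2) * (v2 \<mu> x)\<^sup>2"
    using sum_squares_bound[of "v1 \<mu> x" "c * v2 \<mu> x"] by (simp add: power2_sum power_mult_distrib)
   from ennreal_leI[OF this] show "ennreal ((v1 \<mu> x + c * v2 \<mu> x)\<^sup>2)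
     \<le> 2 * ennreal ((v1 \<mu> x)\<^sup>2) + ennreal (2 * c\<^sup>2) * ennreal ((v2 \<mu> x)\<^sup>2)"
    by (simp add: ennreal_mult)
  qed
  also have "\<dots> = 2 * (\<integral>\<^sup>+x. ennreal ((v1 \<mu> x)\<^sup>2) \<partial>lebesgue_on \<Omega>)
    + ennreal (2 * c\<^sup>2) * (\<integral>\<^sup>+x. ennreal ((v2 \<mu> x)\<^sup>2) \<partial>lebesgue_on \<Omega>)"
   using m by (subst nn_integral_add) (auto simp: nn_integral_cmult)
  also have "\<dots> < \<infinity>"
  proof -
   have "(\<integral>\<^sup>+x. ennreal ((v1 \<mu> x)\<^sup>2) \<partial>lebesgue_on \<Omega>) < top" "(\<integral>\<^sup>+x. ennreal ((v2 \<mu> x)\<^sup>2) \<partial>lebesgue_on \<Omega>) < top"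
    using v1 v2 \<mu> lp_norm_2_less_top by (auto simp: infinity_ennreal_def)
   then show ?thesis by (simp add: ennreal_mult_less_top)
  qed
  finally show "lp_norm (lebesgue_on \<Omega>) 2 (\<lambda>x. v1 \<mu> x + c * v2 \<mu> x) < \<infinity>" by (simp add: lp_norm_2_less_top)
 qed
 then show ?thesis unfolding sobolev_space_1_2 by (intro exI[of _ "\<lambda>\<mu> x. v1 \<mu> x + c * v2 \<mu> x"]) blast
qed

lemma zero_in_sobolev_space: "(\<lambda>x. 0) \<in> sobolev_space \<Omega> 1 2"
 unfolding sobolev_space_1_2
 by (intro exI[of _ "\<lambda>_ _. 0"]) (auto simp: weak_derivative_def locally_integrable_def L2_inner_def lp_norm_2_less_top)

text \<open>Differentiating the constant function \<open>t \<mapsto> \<integral> w (x + t b) dx\<close> at \<open>t = 0\<close>.\<close>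

lemma integral_pderivative_zero:
 fixes w :: "'a::euclidean_space \<Rightarrow> real"
 assumes w: "\<And>x. w differentiable (at x)" and cont: "continuous_on UNIV (pderivative b w)"
  and b: "b \<in> Basis" and S: "compact S" "\<And>x. x \<notin> S ==> w x = 0"
 shows "(\<integral>x. pderivative b w x \<partial>lebesgue) = 0"
proof -
 obtain r where r: "0 < r" "\<forall>x\<in>S. norm x \<le> r"
  using compact_imp_bounded[OF S(1)] by (auto simp: bounded_pos)
 define B where "B = cball (0::'a) (r + 1)"
 have Bs: "B \<in> lmeasurable" by (simp add: B_def)
 have wc: "continuous_on UNIV w" using w
  by (intro continuous_at_imp_continuous_on ballI differentiable_imp_continuous_within)
 have pz: "pderivative b w x = 0" if "x \<notin> S" for x
  using pderivative_zero_off[OF compact_imp_closed[OF S(1)] S(2) that] .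
 obtain C where C: "0 < C" "\<And>x. \<bar>pderivative b w x\<bar> \<le> C"
 proof -
  obtain C where C: "0 < C" "\<forall>y\<in>pderivative b w ` S. norm y \<le> C"
   using compact_imp_bounded[OF compact_continuous_image[OF continuous_on_subset[OF cont, of S] S(1)]]
   by (auto simp: bounded_pos)
  have "\<bar>pderivative b w x\<bar> \<le> C" for x using C pz[of x] by (cases "x \<in> S") auto
  then show thesis using that C by blast
 qed
 have der: "((\<lambda>s. w (x + s *\<^sub>R b)) has_real_derivative pderivative b w (x + t *\<^sub>R b)) (at t)" for x t
 proof -
  have "((\<lambda>s. w (x + s *\<^sub>R b)) has_derivative (\<lambda>h. grad w (x + t *\<^sub>R b) \<bullet> (h *\<^sub>R b))) (at t)"
   using has_derivative_grad[OF w]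
   by (intro has_derivative_compose[of "\<lambda>s. x + s *\<^sub>R b" "\<lambda>h. h *\<^sub>R b" t UNIV w]) (auto intro!: derivative_eq_intros)
  then show ?thesis unfolding has_field_derivative_def
   by (rule has_derivative_eq_rhs) (auto simp: grad_inner_Basis[OF b] mult.commute)
 qed
 have meas: "(\<lambda>x. w (x + s *\<^sub>R b)) \<in> borel_measurable borel" for s
  by (intro borel_measurable_continuous_onI continuous_on_compose2[OF wc] continuous_intros) auto
 have measB: "f \<in> borel_measurable borel ==> f \<in> Lmeas B" for f :: "'a \<Rightarrow> real"
  by (intro measurable_restrict_space1 measurable_completion) simp
 have const: "(\<integral>x. w (x + s *\<^sub>R b) \<partial>lebesgue_on B) = (\<integral>x. w x \<partial>lborel)" if s: "\<bar>s\<bar> < 1" for s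
 proof -
  have "(\<integral>x. w (x + s *\<^sub>R b) \<partial>lebesgue_on B) = (\<integral>x. indicator B x *\<^sub>R w (x + s *\<^sub>R b) \<partial>lebesgue)"
   using Bs by (subst integral_restrict_space) auto
  also have "\<dots> = (\<integral>x. w (x + s *\<^sub>R b) \<partial>lebesgue)"
  proof (rule Bochner_Integration.integral_cong[OF refl])
   fix x
   have "w (x + s *\<^sub>R b) = 0" if "x \<notin> B"
   proof (rule S(2))
    have "norm x \<le> norm (x + s *\<^sub>R b) + norm (s *\<^sub>R b)" using norm_triangle_ineq4[of "x + s *\<^sub>R b" "s *\<^sub>R b"] by simp
    moreover have "norm (s *\<^sub>R b) < 1" using s b by simp
    ultimately have "r < norm (x + s *\<^sub>R b)" using that by (simp add: B_def)
    then show "x + s *\<^sub>R b \<notin> S" using r by force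
   qed
   then show "indicator B x *\<^sub>R w (x + s *\<^sub>R b) = w (x + s *\<^sub>R b)" by (auto simp: indicator_def)
  qed
  also have "\<dots> = (\<integral>x. w (x + s *\<^sub>R b) \<partial>lborel)" using meas by (intro integral_completion) simp
  also have "\<dots> = (\<integral>x. w x \<partial>distr lborel borel ((+) (s *\<^sub>R b)))"
   using meas[of 0] by (subst integral_distr) (auto simp: add.commute)
  finally show ?thesis by (simp add: lborel_distr_plus)
 qed
 have "((\<lambda>s. \<integral>x. w (x + s *\<^sub>R b) \<partial>lebesgue_on B) has_real_derivative (\<integral>x. pderivative b w x \<partial>lebesgue_on B)) (at 0)"
 proof (rule has_derivative_param_integral[OF finite_measure_lebesgue_on[OF Bs], where d = 1 and B = C])
  have lip: "\<bar>w (x + s *\<^sub>R b) - w (x + 0 *\<^sub>R b)\<bar> \<le> C * \<bar>s - 0\<bar>" for x s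
  proof -
   have "norm (w (x + s *\<^sub>R b) - w (x + 0 *\<^sub>R b)) \<le> C * norm (s - 0)"
    by (rule field_differentiable_bound[of UNIV]) (use der C in auto)
   then show ?thesis by simp
  qed
  then show "AE x in lebesgue_on B. \<bar>w (x + s *\<^sub>R b) - w (x + 0 *\<^sub>R b)\<bar> \<le> C * \<bar>s - 0\<bar>" for s by simp
  obtain Q where Q: "\<forall>y\<in>w ` S. norm y \<le> Q"
   using compact_imp_bounded[OF compact_continuous_image[OF continuous_on_subset[OF wc, of S] S(1)]]
   by (auto simp: bounded_pos)
  have Qb: "norm (w x) \<le> max Q 0" for x using Q S(2)[of x] by (cases "x \<in> S") fastforce+
  show "integrable (lebesgue_on B) (\<lambda>x. w (x + s *\<^sub>R b))" for s
   by (rule finite_measure.integrable_const_bound[OF finite_measure_lebesgue_on[OF Bs], where B = "max Q 0"])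
     (use Qb measB[OF meas] in auto)
  show "AE x in lebesgue_on B. ((\<lambda>s. w (x + s *\<^sub>R b)) has_real_derivative pderivative b w x) (at 0)"
   using der[of _ 0] by simp
  show "pderivative b w \<in> Lmeas B"
   by (intro measB borel_measurable_continuous_onI cont)
 qed simp
 moreover have "((\<lambda>s. \<integral>x. w (x + s *\<^sub>R b) \<partial>lebesgue_on B) has_real_derivative 0) (at 0)"
  by (rule has_field_derivative_transform_within[where d = 1 and f = "\<lambda>_. \<integral>x. w x \<partial>lborel"])
    (auto simp: dist_real_def const)
 ultimately have "(\<integral>x. pderivative b w x \<partial>lebesgue_on B) = 0" by (rule DERIV_unique)
 moreover have "(\<integral>x. pderivative b w x \<partial>lebesgue_on B) = (\<integral>x. indicator B x *\<^sub>R pderivative b w x \<partial>lebesgue)"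
  using Bs by (subst integral_restrict_space) auto
 moreover have "(\<lambda>x. indicator B x *\<^sub>R pderivative b w x) = pderivative b w"
 proof
  fix x
  have "x \<in> B" if "x \<in> S" using r that by (force simp: B_def)
  then show "indicator B x *\<^sub>R pderivative b w x = pderivative b w x"
   using pz[of x] by (cases "x \<in> S") (auto simp: indicator_def)
 qed
 ultimately show ?thesis by simp
qed

lemma smooth_weak_derivative:
 fixes u v :: "'a::euclidean_space \<Rightarrow> real"
 assumes \<Omega>: "open \<Omega>" "bounded \<Omega>" and U: "open U" "closure \<Omega> \<subseteq> U"
  and v: "Ck_on 1 U v" and uv: "\<And>x. x \<in> closure \<Omega> ==> v x = u x" and b: "b \<in> Basis"
 shows "weak_derivative \<Omega> (\<lambda>_. 0) u u"
  and "weak_derivative \<Omega> (\<lambda>c. if c = b then 1 else 0) u (pderivative b v)"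
proof -
 have vd: "\<And>x. x \<in> U ==> v differentiable (at x)" and pc: "continuous_on U (pderivative b v)"
  using v b by auto
 have vc: "continuous_on U v"
  using vd by (intro continuous_at_imp_continuous_on ballI differentiable_imp_continuous_within) auto
 have li: "locally_integrable \<Omega> f" if f: "continuous_on \<Omega> f" for f :: "'a \<Rightarrow> real"
  unfolding locally_integrable_def
 proof (intro allI impI, elim conjE)
  fix S assume S: "compact S" "S \<subseteq> \<Omega>"
  have "integrable lborel (\<lambda>x. indicator S x *\<^sub>R f x)"
   using S continuous_on_subset[OF f] by (intro borel_integrable_compact) auto
  then have "integrable lebesgue (\<lambda>x. indicator S x *\<^sub>R f x)" by (simp add: integrable_completion)
  then show "integrable (lebesgue_on S) f" using S by (simp add: integrable_restrict_space borel_compact)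
 qed
 have uc: "continuous_on \<Omega> u"
  using continuous_on_subset[OF vc, of \<Omega>] U uv closure_subset[of \<Omega>] by (subst continuous_on_cong[OF refl, of _ _ v]) auto
 have lu: "locally_integrable \<Omega> u" by (rule li[OF uc])
 have lp: "locally_integrable \<Omega> (pderivative b v)"
  using pc U closure_subset[of \<Omega>] by (intro li continuous_on_subset[OF pc]) auto
 show "weak_derivative \<Omega> (\<lambda>_. 0) u u" using lu by (simp add: weak_derivative_def mderivative_0)
 have "L2_inner (lebesgue_on \<Omega>) u (pderivative b \<eta>) = - L2_inner (lebesgue_on \<Omega>) (pderivative b v) \<eta>"
  if \<eta>: "test_function \<Omega> \<eta>" for \<eta>
 proof -
  obtain S where S: "compact S" "S \<subseteq> \<Omega>" "\<forall>x. x \<notin> S \<longrightarrow> \<eta> x = 0" using \<eta> by (auto simp: test_function_def)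
  have "Ck_on (Suc 0) UNIV \<eta>" using \<eta> unfolding test_function_def by blast
  then have \<eta>d: "\<And>x. \<eta> differentiable (at x)" and \<eta>c: "continuous_on UNIV (pderivative b \<eta>)" using b by auto
  have \<eta>cc: "continuous_on UNIV \<eta>" using \<eta>d
   by (intro continuous_at_imp_continuous_on ballI differentiable_imp_continuous_within)
  have p\<eta>: "pderivative b \<eta> x = 0" if "x \<notin> S" for x
   using pderivative_zero_off[OF compact_imp_closed[OF S(1)] _ that, of \<eta>] S by blast
  define w where "w x = (if x \<in> S then v x * \<eta> x else 0)" for x
  have SU: "S \<subseteq> U" using S U closure_subset[of \<Omega>] by blast
  have der: "(w has_derivative (\<lambda>y. (if x \<in> S then v x * (grad \<eta> x \<bullet> y) + (grad v x \<bullet> y) * \<eta> x else 0))) (at x)" for x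
  proof (cases "x \<in> U")
   case True
   have "((\<lambda>x. v x * \<eta> x) has_derivative (\<lambda>y. v x * (grad \<eta> x \<bullet> y) + (grad v x \<bullet> y) * \<eta> x)) (at x)"
    by (rule has_derivative_mult[OF has_derivative_grad[OF vd[OF True]] has_derivative_grad[OF \<eta>d]])
   then have "(w has_derivative (\<lambda>y. v x * (grad \<eta> x \<bullet> y) + (grad v x \<bullet> y) * \<eta> x)) (at x)"
    by (rule has_derivative_transform_within_open[OF _ U(1) True]) (use S in \<open>auto simp: w_def\<close>)
   moreover have "grad \<eta> x = 0" "\<eta> x = 0" if "x \<notin> S"
    using that S pderivative_zero_off[OF compact_imp_closed[OF S(1)] _ that, of \<eta>] by (auto simp: grad_def)
   ultimately show ?thesis by (cases "x \<in> S") auto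
  next
   case False
   then have xS: "x \<notin> S" using SU by blast
   have "((\<lambda>_. 0) has_derivative (\<lambda>_. 0)) (at x)" by simp
   then have "(w has_derivative (\<lambda>_. 0)) (at x)"
    by (rule has_derivative_transform_within_open[of _ _ _ _ "- S"]) (use xS compact_imp_closed[OF S(1)] in \<open>auto simp: w_def\<close>)
   then show ?thesis using xS by simp
  qed
  have pw: "pderivative b w x = (if x \<in> S then v x * pderivative b \<eta> x + pderivative b v x * \<eta> x else 0)" for x
   using grad_inner_derivative(2)[OF der[of x], of b] grad_inner_Basis[OF b] by simp
  have cw: "continuous_on UNIV (pderivative b w)"
  proof (rule continuous_at_imp_continuous_on, rule ballI)
   fix x :: 'a
   show "isCont (pderivative b w) x"
   proof (cases "x \<in> U")
    case True
    have "continuous_on U (\<lambda>x. v x * pderivative b \<eta> x + pderivative b v x * \<eta> x)"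
     using continuous_on_subset[OF \<eta>c] continuous_on_subset[OF \<eta>cc] by (intro continuous_intros vc pc) auto
    moreover have "pderivative b w x = v x * pderivative b \<eta> x + pderivative b v x * \<eta> x" for x
     using pw[of x] p\<eta>[of x] S by auto
    ultimately have "continuous_on U (pderivative b w)" by simp
    then show ?thesis using True U(1) by (simp add: continuous_on_eq_continuous_at)
   next
    case False
    then have "x \<in> - S" using SU by blast
    moreover have "continuous_on (- S) (pderivative b w)"
     using pw by (subst continuous_on_cong[OF refl, of _ _ "\<lambda>_. 0"]) auto
    ultimately show ?thesis using compact_imp_closed[OF S(1)] by (simp add: continuous_on_eq_continuous_at open_Compl)
   qed
  qed
  have "(\<integral>x. pderivative b w x \<partial>lebesgue) = 0"
   by (rule integral_pderivative_zero[OF _ cw b S(1)]) (use der in \<open>auto simp: w_def differentiable_def\<close>)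
  moreover have "(\<integral>x. pderivative b w x \<partial>lebesgue) = (\<integral>x. u x * pderivative b \<eta> x + pderivative b v x * \<eta> x \<partial>lebesgue_on \<Omega>)"
  proof -
   have "pderivative b w x = indicator \<Omega> x *\<^sub>R (u x * pderivative b \<eta> x + pderivative b v x * \<eta> x)" for x
    using pw[of x] p\<eta>[of x] S uv[of x] closure_subset[of \<Omega>] by (auto simp: indicator_def)
   then show ?thesis using \<Omega> by (simp add: integral_restrict_space borel_open)
  qed
  moreover have "integrable (lebesgue_on \<Omega>) (\<lambda>x. u x * pderivative b \<eta> x)" "integrable (lebesgue_on \<Omega>) (\<lambda>x. pderivative b v x * \<eta> x)"
   using integrable_compactly_supported[OF lu \<Omega>(1) S(1,2) \<eta>c] integrable_compactly_supported[OF lp \<Omega>(1) S(1,2) \<eta>cc] p\<eta> S(3) by blast+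
  ultimately show ?thesis by (simp add: L2_inner_def)
 qed
 then show "weak_derivative \<Omega> (\<lambda>c. if c = b then 1 else 0) u (pderivative b v)"
  using lu lp b by (simp add: weak_derivative_def mderivative_unit)
qed

section \<open>The scalar element space\<close>

context mesh
begin

lemma polynomial_on_element:
 assumes u: "u \<in> piecewise_polynomials k \<T>" "continuous_on (closure \<Omega>) u" and E: "E \<in> \<T>"
 shows "\<exists>p\<in>polynomials k. \<forall>x\<in>E. u x = p x"
proof -
 obtain p where p: "p \<in> polynomials k" "\<forall>x\<in>interior E. u x = p x"
  using u(1) E by (auto simp: piecewise_polynomials_def)
 have cont: "continuous_on (closure (interior E)) (\<lambda>x. u x - p x)"
  unfolding element(4)[OF E] using element(5)[OF E]
  by (intro continuous_on_diff continuous_on_subset[OF u(2)] polynomials_continuous_on[OF p(1)])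
 have "u x - p x = 0" if "x \<in> E" for x
  by (rule continuous_constant_on_closure[OF cont]) (use p(2) that element(4)[OF E] in auto)
 then show ?thesis using p(1) by (intro bexI[of _ p]) auto
qed

lemma R_space_lincomb:
 assumes u: "u \<in> R_space \<Omega> k \<T>" and v: "v \<in> R_space \<Omega> k \<T>"
 shows "(\<lambda>x. u x + c * v x) \<in> R_space \<Omega> k \<T>"
proof -
 have "(\<lambda>x. \<Sum>i\<in>{True, False}. (if i then 1 else c) * (if i then u else v) x) \<in> piecewise_polynomials k \<T>"
  using u v by (intro piecewise_polynomials_lincomb) (auto simp: R_space_def)
 then have "(\<lambda>x. u x + c * v x) \<in> piecewise_polynomials k \<T>" by simp
 then show ?thesis using u v sobolev_space_lincomb[OF domain_open, of u v c]
  by (auto simp: R_space_def intro!: continuous_intros)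
qed

lemma zero_in_R_space: "(\<lambda>x. 0) \<in> R_space \<Omega> k \<T>"
proof -
 have "(\<lambda>x::'a. 0) \<in> polynomials k" by (rule const_in_polynomials)
 then have "(\<lambda>x::'a. 0) \<in> piecewise_polynomials k \<T>" by (auto simp: piecewise_polynomials_def intro!: bexI[of _ "\<lambda>x. 0"])
 then show ?thesis using zero_in_sobolev_space[of \<Omega>] unfolding R_space_def by simp
qed

lemma R_space_sum:
 assumes "\<And>j. j < n ==> e j \<in> R_space \<Omega> k \<T>"
 shows "(\<lambda>x. \<Sum>j<(n::nat). a j * e j x) \<in> R_space \<Omega> k \<T>"
proof -
 have "(\<lambda>x. 0 + (\<Sum>j<n. a j * e j x)) \<in> R_space \<Omega> k \<T>"
  by (rule subspace_lincomb) (fact R_space_lincomb zero_in_R_space assms)+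
 then show ?thesis by simp
qed

lemma nodal_basis:
 "\<exists>(n::nat) y e. (\<forall>j<n. y j \<in> closure \<Omega> \<and> e j \<in> R_space \<Omega> k \<T>) \<and>
   (\<forall>u\<in>R_space \<Omega> k \<T>. \<forall>x\<in>closure \<Omega>. u x = (\<Sum>j<n. u (y j) * e j x))"
proof -
 have "\<forall>x\<in>closure \<Omega>. \<exists>E. E \<in> \<T> \<and> x \<in> E" using Union_mesh by blast
 then obtain sel where sel: "\<And>x. x \<in> closure \<Omega> ==> sel x \<in> \<T> \<and> x \<in> sel x" unfolding bchoice_iff by blast
 let ?V = "R_space \<Omega> k \<T>"
 define \<Lambda> where "\<Lambda> = (\<lambda>x (u :: 'a \<Rightarrow> real). u x) ` closure \<Omega>"
 define I where "I = \<T> \<times> (multi_indices k :: ('a \<Rightarrow> nat) set)"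
 define mon where "mon i x = (if sel x = fst i then monomial (snd i) x else 0)" for i :: "'a set \<times> ('a \<Rightarrow> nat)" and x :: 'a
 have "\<exists>(n::nat) l e. (\<forall>j<n. l j \<in> \<Lambda> \<and> e j \<in> ?V) \<and> (\<forall>i<n. \<forall>j<n. l i (e j) = of_bool (i = j)) \<and>
      (\<forall>u\<in>?V. \<forall>x\<in>closure \<Omega>. u x = (\<Sum>j<n. l j u * e j x))"
 proof (rule dual_basis_exists[where I = I and m = mon])
  show "finite I" using finite_mesh by (simp add: I_def)
  fix u assume u: "u \<in> ?V"
  have "\<forall>E\<in>\<T>. \<exists>c. \<forall>x\<in>E. u x = (\<Sum>\<mu>\<in>multi_indices k. c \<mu> * monomial \<mu> x)"
  proof
   fix E assume E: "E \<in> \<T>"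
   have "u \<in> piecewise_polynomials k \<T>" "continuous_on (closure \<Omega>) u" using u by (auto simp: R_space_def)
   from polynomial_on_element[OF this E] obtain p where p: "p \<in> polynomials k" "\<forall>x\<in>E. u x = p x" by blast
   then show "\<exists>c. \<forall>x\<in>E. u x = (\<Sum>\<mu>\<in>multi_indices k. c \<mu> * monomial \<mu> x)"
    unfolding polynomials_iff by auto
  qed
  then obtain c where c: "\<And>E x. E \<in> \<T> ==> x \<in> E ==> u x = (\<Sum>\<mu>\<in>multi_indices k. c E \<mu> * monomial \<mu> x)"
   unfolding bchoice_iff by blast
  have "\<forall>x\<in>closure \<Omega>. u x = (\<Sum>i\<in>I. c (fst i) (snd i) * mon i x)"
  proof
   fix x assume x: "x \<in> closure \<Omega>"
   have "(\<Sum>i\<in>I. c (fst i) (snd i) * mon i x) = (\<Sum>E\<in>\<T>. \<Sum>\<mu>\<in>multi_indices k. c E \<mu> * mon (E, \<mu>) x)"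
    by (simp add: I_def sum.cartesian_product case_prod_beta)
   also have "\<dots> = (\<Sum>E\<in>\<T>. if E = sel x then u x else 0)"
   proof (rule sum.cong[OF refl])
    fix E assume E: "E \<in> \<T>"
    show "(\<Sum>\<mu>\<in>multi_indices k. c E \<mu> * mon (E, \<mu>) x) = (if E = sel x then u x else 0)"
    proof (cases "E = sel x")
     case True
     then have "x \<in> E" using sel[OF x] by simp
     then show ?thesis using True c[OF E] by (simp add: mon_def)
    qed (simp add: mon_def)
   qed
   also have "\<dots> = u x" using finite_mesh sel[OF x] by simp
   finally show "u x = (\<Sum>i\<in>I. c (fst i) (snd i) * mon i x)" by simp
  qed
  then show "\<exists>a. \<forall>x\<in>closure \<Omega>. u x = (\<Sum>i\<in>I. a i * mon i x)"
   by (rule exI[of _ "\<lambda>i. c (fst i) (snd i)"])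
 qed (auto simp: \<Lambda>_def intro: R_space_lincomb zero_in_R_space)
 then obtain n l e where le: "\<forall>j<(n::nat). l j \<in> \<Lambda> \<and> e j \<in> ?V"
  "\<forall>u\<in>?V. \<forall>x\<in>closure \<Omega>. u x = (\<Sum>j<n. l j u * e j x)" by blast
 have "\<forall>j. \<exists>y. j < n \<longrightarrow> y \<in> closure \<Omega> \<and> l j = (\<lambda>u. u y)" using le(1) by (auto simp: \<Lambda>_def)
 then obtain y where y: "\<And>j. j < n ==> y j \<in> closure \<Omega> \<and> l j = (\<lambda>u. u (y j))" by metis
 have "\<forall>u\<in>?V. \<forall>x\<in>closure \<Omega>. u x = (\<Sum>j<n. u (y j) * e j x)"
  using le(2) y by simp
 then show ?thesis using le(1) y by blast
qed

end

section \<open>The projected initial value\<close>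

lemma polynomial_zero_of_ball:
 fixes p :: "'a::euclidean_space \<Rightarrow> real"
 assumes p: "p \<in> polynomials k" and \<gamma>: "0 < \<gamma>" and z: "\<And>x. x \<in> ball 0 \<gamma> ==> p x = 0"
 shows "p y = 0"
proof -
 obtain c where c: "\<And>x. p x = (\<Sum>\<mu>\<in>multi_indices k. c \<mu> * monomial \<mu> x)"
  using p by (auto simp: polynomials_iff)
 define q where "q = (\<Sum>\<mu>\<in>multi_indices k. Polynomial.monom (c \<mu> * monomial \<mu> y) (sum \<mu> Basis))"
 have q: "poly q t = p (t *\<^sub>R y)" for t
  unfolding q_def c poly_sum
  by (intro sum.cong refl) (simp add: poly_monom monomial_def power_mult_distrib prod.distrib power_sum)
 have "q = 0"
 proof (rule ccontr)
  assume "q \<noteq> 0"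
  then have fin: "finite {t. poly q t = 0}" by (rule poly_roots_finite)
  define d where "d = \<gamma> / (norm y + 1)"
  have y1: "0 < norm y + 1" using norm_ge_zero[of y] by linarith
  have d: "0 < d" using \<gamma> y1 by (simp add: d_def)
  have "poly q t = 0" if t: "t \<in> {0<..<d}" for t
  proof -
   have "norm (t *\<^sub>R y) < \<gamma>"
   proof -
    have "t * norm y \<le> t * (norm y + 1)" using t by (intro mult_left_mono) auto
    also have "\<dots> < d * (norm y + 1)" using t y1 by (intro mult_strict_right_mono) auto
    also have "\<dots> = \<gamma>" using y1 by (simp add: d_def)
    finally show ?thesis using t by simp
   qed
   then show ?thesis using z by (simp add: q)
  qed
  then have "{0<..<d} \<subseteq> {t. poly q t = 0}" by blast
  then have "finite {0<..<d}" using fin finite_subset by blast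
  then show False using d infinite_Ioo by blast
 qed
 then show ?thesis using q[of 1] by simp
qed

text \<open>Every polynomial is the integral over a small ball of its values against fixed kernels.\<close>

lemma polynomial_gradient_bound:
 assumes \<gamma>: "0 < \<gamma>"
 shows "\<exists>C\<ge>0. \<forall>p\<in>polynomials k. \<forall>y\<in>cball (0::'a::euclidean_space) 1.
   norm (grad p y) \<le> C * (\<integral>x. \<bar>p x\<bar> \<partial>lebesgue_on (ball 0 \<gamma>))"
proof -
 let ?B = "ball (0::'a) \<gamma>" and ?V = "polynomials k :: ('a \<Rightarrow> real) set"
 define \<Lambda> where "\<Lambda> = (\<lambda>q (u :: 'a \<Rightarrow> real). \<integral>x. u x * q x \<partial>lebesgue_on ?B) ` ?V"
 have fm: "finite_measure (lebesgue_on ?B)" by (rule finite_measure_lebesgue_on) simp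
 have bnd: "\<exists>B\<ge>0. \<forall>x\<in>S. \<bar>u x\<bar> \<le> B" if "u \<in> ?V" "bounded S" for u and S :: "'a set"
 proof -
  have "bounded (u ` closure S)"
   using that polynomials_continuous_on by (intro compact_imp_bounded compact_continuous_image) auto
  then obtain B where "0 < B" "\<forall>y\<in>u ` closure S. norm y \<le> B" by (auto simp: bounded_pos)
  then show ?thesis using closure_subset[of S] by (intro exI[of _ B]) auto
 qed
 have meas: "u \<in> borel_measurable (lebesgue_on ?B)" if "u \<in> ?V" for u
  using polynomials_continuous_on[OF that] by (intro continuous_imp_measurable_on_sets_lebesgue) auto
 have int: "integrable (lebesgue_on ?B) (\<lambda>x. u x * q x)" if u: "u \<in> ?V" and q: "q \<in> ?V" for u q
 proof -
  obtain B1 B2 where "0 \<le> B1" "0 \<le> B2" "\<forall>x\<in>?B. \<bar>u x\<bar> \<le> B1" "\<forall>x\<in>?B. \<bar>q x\<bar> \<le> B2"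
   using bnd[OF u bounded_ball, of 0 \<gamma>] bnd[OF q bounded_ball, of 0 \<gamma>] by blast
  then show ?thesis using meas[OF u] meas[OF q]
   by (intro finite_measure.integrable_const_bound[OF fm, where B = "B1 * B2"])
     (auto simp: abs_mult intro!: AE_I2 mult_mono)
 qed
 have const: "(\<lambda>x. 1) \<in> ?V" by (rule const_in_polynomials)
 have "\<exists>(n::nat) l e. (\<forall>j<n. l j \<in> \<Lambda> \<and> e j \<in> ?V) \<and> (\<forall>i<n. \<forall>j<n. l i (e j) = of_bool (i = j)) \<and>
      (\<forall>u\<in>?V. \<forall>x\<in>UNIV. u x = (\<Sum>j<n. l j u * e j x))"
 proof (rule dual_basis_exists[where I = "multi_indices k" and m = monomial])
  show "(\<lambda>x. u x + c * v x) \<in> ?V" if "u \<in> ?V" "v \<in> ?V" for u v c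
   using polynomials_add[OF that(1) polynomials_lincomb[of "{()}" "\<lambda>_. v" k "\<lambda>_. c"]] that by simp
  show "(\<lambda>x. 0) \<in> ?V" by (rule const_in_polynomials)
  show "\<exists>a. \<forall>x\<in>UNIV. u x = (\<Sum>i\<in>multi_indices k. a i * monomial i x)" if "u \<in> ?V" for u
   using that by (auto simp: polynomials_iff)
  show "l (\<lambda>x. u x + c * v x) = l u + c * l v" if l: "l \<in> \<Lambda>" and u: "u \<in> ?V" and v: "v \<in> ?V" for l u v c
  proof -
   obtain q where q: "q \<in> ?V" "l = (\<lambda>u. \<integral>x. u x * q x \<partial>lebesgue_on ?B)" using l by (auto simp: \<Lambda>_def)
   show ?thesis using int[OF u q(1)] int[OF v q(1)] by (simp add: q(2) distrib_right mult.assoc)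
  qed
  show "u x = 0" if u: "u \<in> ?V" and l0: "\<And>l. l \<in> \<Lambda> ==> l u = 0" for u x
  proof (rule polynomial_zero_of_ball[OF u \<gamma>])
   have i2: "(\<integral>x. u x * u x \<partial>lebesgue_on ?B) = 0" using l0 u by (auto simp: \<Lambda>_def)
   have "AE x in lebesgue_on ?B. u x * u x = 0"
    using integral_nonneg_eq_0_iff_AE[OF int[OF u u]] i2 by simp
   then have ae: "AE x in lebesgue. x \<in> ?B \<longrightarrow> u x = 0"
    by (subst (asm) AE_restrict_space_iff) auto
   fix y assume y: "y \<in> ?B"
   show "u y = 0"
   proof (rule ccontr)
    assume uy: "u y \<noteq> 0"
    define W where "W = {x \<in> ?B. u x \<noteq> 0}"
    have "open W"
    proof -
     have "open (?B \<inter> u -` (- {0}))"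
      using polynomials_continuous_on[OF u] by (intro continuous_open_preimage) auto
     moreover have "W = ?B \<inter> u -` (- {0})" by (auto simp: W_def)
     ultimately show ?thesis by simp
    qed
    moreover have "y \<in> W" using y uy by (simp add: W_def)
    ultimately have "\<not> negligible W" using open_not_negligible by blast
    moreover have "W \<in> null_sets lebesgue"
    proof -
     have "AE x in lebesgue. x \<notin> W" using ae by eventually_elim (auto simp: W_def)
     moreover have "W \<in> sets lebesgue" using \<open>open W\<close> by (auto intro: borel_open)
     ultimately show ?thesis by (simp add: AE_iff_null_sets)
    qed
    ultimately show False by (simp add: negligible_iff_null_sets)
   qed
  qed
  show "l u = l v" if "\<And>x. x \<in> UNIV ==> u x = v x" for l u v
  proof -
   have "u = v" using that by auto
   then show ?thesis by simp
  qed
 qed simp_all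
 then obtain n l e where "\<forall>j<(n::nat). l j \<in> \<Lambda> \<and> e j \<in> ?V" "\<forall>u\<in>?V. \<forall>x\<in>UNIV. u x = (\<Sum>j<n. l j u * e j x)" by blast
 then have le: "\<And>j. j < n ==> l j \<in> \<Lambda>" "\<And>j. j < n ==> e j \<in> ?V"
  and rep: "\<And>u x. u \<in> ?V ==> u x = (\<Sum>j<n. l j u * e j x)" by auto
 have "\<forall>j. \<exists>Q. j < n \<longrightarrow> 0 \<le> Q \<and> (\<forall>u\<in>?V. \<bar>l j u\<bar> \<le> Q * (\<integral>x. \<bar>u x\<bar> \<partial>lebesgue_on ?B))"
 proof (intro allI)
  fix j
  show "\<exists>Q. j < n \<longrightarrow> 0 \<le> Q \<and> (\<forall>u\<in>?V. \<bar>l j u\<bar> \<le> Q * (\<integral>x. \<bar>u x\<bar> \<partial>lebesgue_on ?B))"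
  proof (cases "j < n")
   case True
   then obtain q where q: "q \<in> ?V" "l j = (\<lambda>u. \<integral>x. u x * q x \<partial>lebesgue_on ?B)" using le(1) by (auto simp: \<Lambda>_def)
   obtain Q where Q: "0 \<le> Q" "\<forall>x\<in>?B. \<bar>q x\<bar> \<le> Q" using bnd[OF q(1) bounded_ball] by blast
   have "\<bar>l j u\<bar> \<le> Q * (\<integral>x. \<bar>u x\<bar> \<partial>lebesgue_on ?B)" if u: "u \<in> ?V" for u
   proof -
    have iu: "integrable (lebesgue_on ?B) (\<lambda>x. \<bar>u x\<bar>)" using int[OF u const] by simp
    have "\<bar>l j u\<bar> \<le> (\<integral>x. \<bar>u x * q x\<bar> \<partial>lebesgue_on ?B)" unfolding q(2) by (rule integral_abs_bound)
    also have "\<dots> \<le> (\<integral>x. Q * \<bar>u x\<bar> \<partial>lebesgue_on ?B)"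
    proof (rule integral_mono)
     show "integrable (lebesgue_on ?B) (\<lambda>x. \<bar>u x * q x\<bar>)" using int[OF u q(1)] by (rule integrable_abs)
     show "integrable (lebesgue_on ?B) (\<lambda>x. Q * \<bar>u x\<bar>)" using iu by simp
     fix x assume "x \<in> space (lebesgue_on ?B)"
     then have "\<bar>q x\<bar> \<le> Q" using Q(2) by simp
     from mult_right_mono[OF this, of "\<bar>u x\<bar>"] show "\<bar>u x * q x\<bar> \<le> Q * \<bar>u x\<bar>" by (simp add: abs_mult mult.commute)
    qed
    finally show ?thesis by simp
   qed
   then show ?thesis using Q(1) by blast
  qed simp
 qed
 then obtain Q where Q: "\<And>j. j < n ==> 0 \<le> Q j" "\<And>j u. j < n ==> u \<in> ?V ==> \<bar>l j u\<bar> \<le> Q j * (\<integral>x. \<bar>u x\<bar> \<partial>lebesgue_on ?B)"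
  by metis
 have "\<forall>j. \<exists>P. j < n \<longrightarrow> 0 \<le> P \<and> (\<forall>y\<in>cball 0 1. norm (grad (e j) y) \<le> P)"
 proof (intro allI)
  fix j
  show "\<exists>P. j < n \<longrightarrow> 0 \<le> P \<and> (\<forall>y\<in>cball 0 1. norm (grad (e j) y) \<le> P)"
  proof (cases "j < n")
   case True
   have "\<forall>b\<in>Basis. \<exists>P. 0 \<le> P \<and> (\<forall>y\<in>cball 0 1. \<bar>pderivative b (e j) y\<bar> \<le> P)"
    using bnd[OF pderivative_in_polynomials[OF le(2)[OF True]] bounded_cball] by blast
   then obtain P where P: "\<And>b. b \<in> Basis ==> 0 \<le> P b" "\<And>b y. b \<in> Basis ==> y \<in> cball 0 1 ==> \<bar>pderivative b (e j) y\<bar> \<le> P b"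
    unfolding bchoice_iff by blast
   have "norm (grad (e j) y) \<le> sum P Basis" if "y \<in> cball 0 1" for y
    using norm_le_l1[of "grad (e j) y"] sum_mono[of Basis "\<lambda>b. \<bar>grad (e j) y \<bullet> b\<bar>" P] P(2)[OF _ that]
    by (auto simp: grad_inner_Basis)
   then show ?thesis using P(1) by (intro exI[of _ "sum P Basis"]) (auto intro: sum_nonneg)
  qed simp
 qed
 then obtain P where P: "\<And>j. j < n ==> 0 \<le> P j" "\<And>j y. j < n ==> y \<in> cball 0 1 ==> norm (grad (e j) y) \<le> P j"
  by metis
 have "norm (grad p y) \<le> (\<Sum>j<n. Q j * P j) * (\<integral>x. \<bar>p x\<bar> \<partial>lebesgue_on ?B)"
  if p: "p \<in> ?V" and y: "y \<in> cball 0 1" for p y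
 proof -
  have "p = (\<lambda>x. \<Sum>j<n. l j p * e j x)" using rep[OF p] by (rule ext)
  then have "grad p y = (\<Sum>j<n. l j p *\<^sub>R grad (e j) y)"
   using grad_lincomb(2)[of "{..<n}" e y "\<lambda>j. l j p"] polynomials_differentiable[OF le(2)] by simp
  also have "norm \<dots> \<le> (\<Sum>j<n. \<bar>l j p\<bar> * norm (grad (e j) y))"
   by (rule order_trans[OF norm_sum]) simp
  also have "\<dots> \<le> (\<Sum>j<n. (Q j * (\<integral>x. \<bar>p x\<bar> \<partial>lebesgue_on ?B)) * P j)"
   using Q P p y by (intro sum_mono mult_mono) auto
  also have "\<dots> = (\<Sum>j<n. Q j * P j) * (\<integral>x. \<bar>p x\<bar> \<partial>lebesgue_on ?B)"
   by (simp add: sum_distrib_right mult_ac)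
  finally show ?thesis .
 qed
 moreover have "0 \<le> (\<Sum>j<n. Q j * P j)" using Q(1) P(1) by (intro sum_nonneg) auto
 ultimately show ?thesis by blast
qed

lemma nn_integral_lborel_scale:
 fixes f :: "'a::euclidean_space \<Rightarrow> ennreal"
 assumes f: "f \<in> borel_measurable borel" and h: "0 < h"
 shows "(\<integral>\<^sup>+x. f x \<partial>lborel) = ennreal (h ^ DIM('a)) * (\<integral>\<^sup>+x. f (t + h *\<^sub>R x) \<partial>lborel)"
proof -
 have "(\<integral>\<^sup>+x. f x \<partial>lborel) = (\<integral>\<^sup>+x. f x \<partial>density (distr lborel borel (\<lambda>x. t + h *\<^sub>R x)) (\<lambda>_. \<bar>h\<bar>^DIM('a)))"
  using lborel_affine[of h t] h by simp
 also have "\<dots> = ennreal (h ^ DIM('a)) * (\<integral>\<^sup>+x. f (t + h *\<^sub>R x) \<partial>lborel)"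
  using f h by (simp add: nn_integral_density nn_integral_distr nn_integral_cmult)
 finally show ?thesis .
qed

lemma nn_integral_lborel_translate:
 fixes f :: "'a::euclidean_space \<Rightarrow> ennreal"
 assumes f: "f \<in> borel_measurable borel"
 shows "(\<integral>\<^sup>+x. f (x + t) \<partial>lborel) = (\<integral>\<^sup>+x. f x \<partial>lborel)"
 using nn_integral_lborel_scale[OF f, of 1 t] by (simp add: add.commute)

lemma jensen_powr:
 assumes \<beta>: "1 < \<beta>" and V: "emeasure M (space M) = ennreal V" "0 < V"
  and f: "f \<in> borel_measurable M" "\<And>x. x \<in> space M ==> 0 \<le> f x"
  and m: "0 \<le> m" "ennreal (V * m) \<le> (\<integral>\<^sup>+x. ennreal (f x) \<partial>M)"
 shows "ennreal (V * m powr \<beta>) \<le> (\<integral>\<^sup>+x. ennreal (f x powr \<beta>) \<partial>M)"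
proof -
 define d where "d = \<beta> * m powr (\<beta> - 1)"
 have d: "0 \<le> d" using \<beta> by (simp add: d_def)
 have dm: "d * m = \<beta> * m powr \<beta>" using m(1) \<beta> by (cases "m = 0") (auto simp: d_def powr_diff field_simps)
 have young: "d * t \<le> t powr \<beta> + (\<beta> - 1) * m powr \<beta>" if t: "0 \<le> t" for t
 proof -
  have "t * m powr (\<beta> - 1) \<le> t powr \<beta> / \<beta> + (m powr (\<beta> - 1)) powr (\<beta> / (\<beta> - 1)) / (\<beta> / (\<beta> - 1))"
   using \<beta> t by (intro Youngs_inequality) (auto simp: field_simps)
  also have "(m powr (\<beta> - 1)) powr (\<beta> / (\<beta> - 1)) = m powr \<beta>" using \<beta> by (simp add: powr_powr)
  also have "t powr \<beta> / \<beta> + m powr \<beta> / (\<beta> / (\<beta> - 1)) = (t powr \<beta> + (\<beta> - 1) * m powr \<beta>) / \<beta>" using \<beta> by (simp add: field_simps)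
  finally show ?thesis using \<beta> by (simp add: d_def field_simps)
 qed
 have "ennreal (V * m powr \<beta>) + ennreal (V * ((\<beta> - 1) * m powr \<beta>)) = ennreal (d * (V * m))"
 proof -
  have "d * (V * m) = V * (\<beta> * m powr \<beta>)" unfolding dm[symmetric] by (simp add: mult_ac)
  then have eq: "d * (V * m) = V * m powr \<beta> + V * ((\<beta> - 1) * m powr \<beta>)" by (simp add: algebra_simps)
  show ?thesis unfolding eq using \<beta> V(2) by (intro ennreal_plus[symmetric]) simp_all
 qed
 also have "\<dots> \<le> ennreal d * (\<integral>\<^sup>+x. ennreal (f x) \<partial>M)"
  unfolding ennreal_mult'[OF d] by (rule mult_left_mono[OF m(2)]) simp
 also have "\<dots> = (\<integral>\<^sup>+x. ennreal (d * f x) \<partial>M)"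
  using f(1) d by (simp add: nn_integral_cmult ennreal_mult')
 also have "\<dots> \<le> (\<integral>\<^sup>+x. ennreal (f x powr \<beta>) + ennreal ((\<beta> - 1) * m powr \<beta>) \<partial>M)"
  using young f(2) \<beta> by (intro nn_integral_mono) (simp add: ennreal_plus[symmetric] ennreal_leI del: ennreal_plus)
 also have "\<dots> = (\<integral>\<^sup>+x. ennreal (f x powr \<beta>) \<partial>M) + ennreal (V * ((\<beta> - 1) * m powr \<beta>))"
  using f(1) \<beta> V by (simp add: nn_integral_add ennreal_mult'[symmetric] mult_ac)
 finally show ?thesis by (simp add: add.commute[of "ennreal (V * m powr \<beta>)"] add.commute[of "\<integral>\<^sup>+x. _ x \<partial>M"] ennreal_add_left_cancel_le)
qed

lemma segment_bound:
 fixes v :: "'a::euclidean_space \<Rightarrow> real"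
 assumes B: "convex B" "B \<subseteq> W" and W: "open W"
  and v: "\<And>x. x \<in> W ==> v differentiable (at x)" "continuous_on W (grad v)"
  and y: "y \<in> B" "y + w \<in> B"
 shows "ennreal \<bar>v (y + w) - v y\<bar> \<le>
  ennreal (norm w) * (\<integral>\<^sup>+s. ennreal (norm (grad v (y + s *\<^sub>R w))) * indicator B (y + s *\<^sub>R w) * indicator {0..1} s \<partial>lborel)"
proof -
 have inB: "y + s *\<^sub>R w \<in> B" if "s \<in> {0..1}" for s
 proof -
  have "(1 - s) *\<^sub>R y + s *\<^sub>R (y + w) \<in> B" using that y by (intro convexD[OF B(1)]) auto
  then show ?thesis by (simp add: algebra_simps)
 qed
 have cg: "continuous_on {0..1} (\<lambda>s. grad v (y + s *\<^sub>R w))"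
  using inB B(2) by (intro continuous_on_compose2[OF v(2)] continuous_intros) auto
 have "((\<lambda>s. grad v (y + s *\<^sub>R w) \<bullet> w) has_integral v (y + 1 *\<^sub>R w) - v (y + 0 *\<^sub>R w)) {0..1}"
 proof (rule fundamental_theorem_of_calculus)
  fix s :: real assume s: "s \<in> {0..1}"
  have "((\<lambda>s. v (y + s *\<^sub>R w)) has_derivative (\<lambda>h. grad v (y + s *\<^sub>R w) \<bullet> (h *\<^sub>R w))) (at s)"
   using has_derivative_grad[OF v(1)] inB[OF s] B(2)
   by (intro has_derivative_compose[of "\<lambda>s. y + s *\<^sub>R w" "\<lambda>h. h *\<^sub>R w" s UNIV v]) (auto intro!: derivative_eq_intros)
  then show "((\<lambda>s. v (y + s *\<^sub>R w)) has_vector_derivative grad v (y + s *\<^sub>R w) \<bullet> w) (at s within {0..1})"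
   unfolding has_vector_derivative_def by (rule has_derivative_at_withinI[OF has_derivative_eq_rhs]) auto
 qed simp
 then have I: "integral {0..1} (\<lambda>s. grad v (y + s *\<^sub>R w) \<bullet> w) = v (y + w) - v y" by (simp add: integral_unique)
 have "norm (integral {0..1} (\<lambda>s. grad v (y + s *\<^sub>R w) \<bullet> w)) \<le> integral {0..1} (\<lambda>s. norm (grad v (y + s *\<^sub>R w)) * norm w)"
  by (rule integral_norm_bound_integral)
    (auto intro!: integrable_continuous_interval continuous_intros cg simp: Cauchy_Schwarz_ineq2)
 then have le: "\<bar>v (y + w) - v y\<bar> \<le> norm w * integral {0..1} (\<lambda>s. norm (grad v (y + s *\<^sub>R w)))"
  unfolding I by (simp add: mult.commute)
 have "(\<integral>\<^sup>+s. ennreal (norm (grad v (y + s *\<^sub>R w))) * indicator {0..1} s \<partial>lborel) = ennreal (integral {0..1} (\<lambda>s. norm (grad v (y + s *\<^sub>R w))))"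
  by (rule nn_integral_has_integral_lebesgue')
    (auto intro!: integrable_integral integrable_continuous_interval continuous_intros cg)
 moreover have "(\<integral>\<^sup>+s. ennreal (norm (grad v (y + s *\<^sub>R w))) * indicator B (y + s *\<^sub>R w) * indicator {0..1} s \<partial>lborel)
   = (\<integral>\<^sup>+s. ennreal (norm (grad v (y + s *\<^sub>R w))) * indicator {0..1} s \<partial>lborel)"
  using inB by (intro nn_integral_cong) (auto simp: indicator_def)
 ultimately show ?thesis using ennreal_leI[OF le] by (simp add: ennreal_mult')
qed

text \<open>Averaging the segment bound over all pairs of points; the substitution \<open>x = y + w\<close> makes the inner
 integral translation invariant.\<close>

lemma poincare_ball:
 fixes v :: "'a::euclidean_space \<Rightarrow> real" and x0 :: 'a and r :: real
 defines "B \<equiv> ball x0 r"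
 assumes W: "open W" "B \<subseteq> W" and r: "0 \<le> r"
  and v: "\<And>x. x \<in> W ==> v differentiable (at x)" "continuous_on W (grad v)"
 shows "(\<integral>\<^sup>+y\<in>B. (\<integral>\<^sup>+x\<in>B. ennreal \<bar>v x - v y\<bar> \<partial>lborel) \<partial>lborel) \<le>
  ennreal (2 * r) * emeasure lborel (ball (0::'a) (2 * r)) * (\<integral>\<^sup>+x\<in>B. ennreal (norm (grad v x)) \<partial>lborel)"
proof -
 have vc: "continuous_on W v"
  using v(1) by (intro continuous_at_imp_continuous_on ballI differentiable_imp_continuous_within) auto
 define vB where "vB x = indicator B x *\<^sub>R v x" for x
 define g where "g x = ennreal (norm (indicator B x *\<^sub>R grad v x))" for x
 have Bb[measurable]: "B \<in> sets borel" by (simp add: B_def)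
 have vB[measurable]: "vB \<in> borel_measurable borel" unfolding vB_def[abs_def]
  by (rule borel_measurable_continuous_on_indicator[OF Bb continuous_on_subset[OF vc W(2)]])
 have gg: "(\<lambda>x. indicator B x *\<^sub>R grad v x) \<in> borel_measurable borel"
  by (rule borel_measurable_continuous_on_indicator[OF Bb continuous_on_subset[OF v(2) W(2)]])
 then have g[measurable]: "g \<in> borel_measurable borel" unfolding g_def[abs_def] by measurable
 let ?D = "ball (0::'a) (2 * r)"
 let ?J = "\<lambda>y w. \<integral>\<^sup>+s. g (y + s *\<^sub>R w) * indicator {0..1::real} s \<partial>lborel"
 have gI: "g x = ennreal (norm (grad v x)) * indicator B x" for x by (auto simp: g_def indicator_def)
 have "(\<integral>\<^sup>+y\<in>B. (\<integral>\<^sup>+x\<in>B. ennreal \<bar>v x - v y\<bar> \<partial>lborel) \<partial>lborel)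
   = (\<integral>\<^sup>+y. (\<integral>\<^sup>+x. ennreal \<bar>vB x - vB y\<bar> * indicator B x * indicator B y \<partial>lborel) \<partial>lborel)"
 proof (rule nn_integral_cong)
  fix y :: 'a
  have "(\<integral>\<^sup>+x\<in>B. ennreal \<bar>v x - v y\<bar> \<partial>lborel) = (\<integral>\<^sup>+x. ennreal \<bar>vB x - vB y\<bar> * indicator B x * indicator B y \<partial>lborel)"
   if "y \<in> B" using that by (intro nn_integral_cong) (auto simp: indicator_def vB_def)
  then show "(\<integral>\<^sup>+x\<in>B. ennreal \<bar>v x - v y\<bar> \<partial>lborel) * indicator B y =
    (\<integral>\<^sup>+x. ennreal \<bar>vB x - vB y\<bar> * indicator B x * indicator B y \<partial>lborel)"
   by (cases "y \<in> B") auto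
 qed
 also have "\<dots> = (\<integral>\<^sup>+y. (\<integral>\<^sup>+w. ennreal \<bar>vB (w + y) - vB y\<bar> * indicator B (w + y) * indicator B y \<partial>lborel) \<partial>lborel)"
  by (rule nn_integral_cong, subst nn_integral_lborel_translate[symmetric]) auto
 also have "\<dots> \<le> (\<integral>\<^sup>+y. (\<integral>\<^sup>+w. ennreal (2 * r) * indicator ?D w * ?J y w \<partial>lborel) \<partial>lborel)"
 proof (rule nn_integral_mono, rule nn_integral_mono)
  fix y w :: 'a
  show "ennreal \<bar>vB (w + y) - vB y\<bar> * indicator B (w + y) * indicator B y \<le>
   ennreal (2 * r) * indicator ?D w * ?J y w"
  proof (cases "y \<in> B \<and> y + w \<in> B")
   case True
   have "norm w \<le> dist x0 (y + w) + dist x0 y"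
    using norm_triangle_ineq4[of "y + w - x0" "y - x0"] by (simp add: dist_norm norm_minus_commute)
   then have w: "norm w < 2 * r" using True by (simp add: B_def)
   have "ennreal \<bar>v (y + w) - v y\<bar> \<le> ennreal (norm w) * (\<integral>\<^sup>+s. g (y + s *\<^sub>R w) * indicator {0..1} s \<partial>lborel)"
    unfolding gI by (rule segment_bound[of B W]) (use True W v in \<open>auto simp: B_def\<close>)
   also have "\<dots> \<le> ennreal (2 * r) * (\<integral>\<^sup>+s. g (y + s *\<^sub>R w) * indicator {0..1} s \<partial>lborel)"
    using w by (intro mult_right_mono ennreal_leI) auto
   finally show ?thesis using True w by (simp add: vB_def add.commute)
  qed (auto simp: indicator_def add.commute)
 qed
 also have "\<dots> = (\<integral>\<^sup>+w. (\<integral>\<^sup>+y. ennreal (2 * r) * indicator ?D w * ?J y w \<partial>lborel) \<partial>lborel)"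
 proof (rule lborel_pair.Fubini')
  have [measurable]: "(\<lambda>x. indicator ?D (snd x) :: ennreal) \<in> borel_measurable (lborel \<Otimes>\<^sub>M lborel)"
   by (rule measurable_compose[OF measurable_snd borel_measurable_indicator]) simp
  have "(\<lambda>z. g (fst (fst z) + snd z *\<^sub>R snd (fst z))) \<in> borel_measurable ((lborel \<Otimes>\<^sub>M lborel) \<Otimes>\<^sub>M (lborel :: real measure))"
   by (rule measurable_compose[OF _ g]) measurable
  moreover have "(\<lambda>z. indicator {0..1::real} (snd z) :: ennreal) \<in> borel_measurable ((lborel \<Otimes>\<^sub>M lborel) \<Otimes>\<^sub>M (lborel :: real measure))"
   by (rule measurable_compose[OF measurable_snd]) simp
  ultimately have "(\<lambda>z. g (fst (fst z) + snd z *\<^sub>R snd (fst z)) * indicator {0..1::real} (snd z))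
    \<in> borel_measurable ((lborel \<Otimes>\<^sub>M lborel) \<Otimes>\<^sub>M lborel)" by (rule borel_measurable_times_ennreal)
  then have [measurable]: "(\<lambda>x. \<integral>\<^sup>+s. g (fst x + s *\<^sub>R snd x) * indicator {0..1::real} s \<partial>lborel) \<in> borel_measurable (lborel \<Otimes>\<^sub>M lborel)"
   by (intro lborel.borel_measurable_nn_integral) (simp add: case_prod_beta)
  have "(\<lambda>x. ennreal (2 * r) * indicator ?D (fst x) * (\<integral>\<^sup>+s. g (snd x + s *\<^sub>R fst x) * indicator {0..1::real} s \<partial>lborel))
   \<in> borel_measurable (lborel \<Otimes>\<^sub>M lborel)"
  proof -
   have "(\<lambda>x. ennreal (2 * r) * indicator ?D (snd x) * (\<integral>\<^sup>+s. g (fst x + s *\<^sub>R snd x) * indicator {0..1::real} s \<partial>lborel))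
    \<in> borel_measurable (lborel \<Otimes>\<^sub>M lborel)" by measurable
   from measurable_compose[OF measurable_pair_swap' this] show ?thesis by (simp add: case_prod_beta)
  qed
  then show "(\<lambda>(w, y). ennreal (2 * r) * indicator ?D w * ?J y w)
   \<in> borel_measurable (lborel \<Otimes>\<^sub>M lborel)" by (simp add: case_prod_beta)
 qed
 also have "\<dots> = (\<integral>\<^sup>+w. ennreal (2 * r) * indicator ?D w * integral\<^sup>N lborel g \<partial>lborel)"
 proof (rule nn_integral_cong)
  fix w :: 'a
  have "(\<integral>\<^sup>+y. ?J y w \<partial>lborel)
    = (\<integral>\<^sup>+s. (\<integral>\<^sup>+y. g (y + s *\<^sub>R w) * indicator {0..1::real} s \<partial>lborel) \<partial>lborel)"
   by (rule lborel_pair.Fubini'[symmetric]) measurable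
  also have "\<dots> = (\<integral>\<^sup>+s. integral\<^sup>N lborel g * indicator {0..1::real} s \<partial>lborel)"
  proof (rule nn_integral_cong)
   fix s :: real
   show "(\<integral>\<^sup>+y. g (y + s *\<^sub>R w) * indicator {0..1::real} s \<partial>lborel) = integral\<^sup>N lborel g * indicator {0..1::real} s"
    by (subst nn_integral_multc) (auto simp: nn_integral_lborel_translate)
  qed
  also have "\<dots> = integral\<^sup>N lborel g" by (simp add: nn_integral_cmult)
  finally show "(\<integral>\<^sup>+y. ennreal (2 * r) * indicator ?D w * ?J y w \<partial>lborel)
    = ennreal (2 * r) * indicator ?D w * integral\<^sup>N lborel g"
   by (subst nn_integral_cmult) auto
 qed
 also have "\<dots> = ennreal (2 * r) * emeasure lborel ?D * integral\<^sup>N lborel g"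
 proof -
  have "(\<integral>\<^sup>+w. ennreal (2 * r) * indicator ?D w * integral\<^sup>N lborel g \<partial>lborel)
    = (\<integral>\<^sup>+w. (ennreal (2 * r) * integral\<^sup>N lborel g) * indicator ?D w \<partial>lborel)"
   by (simp add: mult_ac)
  also have "\<dots> = (ennreal (2 * r) * integral\<^sup>N lborel g) * emeasure lborel ?D"
   by (rule nn_integral_cmult_indicator) simp
  finally show ?thesis by (simp add: mult_ac)
 qed
 finally show ?thesis by (simp add: gI[abs_def])
qed

lemma polynomial_gradient_bound_scaled:
 assumes \<gamma>: "0 < \<gamma>"
 shows "\<exists>C\<ge>0. \<forall>p\<in>polynomials k. \<forall>h>0. \<forall>x0. \<forall>z\<in>cball (x0::'a::euclidean_space) h. \<forall>c.
   ennreal (h * h ^ DIM('a) * norm (grad p z)) \<le> ennreal C * (\<integral>\<^sup>+x\<in>ball x0 (\<gamma> * h). ennreal \<bar>p x - c\<bar> \<partial>lborel)"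
proof -
 obtain C where C: "0 \<le> C" "\<And>p y. p \<in> polynomials k ==> y \<in> cball (0::'a) 1 ==>
   norm (grad p y) \<le> C * (\<integral>x. \<bar>p x\<bar> \<partial>lebesgue_on (ball 0 \<gamma>))"
  using polynomial_gradient_bound[OF \<gamma>, of k, where 'a = 'a] by blast
 have "ennreal (h * h ^ DIM('a) * norm (grad p z)) \<le> ennreal C * (\<integral>\<^sup>+x\<in>ball x0 (\<gamma> * h). ennreal \<bar>p x - c\<bar> \<partial>lborel)"
  if p: "p \<in> polynomials k" and h: "0 < h" and z: "z \<in> cball (x0::'a) h" for p h x0 z c
 proof -
  define q where "q y = p (x0 + h *\<^sub>R y) - c" for y
  define y where "y = (z - x0) /\<^sub>R h"
  let ?Q = "\<integral>\<^sup>+x. ennreal \<bar>q x\<bar> * indicator (ball 0 \<gamma>) x \<partial>lborel"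
  let ?P = "\<integral>\<^sup>+x\<in>ball x0 (\<gamma> * h). ennreal \<bar>p x - c\<bar> \<partial>lborel"
  have zy: "z = x0 + h *\<^sub>R y" using h by (simp add: y_def)
  have "norm y = norm (z - x0) / h" using h by (simp add: y_def divide_inverse mult.commute)
  then have y1: "y \<in> cball 0 1" using z h by (simp add: dist_norm norm_minus_commute)
  have "(\<lambda>y. p (x0 + h *\<^sub>R y) + - c) \<in> polynomials k"
   by (rule polynomials_add[OF polynomials_affine[OF p] const_in_polynomials])
  then have q: "q \<in> polynomials k" by (simp add: q_def[abs_def])
  have qc: "continuous_on S q" for S using polynomials_continuous_on[OF q] by (rule continuous_on_subset) (rule subset_UNIV)
  have pc: "continuous_on UNIV p" using polynomials_continuous_on[OF p] .
  have "(q has_derivative (\<lambda>e. grad p (x0 + h *\<^sub>R y) \<bullet> (h *\<^sub>R e))) (at y)"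
  proof -
   have "((\<lambda>y. p (x0 + h *\<^sub>R y)) has_derivative (\<lambda>e. grad p (x0 + h *\<^sub>R y) \<bullet> (h *\<^sub>R e))) (at y)"
    using has_derivative_grad[OF polynomials_differentiable[OF p]]
    by (intro has_derivative_compose[of "\<lambda>y. x0 + h *\<^sub>R y" "\<lambda>e. h *\<^sub>R e" y UNIV p]) (auto intro!: derivative_eq_intros)
   then show ?thesis unfolding q_def[abs_def] by (auto intro!: derivative_eq_intros)
  qed
  then have gq: "grad q y = h *\<^sub>R grad p z" unfolding zy by (intro grad_eqI) simp
  have fm: "finite_measure (lebesgue_on (ball (0::'a) \<gamma>))" by (rule finite_measure_lebesgue_on) simp
  have iq: "integrable (lebesgue_on (ball 0 \<gamma>)) (\<lambda>x. \<bar>q x\<bar>)"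
  proof -
   have "bounded (q ` cball 0 \<gamma>)" by (intro compact_imp_bounded compact_continuous_image qc) auto
   then obtain b where "\<forall>y\<in>q ` cball 0 \<gamma>. norm y \<le> b" by (auto simp: bounded_iff)
   then show ?thesis
    by (intro finite_measure.integrable_const_bound[OF fm, where B = b] AE_I2 borel_measurable_abs
      continuous_imp_measurable_on_sets_lebesgue qc) auto
  qed
  have "ennreal (h * norm (grad p z)) \<le> ennreal (C * (\<integral>x. \<bar>q x\<bar> \<partial>lebesgue_on (ball 0 \<gamma>)))"
   using C(2)[OF q y1] h by (intro ennreal_leI) (simp add: gq)
  also have "\<dots> = ennreal C * (\<integral>\<^sup>+x. ennreal \<bar>q x\<bar> \<partial>lebesgue_on (ball 0 \<gamma>))"
   using C(1) iq by (simp add: ennreal_mult' nn_integral_eq_integral)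
  also have "(\<integral>\<^sup>+x. ennreal \<bar>q x\<bar> \<partial>lebesgue_on (ball 0 \<gamma>)) = ?Q"
   by (simp add: nn_integral_restrict_space nn_integral_completion borel_measurable_continuous_onI[OF qc])
  finally have 1: "ennreal (h * norm (grad p z)) \<le> ennreal C * ?Q" .
  have "?P
    = ennreal (h ^ DIM('a)) * (\<integral>\<^sup>+x. ennreal \<bar>p (x0 + h *\<^sub>R x) - c\<bar> * indicator (ball x0 (\<gamma> * h)) (x0 + h *\<^sub>R x) \<partial>lborel)"
  proof (rule nn_integral_lborel_scale[OF _ h])
   have [measurable]: "p \<in> borel_measurable borel" by (rule borel_measurable_continuous_onI[OF pc])
   have [measurable]: "ball x0 (\<gamma> * h) \<in> sets borel" by simp
   show "(\<lambda>x. ennreal \<bar>p x - c\<bar> * indicator (ball x0 (\<gamma> * h)) x) \<in> borel_measurable borel" by measurable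
  qed
  also have "(\<integral>\<^sup>+x. ennreal \<bar>p (x0 + h *\<^sub>R x) - c\<bar> * indicator (ball x0 (\<gamma> * h)) (x0 + h *\<^sub>R x) \<partial>lborel)
    = ?Q"
   using h by (intro nn_integral_cong) (auto simp: q_def indicator_def dist_norm mult.commute)
  finally have 2: "?P
    = ennreal (h ^ DIM('a)) * ?Q" .
  have "ennreal (h * h ^ DIM('a) * norm (grad p z)) = ennreal (h ^ DIM('a)) * ennreal (h * norm (grad p z))"
   using h by (simp add: ennreal_mult'[symmetric] mult_ac)
  also have "\<dots> \<le> ennreal (h ^ DIM('a)) * (ennreal C * ?Q)"
   by (rule mult_left_mono[OF 1]) simp
  finally show ?thesis unfolding 2 by (simp add: mult_ac)
 qed
 then show ?thesis using C(1) by blast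
qed

definition gradient_control :: "real \<Rightarrow> real \<Rightarrow> real \<Rightarrow> ('a::euclidean_space \<Rightarrow> real) \<Rightarrow> bool" where
 "gradient_control \<gamma> \<beta> C p \<longleftrightarrow> (\<forall>h>0. \<forall>x0 E v W. E \<in> sets borel \<and> E \<subseteq> cball x0 h \<and> open W \<and> ball x0 (\<gamma> * h) \<subseteq> W \<and>
   (\<forall>x\<in>W. v differentiable (at x)) \<and> continuous_on W (grad v) \<longrightarrow>
   (\<integral>\<^sup>+z\<in>E. ennreal (norm (grad p z) powr \<beta>) \<partial>lborel)
    \<le> ennreal C * (\<integral>\<^sup>+x\<in>ball x0 (\<gamma> * h). ennreal ((\<bar>p x - v x\<bar> / h) powr \<beta> + norm (grad v x) powr \<beta>) \<partial>lborel))"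

lemma element_gradient_estimate:
 assumes \<gamma>: "0 < \<gamma>" and \<beta>: "1 < \<beta>"
 shows "\<exists>C\<ge>0. \<forall>p\<in>polynomials k. gradient_control \<gamma> \<beta> C (p :: 'a::euclidean_space \<Rightarrow> real)"
proof -
 obtain C where C: "0 \<le> C" "\<And>p h x0 z c. p \<in> polynomials k ==> 0 < h ==> z \<in> cball (x0::'a) h ==>
   ennreal (h * h ^ DIM('a) * norm (grad p z)) \<le> ennreal C * (\<integral>\<^sup>+x\<in>ball x0 (\<gamma> * h). ennreal \<bar>p x - c\<bar> \<partial>lborel)"
  using polynomial_gradient_bound_scaled[OF \<gamma>, of k, where 'a = 'a] by blast
 define \<omega> where "\<omega> = unit_ball_vol (real DIM('a))"
 have \<omega>: "0 < \<omega>" by (simp add: \<omega>_def)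
 define c2 where "c2 = 2 * \<gamma> * 2 ^ DIM('a)"
 have c2: "0 \<le> c2" using \<gamma> by (simp add: c2_def)
 define K where "K = C * \<omega> * \<gamma> ^ DIM('a) + 1"
 have K: "0 < K" using C(1) \<omega> \<gamma> by (auto simp: K_def intro!: add_nonneg_pos)
 define c3 where "c3 = 2 powr \<beta> * (1 + c2) powr \<beta>"
 have c3: "0 \<le> c3" by (simp add: c3_def)
 define C' where "C' = K powr \<beta> / \<gamma> ^ DIM('a) * c3"
 have "(\<integral>\<^sup>+z\<in>E. ennreal (norm (grad p z) powr \<beta>) \<partial>lborel)
    \<le> ennreal C' * (\<integral>\<^sup>+x\<in>ball x0 (\<gamma> * h). ennreal ((\<bar>p x - v x\<bar> / h) powr \<beta> + norm (grad v x) powr \<beta>) \<partial>lborel)"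
  if p: "p \<in> polynomials k" and h: "0 < h" and E: "E \<in> sets borel" "E \<subseteq> cball x0 h" and W: "open W" "ball x0 (\<gamma> * h) \<subseteq> W"
   and v: "\<And>x. x \<in> W ==> v differentiable (at x)" "continuous_on W (grad v)"
  for p h x0 E W and v :: "'a \<Rightarrow> real"
 proof -
  define B where "B = ball x0 (\<gamma> * h)"
  have Bb[measurable]: "B \<in> sets borel" by (simp add: B_def)
  have gh: "0 < \<gamma> * h" using \<gamma> h by simp
  define V where "V = \<omega> * (\<gamma> * h) ^ DIM('a)"
  have V: "0 < V" using \<omega> gh by (simp add: V_def)
  have eB: "emeasure lborel B = ennreal V" unfolding B_def V_def \<omega>_def using gh by (intro emeasure_ball) simp
  have vc: "continuous_on W v"
   using v(1) by (intro continuous_at_imp_continuous_on ballI differentiable_imp_continuous_within) auto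
  have pm[measurable]: "p \<in> borel_measurable borel"
   by (intro borel_measurable_continuous_onI polynomials_continuous_on[OF p])
  define vB where "vB x = indicator B x *\<^sub>R v x" for x
  define gB where "gB x = norm (indicator B x *\<^sub>R grad v x)" for x
  have WB: "B \<subseteq> W" using W by (simp add: B_def)
  have vB[measurable]: "vB \<in> borel_measurable borel" unfolding vB_def[abs_def]
   by (rule borel_measurable_continuous_on_indicator[OF Bb continuous_on_subset[OF vc WB]])
  have "(\<lambda>x. indicator B x *\<^sub>R grad v x) \<in> borel_measurable borel"
   by (rule borel_measurable_continuous_on_indicator[OF Bb continuous_on_subset[OF v(2) WB]])
  then have gB[measurable]: "gB \<in> borel_measurable borel" unfolding gB_def[abs_def] by measurable
  define F where "F x = \<bar>p x - vB x\<bar> / h + c2 * gB x" for x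
  have F0: "0 \<le> F x" for x using h c2 by (simp add: F_def gB_def)
  have Fm[measurable]: "F \<in> borel_measurable borel" unfolding F_def[abs_def] by measurable
  let ?Ip = "\<integral>\<^sup>+x\<in>B. ennreal \<bar>p x - vB x\<bar> \<partial>lborel" and ?Ig = "\<integral>\<^sup>+x\<in>B. ennreal (gB x) \<partial>lborel"
  let ?IF = "\<integral>\<^sup>+x\<in>B. ennreal (F x) \<partial>lborel" and ?IFb = "\<integral>\<^sup>+x\<in>B. ennreal (F x powr \<beta>) \<partial>lborel"
  let ?Iv = "\<integral>\<^sup>+y\<in>B. (\<integral>\<^sup>+x\<in>B. ennreal \<bar>v x - v y\<bar> \<partial>lborel) \<partial>lborel"
  let ?W = "\<lambda>y. \<integral>\<^sup>+x. ennreal \<bar>vB x - vB y\<bar> * indicator B x * indicator B y \<partial>lborel"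
  let ?P = "\<integral>\<^sup>+z\<in>E. ennreal (norm (grad p z) powr \<beta>) \<partial>lborel"
  have key: "ennreal (V * (norm (grad p z) / K)) \<le> ?IF" if z: "z \<in> E" for z
  proof -
   let ?hg = "ennreal (h * h ^ DIM('a) * norm (grad p z))"
   have zc: "z \<in> cball x0 h" using z E by blast
   have "?hg * ennreal V = (\<integral>\<^sup>+y\<in>B. ?hg \<partial>lborel)"
    by (simp add: nn_integral_cmult_indicator eB)
   also have "\<dots> \<le> (\<integral>\<^sup>+y. ennreal C * (?Ip * indicator B y + ?W y) \<partial>lborel)"
   proof (rule nn_integral_mono)
    fix y
    show "?hg * indicator B y \<le>
     ennreal C * (?Ip * indicator B y + ?W y)"
    proof (cases "y \<in> B")
     case True
     have "(\<integral>\<^sup>+x\<in>B. ennreal \<bar>p x - vB y\<bar> \<partial>lborel)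
       \<le> (\<integral>\<^sup>+x. ennreal \<bar>p x - vB x\<bar> * indicator B x + ennreal \<bar>vB x - vB y\<bar> * indicator B x \<partial>lborel)"
     proof (rule nn_integral_mono)
      fix x
      have "ennreal \<bar>p x - vB y\<bar> \<le> ennreal \<bar>p x - vB x\<bar> + ennreal \<bar>vB x - vB y\<bar>"
       unfolding ennreal_plus[symmetric, OF abs_ge_zero abs_ge_zero] by (rule ennreal_leI) linarith
      then show "ennreal \<bar>p x - vB y\<bar> * indicator B x \<le> ennreal \<bar>p x - vB x\<bar> * indicator B x + ennreal \<bar>vB x - vB y\<bar> * indicator B x"
       by (auto simp: indicator_def)
     qed
     also have "\<dots> = ?Ip + (\<integral>\<^sup>+x\<in>B. ennreal \<bar>vB x - vB y\<bar> \<partial>lborel)" by (rule nn_integral_add) measurable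
     finally have "ennreal C * (\<integral>\<^sup>+x\<in>B. ennreal \<bar>p x - vB y\<bar> \<partial>lborel) \<le> ennreal C * (?Ip + (\<integral>\<^sup>+x\<in>B. ennreal \<bar>vB x - vB y\<bar> \<partial>lborel))"
      by (rule mult_left_mono) simp
     with C(2)[OF p h zc, of "vB y"] show ?thesis using True by (simp add: B_def[symmetric])
    qed simp
   qed
   also have "\<dots> = ennreal C * (?Ip * ennreal V + (\<integral>\<^sup>+y. ?W y \<partial>lborel))"
   proof -
    have m: "(\<lambda>y. \<integral>\<^sup>+x. ennreal \<bar>vB x - vB y\<bar> * indicator B x * indicator B y \<partial>lborel) \<in> borel_measurable lborel"
     by (intro lborel.borel_measurable_nn_integral) measurable
    show ?thesis
     by (subst nn_integral_cmult, use m in measurable, subst nn_integral_add, use m in \<open>simp_all add: nn_integral_cmult_indicator eB\<close>)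
   qed
   also have "(\<integral>\<^sup>+y. ?W y \<partial>lborel)
     = ?Iv"
   proof (rule nn_integral_cong)
    fix y
    have "(\<integral>\<^sup>+x\<in>B. ennreal \<bar>v x - v y\<bar> \<partial>lborel) = ?W y"
     if "y \<in> B" using that by (intro nn_integral_cong) (auto simp: indicator_def vB_def)
    then show "?W y
      = (\<integral>\<^sup>+x\<in>B. ennreal \<bar>v x - v y\<bar> \<partial>lborel) * indicator B y"
     by (cases "y \<in> B") auto
   qed
   finally have 1: "?hg * ennreal V \<le>
    ennreal C * (?Ip * ennreal V + ?Iv)" .
   have "?Iv
     \<le> ennreal (2 * (\<gamma> * h)) * emeasure lborel (ball (0::'a) (2 * (\<gamma> * h))) * (\<integral>\<^sup>+x\<in>B. ennreal (norm (grad v x)) \<partial>lborel)"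
    unfolding B_def using W gh v by (intro poincare_ball) auto
   also have "(\<integral>\<^sup>+x\<in>B. ennreal (norm (grad v x)) \<partial>lborel) = ?Ig"
    by (rule nn_integral_cong) (auto simp: gB_def indicator_def)
   also have "ennreal (2 * (\<gamma> * h)) * emeasure lborel (ball (0::'a) (2 * (\<gamma> * h))) = ennreal V * ennreal (h * c2)"
   proof -
    have "2 * (\<gamma> * h) * (\<omega> * (2 * (\<gamma> * h)) ^ DIM('a)) = V * (h * c2)"
     by (simp add: V_def c2_def power_mult_distrib)
    then have "ennreal (2 * (\<gamma> * h)) * ennreal (\<omega> * (2 * (\<gamma> * h)) ^ DIM('a)) = ennreal V * ennreal (h * c2)"
     using gh V by (simp only: ennreal_mult'[symmetric] mult_nonneg_nonneg less_imp_le zero_le_numeral)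
    then show ?thesis using gh by (subst emeasure_ball) (auto simp: \<omega>_def)
   qed
   finally have 2: "?Iv \<le> ennreal V * ennreal (h * c2) * ?Ig" .
   have "?hg * ennreal V \<le> ennreal C * (?Ip * ennreal V + ennreal V * ennreal (h * c2) * ?Ig)"
    by (rule order_trans[OF 1]) (intro mult_left_mono add_left_mono 2, simp)
   also have "\<dots> = (ennreal C * (?Ip + ennreal (h * c2) * ?Ig)) * ennreal V" by (simp only: distrib_left distrib_right ac_simps)
   finally have "ennreal V * ?hg \<le> ennreal V * (ennreal C * (?Ip + ennreal (h * c2) * ?Ig))"
    by (simp only: mult.commute)
   then have "?hg \<le> ennreal C * (?Ip + ennreal (h * c2) * ?Ig)"
    using V by (subst (asm) ennreal_mult_le_mult_iff) auto
   also have "?Ip + ennreal (h * c2) * ?Ig = ennreal h * ?IF"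
   proof -
    have "ennreal h * ?IF = (\<integral>\<^sup>+x. ennreal h * (ennreal (F x) * indicator B x) \<partial>lborel)"
     by (rule nn_integral_cmult[symmetric]) measurable
    also have "\<dots> = (\<integral>\<^sup>+x. ennreal \<bar>p x - vB x\<bar> * indicator B x + ennreal (h * c2) * (ennreal (gB x) * indicator B x) \<partial>lborel)"
    proof (rule nn_integral_cong)
     fix x
     have "h * F x = \<bar>p x - vB x\<bar> + h * c2 * gB x" using h by (simp add: F_def algebra_simps)
     then have "ennreal h * ennreal (F x) = ennreal \<bar>p x - vB x\<bar> + ennreal (h * c2) * ennreal (gB x)"
      using h c2 by (simp add: ennreal_mult'[symmetric] ennreal_plus gB_def)
     then show "ennreal h * (ennreal (F x) * indicator B x) = ennreal \<bar>p x - vB x\<bar> * indicator B x + ennreal (h * c2) * (ennreal (gB x) * indicator B x)"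
      by (auto simp: indicator_def)
    qed
    also have "\<dots> = ?Ip + ennreal (h * c2) * ?Ig"
     by (subst nn_integral_add, measurable, subst nn_integral_cmult) auto
    finally show ?thesis by simp
   qed
   also have "?hg = ennreal h * ennreal (h ^ DIM('a) * norm (grad p z))"
    using h by (subst ennreal_mult[symmetric]) (auto simp: mult_ac)
   also have "ennreal C * (ennreal h * ?IF) = ennreal h * (ennreal C * ?IF)"
    by (rule mult.left_commute)
   finally have A: "ennreal (h ^ DIM('a) * norm (grad p z)) \<le> ennreal C * ?IF"
    using h by (subst (asm) ennreal_mult_le_mult_iff) auto
   have "ennreal K * ennreal (V * (norm (grad p z) / K)) = ennreal (\<omega> * \<gamma> ^ DIM('a)) * ennreal (h ^ DIM('a) * norm (grad p z))"
   proof -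
    have "K * (V * (norm (grad p z) / K)) = \<omega> * \<gamma> ^ DIM('a) * (h ^ DIM('a) * norm (grad p z))"
     using K by (simp add: V_def power_mult_distrib)
    then show ?thesis using K V \<omega> \<gamma> h by (simp add: ennreal_mult'[symmetric])
   qed
   also have "\<dots> \<le> ennreal (\<omega> * \<gamma> ^ DIM('a)) * (ennreal C * ?IF)"
    by (rule mult_left_mono[OF A]) simp
   also have "\<dots> = ennreal (C * \<omega> * \<gamma> ^ DIM('a)) * ?IF"
   proof -
    have "ennreal (\<omega> * \<gamma> ^ DIM('a)) * ennreal C = ennreal (C * \<omega> * \<gamma> ^ DIM('a))"
     using C(1) \<omega> \<gamma> by (subst ennreal_mult[symmetric]) (auto simp: mult_ac)
    then show ?thesis by (simp only: mult.assoc[symmetric])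
   qed
   also have "\<dots> \<le> ennreal K * ?IF"
    by (intro mult_right_mono ennreal_leI) (auto simp: K_def)
   finally show ?thesis using K by (subst (asm) ennreal_mult_le_mult_iff) auto
  qed
  have key2: "ennreal (norm (grad p z) powr \<beta>) \<le> ennreal (K powr \<beta> / V) * ?IFb" if z: "z \<in> E" for z
  proof -
   let ?M = "restrict_space lborel B"
   have conv: "(\<integral>\<^sup>+x. f x \<partial>?M) = (\<integral>\<^sup>+x\<in>B. f x \<partial>lborel)" for f :: "'a \<Rightarrow> ennreal"
    by (subst nn_integral_restrict_space) auto
   have "ennreal (V * (norm (grad p z) / K) powr \<beta>) \<le> (\<integral>\<^sup>+x. ennreal (F x powr \<beta>) \<partial>?M)"
   proof (rule jensen_powr[OF \<beta> _ V])
    show "emeasure ?M (space ?M) = ennreal V" using eB by (simp add: emeasure_restrict_space space_restrict_space)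
    show "F \<in> borel_measurable ?M" by (intro measurable_restrict_space1) simp
    show "ennreal (V * (norm (grad p z) / K)) \<le> (\<integral>\<^sup>+x. ennreal (F x) \<partial>?M)" unfolding conv by (rule key[OF z])
   qed (use F0 K in auto)
   then have "ennreal (V * (norm (grad p z) / K) powr \<beta>) \<le> ?IFb" unfolding conv .
   then have "ennreal (K powr \<beta> / V) * ennreal (V * (norm (grad p z) / K) powr \<beta>) \<le> ennreal (K powr \<beta> / V) * ?IFb"
    by (rule mult_left_mono) simp
   moreover have "ennreal (K powr \<beta> / V) * ennreal (V * (norm (grad p z) / K) powr \<beta>) = ennreal (norm (grad p z) powr \<beta>)"
    using K V by (simp add: ennreal_mult'[symmetric] powr_divide)
   ultimately show ?thesis by simp
  qed
  have "?P \<le> (\<integral>\<^sup>+z. (ennreal (K powr \<beta> / V) * ?IFb) * indicator E z \<partial>lborel)"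
   using key2 by (intro nn_integral_mono) (auto simp: indicator_def)
  also have "\<dots> = (ennreal (K powr \<beta> / V) * ?IFb) * emeasure lborel E"
   using E by (intro nn_integral_cmult_indicator) simp
  also have "\<dots> \<le> (ennreal (K powr \<beta> / V) * ?IFb) * ennreal (\<omega> * h ^ DIM('a))"
  proof (rule mult_left_mono)
   have "emeasure lborel E \<le> emeasure lborel (cball x0 h)" using E by (intro emeasure_mono) auto
   then show "emeasure lborel E \<le> ennreal (\<omega> * h ^ DIM('a))" using h by (simp add: emeasure_cball \<omega>_def)
  qed simp
  also have "\<dots> = (ennreal (K powr \<beta> / V) * ennreal (\<omega> * h ^ DIM('a))) * ?IFb"
   by (simp only: ac_simps)
  also have "ennreal (K powr \<beta> / V) * ennreal (\<omega> * h ^ DIM('a)) = ennreal (K powr \<beta> / \<gamma> ^ DIM('a))"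
   using V h \<gamma> \<omega> by (simp add: ennreal_mult'[symmetric] V_def power_mult_distrib)
  finally have 1: "?P \<le>
   ennreal (K powr \<beta> / \<gamma> ^ DIM('a)) * ?IFb" .
  have "?IFb \<le> (\<integral>\<^sup>+x. ennreal c3 * (ennreal ((\<bar>p x - vB x\<bar> / h) powr \<beta> + gB x powr \<beta>) * indicator B x) \<partial>lborel)"
  proof (rule nn_integral_mono)
   fix x
   define s where "s = \<bar>p x - vB x\<bar> / h"
   have s: "0 \<le> s" using h by (simp add: s_def)
   have g: "0 \<le> gB x" by (simp add: gB_def)
   have "F x \<le> (1 + c2) * (2 * max s (gB x))"
   proof -
    have "F x \<le> max s (gB x) + c2 * max s (gB x)" unfolding F_def s_def[symmetric] using c2 by (intro add_mono mult_left_mono) auto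
    also have "\<dots> \<le> (1 + c2) * (2 * max s (gB x))" using s c2 by (simp add: algebra_simps)
    finally show ?thesis .
   qed
   then have "F x powr \<beta> \<le> ((1 + c2) * (2 * max s (gB x))) powr \<beta>" using F0 \<beta> by (intro powr_mono2) auto
   also have "\<dots> = c3 * max s (gB x) powr \<beta>" using s c2 by (simp add: powr_mult c3_def)
   also have "\<dots> \<le> c3 * (s powr \<beta> + gB x powr \<beta>)" using c3 by (intro mult_left_mono) (auto simp: max_def)
   finally have "ennreal (F x powr \<beta>) \<le> ennreal c3 * ennreal (s powr \<beta> + gB x powr \<beta>)"
    using c3 by (simp add: ennreal_mult'[symmetric] ennreal_leI del: ennreal_plus)
   then show "ennreal (F x powr \<beta>) * indicator B x \<le> ennreal c3 * (ennreal ((\<bar>p x - vB x\<bar> / h) powr \<beta> + gB x powr \<beta>) * indicator B x)"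
    by (auto simp: indicator_def s_def)
  qed
  also have "\<dots> = ennreal c3 * (\<integral>\<^sup>+x. ennreal ((\<bar>p x - vB x\<bar> / h) powr \<beta> + gB x powr \<beta>) * indicator B x \<partial>lborel)"
   by (rule nn_integral_cmult) measurable
  also have "(\<integral>\<^sup>+x. ennreal ((\<bar>p x - vB x\<bar> / h) powr \<beta> + gB x powr \<beta>) * indicator B x \<partial>lborel)
    = (\<integral>\<^sup>+x\<in>B. ennreal ((\<bar>p x - v x\<bar> / h) powr \<beta> + norm (grad v x) powr \<beta>) \<partial>lborel)"
   by (rule nn_integral_cong) (auto simp: vB_def gB_def indicator_def)
  finally have 2: "?IFb \<le> ennreal c3 *
   (\<integral>\<^sup>+x\<in>B. ennreal ((\<bar>p x - v x\<bar> / h) powr \<beta> + norm (grad v x) powr \<beta>) \<partial>lborel)" .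
  have "ennreal C' = ennreal (K powr \<beta> / \<gamma> ^ DIM('a)) * ennreal c3"
   unfolding C'_def using K \<gamma> by (intro ennreal_mult') simp
  then show ?thesis unfolding B_def[symmetric] using order_trans[OF 1 mult_left_mono[OF 2]] by (simp only: mult.assoc zero_le)
 qed
 note est = this
 have "0 \<le> C'" using K \<gamma> c3 by (simp add: C'_def)
 then show ?thesis unfolding gradient_control_def
  by (intro exI[of _ C'] conjI ballI allI impI) (assumption | elim conjE, rule est, assumption+, blast, assumption)+
qed

context mesh
begin

lemma nn_integral_core_sum:
 assumes f: "continuous_on core f" "\<And>x. 0 \<le> f x"
 shows "(\<integral>\<^sup>+x. ennreal (f x) \<partial>lebesgue_on \<Omega>) = (\<Sum>E\<in>\<T>. \<integral>\<^sup>+x\<in>interior E. ennreal (f x) \<partial>lborel)"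
proof -
 have cs: "core \<in> sets lebesgue" "core \<in> sets borel" using core_open by (auto intro: borel_open)
 have m: "(\<lambda>x. ennreal (f x) * indicator S x) \<in> borel_measurable borel" if "open S" "S \<subseteq> core" for S
 proof -
  have "(\<lambda>x. indicator S x *\<^sub>R f x) \<in> borel_measurable borel"
   using that by (intro borel_measurable_continuous_on_indicator continuous_on_subset[OF f(1)]) auto
  then have "(\<lambda>x. ennreal (indicator S x *\<^sub>R f x)) \<in> borel_measurable borel" by measurable
  moreover have "(\<lambda>x. ennreal (indicator S x *\<^sub>R f x)) = (\<lambda>x. ennreal (f x) * indicator S x)"
   by (auto simp: fun_eq_iff indicator_def)
  ultimately show ?thesis by simp
 qed
 have "(\<integral>\<^sup>+x. ennreal (f x) \<partial>lebesgue_on \<Omega>) = (\<integral>\<^sup>+x. ennreal (f x) * indicator core x \<partial>lebesgue)"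
  unfolding nn_integral_core using cs(1) by (intro nn_integral_restrict_space) simp
 also have "\<dots> = (\<integral>\<^sup>+x. ennreal (f x) * indicator core x \<partial>lborel)"
  using m[OF core_open] by (simp add: nn_integral_completion)
 also have "\<dots> = (\<integral>\<^sup>+x. (\<Sum>E\<in>\<T>. ennreal (f x) * indicator (interior E) x) \<partial>lborel)"
 proof (rule nn_integral_cong)
  fix x
  have "(indicator core x :: ennreal) = (\<Sum>E\<in>\<T>. indicator (interior E) x)"
   unfolding core_def using finite_mesh element_interiors_disjoint
   by (intro indicator_UN_disjoint) (auto simp: disjoint_family_on_def)
  then show "ennreal (f x) * indicator core x = (\<Sum>E\<in>\<T>. ennreal (f x) * indicator (interior E) x)"
   by (simp add: sum_distrib_left)
 qed
 also have "\<dots> = (\<Sum>E\<in>\<T>. \<integral>\<^sup>+x\<in>interior E. ennreal (f x) \<partial>lborel)"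
  using m by (intro nn_integral_sum) (auto simp: core_def)
 finally show ?thesis .
qed

lemma gradient_estimate:
 assumes C: "\<forall>p\<in>polynomials k. gradient_control \<gamma> \<beta> C (p :: 'a \<Rightarrow> real)"
  and \<gamma>: "0 < \<gamma>" and \<beta>: "1 < \<beta>" and h: "0 < h" "Max (diameter ` \<T>) = h" and balls: "\<forall>E\<in>\<T>. \<exists>x. ball x (\<gamma> * h) \<subseteq> E"
  and u: "u \<in> piecewise_polynomials k \<T>"
  and W: "open W" "closure \<Omega> \<subseteq> W" and v: "\<forall>x\<in>W. v differentiable (at x)" "continuous_on W (grad v)"
 shows "(\<integral>\<^sup>+x. ennreal (norm (grad u x) powr \<beta>) \<partial>lebesgue_on \<Omega>)
   \<le> ennreal C * (\<integral>\<^sup>+x. ennreal ((\<bar>u x - v x\<bar> / h) powr \<beta> + norm (grad v x) powr \<beta>) \<partial>lebesgue_on \<Omega>)"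
proof -
 let ?F = "\<lambda>u x. (\<bar>u x - v x\<bar> / h) powr \<beta> + norm (grad v x) powr \<beta>"
 have vc: "continuous_on W v"
  using v(1) by (intro continuous_at_imp_continuous_on ballI differentiable_imp_continuous_within) auto
 have coreW: "core \<subseteq> W" using core_subset closure_subset[of \<Omega>] W by blast
 have gu: "continuous_on core (grad u)" by (rule M_space_continuous_on[OF grad_in_M_space[OF u]])
 have uc: "continuous_on core u" by (rule piecewise_polynomial_continuous_on[OF u])
 have "(\<integral>\<^sup>+z\<in>interior E. ennreal (norm (grad u z) powr \<beta>) \<partial>lborel)
   \<le> ennreal C * (\<integral>\<^sup>+x\<in>interior E. ennreal (?F u x) \<partial>lborel)" if E: "E \<in> \<T>" for E
 proof -
  obtain p where p: "p \<in> polynomials k" "\<And>x. x \<in> interior E ==> u x = p x"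
   using u E by (auto simp: piecewise_polynomials_def)
  obtain x0 where x0: "ball x0 (\<gamma> * h) \<subseteq> E" using balls E by blast
  have bi: "ball x0 (\<gamma> * h) \<subseteq> interior E" using x0 by (simp add: interior_maximal)
  have "x0 \<in> E" using x0 \<gamma> h by auto
  have "E \<subseteq> cball x0 h"
  proof
   fix y assume y: "y \<in> E"
   have "dist x0 y \<le> diameter E"
    using element(2)[OF E] \<open>x0 \<in> E\<close> y by (intro diameter_bounded_bound compact_imp_bounded)
   also have "\<dots> \<le> h" using finite_mesh E h by auto
   finally show "y \<in> cball x0 h" by simp
  qed
  then have "interior E \<subseteq> cball x0 h" using interior_subset by blast
  moreover have "ball x0 (\<gamma> * h) \<subseteq> W" using x0 element(5)[OF E] W by blast
  ultimately have est: "(\<integral>\<^sup>+z\<in>interior E. ennreal (norm (grad p z) powr \<beta>) \<partial>lborel)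
    \<le> ennreal C * (\<integral>\<^sup>+x\<in>ball x0 (\<gamma> * h). ennreal (?F p x) \<partial>lborel)"
   using C[rule_format, OF p(1), unfolded gradient_control_def, rule_format, OF h(1), of "interior E" x0 W v] W(1) v
   by (simp only: borel_open[OF open_interior])
  have "grad u x = grad p x" if "x \<in> interior E" for x
   using grad_transform_open(2)[of "interior E" x u p] that p polynomials_differentiable[OF p(1)] by simp
  then have "(\<integral>\<^sup>+z\<in>interior E. ennreal (norm (grad u z) powr \<beta>) \<partial>lborel) = (\<integral>\<^sup>+z\<in>interior E. ennreal (norm (grad p z) powr \<beta>) \<partial>lborel)"
   by (intro nn_integral_cong) (auto simp: indicator_def)
  also note est
  also have "ennreal C * (\<integral>\<^sup>+x\<in>ball x0 (\<gamma> * h). ennreal (?F p x) \<partial>lborel)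
   \<le> ennreal C * (\<integral>\<^sup>+x\<in>interior E. ennreal (?F u x) \<partial>lborel)"
  proof (rule mult_left_mono[OF nn_integral_mono])
   fix x
   show "ennreal (?F p x) * indicator (ball x0 (\<gamma> * h)) x
     \<le> ennreal (?F u x) * indicator (interior E) x"
    using p(2)[of x] bi by (cases "x \<in> ball x0 (\<gamma> * h)") auto
  qed simp
  finally show ?thesis .
 qed
 then have "(\<Sum>E\<in>\<T>. \<integral>\<^sup>+z\<in>interior E. ennreal (norm (grad u z) powr \<beta>) \<partial>lborel)
   \<le> (\<Sum>E\<in>\<T>. ennreal C * (\<integral>\<^sup>+x\<in>interior E. ennreal (?F u x) \<partial>lborel))"
  by (rule sum_mono)
 moreover have "continuous_on core (\<lambda>x. norm (grad u x) powr \<beta>)"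
  using \<beta> by (intro continuous_on_powr' continuous_intros gu) auto
 moreover have "continuous_on core (\<lambda>x. ?F u x)"
  using \<beta> h by (intro continuous_on_powr' continuous_intros uc continuous_on_subset[OF vc coreW] continuous_on_subset[OF v(2) coreW]) auto
 ultimately show ?thesis by (simp add: nn_integral_core_sum sum_distrib_left del: ennreal_plus)
qed

end

lemma epowr_mono: "x \<le> y ==> 0 \<le> p ==> epowr x p \<le> epowr y p"
 by (cases x; cases y) (auto simp: epowr_def powr_mono2 ennreal_leI top_unique)

lemma epowr_cmult: "0 < c ==> epowr (ennreal c * x) p = ennreal (c powr p) * epowr x p"
 by (cases x) (auto simp: epowr_def ennreal_mult_top powr_mult ennreal_mult'[symmetric])

lemma smooth_extension:
 assumes "smooth_on S u"
 obtains U v where "open U" "S \<subseteq> U" "\<And>k. Ck_on k U v" "\<And>x. x \<in> S ==> v x = u x"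
 using assms unfolding smooth_on_def by blast

lemma Ck_on_1:
 assumes "Ck_on 1 U v"
 shows "\<forall>x\<in>U. v differentiable (at x)" "continuous_on U v" "continuous_on U (grad v)"
proof -
 show d: "\<forall>x\<in>U. v differentiable (at x)" using assms by auto
 then show "continuous_on U v"
  by (intro continuous_at_imp_continuous_on ballI differentiable_imp_continuous_within) auto
 show "continuous_on U (grad v)" unfolding grad_def[abs_def] using assms
  by (intro continuous_intros) auto
qed

lemma initial_value_sobolev:
 fixes \<rho>0 :: "'a::euclidean_space \<Rightarrow> real"
 assumes \<Omega>: "open \<Omega>" "bounded \<Omega>" and \<rho>: "smooth_on (closure \<Omega>) \<rho>0" and \<beta>: "1 < \<beta>"
 shows "\<rho>0 \<in> sobolev_space \<Omega> 1 2"
  and "epowr (sobolev_norm \<Omega> 1 (ennreal \<beta>) \<rho>0) \<beta> \<le> ennreal (real (card (multi_indices 1 :: ('a \<Rightarrow> nat) set))) *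
   ((\<integral>\<^sup>+x. ennreal (\<bar>\<rho>0 x\<bar> powr \<beta>) \<partial>lebesgue_on \<Omega>) + (\<integral>\<^sup>+x. ennreal (norm (grad \<rho>0 x) powr \<beta>) \<partial>lebesgue_on \<Omega>))"
proof -
 obtain U v where U: "open U" "closure \<Omega> \<subseteq> U" and Ck: "\<And>k. Ck_on k U v" and v: "\<And>x. x \<in> closure \<Omega> ==> v x = \<rho>0 x"
  using smooth_extension[OF \<rho>] by blast
 note C1 = Ck_on_1[OF Ck[of 1]]
 have cl: "\<Omega> \<subseteq> closure \<Omega>" by (rule closure_subset)
 have g: "grad \<rho>0 x = grad v x" if "x \<in> \<Omega>" for x
  using grad_transform_open(2)[OF \<Omega>(1) that, of \<rho>0 v] v C1(1) U cl that by (metis subsetD)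
 define D where "D \<mu> = (if \<mu> = (\<lambda>_. 0) then \<rho>0 else pderivative (SOME b. b \<in> Basis \<and> \<mu> = (\<lambda>c. if c = b then 1 else 0)) v)"
  for \<mu> :: "'a \<Rightarrow> nat"
 have D: "weak_derivative \<Omega> \<mu> \<rho>0 (D \<mu>) \<and> continuous_on (closure \<Omega>) (D \<mu>) \<and> (\<forall>x\<in>\<Omega>. \<bar>D \<mu> x\<bar> \<le> max \<bar>\<rho>0 x\<bar> (norm (grad \<rho>0 x)))"
  if \<mu>: "\<mu> \<in> multi_indices 1" for \<mu>
 proof (cases "\<mu> = (\<lambda>_. 0)")
  case True
  obtain b :: 'a where b: "b \<in> Basis" using nonempty_Basis by blast
  have "continuous_on (closure \<Omega>) \<rho>0"
   using continuous_on_subset[OF C1(2) U(2)] v by (subst continuous_on_cong[OF refl, of _ _ v]) auto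
  then show ?thesis using True smooth_weak_derivative(1)[OF \<Omega> U Ck v b] by (simp add: D_def)
 next
  case False
  then have ex: "\<exists>b. b \<in> Basis \<and> \<mu> = (\<lambda>c. if c = b then 1 else 0)" using multi_index_1_cases[OF \<mu>] by blast
  define b where "b = (SOME b. b \<in> Basis \<and> \<mu> = (\<lambda>c. if c = b then 1 else 0))"
  have b: "b \<in> Basis" "\<mu> = (\<lambda>c. if c = b then 1 else 0)" using someI_ex[OF ex] unfolding b_def by blast+
  have Dm: "D \<mu> = pderivative b v" using False by (simp add: D_def b_def)
  have "\<bar>pderivative b v x\<bar> \<le> norm (grad \<rho>0 x)" if x: "x \<in> \<Omega>" for x
   using Basis_le_norm[OF b(1), of "grad v x"] by (simp add: g[OF x] grad_inner_Basis[OF b(1)])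
  moreover have "continuous_on (closure \<Omega>) (pderivative b v)"
   using Ck[of 1] b U by (auto intro: continuous_on_subset)
  moreover have "weak_derivative \<Omega> \<mu> \<rho>0 (pderivative b v)"
   using smooth_weak_derivative(2)[OF \<Omega> U Ck v b(1)] by (simp add: b(2))
  ultimately show ?thesis unfolding Dm by (auto intro: max.coboundedI2)
 qed
 have fin: "finite_measure (lebesgue_on \<Omega>)" using \<Omega> by (intro finite_measure_lebesgue_on lmeasurable_open) auto
 have "lp_norm (lebesgue_on \<Omega>) 2 (D \<mu>) < \<infinity>" if \<mu>: "\<mu> \<in> multi_indices 1" for \<mu>
 proof -
  have "bounded (D \<mu> ` closure \<Omega>)" using D[OF \<mu>] \<Omega> by (intro compact_imp_bounded compact_continuous_image) auto
  then obtain b where b: "\<forall>y\<in>D \<mu> ` closure \<Omega>. norm y \<le> b" by (auto simp: bounded_iff)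
  have "(\<integral>\<^sup>+x. ennreal ((D \<mu> x)\<^sup>2) \<partial>lebesgue_on \<Omega>) \<le> (\<integral>\<^sup>+x. ennreal (b\<^sup>2) \<partial>lebesgue_on \<Omega>)"
  proof (rule nn_integral_mono)
   fix x assume "x \<in> space (lebesgue_on \<Omega>)"
   then have "\<bar>D \<mu> x\<bar> \<le> b" using b cl by auto
   then show "ennreal ((D \<mu> x)\<^sup>2) \<le> ennreal (b\<^sup>2)" by (intro ennreal_leI) (rule abs_le_square_iff[THEN iffD1], auto)
  qed
  also have "\<dots> < top" using finite_measure.emeasure_finite[OF fin, of "space (lebesgue_on \<Omega>)"]
   by (simp add: ennreal_mult_less_top less_top)
  finally show ?thesis by (simp add: lp_norm_2_less_top)
 qed
 then show "\<rho>0 \<in> sobolev_space \<Omega> 1 2" unfolding sobolev_space_1_2 using D by blast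
 let ?S = "\<Sum>\<mu>\<in>multi_indices 1. epowr (lp_norm (lebesgue_on \<Omega>) (ennreal \<beta>) (D \<mu>)) \<beta>"
 let ?R = "(\<integral>\<^sup>+x. ennreal (\<bar>\<rho>0 x\<bar> powr \<beta>) \<partial>lebesgue_on \<Omega>) + (\<integral>\<^sup>+x. ennreal (norm (grad \<rho>0 x) powr \<beta>) \<partial>lebesgue_on \<Omega>)"
 have "sobolev_norm \<Omega> 1 (ennreal \<beta>) \<rho>0 \<le> epowr ?S (1 / \<beta>)"
  unfolding sobolev_norm_def using D \<beta> by (intro INF_lower2[of D]) auto
 then have "epowr (sobolev_norm \<Omega> 1 (ennreal \<beta>) \<rho>0) \<beta> \<le> ?S"
  using epowr_mono[of _ _ \<beta>] epowr_inverse[of \<beta> ?S] \<beta> by fastforce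
 also have "?S \<le> (\<Sum>\<mu>\<in>(multi_indices 1 :: ('a \<Rightarrow> nat) set). ?R)"
 proof (rule sum_mono)
  fix \<mu> :: "'a \<Rightarrow> nat" assume \<mu>: "\<mu> \<in> multi_indices 1"
  have Rm: "(\<lambda>x. ennreal (\<bar>\<rho>0 x\<bar> powr \<beta>)) \<in> Lmeas \<Omega>"
   "(\<lambda>x. ennreal (norm (grad \<rho>0 x) powr \<beta>)) \<in> Lmeas \<Omega>"
  proof -
   have "\<Omega> \<subseteq> U" using U cl by blast
   then have "continuous_on \<Omega> v" "continuous_on \<Omega> (grad v)" using C1 continuous_on_subset by blast+
   moreover have "\<And>x. x \<in> \<Omega> ==> v x = \<rho>0 x" using v cl by blast
   ultimately have c: "continuous_on \<Omega> \<rho>0" "continuous_on \<Omega> (grad \<rho>0)"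
    using g by (simp_all cong: continuous_on_cong)
   have [measurable]: "\<rho>0 \<in> Lmeas \<Omega>" "grad \<rho>0 \<in> Lmeas \<Omega>"
    using \<Omega> c by (auto intro!: continuous_imp_measurable_on_sets_lebesgue borel_open)
   show "(\<lambda>x. ennreal (\<bar>\<rho>0 x\<bar> powr \<beta>)) \<in> Lmeas \<Omega>"
    "(\<lambda>x. ennreal (norm (grad \<rho>0 x) powr \<beta>)) \<in> Lmeas \<Omega>" by measurable
  qed
  have "epowr (lp_norm (lebesgue_on \<Omega>) (ennreal \<beta>) (D \<mu>)) \<beta> = (\<integral>\<^sup>+x. ennreal (\<bar>D \<mu> x\<bar> powr \<beta>) \<partial>lebesgue_on \<Omega>)"
   using epowr_lp_norm[of \<beta> "lebesgue_on \<Omega>" "D \<mu>"] \<beta> by simp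
  also have "\<dots> \<le> (\<integral>\<^sup>+x. ennreal (\<bar>\<rho>0 x\<bar> powr \<beta>) + ennreal (norm (grad \<rho>0 x) powr \<beta>) \<partial>lebesgue_on \<Omega>)"
  proof (rule nn_integral_mono)
   fix x assume "x \<in> space (lebesgue_on \<Omega>)"
   then have "\<bar>D \<mu> x\<bar> \<le> max \<bar>\<rho>0 x\<bar> (norm (grad \<rho>0 x))" using D[OF \<mu>] by simp
   then have "\<bar>D \<mu> x\<bar> powr \<beta> \<le> max \<bar>\<rho>0 x\<bar> (norm (grad \<rho>0 x)) powr \<beta>" using \<beta> by (intro powr_mono2) auto
   also have "\<dots> \<le> \<bar>\<rho>0 x\<bar> powr \<beta> + norm (grad \<rho>0 x) powr \<beta>" by (auto simp: max_def)
   finally show "ennreal (\<bar>D \<mu> x\<bar> powr \<beta>) \<le> ennreal (\<bar>\<rho>0 x\<bar> powr \<beta>) + ennreal (norm (grad \<rho>0 x) powr \<beta>)"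
    by (simp add: ennreal_plus[symmetric] ennreal_leI del: ennreal_plus)
  qed
  also have "\<dots> = ?R" using Rm by (rule nn_integral_add)
  finally show "epowr (lp_norm (lebesgue_on \<Omega>) (ennreal \<beta>) (D \<mu>)) \<beta> \<le> ?R" .
 qed
 also have "\<dots> = ennreal (real (card (multi_indices 1 :: ('a \<Rightarrow> nat) set))) * ?R"
  by (simp add: ennreal_of_nat_eq_real_of_nat)
 finally show "epowr (sobolev_norm \<Omega> 1 (ennreal \<beta>) \<rho>0) \<beta> \<le> ennreal (real (card (multi_indices 1 :: ('a \<Rightarrow> nat) set))) * ?R" .
qed

definition admissible_mesh ::
  "'a::euclidean_space set \<Rightarrow> real \<Rightarrow> nat \<Rightarrow> real \<Rightarrow> real \<Rightarrow> 'a set set \<Rightarrow> real \<Rightarrow> (('a \<Rightarrow> real) \<Rightarrow> 'a \<Rightarrow> real) \<Rightarrow> bool" where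
 "admissible_mesh \<Omega> \<gamma> k C0 C1 \<T> h \<pi>h \<longleftrightarrow> mesh_of \<Omega> \<T> \<and> 0 < h \<and> Max (diameter ` \<T>) = h \<and> (\<forall>E\<in>\<T>. \<exists>x. ball x (\<gamma> * h) \<subseteq> E) \<and>
   is_L2_projection \<Omega> k \<T> \<pi>h \<and> projection_bounds \<Omega> k C0 C1 h \<pi>h"

definition grad_power :: "real \<Rightarrow> 'a::euclidean_space set \<Rightarrow> ('a \<Rightarrow> real) \<Rightarrow> ennreal" where
 "grad_power \<beta> \<Omega> u = (\<integral>\<^sup>+x. ennreal (norm (grad u x) powr \<beta>) \<partial>lebesgue_on \<Omega>)"

lemma initial_gradient_bound:
 fixes \<Omega> :: "'a::euclidean_space set"
 assumes \<Omega>: "bounded_domain \<Omega>" and \<gamma>: "0 < \<gamma>" and \<beta>: "1 < \<beta>" "\<beta> < 2" and C1: "0 < C1"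
 shows "\<exists>C\<ge>0. \<forall>\<T> h \<pi>h \<rho>0. admissible_mesh \<Omega> \<gamma> k C0 C1 \<T> h \<pi>h \<and> smooth_on (closure \<Omega>) \<rho>0 \<longrightarrow>
   grad_power \<beta> \<Omega> (\<pi>h \<rho>0) \<le> ennreal C * (1 + (lp_norm (lebesgue_on \<Omega>) 2 \<rho>0)\<^sup>2 + grad_power \<beta> \<Omega> \<rho>0)"
proof -
 obtain C where C0: "0 \<le> C" and C: "\<forall>p\<in>polynomials k. gradient_control \<gamma> \<beta> C (p :: 'a \<Rightarrow> real)"
  using element_gradient_estimate[OF \<gamma> \<beta>(1), of k, where 'a = 'a] by blast
 have \<Omega>o: "open \<Omega>" "bounded \<Omega>" using \<Omega> by (auto simp: bounded_domain_def)
 have lm: "\<Omega> \<in> lmeasurable" using \<Omega>o by (intro lmeasurable_open) auto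
 define V where "V = measure lebesgue \<Omega>"
 have V: "emeasure (lebesgue_on \<Omega>) (space (lebesgue_on \<Omega>)) = ennreal V"
  using lm by (simp add: V_def emeasure_restrict_space emeasure_eq_measure2 fmeasurableD)
 define N where "N = real (card (multi_indices 1 :: ('a \<Rightarrow> nat) set))"
 define c where "c = C1 powr \<beta> * N"
 have c: "0 \<le> c" by (simp add: c_def N_def)
 define C' where "C' = C * (c * (V + 1) + 1)"
 have V0: "0 \<le> V" by (simp add: V_def)
 have est: "grad_power \<beta> \<Omega> (\<pi>h \<rho>0) \<le> ennreal C' * (1 + (lp_norm (lebesgue_on \<Omega>) 2 \<rho>0)\<^sup>2 + grad_power \<beta> \<Omega> \<rho>0)"
  if am: "admissible_mesh \<Omega> \<gamma> k C0 C1 \<T> h \<pi>h" and \<rho>: "smooth_on (closure \<Omega>) \<rho>0"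
  for \<T> h \<pi>h \<rho>0
 proof -
  have T: "mesh_of \<Omega> \<T>" and h: "0 < h" "Max (diameter ` \<T>) = h" and balls: "\<forall>E\<in>\<T>. \<exists>x. ball x (\<gamma> * h) \<subseteq> E"
   and proj: "is_L2_projection \<Omega> k \<T> \<pi>h" and pb: "projection_bounds \<Omega> k C0 C1 h \<pi>h"
   using am by (auto simp: admissible_mesh_def)
  interpret mesh \<Omega> \<T> using \<Omega> T by unfold_locales
  obtain U v where U: "open U" "closure \<Omega> \<subseteq> U" and Ck: "\<And>k. Ck_on k U v" and v: "\<And>x. x \<in> closure \<Omega> ==> v x = \<rho>0 x"
   using smooth_extension[OF \<rho>] by blast
  note K1 = Ck_on_1[OF Ck[of 1]]
  have cl: "\<Omega> \<subseteq> closure \<Omega>" by (rule closure_subset)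
  have g: "grad \<rho>0 x = grad v x" if "x \<in> \<Omega>" for x
   using grad_transform_open(2)[OF \<Omega>o(1) that, of \<rho>0 v] v K1(1) U cl that by (metis subsetD)
  have vx: "v x = \<rho>0 x" if "x \<in> \<Omega>" for x using v cl that by blast
  note sob = initial_value_sobolev[OF \<Omega>o \<rho> \<beta>(1)]
  let ?u = "\<pi>h \<rho>0"
  have uR: "?u \<in> R_space \<Omega> k \<T>" using proj sob(1) by (auto simp: is_L2_projection_def)
  then have u: "?u \<in> piecewise_polynomials k \<T>" "continuous_on (closure \<Omega>) ?u" by (auto simp: R_space_def)
  let ?L = "lebesgue_on \<Omega>"
  let ?g = "\<integral>\<^sup>+x. ennreal (norm (grad \<rho>0 x) powr \<beta>) \<partial>?L" and ?r = "(lp_norm ?L 2 \<rho>0)\<^sup>2"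
  have "\<Omega> \<subseteq> U" using U cl by blast
  then have cv: "continuous_on \<Omega> v" "continuous_on \<Omega> (grad v)" using K1 continuous_on_subset by blast+
  have cc: "continuous_on \<Omega> \<rho>0" "continuous_on \<Omega> (grad \<rho>0)" using cv g vx by (simp_all cong: continuous_on_cong)
  have [measurable]: "\<rho>0 \<in> borel_measurable ?L" "grad \<rho>0 \<in> borel_measurable ?L" "?u \<in> borel_measurable ?L"
   using \<Omega>o cc continuous_on_subset[OF u(2) cl] by (auto intro!: continuous_imp_measurable_on_sets_lebesgue borel_open)
  have p: "(\<integral>\<^sup>+x. ennreal (\<bar>\<rho>0 x\<bar> powr \<beta>) \<partial>?L) \<le> ennreal V + ?r"
  proof -
   have "(\<integral>\<^sup>+x. ennreal (\<bar>\<rho>0 x\<bar> powr \<beta>) \<partial>?L) \<le> (\<integral>\<^sup>+x. 1 + ennreal ((\<rho>0 x)\<^sup>2) \<partial>?L)"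
   proof (rule nn_integral_mono)
    fix x
    have "\<bar>\<rho>0 x\<bar> powr \<beta> \<le> 1 + (\<rho>0 x)\<^sup>2"
    proof (cases "\<bar>\<rho>0 x\<bar> \<le> 1")
     case True
     then have "\<bar>\<rho>0 x\<bar> powr \<beta> \<le> 1 powr \<beta>" using \<beta> by (intro powr_mono2) auto
     then show ?thesis by (simp add: add_increasing2)
    next
     case False
     then have "\<bar>\<rho>0 x\<bar> powr \<beta> \<le> \<bar>\<rho>0 x\<bar> powr 2" using \<beta> by (intro powr_mono) auto
     then show ?thesis using False by (simp add: powr_numeral)
    qed
    then have "ennreal (\<bar>\<rho>0 x\<bar> powr \<beta>) \<le> ennreal (1 + (\<rho>0 x)\<^sup>2)" by (rule ennreal_leI)
    then show "ennreal (\<bar>\<rho>0 x\<bar> powr \<beta>) \<le> 1 + ennreal ((\<rho>0 x)\<^sup>2)" by (simp add: ennreal_plus)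
   qed
   also have "\<dots> = emeasure ?L (space ?L) + ?r" by (subst nn_integral_add) (auto simp: lp_norm_2_squared)
   also have "\<dots> = ennreal V + ?r" by (simp only: V)
   finally show ?thesis .
  qed
  let ?X = "1 + ?r + ?g" and ?D = "\<integral>\<^sup>+x. ennreal (\<bar>?u x - \<rho>0 x\<bar> powr \<beta>) \<partial>?L"
  have "(\<integral>\<^sup>+x. ennreal (norm (grad ?u x) powr \<beta>) \<partial>?L)
    \<le> ennreal C * (\<integral>\<^sup>+x. ennreal ((\<bar>?u x - v x\<bar> / h) powr \<beta> + norm (grad v x) powr \<beta>) \<partial>?L)"
   by (rule gradient_estimate[OF C \<gamma> \<beta>(1) h balls u(1) U K1(1,3)])
  also have "(\<integral>\<^sup>+x. ennreal ((\<bar>?u x - v x\<bar> / h) powr \<beta> + norm (grad v x) powr \<beta>) \<partial>?L)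
    = (\<integral>\<^sup>+x. ennreal (1 / h powr \<beta>) * ennreal (\<bar>?u x - \<rho>0 x\<bar> powr \<beta>) + ennreal (norm (grad \<rho>0 x) powr \<beta>) \<partial>?L)"
   using h(1) by (intro nn_integral_cong) (simp add: g vx powr_divide ennreal_mult'[symmetric] ennreal_plus)
  also have "\<dots> = ennreal (1 / h powr \<beta>) * ?D + ?g"
   by (subst nn_integral_add, measurable, subst nn_integral_cmult) auto
  finally have 1: "(\<integral>\<^sup>+x. ennreal (norm (grad ?u x) powr \<beta>) \<partial>?L) \<le>
   ennreal C * (ennreal (1 / h powr \<beta>) * ?D + ?g)" .
  have "(1::ennreal) \<le> ennreal \<beta>" using \<beta> by (simp add: ennreal_leI flip: ennreal_1)
  then have "lp_norm ?L (ennreal \<beta>) (\<lambda>x. ?u x - \<rho>0 x) \<le> ennreal (C1 * h) * sobolev_norm \<Omega> 1 (ennreal \<beta>) \<rho>0"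
   using pb sob(1) unfolding projection_bounds_def by (metis le_add2 power_one_right)
  then have "epowr (lp_norm ?L (ennreal \<beta>) (\<lambda>x. ?u x - \<rho>0 x)) \<beta> \<le> epowr (ennreal (C1 * h) * sobolev_norm \<Omega> 1 (ennreal \<beta>) \<rho>0) \<beta>"
   using \<beta> by (intro epowr_mono) auto
  also have "\<dots> = ennreal ((C1 * h) powr \<beta>) * epowr (sobolev_norm \<Omega> 1 (ennreal \<beta>) \<rho>0) \<beta>"
   using C1 h by (intro epowr_cmult) simp
  also have "\<dots> \<le> ennreal ((C1 * h) powr \<beta>) * (ennreal N * (ennreal V + ?r + ?g))"
   using order_trans[OF sob(2) mult_left_mono[OF add_right_mono[OF p]]] by (intro mult_left_mono) (simp_all add: N_def)
  finally have 2: "?D \<le> ennreal ((C1 * h) powr \<beta>) * (ennreal N * (ennreal V + ?r + ?g))"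
   using epowr_lp_norm[of \<beta> ?L "\<lambda>x. ?u x - \<rho>0 x"] \<beta> by simp
  have "ennreal (1 / h powr \<beta>) * ?D
   \<le> ennreal (1 / h powr \<beta>) * (ennreal ((C1 * h) powr \<beta>) * (ennreal N * (ennreal V + ?r + ?g)))"
   by (rule mult_left_mono[OF 2]) simp
  also have "\<dots> = ennreal c * (ennreal V + ?r + ?g)"
  proof -
   have "1 / h powr \<beta> * (C1 * h) powr \<beta> * N = c" using h C1 by (simp add: c_def powr_mult)
   then have "ennreal c = ennreal (1 / h powr \<beta>) * ennreal ((C1 * h) powr \<beta>) * ennreal N"
    by (simp add: ennreal_mult'[symmetric])
   then show ?thesis by (simp only: mult.assoc)
  qed
  also have "\<dots> \<le> ennreal c * (ennreal V * ?X + ?X)"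
  proof (rule mult_left_mono)
   have "ennreal V * 1 \<le> ennreal V * ?X" by (rule mult_left_mono) (auto simp: add.assoc)
   moreover have "?r + ?g \<le> ?X" by (simp add: add.assoc)
   ultimately have "ennreal V + (?r + ?g) \<le> ennreal V * ?X + ?X" by (intro add_mono) simp_all
   then show "ennreal V + ?r + ?g \<le> ennreal V * ?X + ?X" by (simp only: add.assoc)
  qed simp
  finally have 3: "ennreal (1 / h powr \<beta>) * ?D \<le> ennreal c * (ennreal V * ?X + ?X)" .
  have 4: "?g \<le> ?X" by (simp add: add_increasing)
  have "(\<integral>\<^sup>+x. ennreal (norm (grad ?u x) powr \<beta>) \<partial>?L) \<le> ennreal C * (ennreal c * (ennreal V * ?X + ?X) + ?X)"
   by (rule order_trans[OF 1 mult_left_mono[OF add_mono[OF 3 4]]]) simp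
  also have "\<dots> = ennreal C' * ?X"
  proof -
   have "ennreal C' = ennreal C * (ennreal c * (ennreal V + 1) + 1)"
    using C0 c V0 by (simp add: C'_def ennreal_mult ennreal_plus)
   moreover have "A * (b * (w * X + X) + X) = A * (b * (w + 1) + 1) * X" for A b w X :: ennreal
    by (simp add: distrib_left distrib_right ac_simps)
   ultimately show ?thesis by (simp only:)
  qed
  finally show ?thesis by (simp only: grad_power_def)
 qed
 have "0 \<le> C'" using C0 c V0 by (simp add: C'_def)
 then show ?thesis using est by (intro exI[of _ C'] conjI allI impI) (auto simp only:)
qed

lemma (in mesh) projection_contraction:
 assumes proj: "is_L2_projection \<Omega> k \<T> \<pi>h" and \<rho>: "smooth_on (closure \<Omega>) \<rho>0"
 shows "\<pi>h \<rho>0 \<in> R_space \<Omega> k \<T>" "ennreal (\<integral>x. (\<pi>h \<rho>0 x)\<^sup>2 \<partial>lebesgue_on \<Omega>) \<le> (lp_norm (lebesgue_on \<Omega>) 2 \<rho>0)\<^sup>2"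
proof -
 let ?u = "\<pi>h \<rho>0" and ?L = "lebesgue_on \<Omega>"
 have "\<rho>0 \<in> sobolev_space \<Omega> 1 2"
  by (rule initial_value_sobolev(1)[OF domain_open domain_bounded \<rho>, of "3/2"]) simp
 then have uR: "?u \<in> R_space \<Omega> k \<T>" and orth: "L2_inner ?L (\<lambda>x. ?u x - \<rho>0 x) ?u = 0"
  using proj by (auto simp: is_L2_projection_def)
 show "?u \<in> R_space \<Omega> k \<T>" by (rule uR)
 obtain U v where U: "open U" "closure \<Omega> \<subseteq> U" and Ck: "\<And>k. Ck_on k U v" and v: "\<And>x. x \<in> closure \<Omega> ==> v x = \<rho>0 x"
  using smooth_extension[OF \<rho>] by blast
 have "continuous_on (closure \<Omega>) v" using Ck_on_1(2)[OF Ck] U(2) by (rule continuous_on_subset)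
 then have rc: "continuous_on (closure \<Omega>) \<rho>0" using v by (simp cong: continuous_on_cong)
 have uc: "continuous_on (closure \<Omega>) ?u" using uR by (simp add: R_space_def)
 have int: "integrable ?L w" if "continuous_on (closure \<Omega>) w" for w :: "'a \<Rightarrow> real"
 proof -
  have "bounded (w ` closure \<Omega>)" using that domain_bounded by (intro compact_imp_bounded compact_continuous_image) auto
  then obtain b where b: "\<forall>y\<in>w ` closure \<Omega>. norm y \<le> b" by (auto simp: bounded_iff)
  have "finite_measure ?L" using domain_open domain_bounded by (intro finite_measure_lebesgue_on lmeasurable_open) auto
  then show ?thesis
  proof (rule finite_measure.integrable_const_bound)
   show "AE x in ?L. norm (w x) \<le> b" using b closure_subset[of \<Omega>] by (intro AE_I2) auto
   show "w \<in> borel_measurable ?L" using domain_open continuous_on_subset[OF that closure_subset]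
    by (intro continuous_imp_measurable_on_sets_lebesgue) (auto intro: borel_open)
  qed
 qed
 have i: "integrable ?L (\<lambda>x. (?u x)\<^sup>2)" "integrable ?L (\<lambda>x. (\<rho>0 x)\<^sup>2)" "integrable ?L (\<lambda>x. \<rho>0 x * ?u x)"
  by (intro int continuous_intros uc rc)+
 have "(\<integral>x. (?u x)\<^sup>2 \<partial>?L) = (\<integral>x. \<rho>0 x * ?u x \<partial>?L)"
  using orth i by (simp add: L2_inner_def left_diff_distrib power2_eq_square)
 also have "\<dots> \<le> (\<integral>x. (?u x)\<^sup>2 / 2 + (\<rho>0 x)\<^sup>2 / 2 \<partial>?L)"
 proof (rule integral_mono)
  fix x
  have "0 \<le> (?u x - \<rho>0 x)\<^sup>2" by simp
  then show "\<rho>0 x * ?u x \<le> (?u x)\<^sup>2 / 2 + (\<rho>0 x)\<^sup>2 / 2" by (simp add: power2_diff mult_ac)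
 qed (use i in auto)
 also have "\<dots> = (\<integral>x. (?u x)\<^sup>2 \<partial>?L) / 2 + (\<integral>x. (\<rho>0 x)\<^sup>2 \<partial>?L) / 2" using i by simp
 finally have "ennreal (\<integral>x. (?u x)\<^sup>2 \<partial>?L) \<le> ennreal (\<integral>x. (\<rho>0 x)\<^sup>2 \<partial>?L)" by (intro ennreal_leI) simp
 also have "\<dots> = (lp_norm ?L 2 \<rho>0)\<^sup>2" using i(2) by (simp add: lp_norm_2_squared nn_integral_eq_integral)
 finally show "ennreal (\<integral>x. (?u x)\<^sup>2 \<partial>?L) \<le> (lp_norm ?L 2 \<rho>0)\<^sup>2" .
qed

section \<open>Norms in time\<close>

lemma bochner_sup_bound:
 fixes \<psi> :: "real \<Rightarrow> 'b \<Rightarrow> real"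
 assumes T: "0 < T" and A: "{0<..<T} \<subseteq> A" "A \<subseteq> {0..<T}"
  and cont: "\<And>x. x \<in> space S ==> continuous_on A (\<lambda>t. \<psi> t x)"
  and fin: "bochner_norm T \<infinity> S \<infinity> \<psi> < \<infinity>"
 shows "AE x in S. \<forall>t\<in>A. \<bar>\<psi> t x\<bar> \<le> enn2real (bochner_norm T \<infinity> S \<infinity> \<psi>)"
proof -
 define m where "m = enn2real (bochner_norm T \<infinity> S \<infinity> \<psi>)"
 have m: "bochner_norm T \<infinity> S \<infinity> \<psi> = ennreal m" using fin by (simp add: m_def less_top)
 define G where "G = {t \<in> {0<..<T}. lp_norm S \<infinity> (\<psi> t) \<le> ennreal m}"
 have "AE t in lebesgue_on {0<..<T}. lp_norm S \<infinity> (\<psi> t) \<le> ennreal m"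
  using esssup_AE[of "\<lambda>t. lp_norm S \<infinity> (\<psi> t)" "lebesgue_on {0<..<T}"] m by (simp add: bochner_norm_def elp_norm_def)
 then have ae: "AE t in lebesgue. t \<in> {0<..<T} \<longrightarrow> t \<in> G"
  by (subst (asm) AE_restrict_space_iff) (auto simp: G_def)
 obtain Q where Q: "countable Q" "Q \<subseteq> G" "G \<subseteq> closure Q" using separable by metis
 have dense: "\<exists>q\<in>Q. \<bar>q - t\<bar> < d" if t: "t \<in> A" and d: "0 < d" for t d
 proof -
  have t0: "0 \<le> t" "t < T" using t A by auto
  define V where "V = {t<..<min (t + d / 2) T}"
  have "open V" "V \<noteq> {}" using t0 d by (auto simp: V_def)
  have "\<not> V \<subseteq> - G"
  proof
   assume "V \<subseteq> - G"
   moreover have "V \<subseteq> {0<..<T}" using t0 by (auto simp: V_def)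
   ultimately have "AE t in lebesgue. t \<notin> V" using ae by (auto elim!: eventually_mono)
   then have "V \<in> null_sets lebesgue" using \<open>open V\<close> by (subst AE_iff_null_sets) (auto intro: borel_open)
   then show False using open_not_negligible[OF \<open>open V\<close> \<open>V \<noteq> {}\<close>] by (simp add: negligible_iff_null_sets)
  qed
  then obtain g where g: "g \<in> V" "g \<in> G" by blast
  then obtain q where q: "q \<in> Q" "dist q g < d / 2"
   using Q(3) d by (meson closure_approachable half_gt_zero subsetD)
  moreover have "\<bar>g - t\<bar> < d / 2" using g by (simp add: V_def)
  ultimately have "\<bar>q - t\<bar> < d" unfolding dist_real_def by arith
  then show ?thesis using q by blast
 qed
 have "AE x in S. \<bar>\<psi> q x\<bar> \<le> m" if q: "q \<in> Q" for q
 proof -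
  have "esssup S (\<lambda>x. ennreal \<bar>\<psi> q x\<bar>) \<le> ennreal m" using q Q by (auto simp: G_def lp_norm_def elp_norm_def)
  moreover have "AE x in S. ennreal \<bar>\<psi> q x\<bar> \<le> esssup S (\<lambda>x. ennreal \<bar>\<psi> q x\<bar>)" by (rule esssup_AE)
  ultimately have "AE x in S. ennreal \<bar>\<psi> q x\<bar> \<le> ennreal m" by (auto elim!: eventually_mono intro: order_trans)
  then show ?thesis by (simp add: m_def)
 qed
 then have "AE x in S. \<forall>q\<in>Q. \<bar>\<psi> q x\<bar> \<le> m" using Q(1) by (rule AE_ball_countable')
 with AE_space have "AE x in S. \<forall>t\<in>A. \<bar>\<psi> t x\<bar> \<le> m"
 proof eventually_elim
  fix x assume x: "x \<in> space S" and qb: "\<forall>q\<in>Q. \<bar>\<psi> q x\<bar> \<le> m"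
  show "\<forall>t\<in>A. \<bar>\<psi> t x\<bar> \<le> m"
  proof (rule ballI, rule field_le_epsilon)
   fix t \<epsilon> :: real assume t: "t \<in> A" and \<epsilon>: "0 < \<epsilon>"
   obtain d where d: "0 < d" "\<And>s. s \<in> A ==> \<bar>s - t\<bar> < d ==> \<bar>\<psi> s x - \<psi> t x\<bar> < \<epsilon>"
    using cont[OF x] t \<epsilon> unfolding continuous_on_iff dist_real_def by metis
   obtain q where q: "q \<in> Q" "\<bar>q - t\<bar> < d" using dense[OF t d(1)] by blast
   have "q \<in> {0<..<T}" using q Q by (auto simp: G_def)
   then have "q \<in> A" using A by blast
   then show "\<bar>\<psi> t x\<bar> \<le> m + \<epsilon>" using d(2)[OF _ q(2)] qb q(1) by fastforce
  qed
 qed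
 then show ?thesis by (simp add: m_def)
qed

lemma bochner_sup_le:
 assumes h: "h \<in> Lmeas {0<..<T}"
  and "\<And>t. t \<in> {0<..<T} ==> lp_norm M q (u t) = ennreal (h t)" "\<And>t. t \<in> {0<..<T} ==> h t \<le> b"
 shows "bochner_norm T \<infinity> M q u \<le> ennreal b"
proof -
 have "(\<lambda>t. ennreal (h t)) \<in> Lmeas {0<..<T}" using h by measurable
 then have "(\<lambda>t. lp_norm M q (u t)) \<in> Lmeas {0<..<T}"
  using assms(2) by (subst measurable_cong[where g = "\<lambda>t. ennreal (h t)"]) auto
 then show ?thesis unfolding bochner_norm_def elp_norm_def
  using assms(2,3) by (auto intro!: esssup_I AE_I2 ennreal_leI)
qed

lemma epowr_bochner_norm:
 assumes "0 < q" shows "epowr (bochner_norm T (ennreal q) M r u) q = (\<integral>\<^sup>+t. epowr (lp_norm M r (u t)) q \<partial>lebesgue_on {0<..<T})"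
 using assms by (simp add: bochner_norm_def elp_norm_def epowr_inverse)

lemma bochner_norm_2_squared:
 "(bochner_norm T 2 M r u)\<^sup>2 = (\<integral>\<^sup>+t. (lp_norm M r (u t))\<^sup>2 \<partial>lebesgue_on {0<..<T})"
 using epowr_bochner_norm[of 2 T M r u] by (simp add: epowr_two)

lemma ennreal_sqrt_eqI: "x\<^sup>2 = ennreal s ==> 0 \<le> s ==> x = ennreal (sqrt s)"
proof (cases x)
 case (real r)
 assume "x\<^sup>2 = ennreal s" "0 \<le> s"
 then have "r\<^sup>2 = s" using real by (simp add: ennreal_power)
 then show ?thesis using real by (auto simp: real_sqrt_unique)
qed (simp add: power2_eq_square ennreal_top_mult)

section \<open>The semidiscrete solution in nodal coordinates\<close>

locale fem_solution = mesh \<Omega> \<T> + power_law_flux K \<beta> c1 c2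
 for \<Omega> :: "'a::euclidean_space set" and \<T> and K \<beta> c1 c2 +
 fixes T \<phi>lo \<phi>hi Ct D :: real and \<phi> :: "'a \<Rightarrow> real" and k :: nat and \<pi>h and \<rho>0 :: "'a \<Rightarrow> real"
  and \<psi> f \<rho>h :: "real \<Rightarrow> 'a \<Rightarrow> real" and mh :: "real \<Rightarrow> 'a \<Rightarrow> 'a" and n :: nat and y :: "nat \<Rightarrow> 'a" and e :: "nat \<Rightarrow> 'a \<Rightarrow> real"
 assumes T: "0 < T" and \<phi>lo: "0 < \<phi>lo" and \<phi>: "admissible_phi \<Omega> \<phi>lo \<phi>hi \<phi>"
  and \<psi>: "admissible_psi \<Omega> T \<psi>" and f: "admissible_f \<Omega> T f"
  and initial: "\<pi>h \<rho>0 \<in> R_space \<Omega> k \<T>"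
  and sol: "semidiscrete_solution K \<Omega> T \<phi> k \<T> \<pi>h \<rho>0 \<psi> f \<rho>h mh"
  and node: "\<And>j. j < n ==> y j \<in> closure \<Omega>" and e: "\<And>j. j < n ==> e j \<in> R_space \<Omega> k \<T>"
  and basis: "\<And>u x. u \<in> R_space \<Omega> k \<T> ==> x \<in> closure \<Omega> ==> u x = (\<Sum>j<n. u (y j) * e j x)"
  and finite_surface: "finite_measure (surface_measure (frontier \<Omega>))"
  and Ct: "0 \<le> Ct" and D: "0 \<le> D"
  and young: "\<forall>m\<ge>0. \<forall>u\<ge>0. \<forall>\<xi>\<ge>0. m * Ct * (u + \<xi>) \<le> D * (1 + m powr lam) + u\<^sup>2 / 2 + (c1 * 2 powr (- \<beta>) / 2) * \<xi> powr \<beta>"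
  and trace_bound: "\<And>u. u \<in> piecewise_polynomials k \<T> ==> continuous_on (closure \<Omega>) u ==>
   (\<integral>\<^sup>+x. ennreal \<bar>u x\<bar> \<partial>surface_measure (frontier \<Omega>)) \<le> ennreal Ct * W11 \<Omega> u"
  and data_finite: "data_A lam \<Omega> T \<psi> f < \<infinity>"
begin

abbreviation "L \<equiv> lebesgue_on \<Omega>"
abbreviation "I \<equiv> {0<..<T}"
abbreviation "M \<equiv> lebesgue_on core"
abbreviation "S \<equiv> surface_measure (frontier \<Omega>)"
definition c where "c t j = \<rho>h t (y j)"
definition c' where "c' t j = time_deriv \<rho>h t (y j)"
definition m where "m = enn2real (bochner_norm T \<infinity> S \<infinity> \<psi>)"
definition Fb where "Fb = enn2real ((bochner_norm T 2 L 2 f)\<^sup>2)"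

lemma space_S: "space S = frontier \<Omega>"
 by (simp add: surface_measure_def space_restrict_space hausdorff_measure_def)

lemma space_M: "space M = core" by simp

lemma core_closure: "core \<subseteq> closure \<Omega>" and frontier_closure: "frontier \<Omega> \<subseteq> closure \<Omega>"
 using core_subset closure_subset[of \<Omega>] by (auto simp: frontier_def)

lemma R_space_continuous: "u \<in> R_space \<Omega> k \<T> ==> continuous_on (closure \<Omega>) u"
 and R_space_piecewise: "u \<in> R_space \<Omega> k \<T> ==> u \<in> piecewise_polynomials k \<T>"
 by (auto simp: R_space_def)

lemma lincomb_R_space: "(\<lambda>x. \<Sum>j<n. a j * e j x) \<in> R_space \<Omega> k \<T>"
 using e by (rule R_space_sum)

lemma basis_bounded:
 "\<exists>B. 0 \<le> B \<and> (\<forall>j<n. (\<forall>x\<in>closure \<Omega>. \<bar>e j x\<bar> \<le> B) \<and> (\<forall>x\<in>core. norm (grad (e j) x) \<le> B))"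
proof -
 have "\<exists>B. j < n \<longrightarrow> 0 \<le> B \<and> (\<forall>x\<in>closure \<Omega>. \<bar>e j x\<bar> \<le> B) \<and> (\<forall>x\<in>core. norm (grad (e j) x) \<le> B)" for j
 proof (cases "j < n")
  case True
  have "bounded (e j ` closure \<Omega>)"
   using R_space_continuous[OF e[OF True]] domain_bounded by (intro compact_imp_bounded compact_continuous_image) auto
  then obtain B1 where B1: "0 < B1" "\<forall>y\<in>e j ` closure \<Omega>. norm y \<le> B1" by (auto simp: bounded_pos)
  obtain B2 where B2: "0 \<le> B2" "\<And>x. x \<in> core ==> norm (grad (e j) x) \<le> B2"
   using M_space_bounded[OF grad_in_M_space[OF R_space_piecewise[OF e[OF True]]]] by blast
  show ?thesis using B1 B2 by (intro exI[of _ "B1 + B2"]) force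
 qed simp
 then obtain B where B: "\<And>j. j < n ==> 0 \<le> B j \<and> (\<forall>x\<in>closure \<Omega>. \<bar>e j x\<bar> \<le> B j) \<and> (\<forall>x\<in>core. norm (grad (e j) x) \<le> B j)"
  by metis
 have "B j \<le> (\<Sum>i<n. B i)" if "j < n" for j using that B by (intro member_le_sum) auto
 then show ?thesis using B by (intro exI[of _ "\<Sum>i<n. B i"]) (fastforce intro: sum_nonneg order_trans)
qed

definition Be where "Be = (SOME B. 0 \<le> B \<and> (\<forall>j<n. (\<forall>x\<in>closure \<Omega>. \<bar>e j x\<bar> \<le> B) \<and> (\<forall>x\<in>core. norm (grad (e j) x) \<le> B)))"

lemma Be: "0 \<le> Be" "j < n ==> x \<in> closure \<Omega> ==> \<bar>e j x\<bar> \<le> Be" "j < n ==> x \<in> core ==> norm (grad (e j) x) \<le> Be"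
 using someI_ex[OF basis_bounded] unfolding Be_def[symmetric] by blast+

lemma grad_lincomb_core:
 assumes "x \<in> core" shows "grad (\<lambda>x. \<Sum>j<n. a j * e j x) x = (\<Sum>j<n. a j *\<^sub>R grad (e j) x)"
 using piecewise_polynomial_differentiable[OF R_space_piecewise[OF e] assms] by (intro grad_lincomb(2)) auto

lemma grad_R_space:
 assumes u: "u \<in> R_space \<Omega> k \<T>" and x: "x \<in> core"
 shows "grad u x = (\<Sum>j<n. u (y j) *\<^sub>R grad (e j) x)"
proof -
 have "grad u x = grad (\<lambda>x. \<Sum>j<n. u (y j) * e j x) x"
  using core_closure basis[OF u] by (intro grad_transform_open(2)[OF core_open x])
   (auto intro: piecewise_polynomial_differentiable[OF R_space_piecewise[OF lincomb_R_space] x])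
 then show ?thesis using grad_lincomb_core[OF x] by simp
qed

lemma trace_real:
 "(\<integral>x. \<bar>\<Sum>j<n. a j * e j x\<bar> \<partial>S) \<le> Ct * (\<integral>x. \<bar>\<Sum>j<n. a j * e j x\<bar> + norm (\<Sum>j<n. a j *\<^sub>R grad (e j) x) \<partial>M)"
proof -
 let ?u = "\<lambda>x. \<Sum>j<n. a j * e j x" and ?g = "\<lambda>x. \<Sum>j<n. a j *\<^sub>R grad (e j) x"
 have uR: "?u \<in> R_space \<Omega> k \<T>" by (rule lincomb_R_space)
 have b: "\<bar>?u x\<bar> \<le> (\<Sum>j<n. \<bar>a j\<bar> * Be)" if "x \<in> closure \<Omega>" for x
  using Be(2)[OF _ that] by (intro order_trans[OF sum_abs] sum_mono) (auto simp: abs_mult intro: mult_left_mono)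
 have bg: "norm (?g x) \<le> (\<Sum>j<n. \<bar>a j\<bar> * Be)" if "x \<in> core" for x
  using Be(3)[OF _ that] by (intro order_trans[OF norm_sum] sum_mono) (auto intro: mult_left_mono)
 have iS: "integrable S (\<lambda>x. \<bar>?u x\<bar>)"
 proof (rule integrable_bounded[OF finite_surface])
  show "(\<lambda>x. \<bar>?u x\<bar>) \<in> borel_measurable S"
   using continuous_on_subset[OF R_space_continuous[OF uR] frontier_closure]
   by (intro surface_measurable continuous_on_rabs) auto
  show "\<bar>\<bar>?u x\<bar>\<bar> \<le> (\<Sum>j<n. \<bar>a j\<bar> * Be)" if "x \<in> space S" for x using b that frontier_closure by (auto simp: space_S)
 qed
 have cg: "continuous_on core (\<lambda>x. ?g x)"
  using M_space_continuous_on[OF grad_in_M_space[OF R_space_piecewise[OF e]]] by (intro continuous_intros) auto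
 have iM: "integrable M (\<lambda>x. \<bar>?u x\<bar> + norm (?g x))"
 proof (rule integrable_bounded[OF finite_measure_core])
  show "(\<lambda>x. \<bar>?u x\<bar> + norm (?g x)) \<in> borel_measurable M"
   using continuous_on_subset[OF R_space_continuous[OF uR] core_closure] cg
   by (intro measurable_core continuous_on_add continuous_on_rabs continuous_on_norm)
  show "\<bar>\<bar>?u x\<bar> + norm (?g x)\<bar> \<le> (\<Sum>j<n. \<bar>a j\<bar> * Be) + (\<Sum>j<n. \<bar>a j\<bar> * Be)" if "x \<in> space M" for x
  proof -
   have "x \<in> core" "x \<in> closure \<Omega>" using that core_closure by (auto simp: space_M)
   from add_mono[OF b[OF this(2)] bg[OF this(1)]] show ?thesis by (simp add: abs_of_nonneg)
  qed
 qed
 have "ennreal (\<integral>x. \<bar>?u x\<bar> \<partial>S) = (\<integral>\<^sup>+x. ennreal \<bar>?u x\<bar> \<partial>S)" using iS by (intro nn_integral_eq_integral[symmetric]) auto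
 also have "\<dots> \<le> ennreal Ct * W11 \<Omega> ?u"
  by (rule trace_bound[OF R_space_piecewise[OF uR] R_space_continuous[OF uR]])
 also have "W11 \<Omega> ?u = (\<integral>\<^sup>+x. ennreal (\<bar>?u x\<bar> + norm (?g x)) \<partial>M)"
  unfolding nn_integral_core by (intro nn_integral_cong) (simp add: grad_lincomb_core space_M)
 also have "\<dots> = ennreal (\<integral>x. \<bar>?u x\<bar> + norm (?g x) \<partial>M)" using iM by (intro nn_integral_eq_integral) auto
 finally have "ennreal (\<integral>x. \<bar>?u x\<bar> \<partial>S) \<le> ennreal (Ct * (\<integral>x. \<bar>?u x\<bar> + norm (?g x) \<partial>M))"
  using Ct by (simp add: ennreal_mult')
 then show ?thesis using Ct by (subst (asm) ennreal_le_iff) (auto intro!: mult_nonneg_nonneg integral_nonneg_AE)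
qed

lemma \<phi>_bounds: "x \<in> core ==> \<phi>lo \<le> \<phi> x \<and> \<phi> x \<le> \<phi>hi" and \<phi>_continuous: "continuous_on core \<phi>"
proof -
 show "x \<in> core ==> \<phi>lo \<le> \<phi> x \<and> \<phi> x \<le> \<phi>hi" using \<phi> core_subset by (fastforce simp: admissible_phi_def)
 have "continuous_on \<Omega> \<phi>" using \<phi> by (intro Ck_on_1(2)) (auto simp: admissible_phi_def)
 then show "continuous_on core \<phi>" using core_subset by (rule continuous_on_subset)
qed

lemma \<phi>lohi: "\<phi>lo \<le> \<phi>hi"
 using \<phi> domain_nonempty by (fastforce simp: admissible_phi_def)

sublocale ds: discrete_space K \<beta> c1 c2 M S "{..<n}" e "\<lambda>j. grad (e j)" \<phi> \<phi>lo \<phi>hi Ct D T Be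
proof (intro discrete_space.intro discrete_space_axioms.intro)
 show "power_law_flux K \<beta> c1 c2" by (rule power_law_flux_axioms)
 show "finite_measure M" by (rule finite_measure_core)
 show "finite_measure S" by (rule finite_surface)
 fix j assume j: "j \<in> {..<n}"
 have ec: "continuous_on (closure \<Omega>) (e j)" using R_space_continuous e j by simp
 show "e j \<in> borel_measurable M" by (rule measurable_core[OF continuous_on_subset[OF ec core_closure]])
 show "e j \<in> borel_measurable S" by (rule surface_measurable[OF _ continuous_on_subset[OF ec frontier_closure]]) simp
 show "grad (e j) \<in> borel_measurable M"
  using M_space_continuous_on[OF grad_in_M_space[OF R_space_piecewise[OF e]]] j by (intro measurable_core) auto
 show "\<bar>e j x\<bar> \<le> Be" if "x \<in> space M" for x using Be(2) j that core_closure by (auto simp: space_M)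
 show "\<bar>e j x\<bar> \<le> Be" if "x \<in> space S" for x using Be(2) j that frontier_closure by (auto simp: space_S)
 show "norm (grad (e j) x) \<le> Be" if "x \<in> space M" for x using Be(3) j that by (auto simp: space_M)
next
 show "\<phi> \<in> borel_measurable M" by (rule measurable_core[OF \<phi>_continuous])
 show "m * Ct * (u + \<xi>) \<le> D * (1 + m powr (\<beta> / (\<beta> - 1))) + u\<^sup>2 / 2 + (c1 * 2 powr (- \<beta>) / 2) * \<xi> powr \<beta>"
  if "0 \<le> m" "0 \<le> u" "0 \<le> \<xi>" for m u \<xi> using young that by (simp add: lam_def)
 show "\<phi>lo \<le> \<phi> x \<and> \<phi> x \<le> \<phi>hi" if "x \<in> space M" for x using \<phi>_bounds that by simp
qed (rule finite_lessThan \<phi>lo \<phi>lohi Ct T D Be(1) trace_real)+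

lemma solution_facts:
 shows "\<And>x. x \<in> closure \<Omega> ==> \<rho>h 0 x = \<pi>h \<rho>0 x"
  and "\<And>x. x \<in> closure \<Omega> ==> continuous_on {0..<T} (\<lambda>t. \<rho>h t x)"
  and "\<And>x. x \<in> closure \<Omega> ==> (\<lambda>t. \<rho>h t x) differentiable_on I"
  and "\<And>t. t \<in> I ==> mh t \<in> M_space k \<T>"
  and "\<And>t. t \<in> I ==> \<rho>h t \<in> R_space \<Omega> k \<T>"
  and "\<And>t z. t \<in> I ==> z \<in> M_space k \<T> ==> L2_inner L (mh t) z +
      L2_inner L (\<lambda>x. K (norm (grad (\<rho>h t) x)) *\<^sub>R grad (\<rho>h t) x) z = 0"
  and "\<And>t r. t \<in> I ==> r \<in> R_space \<Omega> k \<T> ==>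
      L2_inner L (\<lambda>x. \<phi> x * time_deriv \<rho>h t x) r - L2_inner L (mh t) (grad r) =
      L2_inner L (f t) r - L2_inner S (\<psi> t) r"
 using sol[unfolded semidiscrete_solution_def, THEN conjunct1, rule_format]
  sol[unfolded semidiscrete_solution_def, THEN conjunct2, rule_format] by (blast, blast, blast, blast, blast, blast, blast)

lemma c_continuous: "j < n ==> continuous_on {0..<T} (\<lambda>t. c t j)"
 unfolding c_def by (intro solution_facts(2) node)

lemma time_derivative:
 assumes x: "x \<in> closure \<Omega>" and t: "t \<in> I"
 shows "((\<lambda>t. \<rho>h t x) has_real_derivative time_deriv \<rho>h t x) (at t)"
proof -
 have "(\<lambda>t. \<rho>h t x) differentiable (at t)"
  using solution_facts(3)[OF x] t by (simp add: differentiable_on_eq_differentiable_at)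
 then show ?thesis by (simp add: DERIV_deriv_iff_real_differentiable)
qed

lemma c_derivative: "j < n ==> t \<in> I ==> ((\<lambda>t. c t j) has_real_derivative c' t j) (at t)"
 unfolding c_def c'_def by (intro time_derivative node)

lemma \<rho>h_expansion: "t \<in> I ==> x \<in> closure \<Omega> ==> \<rho>h t x = ds.U (c t) x"
 unfolding ds.U_def c_def by (rule basis[OF solution_facts(5)])

lemma \<pi>h_expansion: "x \<in> closure \<Omega> ==> \<pi>h \<rho>0 x = ds.U (c 0) x"
proof -
 assume x: "x \<in> closure \<Omega>"
 have "\<pi>h \<rho>0 x = (\<Sum>j<n. \<pi>h \<rho>0 (y j) * e j x)" by (rule basis[OF initial x])
 also have "\<dots> = ds.U (c 0) x" unfolding ds.U_def c_def using solution_facts(1)[OF node] by (intro sum.cong) auto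
 finally show ?thesis .
qed

lemma grad_\<rho>h: "t \<in> I ==> x \<in> core ==> grad (\<rho>h t) x = ds.G (c t) x"
 unfolding ds.G_def c_def by (rule grad_R_space[OF solution_facts(5)])

lemma grad_\<pi>h: "x \<in> core ==> grad (\<pi>h \<rho>0) x = ds.G (c 0) x"
proof -
 assume x: "x \<in> core"
 have "grad (\<pi>h \<rho>0) x = (\<Sum>j<n. \<pi>h \<rho>0 (y j) *\<^sub>R grad (e j) x)" by (rule grad_R_space[OF initial x])
 also have "\<dots> = ds.G (c 0) x" unfolding ds.G_def c_def using solution_facts(1)[OF node] by (intro sum.cong) auto
 finally show ?thesis .
qed

lemma time_deriv_expansion:
 assumes x: "x \<in> closure \<Omega>" and t: "t \<in> I"
 shows "time_deriv \<rho>h t x = ds.U (c' t) x"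
proof -
 have "((\<lambda>s. ds.U (c s) x) has_real_derivative ds.U (c' t) x) (at t)"
  unfolding ds.U_def using c_derivative t by (intro DERIV_sum DERIV_cmult_right) auto
 then have "((\<lambda>s. \<rho>h s x) has_real_derivative ds.U (c' t) x) (at t)"
  by (rule has_field_derivative_transform_within_open[of _ _ _ "I"]) (use t \<rho>h_expansion x in auto)
 with time_derivative[OF x t] show ?thesis by (rule DERIV_unique)
qed

lemma m_finite: "bochner_norm T \<infinity> S \<infinity> \<psi> = ennreal m" "0 \<le> m"
 and Fb_finite: "(bochner_norm T 2 L 2 f)\<^sup>2 = ennreal Fb" "0 \<le> Fb"
proof -
 have "epowr (bochner_norm T \<infinity> S \<infinity> \<psi>) lam < \<infinity>" "(bochner_norm T 2 L 2 f)\<^sup>2 < \<infinity>"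
  using data_finite by (auto simp: data_A_def)
 then show "bochner_norm T \<infinity> S \<infinity> \<psi> = ennreal m" "(bochner_norm T 2 L 2 f)\<^sup>2 = ennreal Fb"
  by (simp_all add: m_def Fb_def epowr_less_top[unfolded infinity_ennreal_def] less_top)
qed (simp_all add: m_def Fb_def)

lemma data_A_eq: "data_A lam \<Omega> T \<psi> f = ennreal (1 + m powr lam + Fb)"
 using m_finite Fb_finite by (simp add: data_A_def epowr_ennreal ennreal_plus)

lemma \<psi>_continuous_time: "x \<in> frontier \<Omega> ==> continuous_on {0..<T} (\<lambda>t. \<psi> t x)"
 and \<psi>_continuous_space: "t \<in> {0..<T} ==> continuous_on (frontier \<Omega>) (\<psi> t)"
proof -
 have c: "continuous_on (frontier \<Omega> \<times> {0..<T}) (\<lambda>(x, t). \<psi> t x)" using \<psi> by (simp add: admissible_psi_def)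
 show "continuous_on {0..<T} (\<lambda>t. \<psi> t x)" if "x \<in> frontier \<Omega>"
  using continuous_on_compose2[OF c, of "{0..<T}" "\<lambda>t. (x, t)"] that
  by (auto simp: continuous_on_Pair continuous_on_const continuous_on_id)
 show "continuous_on (frontier \<Omega>) (\<psi> t)" if "t \<in> {0..<T}"
 proof -
  have "continuous_on (frontier \<Omega>) (\<lambda>x. (x, t))" by (intro continuous_on_Pair continuous_on_const continuous_on_id)
  moreover have "(\<lambda>x. (x, t)) ` frontier \<Omega> \<subseteq> frontier \<Omega> \<times> {0..<T}" using that by blast
  ultimately have "continuous_on (frontier \<Omega>) (\<lambda>x. case (x, t) of (x, t) \<Rightarrow> \<psi> t x)" by (rule continuous_on_compose2[OF c])
  then show ?thesis by simp
 qed
qed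

lemma f_facts:
 assumes t: "t \<in> I"
 shows "f t \<in> borel_measurable M" "integrable M (\<lambda>x. (f t x)\<^sup>2)"
  "(lp_norm L 2 (f t))\<^sup>2 = ennreal (\<integral>x. (f t x)\<^sup>2 \<partial>M)"
proof -
 have fm: "f t \<in> Lmeas \<Omega>" and fin: "lp_norm L 2 (f t) < \<infinity>"
  using f t by (auto simp: admissible_f_def)
 have "restrict_space L core = M"
  using core_subset domain_open core_open by (simp add: restrict_restrict_space Int_absorb1 borel_open)
 then show fM: "f t \<in> borel_measurable M" using measurable_restrict_space1[OF fm, of core] by simp
 have sq: "(lp_norm L 2 (f t))\<^sup>2 = (\<integral>\<^sup>+x. ennreal ((f t x)\<^sup>2) \<partial>M)"
  by (simp add: lp_norm_2_squared nn_integral_core)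
 moreover have "(lp_norm L 2 (f t))\<^sup>2 < \<infinity>" using fin by (simp add: power_less_top_ennreal)
 ultimately show int: "integrable M (\<lambda>x. (f t x)\<^sup>2)" using fM by (intro integrableI_nonneg) auto
 show "(lp_norm L 2 (f t))\<^sup>2 = ennreal (\<integral>x. (f t x)\<^sup>2 \<partial>M)"
  unfolding sq using int by (intro nn_integral_eq_integral) auto
qed

lemma flux_test:
 assumes t: "t \<in> I" and z: "z \<in> M_space k \<T>"
 shows "(\<integral>x. mh t x \<bullet> z x \<partial>M) = - (\<integral>x. K (norm (ds.G (c t) x)) * (ds.G (c t) x \<bullet> z x) \<partial>M)"
proof -
 have "L2_inner M (\<lambda>x. K (norm (grad (\<rho>h t) x)) *\<^sub>R grad (\<rho>h t) x) z = (\<integral>x. K (norm (ds.G (c t) x)) * (ds.G (c t) x \<bullet> z x) \<partial>M)"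
  unfolding L2_inner_def using grad_\<rho>h[OF t] by (intro Bochner_Integration.integral_cong) auto
 then show ?thesis using solution_facts(6)[OF t z] by (simp add: L2_inner_core) (simp add: L2_inner_def)
qed

sublocale sol: discrete_solution K \<beta> c1 c2 M S "{..<n}" e "\<lambda>j. grad (e j)" \<phi> \<phi>lo \<phi>hi Ct D T Be c c' \<psi> f m Fb
proof (intro discrete_solution.intro discrete_solution_axioms.intro)
 show "discrete_space K \<beta> c1 c2 M S {..<n} e (\<lambda>j. grad (e j)) \<phi> \<phi>lo \<phi>hi Ct D T Be" by (rule ds.discrete_space_axioms)
 show "AE x in S. \<forall>t\<in>{0..<T}. \<bar>\<psi> t x\<bar> \<le> m"
  unfolding m_def using \<psi>_continuous_time m_finite(1) T by (intro bochner_sup_bound) (auto simp: space_S)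
 show "\<psi> t \<in> borel_measurable S" if "t \<in> {0..<T}" for t
  by (rule surface_measurable[OF _ \<psi>_continuous_space[OF that]]) simp
 show "AE x in S. continuous_on {0..<T} (\<lambda>t. \<psi> t x)" using \<psi>_continuous_time by (intro AE_I2) (auto simp: space_S)
 show "(\<integral>\<^sup>+t. ennreal (\<integral>x. (f t x)\<^sup>2 \<partial>M) \<partial>lebesgue_on I) \<le> ennreal Fb"
 proof -
  have "(\<integral>\<^sup>+t. ennreal (\<integral>x. (f t x)\<^sup>2 \<partial>M) \<partial>lebesgue_on I) = (bochner_norm T 2 L 2 f)\<^sup>2"
   unfolding bochner_norm_2_squared using f_facts(3) by (intro nn_integral_cong) simp
  then show ?thesis using Fb_finite by simp
 qed
 fix t a assume t: "t \<in> I"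
 let ?r = "ds.U a"
 have rR: "?r \<in> R_space \<Omega> k \<T>" unfolding ds.U_def[abs_def] by (rule lincomb_R_space)
 have gr: "grad ?r x = ds.G a x" if "x \<in> core" for x
  using grad_lincomb_core[OF that] by (simp add: ds.U_def[abs_def] ds.G_def)
 have "(\<integral>x. mh t x \<bullet> grad ?r x \<partial>M) = - (\<integral>x. K (norm (ds.G (c t) x)) * (ds.G (c t) x \<bullet> grad ?r x) \<partial>M)"
  by (rule flux_test[OF t grad_in_M_space[OF R_space_piecewise[OF rR]]])
 also have "(\<integral>x. K (norm (ds.G (c t) x)) * (ds.G (c t) x \<bullet> grad ?r x) \<partial>M) = (\<integral>x. K (norm (ds.G (c t) x)) * (ds.G (c t) x \<bullet> ds.G a x) \<partial>M)"
  using gr by (intro Bochner_Integration.integral_cong) auto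
 finally have 1: "L2_inner M (mh t) (grad ?r) = - (\<integral>x. K (norm (ds.G (c t) x)) * (ds.G (c t) x \<bullet> ds.G a x) \<partial>M)"
  by (simp add: L2_inner_def)
 have 2: "L2_inner M (\<lambda>x. \<phi> x * time_deriv \<rho>h t x) ?r = (\<integral>x. \<phi> x * ds.U (c' t) x * ds.U a x \<partial>M)"
  unfolding L2_inner_def using time_deriv_expansion[OF _ t] core_closure by (intro Bochner_Integration.integral_cong) auto
 show "(\<integral>x. \<phi> x * ds.U (c' t) x * ds.U a x \<partial>M) + (\<integral>x. K (norm (ds.G (c t) x)) * (ds.G (c t) x \<bullet> ds.G a x) \<partial>M)
     = (\<integral>x. f t x * ds.U a x \<partial>M) - (\<integral>x. \<psi> t x * ds.U a x \<partial>S)"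
  using solution_facts(7)[OF t rR] 1 2 by (simp add: L2_inner_core) (simp add: L2_inner_def)
next
 show "continuous_on {0..<T} (\<lambda>t. c t j)" if "j \<in> {..<n}" for j using c_continuous that by simp
 show "((\<lambda>t. c t j) has_real_derivative c' t j) (at t)" if "j \<in> {..<n}" "t \<in> I" for j t
  using c_derivative that by simp
 show "0 \<le> m" "0 \<le> Fb" by (fact m_finite(2) Fb_finite(2))+
 show "f t \<in> borel_measurable M" "integrable M (\<lambda>x. (f t x)\<^sup>2)" if "t \<in> I" for t
  using f_facts[OF that] by blast+
qed

lemma M_measure: "measure M (space M) = measure lebesgue \<Omega>"
proof -
 have "measure M (space M) = measure lebesgue core"
  using core_lmeasurable by (simp add: measure_restrict_space fmeasurableD)
 also have "\<dots> = measure lebesgue \<Omega>"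
  using domain_open core_open eventually_mono[OF AE_core] by (intro measure_eq_AE) (auto intro: borel_open)
 finally show ?thesis .
qed

lemma norm_\<rho>h: "t \<in> I ==> lp_norm L 2 (\<rho>h t) = ennreal (sqrt (sol.u2 t))"
 and norm_grad_\<rho>h: "t \<in> I ==> epowr (lp_norm L (ennreal \<beta>) (grad (\<rho>h t))) \<beta> = ennreal (sol.gB t)"
proof -
 assume t: "t \<in> I"
 have "(lp_norm L 2 (\<rho>h t))\<^sup>2 = (\<integral>\<^sup>+x. ennreal ((ds.U (c t) x)\<^sup>2) \<partial>M)"
  unfolding lp_norm_2_squared nn_integral_core using \<rho>h_expansion[OF t] core_closure by (intro nn_integral_cong) auto
 also have "\<dots> = ennreal (sol.u2 t)" unfolding sol.u2_def using ds.U2_integrable(1) by (intro nn_integral_eq_integral) auto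
 finally show "lp_norm L 2 (\<rho>h t) = ennreal (sqrt (sol.u2 t))"
  using sol.u2_nonneg by (rule ennreal_sqrt_eqI)
 have "epowr (lp_norm L (ennreal \<beta>) (grad (\<rho>h t))) \<beta> = (\<integral>\<^sup>+x. ennreal (norm (ds.G (c t) x) powr \<beta>) \<partial>M)"
 proof -
  have "epowr (lp_norm L (ennreal \<beta>) (grad (\<rho>h t))) \<beta> = (\<integral>\<^sup>+x. ennreal (norm (grad (\<rho>h t) x) powr \<beta>) \<partial>M)"
   using beta by (simp add: epowr_lp_norm nn_integral_core)
  also have "\<dots> = (\<integral>\<^sup>+x. ennreal (norm (ds.G (c t) x) powr \<beta>) \<partial>M)"
   using grad_\<rho>h[OF t] by (intro nn_integral_cong) simp
  finally show ?thesis .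
 qed
 also have "\<dots> = ennreal (sol.gB t)" unfolding sol.gB_def using ds.GB_integrable by (intro nn_integral_eq_integral) auto
 finally show "epowr (lp_norm L (ennreal \<beta>) (grad (\<rho>h t))) \<beta> = ennreal (sol.gB t)" .
qed

lemma sol_continuous_measurable: "continuous_on {0..<T} h ==> h \<in> Lmeas I" for h :: "real \<Rightarrow> real"
 by (rule continuous_imp_measurable_on_sets_lebesgue[OF continuous_on_subset]) auto

lemma X_bound:
 assumes "ennreal (\<integral>x. (\<pi>h \<rho>0 x)\<^sup>2 \<partial>L) \<le> R"
 shows "ennreal (ds.X (sol.u2 0) m Fb) \<le> R + data_A lam \<Omega> T \<psi> f" "1 \<le> ds.X (sol.u2 0) m Fb"
proof -
 have "(\<integral>x. (\<pi>h \<rho>0 x)\<^sup>2 \<partial>L) = sol.u2 0"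
  unfolding integral_core sol.u2_def using \<pi>h_expansion core_closure by (intro Bochner_Integration.integral_cong) auto
 then have "ennreal (sol.u2 0) \<le> R" using assms by simp
 moreover have "ds.X (sol.u2 0) m Fb = sol.u2 0 + (1 + m powr lam + Fb)" by (simp add: ds.X_def)
 ultimately show "ennreal (ds.X (sol.u2 0) m Fb) \<le> R + data_A lam \<Omega> T \<psi> f"
  using sol.u2_nonneg[of 0] Fb_finite(2) unfolding data_A_eq by (simp add: ennreal_plus add_right_mono)
 show "1 \<le> ds.X (sol.u2 0) m Fb" using sol.u2_nonneg[of 0] Fb_finite(2) by (simp add: ds.X_def)
qed

lemma first_bound:
 assumes R: "ennreal (\<integral>x. (\<pi>h \<rho>0 x)\<^sup>2 \<partial>L) \<le> R"
 shows "(bochner_norm T \<infinity> L 2 \<rho>h)\<^sup>2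
     + epowr (bochner_norm T (ennreal \<beta>) L (ennreal \<beta>) (\<lambda>t. grad (\<rho>h t))) \<beta>
   \<le> ennreal ((2 / \<phi>lo + 2 / c1) * ds.A1) * (R + data_A lam \<Omega> T \<psi> f)"
proof -
 let ?X = "ds.X (sol.u2 0) m Fb"
 have X: "0 \<le> ?X" using X_bound(2)[OF R] by simp
 have "bochner_norm T \<infinity> L 2 \<rho>h \<le> ennreal (sqrt (2 / \<phi>lo * ds.A1 * ?X))"
  using norm_\<rho>h sol.first_estimate(1)
  by (intro bochner_sup_le[where h = "\<lambda>t. sqrt (sol.u2 t)"] sol_continuous_measurable continuous_on_real_sqrt sol.u2_continuous) auto
 then have "(bochner_norm T \<infinity> L 2 \<rho>h)\<^sup>2 \<le> (ennreal (sqrt (2 / \<phi>lo * ds.A1 * ?X)))\<^sup>2"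
  by (rule power_mono) simp
 also have "\<dots> = ennreal (2 / \<phi>lo * ds.A1 * ?X)" using X \<phi>lo ds.A1_nonneg by (simp add: ennreal_power)
 finally have 1: "(bochner_norm T \<infinity> L 2 \<rho>h)\<^sup>2 \<le> ennreal (2 / \<phi>lo * ds.A1 * ?X)" .
 have "epowr (bochner_norm T (ennreal \<beta>) L (ennreal \<beta>) (\<lambda>t. grad (\<rho>h t))) \<beta> = time_integral T sol.gB"
  using beta norm_grad_\<rho>h by (subst epowr_bochner_norm) (auto intro!: nn_integral_cong)
 also have "\<dots> \<le> ennreal (2 / c1 * ds.A1 * ?X)" by (rule sol.first_estimate(2))
 finally have "(bochner_norm T \<infinity> L 2 \<rho>h)\<^sup>2
     + epowr (bochner_norm T (ennreal \<beta>) L (ennreal \<beta>) (\<lambda>t. grad (\<rho>h t))) \<beta>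
   \<le> ennreal (2 / \<phi>lo * ds.A1 * ?X) + ennreal (2 / c1 * ds.A1 * ?X)" using 1 by (rule add_mono[rotated])
 also have "\<dots> = ennreal ((2 / \<phi>lo + 2 / c1) * ds.A1) * ennreal ?X"
 proof -
  have nn: "0 \<le> 2 / \<phi>lo * ds.A1 * ?X" "0 \<le> 2 / c1 * ds.A1 * ?X" "0 \<le> (2 / \<phi>lo + 2 / c1) * ds.A1"
   using X \<phi>lo c1_pos ds.A1_nonneg by auto
  have "2 / \<phi>lo * ds.A1 * ?X + 2 / c1 * ds.A1 * ?X = ((2 / \<phi>lo + 2 / c1) * ds.A1) * ?X" by (simp only: distrib_right)
  then show ?thesis unfolding ennreal_plus[OF nn(1,2), symmetric] ennreal_mult'[OF nn(3), symmetric] by simp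
 qed
 also have "\<dots> \<le> ennreal ((2 / \<phi>lo + 2 / c1) * ds.A1) * (R + data_A lam \<Omega> T \<psi> f)"
  by (rule mult_left_mono[OF X_bound(1)[OF R]]) simp
 finally show ?thesis .
qed

end

lemma epowr_eqI: "epowr x p = ennreal s ==> 0 \<le> s ==> 0 < p ==> x = ennreal (s powr (1 / p))"
proof (cases x)
 case (real r)
 assume "epowr x p = ennreal s" "0 \<le> s" "0 < p"
 then have "r powr p = s" using real by (simp add: epowr_def)
 then show ?thesis using real \<open>0 < p\<close> by (auto simp: powr_powr)
qed (simp add: epowr_def)

context fem_solution
begin

lemma \<psi>_smooth:
 shows "\<And>x t. x \<in> frontier \<Omega> ==> t \<in> I ==> ((\<lambda>s. \<psi> s x) has_real_derivative time_deriv \<psi> t x) (at t)"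
  and "\<And>x. x \<in> frontier \<Omega> ==> continuous_on I (\<lambda>t. time_deriv \<psi> t x)"
  and "\<And>t. t \<in> I ==> continuous_on (frontier \<Omega>) (\<lambda>x. time_deriv \<psi> t x)"
proof -
 have "smooth_on (frontier \<Omega> \<times> I) (\<lambda>(x, t). \<psi> t x)" using \<psi> by (simp add: admissible_psi_def)
 then obtain U v where U: "open U" "frontier \<Omega> \<times> I \<subseteq> U" and Ck: "\<And>k. Ck_on k U v"
  and v: "\<And>z. z \<in> frontier \<Omega> \<times> I ==> v z = (case z of (x, t) \<Rightarrow> \<psi> t x)"
  by (rule smooth_extension) blast
 define b where "b = (0::'a, 1::real)"
 have b: "b \<in> Basis" by (simp add: b_def Basis_prod_def)
 have pc: "continuous_on U (pderivative b v)" using Ck[of 1] b by auto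
 have der: "((\<lambda>s. \<psi> s x) has_real_derivative pderivative b v (x, t)) (at t)" if x: "x \<in> frontier \<Omega>" and t: "t \<in> I" for x t
 proof -
  have "(x, t) \<in> U" using U x t by auto
  then have "(v has_derivative (\<lambda>z. grad v (x, t) \<bullet> z)) (at (x, t))"
   using Ck_on_1(1)[OF Ck[of 1]] by (intro has_derivative_grad) blast
  then have "((\<lambda>s. v (x, s)) has_derivative (\<lambda>h. grad v (x, t) \<bullet> (0, h))) (at t)"
   by (intro has_derivative_compose[of "\<lambda>s. (x, s)" "\<lambda>h. (0, h)" t UNIV v]) (auto intro!: derivative_eq_intros)
  note d = this
  have eq: "grad v (x, t) \<bullet> (0, h) = h * pderivative b v (x, t)" for h
  proof -
   have "(0, h) = h *\<^sub>R b" by (simp add: b_def)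
   then show ?thesis by (simp add: grad_inner_Basis[OF b])
  qed
  have "((\<lambda>s. v (x, s)) has_real_derivative pderivative b v (x, t)) (at t)"
   unfolding has_field_derivative_def by (rule has_derivative_eq_rhs[OF d]) (auto simp: eq mult.commute)
  then show ?thesis
   by (rule has_field_derivative_transform_within_open[of _ _ _ "I"]) (use x t v in auto)
 qed
 have td: "time_deriv \<psi> t x = pderivative b v (x, t)" if "x \<in> frontier \<Omega>" "t \<in> I" for x t
  using der[OF that] by (rule DERIV_imp_deriv)
 show "((\<lambda>s. \<psi> s x) has_real_derivative time_deriv \<psi> t x) (at t)" if "x \<in> frontier \<Omega>" "t \<in> I" for x t
  using der[OF that] td[OF that] by simp
 show "continuous_on I (\<lambda>t. time_deriv \<psi> t x)" if x: "x \<in> frontier \<Omega>" for x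
 proof -
  have "continuous_on I (\<lambda>t. (x, t))" by (intro continuous_on_Pair continuous_on_const continuous_on_id)
  then have "continuous_on I (\<lambda>t. pderivative b v (x, t))"
   by (rule continuous_on_compose2[OF pc]) (use U x in auto)
  then show ?thesis by (rule continuous_on_eq) (use td x in simp)
 qed
 show "continuous_on (frontier \<Omega>) (\<lambda>x. time_deriv \<psi> t x)" if t: "t \<in> I" for t
 proof -
  have "continuous_on (frontier \<Omega>) (\<lambda>x. (x, t))" by (intro continuous_on_Pair continuous_on_const continuous_on_id)
  then have "continuous_on (frontier \<Omega>) (\<lambda>x. pderivative b v (x, t))"
   by (rule continuous_on_compose2[OF pc]) (use U t in auto)
  then show ?thesis by (rule continuous_on_eq) (use td t in simp)
 qed
qed

definition flux_energy where "flux_energy t = (\<integral>x. (norm (mh t x))\<^sup>2 \<partial>M)"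

lemma M_space_integrable:
 assumes z: "z \<in> M_space k \<T>" "w \<in> M_space k \<T>"
 shows "integrable M (\<lambda>x. z x \<bullet> w x)"
proof -
 obtain B1 where B1: "0 \<le> B1" "\<And>x. x \<in> core ==> norm (z x) \<le> B1" using M_space_bounded[OF z(1)] by blast
 obtain B2 where B2: "0 \<le> B2" "\<And>x. x \<in> core ==> norm (w x) \<le> B2" using M_space_bounded[OF z(2)] by blast
 show ?thesis
 proof (rule integrable_bounded[OF finite_measure_core])
  show "(\<lambda>x. z x \<bullet> w x) \<in> borel_measurable M"
   using z by (intro measurable_core continuous_intros M_space_continuous_on)
  show "\<bar>z x \<bullet> w x\<bar> \<le> B1 * B2" if "x \<in> space M" for x
   using that B1 B2 by (intro order_trans[OF Cauchy_Schwarz_ineq2] mult_mono) auto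
 qed
qed

lemma flux_integrable:
 assumes z: "z \<in> M_space k \<T>"
 shows "integrable M (\<lambda>x. K (norm (ds.G a x)) * (ds.G a x \<bullet> z x))"
  and "continuous_on {0..<T} (\<lambda>t. \<integral>x. K (norm (ds.G (c t) x)) * (ds.G (c t) x \<bullet> z x) \<partial>M)"
proof -
 obtain Bz where Bz: "0 \<le> Bz" "\<And>x. x \<in> core ==> norm (z x) \<le> Bz" using M_space_bounded[OF z] by blast
 have zm: "z \<in> borel_measurable M" by (rule measurable_core[OF M_space_continuous_on[OF z]])
 have Fc: "continuous_on UNIV (\<lambda>u :: real \<times> 'a. K (norm (snd u)) * norm (snd u))"
  by (intro continuous_intros continuous_on_compose2[OF ds.flux_inner_continuous]) auto
 have Km: "(\<lambda>x. K (norm (ds.G a x))) \<in> borel_measurable M" for a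
  by (rule measurable_compose[OF ds.G_measurable borel_measurable_continuous_onI[OF ds.flux_inner_continuous]])
 have meas: "(\<lambda>x. K (norm (ds.G a x)) * (ds.G a x \<bullet> z x)) \<in> borel_measurable M" for a
  by (intro borel_measurable_times Km borel_measurable_inner ds.G_measurable zm)
 have bound: "\<exists>B. \<forall>a x. x \<in> core \<longrightarrow> ds.sz a \<le> r \<longrightarrow> \<bar>K (norm (ds.G a x)) * (ds.G a x \<bullet> z x)\<bar> \<le> B" if r: "0 \<le> r" for r
 proof -
  obtain B where B: "0 \<le> B" "\<And>a x. x \<in> core ==> ds.sz a \<le> r ==> \<bar>K (norm (ds.G a x)) * norm (ds.G a x)\<bar> \<le> B"
   using ds.functional_bounded[OF Fc r] by auto
  have "\<bar>K (norm (ds.G a x)) * (ds.G a x \<bullet> z x)\<bar> \<le> B * Bz" if "x \<in> core" "ds.sz a \<le> r" for a x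
  proof -
   have "\<bar>K (norm (ds.G a x)) * (ds.G a x \<bullet> z x)\<bar> \<le> \<bar>K (norm (ds.G a x))\<bar> * (norm (ds.G a x) * norm (z x))"
    unfolding abs_mult by (rule mult_left_mono[OF Cauchy_Schwarz_ineq2]) simp
   also have "\<dots> = \<bar>K (norm (ds.G a x)) * norm (ds.G a x)\<bar> * norm (z x)" by (simp add: abs_mult)
   also have "\<dots> \<le> B * Bz" using B(2)[OF that] Bz(2)[OF that(1)] B(1) by (intro mult_mono) auto
   finally show ?thesis .
  qed
  then show ?thesis by blast
 qed
 show "integrable M (\<lambda>x. K (norm (ds.G a x)) * (ds.G a x \<bullet> z x))"
 proof -
  obtain B where "\<forall>b x. x \<in> core \<longrightarrow> ds.sz b \<le> ds.sz a \<longrightarrow> \<bar>K (norm (ds.G b x)) * (ds.G b x \<bullet> z x)\<bar> \<le> B"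
   using bound[OF ds.sz_nonneg] by blast
  then show ?thesis by (intro integrable_bounded[OF finite_measure_core meas]) auto
 qed
 show "continuous_on {0..<T} (\<lambda>t. \<integral>x. K (norm (ds.G (c t) x)) * (ds.G (c t) x \<bullet> z x) \<partial>M)"
  unfolding continuous_on_eq_continuous_within
 proof
  fix t assume t: "t \<in> {0..<T}"
  obtain d r where d: "0 < d" "0 \<le> r" "\<And>s. s \<in> {0..<T} ==> \<bar>s - t\<bar> < d ==> ds.sz (c s) \<le> r"
   using sol.local_bound[OF t] by blast
  obtain B where B: "\<forall>a x. x \<in> core \<longrightarrow> ds.sz a \<le> r \<longrightarrow> \<bar>K (norm (ds.G a x)) * (ds.G a x \<bullet> z x)\<bar> \<le> B"
   using bound[OF d(2)] by blast
  show "continuous (at t within {0..<T}) (\<lambda>t. \<integral>x. K (norm (ds.G (c t) x)) * (ds.G (c t) x \<bullet> z x) \<partial>M)"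
  proof (rule continuous_param_integral[OF finite_measure_core t d(1)])
   show "(\<lambda>x. K (norm (ds.G (c s) x)) * (ds.G (c s) x \<bullet> z x)) \<in> borel_measurable M" for s by (rule meas)
   show "AE x in M. \<bar>K (norm (ds.G (c s) x)) * (ds.G (c s) x \<bullet> z x)\<bar> \<le> B" if "s \<in> {0..<T}" "\<bar>s - t\<bar> < d" for s
    using B d(3)[OF that] by (intro AE_I2) simp
   show "AE x in M. continuous (at t within {0..<T}) (\<lambda>s. K (norm (ds.G (c s) x)) * (ds.G (c s) x \<bullet> z x))"
   proof (rule AE_I2)
    fix x
    have "continuous_on {0..<T} (\<lambda>s. K (norm (ds.G (c s) x)) * (ds.G (c s) x \<bullet> z x))"
     by (intro continuous_on_mult continuous_on_inner continuous_on_const sol.G_continuous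
       continuous_on_compose2[OF ds.flux_inner_continuous sol.G_continuous]) auto
    then show "continuous (at t within {0..<T}) (\<lambda>s. K (norm (ds.G (c s) x)) * (ds.G (c s) x \<bullet> z x))"
     using t by (simp add: continuous_on_eq_continuous_within)
   qed
  qed
 qed
qed

text \<open>By duality \<open>\<parallel>m(t)\<parallel>\<^sup>2\<close> is a supremum over \<open>z\<close> of functions that are continuous in \<open>t\<close>, because
 \<open>(m(t), z)\<close> only involves the flux of \<open>\<rho>(t)\<close>; hence it is lower semicontinuous.\<close>

lemma flux_energy_measurable: "flux_energy \<in> Lmeas I"
proof (rule borel_measurableI_greater)
 fix a
 define q where "q z t = - 2 * (\<integral>x. K (norm (ds.G (c t) x)) * (ds.G (c t) x \<bullet> z x) \<partial>M) - (\<integral>x. z x \<bullet> z x \<partial>M)" for z :: "'a \<Rightarrow> 'a" and t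
 have mM: "mh t \<in> M_space k \<T>" if "t \<in> I" for t using solution_facts(4) that by blast
 have q: "q z t = 2 * (\<integral>x. mh t x \<bullet> z x \<partial>M) - (\<integral>x. z x \<bullet> z x \<partial>M)" if "z \<in> M_space k \<T>" "t \<in> I" for z t
  using flux_test[OF that(2,1)] by (simp add: q_def)
 have qle: "q z t \<le> flux_energy t" if z: "z \<in> M_space k \<T>" and t: "t \<in> I" for z t
 proof -
  note i = M_space_integrable[OF mM[OF t] z] M_space_integrable[OF z z] M_space_integrable[OF mM[OF t] mM[OF t]]
  have "q z t = (\<integral>x. 2 * (mh t x \<bullet> z x) - z x \<bullet> z x \<partial>M)" unfolding q[OF z t] using i by simp
  also have "\<dots> \<le> (\<integral>x. mh t x \<bullet> mh t x \<partial>M)"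
  proof (rule integral_mono)
   fix x
   have "0 \<le> (mh t x - z x) \<bullet> (mh t x - z x)" by simp
   then show "2 * (mh t x \<bullet> z x) - z x \<bullet> z x \<le> mh t x \<bullet> mh t x"
    by (simp add: inner_diff_left inner_diff_right inner_commute[of "z x" "mh t x"])
  qed (use i in auto)
  finally show ?thesis by (simp add: flux_energy_def power2_norm_eq_inner)
 qed
 have qeq: "q (mh t) t = flux_energy t" if "t \<in> I" for t
  using q[OF mM[OF that] that] by (simp add: flux_energy_def power2_norm_eq_inner)
 have "{t \<in> space (lebesgue_on I). a < flux_energy t} = (\<Union>s\<in>I. {t \<in> I. a < q (mh s) t})"
  using qle[OF mM] qeq by (auto intro: less_le_trans)
 moreover have "open {t \<in> I. a < q (mh s) t}" if "s \<in> I" for s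
 proof -
  have "continuous_on I (q (mh s))" unfolding q_def[abs_def]
   by (intro continuous_intros continuous_on_subset[OF flux_integrable(2)[OF mM[OF that]]]) auto
  then have "open (q (mh s) -` {a<..} \<inter> I)" by (simp add: continuous_on_open_vimage)
  moreover have "{t \<in> I. a < q (mh s) t} = q (mh s) -` {a<..} \<inter> I" by auto
  ultimately show ?thesis by simp
 qed
 ultimately have op: "open {t \<in> space (lebesgue_on I). a < flux_energy t}" by (simp add: open_UN)
 show "{t \<in> space (lebesgue_on I). a < flux_energy t} \<in> sets (lebesgue_on I)"
  using borel_open[OF op] by (auto simp: sets_restrict_space_iff)
qed

lemma flux_energy_bound:
 assumes t: "t \<in> I"
 shows "flux_energy t \<le> c2\<^sup>2 * (ds.\<mu> + sol.gB t)"
proof -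
 have mM: "mh t \<in> M_space k \<T>" using solution_facts(4) t by blast
 have im: "integrable M (\<lambda>x. (norm (mh t x))\<^sup>2)" using M_space_integrable[OF mM mM] by (simp add: power2_norm_eq_inner)
 have i1: "integrable M (\<lambda>x. 1 :: real)" by (rule finite_measure.integrable_const[OF finite_measure_core])
 have iG: "integrable M (\<lambda>x. c2\<^sup>2 * (1 + norm (ds.G (c t) x) powr \<beta>))"
  using Bochner_Integration.integrable_add[OF i1 ds.GB_integrable[of "c t"]] by (rule integrable_mult_right)
 have pw: "- (K (norm g) * (g \<bullet> w)) \<le> c2\<^sup>2 * (1 + norm g powr \<beta>) / 2 + (norm w)\<^sup>2 / 2" for g w :: 'a
 proof -
  define s where "s = K (norm g) * norm g"
  have s: "0 \<le> s" "s \<le> c2 * norm g powr (\<beta> - 1)" using K_nonneg[of "norm g"] flux_upper[of "norm g"] by (auto simp: s_def)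
  have "s\<^sup>2 \<le> (c2 * norm g powr (\<beta> - 1))\<^sup>2" using s by (intro power_mono) auto
  also have "\<dots> = c2\<^sup>2 * norm g powr (2 * (\<beta> - 1))"
  proof -
   have "(norm g powr (\<beta> - 1))\<^sup>2 = norm g powr (2 * (\<beta> - 1))"
    by (simp add: power2_eq_square powr_add[symmetric])
   then show ?thesis by (simp add: power_mult_distrib)
  qed
  also have "\<dots> \<le> c2\<^sup>2 * (1 + norm g powr \<beta>)"
  proof (rule mult_left_mono)
   show "norm g powr (2 * (\<beta> - 1)) \<le> 1 + norm g powr \<beta>"
   proof (cases "norm g \<le> 1")
    case True
    then have "norm g powr (2 * (\<beta> - 1)) \<le> 1 powr (2 * (\<beta> - 1))" using beta by (intro powr_mono2) auto
    then show ?thesis by (simp add: add_increasing2)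
   next
    case False
    then have "norm g powr (2 * (\<beta> - 1)) \<le> norm g powr \<beta>" using beta by (intro powr_mono) auto
    then show ?thesis by simp
   qed
  qed simp
  finally have s2: "s\<^sup>2 \<le> c2\<^sup>2 * (1 + norm g powr \<beta>)" .
  have "- (K (norm g) * (g \<bullet> w)) \<le> K (norm g) * \<bar>g \<bullet> w\<bar>"
   using mult_left_mono[of "- (g \<bullet> w)" "\<bar>g \<bullet> w\<bar>" "K (norm g)"] K_nonneg[of "norm g"] by simp
  also have "\<dots> \<le> K (norm g) * (norm g * norm w)"
   using K_nonneg[of "norm g"] by (intro mult_left_mono Cauchy_Schwarz_ineq2) auto
  also have "\<dots> = s * norm w" by (simp add: s_def)
  also have "\<dots> \<le> s\<^sup>2 / 2 + (norm w)\<^sup>2 / 2"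
   using sum_squares_bound[of s "norm w"] by simp
  finally show ?thesis using s2 by linarith
 qed
 have "flux_energy t = (\<integral>x. mh t x \<bullet> mh t x \<partial>M)" by (simp add: flux_energy_def power2_norm_eq_inner)
 also have "\<dots> = (\<integral>x. - (K (norm (ds.G (c t) x)) * (ds.G (c t) x \<bullet> mh t x)) \<partial>M)"
  using flux_test[OF t mM] by simp
 also have "\<dots> \<le> (\<integral>x. c2\<^sup>2 * (1 + norm (ds.G (c t) x) powr \<beta>) / 2 + (norm (mh t x))\<^sup>2 / 2 \<partial>M)"
  using flux_integrable(1)[OF mM] im iG pw by (intro integral_mono) auto
 also have "\<dots> = (\<integral>x. c2\<^sup>2 * (1 + norm (ds.G (c t) x) powr \<beta>) \<partial>M) / 2 + flux_energy t / 2"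
  using im iG by (simp add: flux_energy_def del: integral_mult_right_zero)
 finally have "flux_energy t \<le> (\<integral>x. c2\<^sup>2 * (1 + norm (ds.G (c t) x) powr \<beta>) \<partial>M)" by simp
 also have "\<dots> = c2\<^sup>2 * (ds.\<mu> + sol.gB t)"
  using Bochner_Integration.integral_add[OF i1 ds.GB_integrable[of "c t"]] by (simp add: ds.\<mu>_def sol.gB_def)
 finally show ?thesis .
qed

lemma norm_mh: "t \<in> I ==> lp_norm L 2 (mh t) = ennreal (sqrt (flux_energy t))"
proof -
 assume t: "t \<in> I"
 have mM: "mh t \<in> M_space k \<T>" using solution_facts(4) t by blast
 have im: "integrable M (\<lambda>x. (norm (mh t x))\<^sup>2)" using M_space_integrable[OF mM mM] by (simp add: power2_norm_eq_inner)
 have "(lp_norm L 2 (mh t))\<^sup>2 = ennreal (flux_energy t)"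
  unfolding lp_norm_2_squared nn_integral_core flux_energy_def using im by (intro nn_integral_eq_integral) auto
 then show ?thesis by (rule ennreal_sqrt_eqI) (simp add: flux_energy_def)
qed

end

locale fem_solution_smooth = fem_solution \<Omega> \<T> K \<beta> c1 c2 T \<phi>lo \<phi>hi Ct D \<phi> k \<pi>h \<rho>0 \<psi> f \<rho>h mh n y e
 for \<Omega> :: "'a::euclidean_space set" and \<T> K \<beta> c1 c2 T \<phi>lo \<phi>hi Ct D \<phi> k \<pi>h \<rho>0 \<psi> f \<rho>h mh n y e +
 assumes \<psi>t_finite: "bochner_norm T \<infinity> (surface_measure (frontier \<Omega>)) \<infinity> (time_deriv \<psi>) < \<infinity>"
begin

definition m' where "m' = enn2real (bochner_norm T \<infinity> S \<infinity> (time_deriv \<psi>))"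

sublocale smooth: discrete_solution_smooth K \<beta> c1 c2 M S "{..<n}" e "\<lambda>j. grad (e j)" \<phi> \<phi>lo \<phi>hi Ct D T Be c c' \<psi> f m Fb "time_deriv \<psi>" m'
proof (intro discrete_solution_smooth.intro discrete_solution_smooth_axioms.intro)
 show "discrete_solution K \<beta> c1 c2 M S {..<n} e (\<lambda>j. grad (e j)) \<phi> \<phi>lo \<phi>hi Ct D T Be c c' \<psi> f m Fb"
  by (rule sol.discrete_solution_axioms)
 show "0 \<le> m'" by (simp add: m'_def)
 show "AE x in S. \<forall>t\<in>I. \<bar>time_deriv \<psi> t x\<bar> \<le> m'"
  unfolding m'_def using \<psi>_smooth(2) \<psi>t_finite T by (intro bochner_sup_bound) (auto simp: space_S)
 show "(\<lambda>x. time_deriv \<psi> t x) \<in> borel_measurable S" if "t \<in> I" for t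
  by (rule surface_measurable[OF _ \<psi>_smooth(3)[OF that]]) simp
 show "AE x in S. \<forall>t\<in>I. ((\<lambda>s. \<psi> s x) has_real_derivative time_deriv \<psi> t x) (at t)"
  using \<psi>_smooth(1) by (intro AE_I2) (simp add: space_S)
qed

lemma Y_bound:
 assumes R: "ennreal (\<integral>x. (\<pi>h \<rho>0 x)\<^sup>2 \<partial>L) \<le> R"
  and P: "grad_power \<beta> \<Omega> (\<pi>h \<rho>0) \<le> P"
 shows "ennreal smooth.Y \<le> R + data_A lam \<Omega> T \<psi> f + P + epowr (bochner_norm T \<infinity> S \<infinity> (time_deriv \<psi>)) lam" "1 \<le> smooth.Y"
proof -
 have "grad_power \<beta> \<Omega> (\<pi>h \<rho>0) = (\<integral>\<^sup>+x. ennreal (norm (ds.G (c 0) x) powr \<beta>) \<partial>M)"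
  unfolding grad_power_def nn_integral_core using grad_\<pi>h by (intro nn_integral_cong) simp
 also have "\<dots> = ennreal (sol.gB 0)" unfolding sol.gB_def using ds.GB_integrable by (intro nn_integral_eq_integral) auto
 finally have g: "ennreal (sol.gB 0) \<le> P" using P by simp
 have eq: "bochner_norm T \<infinity> S \<infinity> (time_deriv \<psi>) = ennreal m'" using \<psi>t_finite by (simp add: m'_def less_top)
 have e: "epowr (bochner_norm T \<infinity> S \<infinity> (time_deriv \<psi>)) lam = ennreal (m' powr lam)"
  unfolding eq by (rule epowr_ennreal) (simp add: m'_def)
 have nn: "0 \<le> ds.X (sol.u2 0) m Fb" "0 \<le> sol.gB 0" using X_bound(2)[OF R] sol.gB_nonneg by auto
 have "ennreal smooth.Y = ennreal (ds.X (sol.u2 0) m Fb) + ennreal (sol.gB 0) + ennreal (m' powr lam)"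
  unfolding smooth.Y_def using nn by (simp add: ennreal_plus)
 then show "ennreal smooth.Y \<le> R + data_A lam \<Omega> T \<psi> f + P + epowr (bochner_norm T \<infinity> S \<infinity> (time_deriv \<psi>)) lam"
  unfolding e using X_bound(1)[OF R] g by (simp add: add_mono)
 show "1 \<le> smooth.Y" using X_bound(2)[OF R] sol.gB_nonneg[of 0] by (simp add: smooth.Y_def add_increasing2)
qed

definition Cb where "Cb = 1 / (ds.ch * \<phi>lo) * ds.A2"

lemma A2_nonneg: "0 \<le> ds.A2" and Cb_nonneg: "0 \<le> Cb"
proof -
 have ch: "0 < ds.ch" using c1_pos by (simp add: ds.ch_def)
 show A2: "0 \<le> ds.A2" unfolding ds.A2_def
  using ch \<phi>lo c1_pos c2_pos D T ds.\<mu>_nonneg ds.A1_nonneg by (intro add_nonneg_nonneg mult_nonneg_nonneg divide_nonneg_pos) auto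
 then show "0 \<le> Cb" using ch \<phi>lo by (simp add: Cb_def)
qed

lemma second_bound:
 assumes R: "ennreal (\<integral>x. (\<pi>h \<rho>0 x)\<^sup>2 \<partial>L) \<le> R"
 shows "(bochner_norm T 2 L 2 (time_deriv \<rho>h))\<^sup>2
     + epowr (bochner_norm T \<infinity> L (ennreal \<beta>) (\<lambda>t. grad (\<rho>h t))) \<beta>
     + bochner_norm T \<infinity> L 2 mh
   \<le> ennreal (1 / \<phi>lo\<^sup>2 * ds.A2 + Cb + (1 + c2\<^sup>2 * (ds.\<mu> + Cb))) * ennreal smooth.Y"
proof -
 let ?Y = smooth.Y
 let ?N = "bochner_norm T \<infinity> L (ennreal \<beta>) (\<lambda>t. grad (\<rho>h t))"
 have Y1: "1 \<le> ?Y" using Y_bound(2)[OF R order_refl] .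
 have gB: "sol.gB t \<le> Cb * ?Y" if "t \<in> I" for t
  using smooth.second_estimate(1)[OF that] by (simp add: Cb_def)
 have "(bochner_norm T 2 L 2 (time_deriv \<rho>h))\<^sup>2 = time_integral T smooth.a2"
  unfolding bochner_norm_2_squared
 proof (rule nn_integral_cong)
  fix t assume "t \<in> space (lebesgue_on I)"
  then have t: "t \<in> I" by simp
  have "(lp_norm L 2 (time_deriv \<rho>h t))\<^sup>2 = (\<integral>\<^sup>+x. ennreal ((ds.U (c' t) x)\<^sup>2) \<partial>M)"
   unfolding lp_norm_2_squared nn_integral_core using time_deriv_expansion[OF _ t] core_closure by (intro nn_integral_cong) auto
  also have "\<dots> = ennreal (smooth.a2 t)" unfolding smooth.a2_def using ds.U2_integrable(1) by (intro nn_integral_eq_integral) auto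
  finally show "(lp_norm L 2 (time_deriv \<rho>h t))\<^sup>2 = ennreal (smooth.a2 t)" .
 qed
 then have 1: "(bochner_norm T 2 L 2 (time_deriv \<rho>h))\<^sup>2 \<le> ennreal (1 / \<phi>lo\<^sup>2 * ds.A2 * ?Y)"
  using smooth.second_estimate(2) by simp
 have "bochner_norm T \<infinity> L (ennreal \<beta>) (\<lambda>t. grad (\<rho>h t)) \<le> ennreal ((Cb * ?Y) powr (1 / \<beta>))"
 proof (rule bochner_sup_le[where h = "\<lambda>t. sol.gB t powr (1 / \<beta>)"])
  show "(\<lambda>t. sol.gB t powr (1 / \<beta>)) \<in> Lmeas I"
   using sol_continuous_measurable[OF sol.gB_continuous] by measurable
  show "lp_norm L (ennreal \<beta>) (grad (\<rho>h t)) = ennreal (sol.gB t powr (1 / \<beta>))" if "t \<in> I" for t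
   using epowr_eqI[OF norm_grad_\<rho>h[OF that] sol.gB_nonneg] beta by simp
  show "sol.gB t powr (1 / \<beta>) \<le> (Cb * ?Y) powr (1 / \<beta>)" if "t \<in> I" for t
   using gB[OF that] sol.gB_nonneg beta by (intro powr_mono2) auto
 qed
 then have "epowr ?N \<beta> \<le> epowr (ennreal ((Cb * ?Y) powr (1 / \<beta>))) \<beta>"
  using beta by (intro epowr_mono) auto
 also have "\<dots> = ennreal (Cb * ?Y)" using Cb_nonneg Y1 beta by (simp add: epowr_ennreal powr_powr)
 finally have 2: "epowr ?N \<beta> \<le> ennreal (Cb * ?Y)" .
 have 3: "bochner_norm T \<infinity> L 2 mh \<le> ennreal ((1 + c2\<^sup>2 * (ds.\<mu> + Cb)) * ?Y)"
 proof (rule bochner_sup_le[where h = "\<lambda>t. sqrt (flux_energy t)"])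
  show "(\<lambda>t. sqrt (flux_energy t)) \<in> Lmeas I"
   using flux_energy_measurable by measurable
  fix t assume t: "t \<in> I"
  show "lp_norm L 2 (mh t) = ennreal (sqrt (flux_energy t))" by (rule norm_mh[OF t])
  have fe: "0 \<le> flux_energy t" by (simp add: flux_energy_def)
  have "sqrt (flux_energy t) \<le> 1 + flux_energy t"
   by (rule real_le_lsqrt) (use fe in \<open>auto simp: power2_eq_square algebra_simps\<close>)
  also have "\<dots> \<le> 1 + c2\<^sup>2 * (ds.\<mu> + Cb * ?Y)"
   using order_trans[OF flux_energy_bound[OF t] mult_left_mono[OF add_left_mono[OF gB[OF t]]]] by simp
  also have "\<dots> \<le> ?Y + c2\<^sup>2 * (ds.\<mu> * ?Y + Cb * ?Y)"
   using Y1 ds.\<mu>_nonneg Cb_nonneg mult_left_mono[OF Y1 ds.\<mu>_nonneg] by (intro add_mono mult_left_mono) auto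
  also have "\<dots> = (1 + c2\<^sup>2 * (ds.\<mu> + Cb)) * ?Y" by (simp add: algebra_simps)
  finally show "sqrt (flux_energy t) \<le> (1 + c2\<^sup>2 * (ds.\<mu> + Cb)) * ?Y" .
 qed
 let ?a = "1 / \<phi>lo\<^sup>2 * ds.A2" and ?b = Cb and ?d = "1 + c2\<^sup>2 * (ds.\<mu> + Cb)"
 have nn: "0 \<le> ?a" "0 \<le> ?b" "0 \<le> ?d" using A2_nonneg Cb_nonneg ds.\<mu>_nonneg by auto
 have "(bochner_norm T 2 L 2 (time_deriv \<rho>h))\<^sup>2
     + epowr ?N \<beta>
     + bochner_norm T \<infinity> L 2 mh
   \<le> ennreal (?a * ?Y) + ennreal (?b * ?Y) + ennreal (?d * ?Y)"
  by (intro add_mono 1 2 3)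
 also have "\<dots> = ennreal ?a * ennreal ?Y + ennreal ?b * ennreal ?Y + ennreal ?d * ennreal ?Y"
  using nn by (simp only: ennreal_mult')
 also have "\<dots> = ennreal (?a + ?b + ?d) * ennreal ?Y"
  using nn by (simp only: ennreal_plus add_nonneg_nonneg distrib_right)
 finally show ?thesis .
qed

end

theorem theorem4p1:
  fixes N :: nat and a \<alpha> :: "nat \<Rightarrow> real" and \<beta> lam :: real
    and \<Omega> :: "'a::euclidean_space set"
    and T \<phi>lo \<phi>hi \<gamma> C0 C1 :: real and k :: nat
  assumes "forchheimer_data N a \<alpha>"
    and "\<beta> = exp_beta N \<alpha>" and "lam = exp_lambda N \<alpha>"
    and "2 \<le> DIM('a)" and "bounded_domain \<Omega>"
    and "0 < T" and "0 < \<phi>lo"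
    and "0 < \<gamma>" and "0 < C0" and "0 < C1"
  shows "\<exists>C>0. \<forall>\<phi> H \<T> \<pi>.
      admissible_phi \<Omega> \<phi>lo \<phi>hi \<phi> \<and>
      quasiuniform_family \<Omega> \<gamma> H \<T> \<and>
      (\<forall>h\<in>H. is_L2_projection \<Omega> k (\<T> h) (\<pi> h) \<and> projection_bounds \<Omega> k C0 C1 h (\<pi> h)) \<longrightarrow>
      (\<forall>h\<in>H. \<forall>\<rho>0 \<psi> f \<rho>h mh.
        smooth_on (closure \<Omega>) \<rho>0 \<and> admissible_psi \<Omega> T \<psi> \<and> admissible_f \<Omega> T f \<and>
        semidiscrete_solution (forchheimer_K N a \<alpha>) \<Omega> T \<phi> k (\<T> h) (\<pi> h) \<rho>0 \<psi> f \<rho>h mh \<longrightarrow>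
        (bochner_norm T \<infinity> (lebesgue_on \<Omega>) 2 \<rho>h)\<^sup>2
          + epowr (bochner_norm T (ennreal \<beta>) (lebesgue_on \<Omega>) (ennreal \<beta>) (\<lambda>t. grad (\<rho>h t))) \<beta>
          \<le> ennreal C * ((lp_norm (lebesgue_on \<Omega>) 2 \<rho>0)\<^sup>2 + data_A lam \<Omega> T \<psi> f)
        \<and>
        (bochner_norm T 2 (lebesgue_on \<Omega>) 2 (time_deriv \<rho>h))\<^sup>2
          + epowr (bochner_norm T \<infinity> (lebesgue_on \<Omega>) (ennreal \<beta>) (\<lambda>t. grad (\<rho>h t))) \<beta>
          + bochner_norm T \<infinity> (lebesgue_on \<Omega>) 2 mh
          \<le> ennreal C * data_B \<beta> lam \<Omega> T \<rho>0 \<psi> f)"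
proof (cases "\<exists>\<T>0. mesh_of \<Omega> \<T>0")
 case False
 then show ?thesis by (intro exI[of _ 1]) (auto simp: quasiuniform_family_def)
next
 case True
 then obtain \<T>0 where T0: "mesh_of \<Omega> \<T>0" by blast
 interpret m0: mesh \<Omega> \<T>0 using assms(5) T0 by unfold_locales
 let ?S = "surface_measure (frontier \<Omega>)"
 define K where "K = forchheimer_K N a \<alpha>"
 obtain c1 c2 where flux: "power_law_flux K \<beta> c1 c2"
  using forchheimer_power_law_flux[OF assms(1)] assms(2) unfolding K_def by blast
 interpret flux: power_law_flux K \<beta> c1 c2 by (rule flux)
 have lam: "lam = flux.lam" unfolding flux.lam_def by (simp add: assms(2,3) exp_lambda_def)
 obtain Ct where Ct: "0 \<le> Ct" "\<And>\<T>' k u. mesh_of \<Omega> \<T>' ==> u \<in> piecewise_polynomials k \<T>' ==> continuous_on (closure \<Omega>) u ==>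
   (\<integral>\<^sup>+x. ennreal \<bar>u x\<bar> \<partial>?S)
    \<le> ennreal Ct * W11 \<Omega> u"
  using m0.trace_inequality[OF assms(4)] by blast
 obtain D where D: "0 \<le> D" "\<forall>m\<ge>0. \<forall>u\<ge>0. \<forall>\<xi>\<ge>0. m * Ct * (u + \<xi>) \<le> D * (1 + m powr flux.lam) + u\<^sup>2 / 2 + (c1 * 2 powr (- \<beta>) / 2) * \<xi> powr \<beta>"
  using flux.boundary_young[OF Ct(1), of "c1 * 2 powr (- \<beta>) / 2"] flux.c1_pos by auto
 obtain Cg where Cg: "0 \<le> Cg" "\<And>\<T> h \<pi>h \<rho>0. admissible_mesh \<Omega> \<gamma> k C0 C1 \<T> h \<pi>h \<and> smooth_on (closure \<Omega>) \<rho>0 ==>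
   grad_power \<beta> \<Omega> (\<pi>h \<rho>0) \<le> ennreal Cg * (1 + (lp_norm (lebesgue_on \<Omega>) 2 \<rho>0)\<^sup>2 + grad_power \<beta> \<Omega> \<rho>0)"
  using initial_gradient_bound[OF assms(5,8) flux.beta assms(10), of k C0] by blast
 have fin_surface: "finite_measure (?S)"
 proof
  have "(\<lambda>x::'a. 1) \<in> polynomials 0" by (rule const_in_polynomials)
  then have pp: "(\<lambda>x::'a. 1) \<in> piecewise_polynomials 0 \<T>0"
   by (auto simp: piecewise_polynomials_def intro!: bexI[of _ "\<lambda>x. 1"])
  have g0: "grad (\<lambda>x::'a. 1) x = 0" for x by (rule grad_eqI) simp
  have "emeasure (?S) (space (?S))
    = (\<integral>\<^sup>+x. ennreal \<bar>1\<bar> \<partial>?S)" by simp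
  also have "\<dots> \<le> ennreal Ct * (\<integral>\<^sup>+x. ennreal (\<bar>1\<bar> + norm (grad (\<lambda>x::'a. 1) x)) \<partial>lebesgue_on \<Omega>)"
   by (rule Ct(2)[OF T0 pp]) simp
  also have "\<dots> = ennreal Ct * emeasure (lebesgue_on m0.core) (space (lebesgue_on m0.core))"
   unfolding g0 m0.nn_integral_core by simp
  also have "\<dots> < \<infinity>"
   using finite_measure.emeasure_finite[OF m0.finite_measure_core, of "space (lebesgue_on m0.core)"]
   by (simp add: ennreal_mult_less_top less_top)
  finally show "emeasure (?S) (space (?S)) \<noteq> \<infinity>" by simp
 qed
 define V where "V = measure lebesgue \<Omega>"
 define ch where "ch = c1 * 2 powr (- \<beta>)"
 define A1 where "A1 = exp (2 / \<phi>lo * T) * (\<phi>hi / 2 + (c2 * V + D * V) * T + 1)"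
 define A2 where "A2 = 2 * \<phi>lo * ((c2 + ch / 2) + D * V + 1 / 2 + (D * V + A1 / \<phi>lo) * T + c2 * V + D * V + A1 / \<phi>lo)
   + 2 * \<phi>lo * ch * A1 / c1 + 1"
 define Cb where "Cb = 1 / (ch * \<phi>lo) * A2"
 define K1 where "K1 = (2 / \<phi>lo + 2 / c1) * A1"
 define K2 where "K2 = (1 / \<phi>lo\<^sup>2 * A2 + Cb + (1 + c2\<^sup>2 * (V + Cb))) * (1 + Cg)"
 define C where "C = 1 + \<bar>K1\<bar> + \<bar>K2\<bar>"
 have C: "0 < C" "K1 \<le> C" "K2 \<le> C" by (auto simp: C_def)
 show ?thesis
 proof (intro exI[of _ C] conjI[OF C(1)] allI impI ballI, elim conjE)
  fix \<phi> H \<T> \<pi> h \<rho>0 \<psi> f \<rho>h mh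
  assume \<phi>: "admissible_phi \<Omega> \<phi>lo \<phi>hi \<phi>" and fam: "quasiuniform_family \<Omega> \<gamma> H \<T>"
   and proj: "\<forall>h\<in>H. is_L2_projection \<Omega> k (\<T> h) (\<pi> h) \<and> projection_bounds \<Omega> k C0 C1 h (\<pi> h)"
   and h: "h \<in> H" and \<rho>0: "smooth_on (closure \<Omega>) \<rho>0" and \<psi>: "admissible_psi \<Omega> T \<psi>" and f: "admissible_f \<Omega> T f"
   and sol: "semidiscrete_solution (forchheimer_K N a \<alpha>) \<Omega> T \<phi> k (\<T> h) (\<pi> h) \<rho>0 \<psi> f \<rho>h mh"
  have Th: "mesh_of \<Omega> (\<T> h)" "0 < h" "Max (diameter ` \<T> h) = h" "\<forall>E\<in>\<T> h. \<exists>x. ball x (\<gamma> * h) \<subseteq> E"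
   using fam h by (auto simp: quasiuniform_family_def)
  have pr: "is_L2_projection \<Omega> k (\<T> h) (\<pi> h)" "projection_bounds \<Omega> k C0 C1 h (\<pi> h)" using proj h by auto
  interpret msh: mesh \<Omega> "\<T> h" using assms(5) Th(1) by unfold_locales
  define R where "R = (lp_norm (lebesgue_on \<Omega>) 2 \<rho>0)\<^sup>2"
  note contr = msh.projection_contraction[OF pr(1) \<rho>0, folded R_def]
  define P where "P = grad_power \<beta> \<Omega> \<rho>0"
  have P: "epowr (lp_norm (lebesgue_on \<Omega>) (ennreal \<beta>) (grad \<rho>0)) \<beta> = P"
   unfolding P_def grad_power_def using flux.beta by (intro epowr_lp_norm) simp
  obtain n y e where basis: "\<forall>j<(n::nat). y j \<in> closure \<Omega> \<and> e j \<in> R_space \<Omega> k (\<T> h)"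
   "\<forall>u\<in>R_space \<Omega> k (\<T> h). \<forall>x\<in>closure \<Omega>. u x = (\<Sum>j<n. u (y j) * e j x)"
   using msh.nodal_basis[of k] by blast
  let ?N1 = "(bochner_norm T \<infinity> (lebesgue_on \<Omega>) 2 \<rho>h)\<^sup>2
     + epowr (bochner_norm T (ennreal \<beta>) (lebesgue_on \<Omega>) (ennreal \<beta>) (\<lambda>t. grad (\<rho>h t))) \<beta>"
  let ?N2 = "(bochner_norm T 2 (lebesgue_on \<Omega>) 2 (time_deriv \<rho>h))\<^sup>2
     + epowr (bochner_norm T \<infinity> (lebesgue_on \<Omega>) (ennreal \<beta>) (\<lambda>t. grad (\<rho>h t))) \<beta>
     + bochner_norm T \<infinity> (lebesgue_on \<Omega>) 2 mh"
  let ?A = "data_A lam \<Omega> T \<psi> f" and ?B = "data_B \<beta> lam \<Omega> T \<rho>0 \<psi> f"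
  show "?N1 \<le> ennreal C * ((lp_norm (lebesgue_on \<Omega>) 2 \<rho>0)\<^sup>2 + ?A) \<and> ?N2 \<le> ennreal C * ?B"
  proof (cases "?A = \<infinity>")
   case True
   then have "?B = \<infinity>" by (simp add: data_B_def)
   then show ?thesis using True C(1) by (simp add: ennreal_mult_top)
  next
   case False
   interpret F: fem_solution \<Omega> "\<T> h" K \<beta> c1 c2 T \<phi>lo \<phi>hi Ct D \<phi> k "\<pi> h" \<rho>0 \<psi> f \<rho>h mh n y e
   proof (intro fem_solution.intro fem_solution_axioms.intro)
    show "mesh \<Omega> (\<T> h)" by (rule msh.mesh_axioms)
    show "power_law_flux K \<beta> c1 c2" by (rule flux)
    show "semidiscrete_solution K \<Omega> T \<phi> k (\<T> h) (\<pi> h) \<rho>0 \<psi> f \<rho>h mh" using sol by (simp add: K_def)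
    show "(\<integral>\<^sup>+x. ennreal \<bar>u x\<bar> \<partial>?S) \<le> ennreal Ct * W11 \<Omega> u"
     if "u \<in> piecewise_polynomials k (\<T> h)" "continuous_on (closure \<Omega>) u" for u
     by (rule Ct(2)[OF Th(1) that])
    show "data_A flux.lam \<Omega> T \<psi> f < \<infinity>" using False by (simp add: lam less_top)
    show "u x = (\<Sum>j<n. u (y j) * e j x)" if "u \<in> R_space \<Omega> k (\<T> h)" "x \<in> closure \<Omega>" for u x
     using basis(2) that by blast
    show "y j \<in> closure \<Omega>" "e j \<in> R_space \<Omega> k (\<T> h)" if "j < n" for j using basis(1) that by auto
   qed (rule assms(6,7) \<phi> \<psi> f contr(1) fin_surface Ct(1) D)+
   have mu: "F.ds.\<mu> = V" by (simp only: F.ds.\<mu>_def F.M_measure V_def)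
   have ch: "F.ds.ch = ch" by (simp only: F.ds.ch_def ch_def)
   have A1: "F.ds.A1 = A1" by (simp only: F.ds.A1_def A1_def mu)
   have A2: "F.ds.A2 = A2" by (simp only: F.ds.A2_def A2_def mu ch A1)
   have "?N1 \<le> ennreal K1 * (R + ?A)"
    using F.first_bound[OF contr(2)] by (simp only: A1 K1_def lam)
   also have "\<dots> \<le> ennreal C * (R + ?A)" by (intro mult_right_mono ennreal_leI C) simp
   finally have first: "?N1 \<le> ennreal C * (R + ?A)" .
   have second: "?N2 \<le> ennreal C * ?B"
   proof (cases "bochner_norm T \<infinity> (?S) \<infinity> (time_deriv \<psi>) = \<infinity>")
    case True
    then have "?B = \<infinity>" by (simp add: data_B_def epowr_def)
    then show ?thesis using C(1) by (simp add: ennreal_mult_top)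
   next
    case False
    interpret G: fem_solution_smooth \<Omega> "\<T> h" K \<beta> c1 c2 T \<phi>lo \<phi>hi Ct D \<phi> k "\<pi> h" \<rho>0 \<psi> f \<rho>h mh n y e
     using False by unfold_locales (simp add: less_top)
    let ?\<Psi> = "epowr (bochner_norm T \<infinity> (?S) \<infinity> (time_deriv \<psi>)) lam"
    have Pb: "grad_power \<beta> \<Omega> (\<pi> h \<rho>0) \<le> ennreal Cg * (1 + R + P)"
     using Cg(2)[of "\<T> h" h "\<pi> h" \<rho>0] Th pr \<rho>0 by (simp add: R_def P_def admissible_mesh_def)
    have B1: "R + ?A + ?\<Psi> \<le> ?B"
    proof -
     have "?B = (R + ?A + ?\<Psi>) + (P + lp_norm (?S) 2 (\<psi> 0) * lp_norm (?S) 2 \<rho>0)"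
      unfolding data_B_def P R_def by (simp only: ac_simps)
     then show ?thesis by simp
    qed
    have B2: "1 + R + P \<le> ?B"
    proof -
     have "1 \<le> ?A" by (simp add: data_A_def add.assoc)
     then have "1 + R + P \<le> ?A + R + P" by (intro add_right_mono)
     also have "\<dots> \<le> ?B"
     proof -
      have "?B = (?A + R + P) + (?\<Psi> + lp_norm (?S) 2 (\<psi> 0) * lp_norm (?S) 2 \<rho>0)"
       unfolding data_B_def P R_def by (simp only: ac_simps)
      then show ?thesis by simp
     qed
     finally show ?thesis .
    qed
    have "ennreal G.smooth.Y \<le> R + ?A + ennreal Cg * (1 + R + P) + ?\<Psi>"
     using G.Y_bound(1)[OF contr(2) Pb] by (simp only: lam)
    also have "\<dots> = (R + ?A + ?\<Psi>) + ennreal Cg * (1 + R + P)" by (simp only: ac_simps)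
    also have "\<dots> \<le> ?B + ennreal Cg * ?B" by (intro add_mono B1 mult_left_mono B2) simp
    also have "\<dots> = ennreal (1 + Cg) * ?B" using Cg(1) by (simp add: ennreal_plus distrib_right)
    finally have Y: "ennreal G.smooth.Y \<le> ennreal (1 + Cg) * ?B" .
    let ?k = "1 / \<phi>lo\<^sup>2 * A2 + Cb + (1 + c2\<^sup>2 * (V + Cb))"
    have Cb: "G.Cb = Cb" by (simp only: G.Cb_def Cb_def ch A2)
    have k0: "0 \<le> ?k"
     using G.A2_nonneg G.Cb_nonneg F.ds.\<mu>_nonneg unfolding Cb A2 mu by (intro add_nonneg_nonneg mult_nonneg_nonneg) auto
    have "?N2 \<le> ennreal ?k * ennreal G.smooth.Y"
     using G.second_bound[OF contr(2)] by (simp only: A2 Cb mu)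
    also have "\<dots> \<le> ennreal ?k * (ennreal (1 + Cg) * ?B)" by (rule mult_left_mono[OF Y]) simp
    also have "\<dots> = ennreal K2 * ?B" unfolding K2_def ennreal_mult'[OF k0] by (simp only: mult.assoc)
    also have "\<dots> \<le> ennreal C * ?B" by (intro mult_right_mono ennreal_leI C) simp
    finally show ?thesis .
   qed
   show ?thesis using first second unfolding R_def by blast
  qed
 qed
qed

end
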